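(* Let $q\ge 1$, $t>0$, and let $\lambda:=q(q-1)\frac{V_\infty}{N}$. For every $F\in\mathcal B_b^{\mathrm{sym}}(E^q)$ and every $N\ge q$, $$\mathbb Q^N_{t,q}(F)=\sum_{k=0}^\infty\frac{(\lambda t)^k e^{-\lambda t}}{k!}E_{t,k}(F)=\gamma_t^{\otimes q}(F)+\sum_{k,i\ge 0,\ k+i\ge 1}(-1)^i\frac{(\lambda t)^{k+i}}{k!\,i!}E_{t,k}(F)$$ $$=\gamma_t^{\otimes q}(F)+\sum_{r=1}^\infty\frac1{N^r}\sum_{k=0}^r\frac{(-1)^{r-k}}{k!(r-k)!}\bigl(q(q-1)V_\infty t\bigr)^rE_{t,k}(F).$$ In particular, the sequence $(\mathbb Q^N_{t,q})_{N}$ is differentiable up to any order, with $$\partial^r\mathbb Q_{t,q}(F)=\sum_{k=0}^r\frac{(-1)^{r-k}}{k!(r-k)!}\bigl(q(q-1)V_\infty t\bigr)^rE_{t,k}(F).$$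
   Context: **Feynman-Kac model.** $E=\mathbb R^d$ (or an arbitrary metric space). $(X_t)_{t\ge 0}$ is an $E$-valued Markov process with continuous trajectories, time-inhomogeneous generator $L_t$ and initial law $\gamma_0=\eta_0$. The potential functions satisfy $0\le V_t(x)\le V_\infty$ for a constant $V_\infty>0$ (with the regularity needed for the objects below to be well defined). Put $\gamma_t(f)=\mathbb E\bigl(f(X_t)\exp(-\int_0^tV_s(X_s)ds)\bigr)$ and $\eta_t(f)=\gamma_t(f)/\gamma_t(1)$. **Functions.** $\mathcal B_b(E^q)$ (resp. $\mathcal B_b^{\mathrm{sym}}(E^q)$) is the set of smooth bounded (resp. smooth bounded symmetric) real functions on $E^q$; on a general metric space, "smooth" means belonging to a suitable class of regular test functions. **$N$-particle system.** At time $0$, $\xi^1_0,\dots,\xi^N_0$ are i.i.d. with law $\eta_0$. Each $\xi^i$ evolves according to $L_t$, independently of the others, and has an independent exponential clock of rate $V_\infty$. When the clock of $\xi^i$ rings, at time $\tau$, then with probability $V_\tau(\xi^i_\tau)/V_\infty$ it jumps to the position of a particle chosen uniformly among the $N$ particles (itself included), and with probability $1-V_\tau(\xi^i_\tau)/V_\infty$ it stays where it is. **Empirical measures.** $\eta^N_t=\frac1N\sum_{i=1}^N\delta_{\xi^i_t}$ and $\gamma^N_t=\gamma^N_t(1)\,\eta^N_t$, where $\gamma^N_t(1)=\exp(-\int_0^t\eta^N_s(V_s)ds)$. For $F$ on $E^q$ and $N\ge q$, $(\eta^N_t)^{\odot q}(F)=\frac1{(N)_q}\sum_sF(\xi_t^{s(1)},\dots,\xi_t^{s(q)})$,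 the sum being over injective maps $s:\{1,\dots,q\}\to\{1,\dots,N\}$, with $(N)_q=N!/(N-q)!$. Also $(\gamma^N_t)^{\odot q}(F)=\gamma^N_t(1)^q(\eta^N_t)^{\odot q}(F)$ and $\mathbb Q^N_{t,q}(F):=\mathbb E\bigl((\gamma^N_t)^{\odot q}(F)\bigr)$. **Auxiliary $q$-particle system.** $\hat\xi^1_0,\dots,\hat\xi^q_0$ are i.i.d. with law $\eta_0$. The particles evolve independently according to $L_t$, and for every ordered pair $(i,j)\in\{1,\dots,q\}^2$, $i\ne j$, there is an independent Poisson process of ringing times of rate $V_\infty/N$. At a ringing time $s$ of $(i,j)$, $\hat\xi^i$ jumps to $\hat\xi^j_s$ with probability $V_s(\hat\xi^i_s)/V_\infty$ and otherwise stays where it is. For $F\in\mathcal B_b(E^q)$, $$F^e\bigl((\hat\xi^1_s,\dots,\hat\xi^q_s)_{0\le s\le t}\bigr)=F(\hat\xi^1_t,\dots,\hat\xi^q_t)\exp\Bigl(-\int_0^t[V_s(\hat\xi^1_s)+\dots+V_s(\hat\xi^q_s)]ds\Bigr),$$ $$E_{t,k}(F)=\mathbb E\bigl(F^e((\hat\xi^1_s,\dots,\hat\xi^q_s)_{0\le s\le t})\mid \text{exactly }k\text{ rings in total on }[0,t]\bigr).$$ $E_{t,k}(F)$ does not depend on $N$. If $q=1$ there are no clocks, $\lambda=0$, and the terms containing $E_{t,k}$ with $k\ge1$ are read as $0$. **Differentiability.** For a linear functional, $\|L\|_{tv}=\sup\{|L(f)|:f\in\mathcal B_b(E^q),\|f\|\le1\}$.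 A sequence of signed measures $\Theta^N$ on $E^q$ is uniformly bounded if $\sup_N\|\Theta^N\|_{tv}<\infty$. A uniformly bounded sequence converges strongly to $\Theta$ if $\Theta^N(f)\to\Theta(f)$ for all $f\in\mathcal B_b(E^q)$. In that case the discrete derivative is $\partial\Theta^N=N[\Theta^N-\Theta]$, and $\Theta^N$ is differentiable if $\partial\Theta^N$ is uniformly bounded and converges strongly to a measure $\partial\Theta$ (the derivative). Higher derivatives are defined by iteration: $\partial^0\Theta^N=\Theta^N$, $\partial^0\Theta=\Theta$, $\partial^{r+1}\Theta^N=N[\partial^r\Theta^N-\partial^r\Theta]$, and $\partial^{r+1}\Theta$ is its strong limit. The sequence is differentiable up to any order if all these limits exist with uniformly bounded discrete derivatives. Sequences here are indexed by $N\ge q$. *)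

theory Defs
  imports "HOL-Probability.Probability" "HOL-Combinatorics.Permutations"
begin

section \<open>Paths and the underlying Markov process\<close>

text \<open>
  Right-continuous paths on \<open>[0,\<infinity>)\<close> with the \<open>\<sigma>\<close>-algebra of the coordinate maps. Right-continuity
  makes \<open>(s, \<omega>) \<mapsto> \<omega> s\<close> jointly measurable over any metric space. The product \<open>\<sigma>\<close>-algebra is
  used on \<open>E\<^sup>q\<close>; points of \<open>E\<^sup>q\<close> are extensional functions on \<open>{..<q}\<close>.
\<close>

definition path_space :: "(real \<Rightarrow> 'a::metric_space) measure" where
  "path_space = restrict_space (PiM {0..} (\<lambda>_. borel))
     {\<omega>. \<forall>t\<ge>0. (\<omega> \<longlongrightarrow> \<omega> t) (at_right t)}"

definition state_space :: "nat \<Rightarrow> (nat \<Rightarrow> 'a::metric_space) measure" where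
  "state_space m = PiM {..<m} (\<lambda>_. borel)"

definition paths :: "nat \<Rightarrow> (nat \<Rightarrow> real \<Rightarrow> 'a::metric_space) measure" where
  "paths m = PiM {..<m} (\<lambda>_. path_space)"

text \<open>
  A time-inhomogeneous evolution (the one generated by \<open>L\<^sub>t\<close>) is given by the laws \<open>K s x\<close> of the
  trajectory that is at \<open>x\<close> at time \<open>s\<close>; only the values on \<open>[s,\<infinity>)\<close> of such a trajectory are
  meaningful. The last clause is the Markov property: given the trajectory on \<open>[s,u]\<close>, the
  trajectory on \<open>[u,\<infinity>)\<close> has the law \<open>K u (\<omega> u)\<close>.
\<close>

definition markov_family :: "(real \<Rightarrow> 'a::metric_space \<Rightarrow> (real \<Rightarrow> 'a) measure) \<Rightarrow> bool" where
  "markov_family K \<longleftrightarrow>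
     (\<lambda>(s, x). K s x) \<in> restrict_space borel {0..} \<Otimes>\<^sub>M borel \<rightarrow>\<^sub>M prob_algebra path_space \<and>
     (\<forall>s\<ge>0. \<forall>x. AE \<omega> in K s x. \<omega> s = x \<and> continuous_on {s..} \<omega>) \<and>
     (\<forall>s\<ge>0. \<forall>u\<ge>s. \<forall>x.
        \<forall>A \<in> sets (PiM {s..u} (\<lambda>_. borel)). \<forall>B \<in> sets (PiM {u..} (\<lambda>_. borel)).
          emeasure (K s x)
            {\<omega> \<in> space path_space. restrict \<omega> {s..u} \<in> A \<and> restrict \<omega> {u..} \<in> B} =
          (\<integral>\<^sup>+ \<omega>. indicator A (restrict \<omega> {s..u}) *
              emeasure (K u (\<omega> u)) {\<omega>' \<in> space path_space. restrict \<omega>' {u..} \<in> B} \<partial>K s x))"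

definition feynman_kac_model ::
  "(real \<Rightarrow> 'a::metric_space \<Rightarrow> (real \<Rightarrow> 'a) measure) \<Rightarrow> 'a measure \<Rightarrow> (real \<Rightarrow> 'a \<Rightarrow> real) \<Rightarrow>
    real \<Rightarrow> bool" where
  "feynman_kac_model K \<eta>0 V Vinf \<longleftrightarrow>
     markov_family K \<and>
     prob_space \<eta>0 \<and> sets \<eta>0 = sets borel \<and>
     (\<lambda>(t, x). V t x) \<in> borel_measurable (restrict_space borel {0..} \<Otimes>\<^sub>M borel) \<and>
     Vinf > 0 \<and> (\<forall>t\<ge>0. \<forall>x. 0 \<le> V t x \<and> V t x \<le> Vinf)"

definition X_law ::
  "(real \<Rightarrow> 'a::metric_space \<Rightarrow> (real \<Rightarrow> 'a) measure) \<Rightarrow> 'a measure \<Rightarrow> (real \<Rightarrow> 'a) measure" where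
  "X_law K \<eta>0 = \<eta>0 \<bind> (\<lambda>x. K 0 x)"

definition gamma_flow ::
  "(real \<Rightarrow> 'a::metric_space \<Rightarrow> (real \<Rightarrow> 'a) measure) \<Rightarrow> 'a measure \<Rightarrow> (real \<Rightarrow> 'a \<Rightarrow> real) \<Rightarrow>
    real \<Rightarrow> 'a measure" where
  "gamma_flow K \<eta>0 V t =
     distr (density (X_law K \<eta>0) (\<lambda>\<omega>. ennreal (exp (- (LINT s:{0..t}|lborel. V s (\<omega> s))))))
       borel (\<lambda>\<omega>. \<omega> t)"

section \<open>Independent clocks\<close>

text \<open>
  The coordinate \<open>\<sigma> (c, n)\<close> is the waiting time between the \<open>n\<close>-th and the \<open>(n+1)\<close>-st ring of the
  clock \<open>c\<close>; the rings of \<open>c\<close> thus form a Poisson process of rate \<open>r\<close>.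
\<close>

definition clocks :: "'c set \<Rightarrow> real \<Rightarrow> ('c \<times> nat \<Rightarrow> real) measure" where
  "clocks C r = PiM (C \<times> UNIV) (\<lambda>_. density lborel (\<lambda>x. ennreal (exponential_density r x)))"

definition ring_time :: "('c \<times> nat \<Rightarrow> real) \<Rightarrow> 'c \<Rightarrow> nat \<Rightarrow> real" where
  "ring_time \<sigma> c n = (\<Sum>l\<le>n. \<sigma> (c, l))"

definition rings :: "'c set \<Rightarrow> real \<Rightarrow> ('c \<times> nat \<Rightarrow> real) \<Rightarrow> (real \<times> 'c) set" where
  "rings C t \<sigma> = {(ring_time \<sigma> c n, c) | c n. c \<in> C \<and> 0 < ring_time \<sigma> c n \<and> ring_time \<sigma> c n \<le> t}"

text \<open>
  The rings in order of time. Simultaneous rings or infinitely many rings before \<open>t\<close> have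
  probability 0; the value there is immaterial.
\<close>

definition chronology :: "(real \<times> 'c) set \<Rightarrow> (real \<times> 'c) list" where
  "chronology A =
     (if \<exists>l. sorted_wrt (<) (map fst l) \<and> set l = A
      then THE l. sorted_wrt (<) (map fst l) \<and> set l = A else [])"

section \<open>Particle systems driven by clocks\<close>

text \<open>
  Law of the trajectories of \<open>m\<close> particles that start from \<open>x\<close> at time \<open>s\<close>, given the list of
  all rings after \<open>s\<close>. Between rings the particles move independently according to \<open>K\<close>;
  \<open>J \<tau> c y\<close> is the law of the configuration right after a ring of \<open>c\<close> at time \<open>\<tau>\<close> if it is \<open>y\<close>
  right before (the trajectories \<open>z\<close> being continuous, this is their position at \<open>\<tau>\<close>). By the
  Markov property, restarting all particles at \<open>\<tau>\<close> lets those that do not jump follow \<open>K\<close>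
  undisturbed.
\<close>

primrec evolve ::
  "(real \<Rightarrow> 'a::metric_space \<Rightarrow> (real \<Rightarrow> 'a) measure) \<Rightarrow> nat \<Rightarrow>
   (real \<Rightarrow> 'c \<Rightarrow> (nat \<Rightarrow> 'a) \<Rightarrow> (nat \<Rightarrow> 'a) measure) \<Rightarrow>
   (real \<times> 'c) list \<Rightarrow> real \<Rightarrow> (nat \<Rightarrow> 'a) \<Rightarrow> (nat \<Rightarrow> real \<Rightarrow> 'a) measure" where
  "evolve K m J [] s x = PiM {..<m} (\<lambda>i. K s (x i))"
| "evolve K m J (a # as) s x =
     (case a of (\<tau>, c) \<Rightarrow>
       PiM {..<m} (\<lambda>i. K s (x i)) \<bind> (\<lambda>z.
         J \<tau> c (\<lambda>i\<in>{..<m}. z i \<tau>) \<bind> (\<lambda>y.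
           distr (evolve K m J as \<tau> y) (paths m)
             (\<lambda>z'. \<lambda>i\<in>{..<m}. \<lambda>u. if u < \<tau> then z i u else z' i u))))"

text \<open>
  Joint law of the clocks (set \<open>C\<close>, common rate \<open>r\<close>) and of the trajectories on \<open>[0,t]\<close> of \<open>m\<close>
  particles with i.i.d. initial positions; rings after \<open>t\<close> are disregarded, so that the
  trajectories are meaningful up to time \<open>t\<close> only.
\<close>

definition system_law ::
  "(real \<Rightarrow> 'a::metric_space \<Rightarrow> (real \<Rightarrow> 'a) measure) \<Rightarrow> 'a measure \<Rightarrow> nat \<Rightarrow> 'c set \<Rightarrow> real \<Rightarrow>
   (real \<Rightarrow> 'c \<Rightarrow> (nat \<Rightarrow> 'a) \<Rightarrow> (nat \<Rightarrow> 'a) measure) \<Rightarrow> real \<Rightarrow>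
   (('c \<times> nat \<Rightarrow> real) \<times> (nat \<Rightarrow> real \<Rightarrow> 'a)) measure" where
  "system_law K \<eta>0 m C r J t =
     clocks C r \<bind> (\<lambda>\<sigma>.
       PiM {..<m} (\<lambda>_. \<eta>0) \<bind> (\<lambda>x.
         distr (evolve K m J (chronology (rings C t \<sigma>)) 0 x) (clocks C r \<Otimes>\<^sub>M paths m)
           (\<lambda>z. (\<sigma>, z))))"

section \<open>The \<open>N\<close>-particle system\<close>

definition jump_N ::
  "(real \<Rightarrow> 'a::metric_space \<Rightarrow> real) \<Rightarrow> real \<Rightarrow> nat \<Rightarrow>
   real \<Rightarrow> nat \<Rightarrow> (nat \<Rightarrow> 'a) \<Rightarrow> (nat \<Rightarrow> 'a) measure" where
  "jump_N V Vinf N \<tau> i x =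
     distr (measure_pmf (pair_pmf (bernoulli_pmf (V \<tau> (x i) / Vinf)) (pmf_of_set {..<N})))
       (state_space N) (\<lambda>(b, j). if b then x(i := x j) else x)"

definition N_system ::
  "(real \<Rightarrow> 'a::metric_space \<Rightarrow> (real \<Rightarrow> 'a) measure) \<Rightarrow> 'a measure \<Rightarrow> (real \<Rightarrow> 'a \<Rightarrow> real) \<Rightarrow>
   real \<Rightarrow> nat \<Rightarrow> real \<Rightarrow> ((nat \<times> nat \<Rightarrow> real) \<times> (nat \<Rightarrow> real \<Rightarrow> 'a)) measure" where
  "N_system K \<eta>0 V Vinf N t = system_law K \<eta>0 N {..<N} Vinf (jump_N V Vinf N) t"

definition eta_N :: "nat \<Rightarrow> (nat \<Rightarrow> real \<Rightarrow> 'a) \<Rightarrow> real \<Rightarrow> ('a \<Rightarrow> real) \<Rightarrow> real" where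
  "eta_N N \<xi> s f = (\<Sum>i<N. f (\<xi> i s)) / real N"

definition gamma_N_mass ::
  "(real \<Rightarrow> 'a \<Rightarrow> real) \<Rightarrow> nat \<Rightarrow> (nat \<Rightarrow> real \<Rightarrow> 'a) \<Rightarrow> real \<Rightarrow> real" where
  "gamma_N_mass V N \<xi> t = exp (- (LINT s:{0..t}|lborel. eta_N N \<xi> s (V s)))"

definition eta_N_odot ::
  "nat \<Rightarrow> nat \<Rightarrow> (nat \<Rightarrow> real \<Rightarrow> 'a) \<Rightarrow> real \<Rightarrow> ((nat \<Rightarrow> 'a) \<Rightarrow> real) \<Rightarrow> real" where
  "eta_N_odot q N \<xi> t F =
     (\<Sum>s \<in> {s \<in> {..<q} \<rightarrow>\<^sub>E {..<N}. inj_on s {..<q}}. F (\<lambda>j\<in>{..<q}. \<xi> (s j) t))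
       / (fact N / fact (N - q))"

definition gamma_N_odot ::
  "(real \<Rightarrow> 'a \<Rightarrow> real) \<Rightarrow> nat \<Rightarrow> nat \<Rightarrow> (nat \<Rightarrow> real \<Rightarrow> 'a) \<Rightarrow> real \<Rightarrow> ((nat \<Rightarrow> 'a) \<Rightarrow> real) \<Rightarrow> real"
  where
  "gamma_N_odot V q N \<xi> t F = gamma_N_mass V N \<xi> t ^ q * eta_N_odot q N \<xi> t F"

definition Q_N ::
  "(real \<Rightarrow> 'a::metric_space \<Rightarrow> (real \<Rightarrow> 'a) measure) \<Rightarrow> 'a measure \<Rightarrow> (real \<Rightarrow> 'a \<Rightarrow> real) \<Rightarrow>
   real \<Rightarrow> real \<Rightarrow> nat \<Rightarrow> nat \<Rightarrow> ((nat \<Rightarrow> 'a) \<Rightarrow> real) \<Rightarrow> real" where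
  "Q_N K \<eta>0 V Vinf t q N F =
     (\<integral>\<omega>. gamma_N_odot V q N (snd \<omega>) t F \<partial>N_system K \<eta>0 V Vinf N t)"

section \<open>The auxiliary \<open>q\<close>-particle system\<close>

definition jump_aux ::
  "(real \<Rightarrow> 'a::metric_space \<Rightarrow> real) \<Rightarrow> real \<Rightarrow> nat \<Rightarrow>
   real \<Rightarrow> nat \<times> nat \<Rightarrow> (nat \<Rightarrow> 'a) \<Rightarrow> (nat \<Rightarrow> 'a) measure" where
  "jump_aux V Vinf q \<tau> c x =
     (case c of (i, j) \<Rightarrow>
       distr (measure_pmf (bernoulli_pmf (V \<tau> (x i) / Vinf)))
         (state_space q) (\<lambda>b. if b then x(i := x j) else x))"

definition aux_clocks :: "nat \<Rightarrow> (nat \<times> nat) set" where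
  "aux_clocks q = {(i, j). i < q \<and> j < q \<and> i \<noteq> j}"

definition aux_system ::
  "(real \<Rightarrow> 'a::metric_space \<Rightarrow> (real \<Rightarrow> 'a) measure) \<Rightarrow> 'a measure \<Rightarrow> (real \<Rightarrow> 'a \<Rightarrow> real) \<Rightarrow>
   real \<Rightarrow> nat \<Rightarrow> nat \<Rightarrow> real \<Rightarrow>
   (((nat \<times> nat) \<times> nat \<Rightarrow> real) \<times> (nat \<Rightarrow> real \<Rightarrow> 'a)) measure" where
  "aux_system K \<eta>0 V Vinf q N t =
     system_law K \<eta>0 q (aux_clocks q) (Vinf / real N) (jump_aux V Vinf q) t"

definition F_e ::
  "(real \<Rightarrow> 'a \<Rightarrow> real) \<Rightarrow> nat \<Rightarrow> real \<Rightarrow> ((nat \<Rightarrow> 'a) \<Rightarrow> real) \<Rightarrow> (nat \<Rightarrow> real \<Rightarrow> 'a) \<Rightarrow> real" where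
  "F_e V q t F \<xi> =
     F (\<lambda>i\<in>{..<q}. \<xi> i t) * exp (- (LINT s:{0..t}|lborel. (\<Sum>i<q. V s (\<xi> i s))))"

text \<open>
  Expectation conditional on exactly \<open>k\<close> rings. Conditioning on a null event gives the zero
  measure, hence 0 for \<open>q = 1\<close> and \<open>k \<ge> 1\<close>, where there are no clocks.
\<close>

definition E_cond ::
  "(real \<Rightarrow> 'a::metric_space \<Rightarrow> (real \<Rightarrow> 'a) measure) \<Rightarrow> 'a measure \<Rightarrow> (real \<Rightarrow> 'a \<Rightarrow> real) \<Rightarrow>
   real \<Rightarrow> nat \<Rightarrow> nat \<Rightarrow> real \<Rightarrow> nat \<Rightarrow> ((nat \<Rightarrow> 'a) \<Rightarrow> real) \<Rightarrow> real" where
  "E_cond K \<eta>0 V Vinf q N t k F =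
     (\<integral>\<omega>. F_e V q t F (snd \<omega>)
        \<partial>uniform_measure (aux_system K \<eta>0 V Vinf q N t)
          {\<omega> \<in> space (aux_system K \<eta>0 V Vinf q N t).
             finite (rings (aux_clocks q) t (fst \<omega>)) \<and>
             card (rings (aux_clocks q) t (fst \<omega>)) = k})"

section \<open>Test functions and differentiability of sequences of signed measures\<close>

definition test_class :: "nat \<Rightarrow> ((nat \<Rightarrow> 'a::metric_space) \<Rightarrow> real) set \<Rightarrow> bool" where
  "test_class q \<B> \<longleftrightarrow>
     (\<forall>F\<in>\<B>. F \<in> borel_measurable (state_space q) \<and> (\<exists>B. \<forall>x\<in>space (state_space q). \<bar>F x\<bar> \<le> B))"

definition symmetric_fun :: "nat \<Rightarrow> ((nat \<Rightarrow> 'a::metric_space) \<Rightarrow> real) \<Rightarrow> bool" where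
  "symmetric_fun q F \<longleftrightarrow>
     (\<forall>p x. p permutes {..<q} \<longrightarrow> x \<in> space (state_space q) \<longrightarrow> F (x \<circ> p) = F x)"

text \<open>
  Signed measures on \<open>E\<^sup>q\<close> are treated as functionals on the class \<open>\<B>\<close> of test functions; those
  that come from a finite signed measure are singled out by their decomposition into two finite
  measures.
\<close>

definition is_signed_measure ::
  "nat \<Rightarrow> ((nat \<Rightarrow> 'a::metric_space) \<Rightarrow> real) set \<Rightarrow> (((nat \<Rightarrow> 'a) \<Rightarrow> real) \<Rightarrow> real) \<Rightarrow> bool" where
  "is_signed_measure q \<B> \<Theta> \<longleftrightarrow>
     (\<exists>\<mu> \<nu>. finite_measure \<mu> \<and> finite_measure \<nu> \<and>
        sets \<mu> = sets (state_space q) \<and> sets \<nu> = sets (state_space q) \<and>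
        (\<forall>f\<in>\<B>. \<Theta> f = (\<integral>x. f x \<partial>\<mu>) - (\<integral>x. f x \<partial>\<nu>)))"

definition tv_norm ::
  "nat \<Rightarrow> ((nat \<Rightarrow> 'a::metric_space) \<Rightarrow> real) set \<Rightarrow> (((nat \<Rightarrow> 'a) \<Rightarrow> real) \<Rightarrow> real) \<Rightarrow> ennreal" where
  "tv_norm q \<B> \<Theta> =
     (SUP f \<in> {f \<in> \<B>. \<forall>x\<in>space (state_space q). \<bar>f x\<bar> \<le> 1}. ennreal \<bar>\<Theta> f\<bar>)"

definition uniformly_bounded ::
  "nat \<Rightarrow> ((nat \<Rightarrow> 'a::metric_space) \<Rightarrow> real) set \<Rightarrow>
   (nat \<Rightarrow> ((nat \<Rightarrow> 'a) \<Rightarrow> real) \<Rightarrow> real) \<Rightarrow> bool" where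
  "uniformly_bounded q \<B> \<Theta> \<longleftrightarrow> (SUP N \<in> {q..}. tv_norm q \<B> (\<Theta> N)) < \<infinity>"

definition strongly_converges ::
  "nat \<Rightarrow> ((nat \<Rightarrow> 'a::metric_space) \<Rightarrow> real) set \<Rightarrow>
   (nat \<Rightarrow> ((nat \<Rightarrow> 'a) \<Rightarrow> real) \<Rightarrow> real) \<Rightarrow> (((nat \<Rightarrow> 'a) \<Rightarrow> real) \<Rightarrow> real) \<Rightarrow> bool" where
  "strongly_converges q \<B> \<Theta> \<Theta>' \<longleftrightarrow>
     uniformly_bounded q \<B> \<Theta> \<and> (\<forall>f\<in>\<B>. (\<lambda>N. \<Theta> N f) \<longlonglongrightarrow> \<Theta>' f)"

primrec discrete_deriv ::
  "nat \<Rightarrow> (nat \<Rightarrow> 'f \<Rightarrow> real) \<Rightarrow> nat \<Rightarrow> 'f \<Rightarrow> real" where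
  "discrete_deriv 0 \<Theta> N f = \<Theta> N f"
| "discrete_deriv (Suc r) \<Theta> N f =
     real N * (discrete_deriv r \<Theta> N f - lim (\<lambda>M. discrete_deriv r \<Theta> M f))"

definition limit_deriv :: "nat \<Rightarrow> (nat \<Rightarrow> 'f \<Rightarrow> real) \<Rightarrow> 'f \<Rightarrow> real" where
  "limit_deriv r \<Theta> f = lim (\<lambda>N. discrete_deriv r \<Theta> N f)"

definition differentiable_any_order ::
  "nat \<Rightarrow> ((nat \<Rightarrow> 'a::metric_space) \<Rightarrow> real) set \<Rightarrow>
   (nat \<Rightarrow> ((nat \<Rightarrow> 'a) \<Rightarrow> real) \<Rightarrow> real) \<Rightarrow> bool" where
  "differentiable_any_order q \<B> \<Theta> \<longleftrightarrow>
     (\<forall>N\<ge>q. is_signed_measure q \<B> (\<Theta> N)) \<and>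
     (\<forall>r. strongly_converges q \<B> (discrete_deriv r \<Theta>) (limit_deriv r \<Theta>) \<and>
          is_signed_measure q \<B> (limit_deriv r \<Theta>))"

end

theory Submission
  imports Defs
begin

text \<open>
  The mean of \<open>F(\<xi>\<^sub>t) exp (- \<integral> W)\<close> over a particle system started from \<open>x\<close> at time \<open>s\<close>, as a function
  of \<open>(s, x)\<close>, is decomposed at the first ring of the clocks; this gives a mild backward equation
  with a unique bounded solution. Averaging over all injections of \<open>q\<close> into \<open>N\<close> particles
  intertwines the jump-and-killing part of the generator of the \<open>N\<close>-particle system with the one
  of the auxiliary system: a jump of a selected particle onto another selected one (rate
  \<open>V/N\<close> per ordered pair) is a ring of the auxiliary system, and the jumps onto unselected particles
  account for the difference between the weights \<open>q \<eta>\<^sup>N(V)\<close> and \<open>V(\<xi>\<^sup>1) + \<dots> + V(\<xi>\<^sup>q)\<close>.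
  By uniqueness, \<open>Q\<^sup>N(F)\<close> is the mean of \<open>F\<^sup>e\<close> over the auxiliary system. There the total number of rings
  is Poisson with mean \<open>\<lambda>t\<close>, and the first-ring decomposition shows that its part with \<open>k\<close> rings
  depends on the rate only through the factor \<open>exp (-\<lambda>t) (V\<^sub>\<infinity>/N)\<^sup>k\<close>, so that \<open>E\<^bsub>t,k\<^esub>\<close> is free of \<open>N\<close>.
  Multiplying out the two exponential series gives an absolutely convergent power series in
  \<open>1/N\<close>, whose coefficients are the derivatives.
\<close>

section \<open>Integration over time and over kernels\<close>

text \<open>The equations that the first ring yields directly cannot be compared. Their propagators
  are killed at rate \<open>lam + W\<close>, and both parts differ between the systems:
  \<open>lam\<close> is \<open>N * Vinf\<close> for one and \<open>q * (q - 1) * Vinf / N\<close>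
  for the other, and \<open>W\<close> is q times the empirical mean of V for one and the sum of V
  over q particles for the other. Moreover the killing of the large system sees all N particles, so
  it does not commute with selecting q of them. Duhamel's formula therefore moves every killing term
  into the source. What remains is the free motion \<open>PE\<close>, which commutes with selection
  because the particles are independent, and a bounded operator \<open>gen\<close>. Only these
  bounded operators have to be compared, and that is finite combinatorics. The mild form also avoids
  the generator of the motion: K is known through path laws only, V is merely measurable, and no
  solution need be differentiable.\<close>

definition tint :: "real \<Rightarrow> real \<Rightarrow> (real \<Rightarrow> real) \<Rightarrow> real" where
  "tint s t g = (\<integral>u. indicator {s..t} u * g u \<partial>lborel)"

lemma tint_eq_set_integral: "tint s t g = (LINT u:{s..t}|lborel. g u)"
  unfolding tint_def set_lebesgue_integral_def by simp

lemma tint_cong: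
  assumes "\<And>u. s \<le> u \<Longrightarrow> u \<le> t \<Longrightarrow> g u = h u" shows "tint s t g = tint s t h"
  unfolding tint_def by (intro Bochner_Integration.integral_cong) (auto simp: indicator_def assms)

lemma measurable_tint [measurable (raw)]:
  assumes [measurable]: "case_prod g \<in> borel_measurable (N \<Otimes>\<^sub>M borel)"
    "s \<in> borel_measurable N" "t \<in> borel_measurable N"
  shows "(\<lambda>x. tint (s x) (t x) (g x)) \<in> borel_measurable N"
proof -
  have *: "indicator {a..b} u = (if a \<le> u \<and> u \<le> b then 1 else 0 :: real)" for a b u :: real
    by (auto simp: indicator_def)
  show ?thesis
    unfolding tint_def * by measurable
qed

lemma tint_integrable:
  fixes g :: "real \<Rightarrow> real"
  assumes [measurable]: "g \<in> borel_measurable borel"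
    and B: "\<And>u. s \<le> u \<Longrightarrow> u \<le> t \<Longrightarrow> \<bar>g u\<bar> \<le> B"
  shows "integrable lborel (\<lambda>u. indicator {s..t} u * g u)"
proof (cases "s \<le> t")
  case True
  have "integrable lborel (\<lambda>u. indicator {s..t} u * B)"
    using integrable_real_indicator[of "{s..t}" lborel] True by simp
  then show ?thesis
    by (rule Bochner_Integration.integrable_bound)
       (use B in \<open>auto simp: indicator_def abs_mult intro!: order_trans[OF _ abs_ge_self]\<close>)
next
  case False
  then have "(\<lambda>u. indicator {s..t} u * g u) = (\<lambda>u. 0)" by (auto simp: indicator_def)
  then show ?thesis by simp
qed

lemma tint_const:
  assumes "s \<le> t" shows "tint s t (\<lambda>_. c) = c * (t - s)"
proof -
  show ?thesis
    using assms by (simp add: tint_def)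
qed

lemma tint_bound:
  assumes [measurable]: "g \<in> borel_measurable borel"
    and B: "\<And>u. s \<le> u \<Longrightarrow> u \<le> t \<Longrightarrow> \<bar>g u\<bar> \<le> h u"
    and [measurable]: "h \<in> borel_measurable borel" and h: "\<And>u. s \<le> u \<Longrightarrow> u \<le> t \<Longrightarrow> h u \<le> B"
   
  shows "\<bar>tint s t g\<bar> \<le> tint s t h"
proof -
  have hi: "integrable lborel (\<lambda>u. indicator {s..t} u * h u)"
    by (rule tint_integrable[where B=B]) (use B h in \<open>force+\<close>)
  have "\<bar>tint s t g\<bar> \<le> (\<integral>u. \<bar>indicator {s..t} u * g u\<bar> \<partial>lborel)"
    unfolding tint_def by (rule integral_abs_bound)
  also have "\<dots> \<le> tint s t h"
    unfolding tint_def
    by (rule integral_mono[OF integrable_abs[OF tint_integrable[where B=B]]])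
       (use B h hi in \<open>auto simp: indicator_def intro: order_trans\<close>)
  finally show ?thesis .
qed

lemma tint_bound_const:
  assumes [measurable]: "g \<in> borel_measurable borel"
    and B: "\<And>u. s \<le> u \<Longrightarrow> u \<le> t \<Longrightarrow> \<bar>g u\<bar> \<le> B" and s: "s \<le> t"
  shows "\<bar>tint s t g\<bar> \<le> B * (t - s)"
  using tint_bound[of g s t "\<lambda>_. B" B] assms tint_const[of s t B] by simp

lemma tint_nonneg:
  assumes "\<And>u. s \<le> u \<Longrightarrow> u \<le> t \<Longrightarrow> 0 \<le> g u" shows "0 \<le> tint s t g"
  unfolding tint_def by (rule Bochner_Integration.integral_nonneg) (use assms in \<open>auto simp: indicator_def\<close>)

lemma tint_refl [simp]:
  assumes [measurable]: "g \<in> borel_measurable borel" shows "tint s s g = 0"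
proof -
  have "tint s s g = (\<integral>u. 0 \<partial>(lborel :: real measure))"
    unfolding tint_def
  proof (rule integral_cong_AE)
    show "AE u in lborel. indicator {s..s} u * g u = 0"
      using AE_lborel_singleton[of s] by eventually_elim auto
  qed auto
  then show ?thesis by simp
qed

lemma tint_add:
  assumes "g \<in> borel_measurable borel" "\<And>u. s \<le> u \<Longrightarrow> u \<le> t \<Longrightarrow> \<bar>g u\<bar> \<le> B"
    "h \<in> borel_measurable borel" "\<And>u. s \<le> u \<Longrightarrow> u \<le> t \<Longrightarrow> \<bar>h u\<bar> \<le> B'"
  shows "tint s t (\<lambda>u. g u + h u) = tint s t g + tint s t h"
  unfolding tint_def distrib_left
  by (intro Bochner_Integration.integral_add tint_integrable[where B=B] tint_integrable[where B=B'] assms)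

lemma tint_diff:
  assumes "g \<in> borel_measurable borel" "\<And>u. s \<le> u \<Longrightarrow> u \<le> t \<Longrightarrow> \<bar>g u\<bar> \<le> B"
    "h \<in> borel_measurable borel" "\<And>u. s \<le> u \<Longrightarrow> u \<le> t \<Longrightarrow> \<bar>h u\<bar> \<le> B'"
  shows "tint s t (\<lambda>u. g u - h u) = tint s t g - tint s t h"
  unfolding tint_def right_diff_distrib
  by (intro Bochner_Integration.integral_diff tint_integrable[where B=B] tint_integrable[where B=B'] assms)

lemma tint_cmult: "tint s t (\<lambda>u. c * g u) = c * tint s t g"
  unfolding tint_def by (subst integral_mult_right_zero[symmetric]) (simp add: ac_simps)

lemma tint_sum:
  assumes "\<And>i. i \<in> I \<Longrightarrow> g i \<in> borel_measurable borel"
    "\<And>i u. i \<in> I \<Longrightarrow> s \<le> u \<Longrightarrow> u \<le> t \<Longrightarrow> \<bar>g i u\<bar> \<le> B"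
  shows "tint s t (\<lambda>u. \<Sum>i\<in>I. g i u) = (\<Sum>i\<in>I. tint s t (g i))"
  unfolding tint_def sum_distrib_left
  by (intro Bochner_Integration.integral_sum tint_integrable[where B=B] assms)

lemma tint_split:
  assumes [measurable]: "g \<in> borel_measurable borel"
    and B: "\<And>u. s \<le> u \<Longrightarrow> u \<le> t \<Longrightarrow> \<bar>g u\<bar> \<le> B" and s: "s \<le> r" "r \<le> t"
  shows "tint s t g = tint s r g + tint r t g"
proof -
  have "tint s t g = (\<integral>u. indicator {s..r} u * g u + indicator {r..t} u * g u \<partial>lborel)"
    unfolding tint_def
    by (rule integral_cong_AE, measurable)
       (use AE_lborel_singleton[of r] s in \<open>auto simp: indicator_def\<close>)
  also have "\<dots> = tint s r g + tint r t g"
    unfolding tint_def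
    by (intro Bochner_Integration.integral_add tint_integrable[where B=B]) (use B s in auto)
  finally show ?thesis .
qed

lemma integral_tint_swap:
  assumes M: "finite_measure M"
    and g[measurable]: "case_prod g \<in> borel_measurable (M \<Otimes>\<^sub>M borel)"
    and B: "\<And>x u. x \<in> space M \<Longrightarrow> s \<le> u \<Longrightarrow> u \<le> t \<Longrightarrow> \<bar>g x u\<bar> \<le> B"
  shows "(\<integral>x. tint s t (g x) \<partial>M) = tint s t (\<lambda>u. \<integral>x. g x u \<partial>M)"
proof -
  interpret M: finite_measure M by fact
  interpret pair_sigma_finite M lborel ..
  have "integrable (M \<Otimes>\<^sub>M lborel) (\<lambda>(x, u). indicator {s..t} u * g x u)"
  proof (rule Fubini_integrable)
    show "(\<lambda>(x, u). indicator {s..t} u * g x u) \<in> borel_measurable (M \<Otimes>\<^sub>M lborel)"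
      by measurable
    have "integrable lborel (\<lambda>u. indicator {s..t} u * g x u)" if "x \<in> space M" for x
      by (rule tint_integrable[where B=B]) (use that B in auto)
    then show "AE x in M. integrable lborel (\<lambda>y. case (x, y) of (x, u) \<Rightarrow> indicator {s..t} u * g x u)"
      by auto
    show "integrable M (\<lambda>x. \<integral>y. norm (case (x, y) of (x, u) \<Rightarrow> indicator {s..t} u * g x u) \<partial>lborel)"
    proof (cases "s \<le> t")
      case True
      show ?thesis
      proof (rule M.integrable_const_bound[where B="B * (t - s)"])
        have "norm (\<integral>u. norm (indicator {s..t} u * g x u) \<partial>lborel) \<le> B * (t - s)" if x: "x \<in> space M" for x
        proof -
          have "(\<integral>u. norm (indicator {s..t} u * g x u) \<partial>lborel) = tint s t (\<lambda>u. \<bar>g x u\<bar>)"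
            unfolding tint_def by (intro Bochner_Integration.integral_cong) (auto simp: abs_mult)
          then show ?thesis
            using tint_bound_const[of "\<lambda>u. \<bar>g x u\<bar>" s t B] B[OF x] x True by simp
        qed
        then show "AE x in M. norm (\<integral>y. norm (case (x, y) of (x, u) \<Rightarrow> indicator {s..t} u * g x u) \<partial>lborel) \<le> B * (t - s)"
          by auto
      qed measurable
    next
      case False
      then have *: "(\<lambda>x. \<integral>y. norm (case (x, y) of (x, u) \<Rightarrow> indicator {s..t} u * g x u) \<partial>lborel) = (\<lambda>x. 0)"
        by auto
      show ?thesis unfolding * by simp
    qed
  qed
  from Fubini_integral[OF this] have
    "(\<integral>x. \<integral>u. indicator {s..t} u * g x u \<partial>lborel \<partial>M) = (\<integral>u. \<integral>x. indicator {s..t} u * g x u \<partial>M \<partial>lborel)"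
    by simp
  then show ?thesis unfolding tint_def by simp
qed

text \<open>Fubini on the triangle s \<le> \<rho> \<le> \<tau> \<le> t. Extending \<open>h\<close>
  by zero outside the triangle frees the inner range from \<tau>, and the outer integral becomes one
  against a finite measure, so that \<open>integral_tint_swap\<close> applies.\<close>

lemma tint_triangle:
  assumes h[measurable]: "case_prod h \<in> borel_measurable (borel \<Otimes>\<^sub>M borel)"
    and B: "\<And>\<rho> \<tau>. s \<le> \<rho> \<Longrightarrow> \<rho> \<le> \<tau> \<Longrightarrow> \<tau> \<le> t \<Longrightarrow> \<bar>h \<rho> \<tau>\<bar> \<le> B" and s: "s \<le> t"
  shows "tint s t (\<lambda>\<tau>. tint s \<tau> (\<lambda>\<rho>. h \<rho> \<tau>)) = tint s t (\<lambda>\<rho>. tint \<rho> t (h \<rho>))"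
proof -
  define M where "M = density lborel (\<lambda>u. ennreal (indicator {s..t} u))"
  have "emeasure M (space M) = emeasure lborel {s..t}"
    unfolding M_def
    by (subst emeasure_density)
       (use s in \<open>auto simp: ennreal_indicator nn_integral_indicator[symmetric] indicator_inter_arith[symmetric]
             simp del: nn_integral_indicator intro!: nn_integral_cong split: split_indicator\<close>)
  then interpret M: finite_measure M
    by (intro finite_measureI) (simp add: s)
  have sM[measurable_cong]: "sets M = sets lborel" by (simp add: M_def)
  have IM: "(\<integral>x. f x \<partial>M) = tint s t f" if [measurable]: "f \<in> borel_measurable borel" for f :: "real \<Rightarrow> real"
    unfolding M_def tint_def by (subst integral_density) (auto simp: indicator_def)
  have [measurable]: "(\<lambda>(\<tau>, \<rho>). if s \<le> \<rho> \<and> \<rho> \<le> \<tau> \<and> \<tau> \<le> t then h \<rho> \<tau> else 0) \<in> borel_measurable (M \<Otimes>\<^sub>M borel)"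
    by measurable
  have "tint s t (\<lambda>\<tau>. tint s \<tau> (\<lambda>\<rho>. h \<rho> \<tau>)) = tint s t (\<lambda>\<tau>. tint s t (\<lambda>\<rho>. if s \<le> \<rho> \<and> \<rho> \<le> \<tau> \<and> \<tau> \<le> t then h \<rho> \<tau> else 0))"
    by (intro tint_cong) (auto simp: tint_def indicator_def intro!: Bochner_Integration.integral_cong)
  also have "\<dots> = (\<integral>\<tau>. tint s t (\<lambda>\<rho>. if s \<le> \<rho> \<and> \<rho> \<le> \<tau> \<and> \<tau> \<le> t then h \<rho> \<tau> else 0) \<partial>M)"
    by (rule IM[symmetric]) measurable
  also have "\<dots> = tint s t (\<lambda>\<rho>. \<integral>\<tau>. (if s \<le> \<rho> \<and> \<rho> \<le> \<tau> \<and> \<tau> \<le> t then h \<rho> \<tau> else 0) \<partial>M)"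
  proof (rule integral_tint_swap[where B="max B 0"])
    show "finite_measure M" by (rule M.finite_measure_axioms)
    show "\<bar>if s \<le> u \<and> u \<le> x \<and> x \<le> t then h u x else 0\<bar> \<le> max B 0" for x u
      using B[of u x] by auto
  qed (use s in auto)
  also have "\<dots> = tint s t (\<lambda>\<rho>. tint \<rho> t (h \<rho>))"
  proof (rule tint_cong)
    fix \<rho> assume r: "s \<le> \<rho>" "\<rho> \<le> t"
    have [measurable]: "h \<rho> \<in> borel_measurable borel"
      using measurable_Pair2[OF h, of \<rho>] by simp
    have "(\<integral>\<tau>. (if s \<le> \<rho> \<and> \<rho> \<le> \<tau> \<and> \<tau> \<le> t then h \<rho> \<tau> else 0) \<partial>M)
      = tint s t (\<lambda>\<tau>. if s \<le> \<rho> \<and> \<rho> \<le> \<tau> \<and> \<tau> \<le> t then h \<rho> \<tau> else 0)"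
      by (rule IM) measurable
    also have "\<dots> = tint \<rho> t (h \<rho>)"
      unfolding tint_def using r by (intro Bochner_Integration.integral_cong) (auto simp: indicator_def)
    finally show "(\<integral>\<tau>. (if s \<le> \<rho> \<and> \<rho> \<le> \<tau> \<and> \<tau> \<le> t then h \<rho> \<tau> else 0) \<partial>M) = tint \<rho> t (h \<rho>)" .
  qed
  finally show ?thesis .
qed

lemma tint_power:
  assumes "s \<le> t"
  shows "tint s t (\<lambda>u. (t - u) ^ k) = (t - s) ^ Suc k / Suc k"
proof -
  define G where "G u = - ((t - u) ^ Suc k / Suc k)" for u
  have D: "(G has_real_derivative (t - u) ^ k) (at u)" for u
    unfolding G_def
    by (rule derivative_eq_intros refl | simp)+
  have "tint s t (\<lambda>u. (t - u) ^ k) = (\<integral>u. (t - u) ^ k * indicator {s..t} u \<partial>lborel)"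
    unfolding tint_eq_set_integral set_lebesgue_integral_def by (simp add: mult.commute)
  also have "\<dots> = G t - G s"
    by (intro integral_FTC_Icc_real assms DERIV_subset[OF D] subset_UNIV D continuous_intros)
  finally show ?thesis by (simp add: G_def)
qed

text \<open>\<phi> is only measurable and bounded, so the exponential need not be differentiable in
  \<rho> at every point. Instead \<open>D\<close>, the exponential plus the integral, both taken
  from \<rho> on, is shown to vary by at most \<open>M\<^sup>2 * (b - a)\<^sup>2\<close> between two
  points. Its derivative is therefore 0, and it keeps the value 1 that it has at t.\<close>

lemma exp_tint_duhamel:
  assumes phi[measurable]: "\<phi> \<in> borel_measurable borel"
    and M: "\<And>u. s \<le> u \<Longrightarrow> u \<le> t \<Longrightarrow> 0 \<le> \<phi> u \<and> \<phi> u \<le> M" and s: "s \<le> t"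
  shows "exp (- tint s t \<phi>) = 1 - tint s t (\<lambda>\<rho>. \<phi> \<rho> * exp (- tint \<rho> t \<phi>))"
proof -
  define D where "D \<rho> = exp (- tint \<rho> t \<phi>) + tint \<rho> t (\<lambda>u. \<phi> u * exp (- tint u t \<phi>))" for \<rho>
  have M0: "0 \<le> M" using M[of s] s by auto
  have le1: "exp (- tint u t \<phi>) \<le> 1" if "s \<le> u" for u
    using tint_nonneg[of u t \<phi>] M that by force
  have sq: "\<bar>D a - D b\<bar> \<le> M\<^sup>2 * (b - a)\<^sup>2" if ab: "s \<le> a" "a \<le> b" "b \<le> t" for a b
  proof -
    define d where "d = tint a b \<phi>"
    define E where "E = exp (- tint b t \<phi>)"
    have d: "0 \<le> d" "d \<le> M * (b - a)"
      using tint_nonneg[of a b \<phi>] tint_bound_const[of \<phi> a b M] M ab s by (auto simp: d_def)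
    have E: "0 \<le> E" "E \<le> 1" using le1[of b] ab by (auto simp: E_def)
    have s1: "tint a t \<phi> = d + tint b t \<phi>"
      unfolding d_def by (rule tint_split[where B=M]) (use M ab s in \<open>auto simp: abs_le_iff intro: order_trans\<close>)
    have bd: "\<bar>\<phi> u * exp (- tint u t \<phi>)\<bar> \<le> M" if "s \<le> u" "u \<le> t" for u
      using M[OF that] le1[of u] that mult_mono[of "\<phi> u" M "exp (- tint u t \<phi>)" 1] by (simp add: abs_mult)
    have s2: "tint a t (\<lambda>u. \<phi> u * exp (- tint u t \<phi>)) =
        tint a b (\<lambda>u. \<phi> u * exp (- tint u t \<phi>)) + tint b t (\<lambda>u. \<phi> u * exp (- tint u t \<phi>))"
      by (rule tint_split[where B=M]) (use bd ab s in auto)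
    \<comment> \<open>Over [a, b] the exponential is trapped between its end values, so the
      increment \<open>I\<close> lies between d * E * exp (-d) and d * E. The first-order terms of D
      a - D b cancel, and a remainder of order d * d is left.\<close>
    have r: "E * exp (-d) \<le> exp (- tint u t \<phi>) \<and> exp (- tint u t \<phi>) \<le> E" if u: "a \<le> u" "u \<le> b" for u
    proof -
      have 1: "tint u t \<phi> = tint u b \<phi> + tint b t \<phi>"
        by (rule tint_split[where B=M]) (use M ab s u in \<open>auto simp: abs_le_iff intro: order_trans\<close>)
      have 2: "d = tint a u \<phi> + tint u b \<phi>"
        unfolding d_def by (rule tint_split[where B=M]) (use M ab s u in \<open>auto simp: abs_le_iff intro: order_trans\<close>)
      have "0 \<le> tint u b \<phi>" "0 \<le> tint a u \<phi>" using M ab u by (auto intro!: tint_nonneg)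
      then show ?thesis using 1 2 by (simp add: E_def flip: exp_add)
    qed
    define I where "I = tint a b (\<lambda>u. \<phi> u * exp (- tint u t \<phi>))"
    have phi_nn: "0 \<le> \<phi> u" "\<phi> u \<le> M" if "a \<le> u" "u \<le> b" for u using M[of u] that ab by auto
    have I1: "I \<le> d * E"
    proof -
      have "\<bar>I\<bar> \<le> tint a b (\<lambda>u. E * \<phi> u)"
        unfolding I_def
        by (rule tint_bound[where B=M]) (use r phi_nn E ab s in \<open>auto simp: abs_mult mult.commute[of E]
             intro!: mult_left_mono order_trans[OF mult_right_le_one_le]\<close>)
      then show ?thesis by (simp add: tint_cmult d_def mult.commute)
    qed
    have I2: "d * (E * exp (-d)) \<le> I"
    proof -
      have le: "\<bar>\<phi> u * (E * exp (-d))\<bar> \<le> \<phi> u * exp (- tint u t \<phi>)" if "a \<le> u" "u \<le> b" for u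
        using r[OF that] phi_nn[OF that] E by (auto simp: abs_mult intro!: mult_left_mono)
      have "\<bar>tint a b (\<lambda>u. \<phi> u * (E * exp (-d)))\<bar> \<le> I"
        unfolding I_def
        by (rule tint_bound[where B=M]) (use le bd ab s in \<open>auto simp: abs_le_iff\<close>)
      moreover have "tint a b (\<lambda>u. \<phi> u * (E * exp (-d))) = d * (E * exp (-d))"
        using tint_cmult[of a b "E * exp (-d)" \<phi>] by (simp add: d_def mult.commute)
      ultimately show ?thesis by (simp add: abs_le_iff)
    qed
    have ex: "exp (-d) \<ge> 1 - d" using exp_ge_add_one_self[of "-d"] by simp
    have ex2: "1 - exp (-d) - d * exp (-d) \<ge> 0"
    proof -
      have "(1 + d) \<le> exp d" by (rule exp_ge_add_one_self)
      then have "(1 + d) * exp (-d) \<le> 1" by (simp add: exp_minus field_simps)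
      then show ?thesis by (simp add: algebra_simps)
    qed
    have DD: "D a - D b = E * exp (-d) - E + I"
      unfolding D_def s1 s2 E_def I_def by (simp add: exp_diff exp_minus exp_add field_simps)
    have "D a - D b \<le> E * (exp (-d) - 1 + d)"
      using I1 DD by (simp add: algebra_simps)
    also have "\<dots> \<le> 1 * (d * d)"
    proof (rule mult_mono)
      have "exp (-d) * (1 + d) \<le> 1" using ex2 by (simp add: algebra_simps)
      then have "exp (-d) \<le> 1 / (1 + d)" using d by (simp add: field_simps)
      also have "\<dots> \<le> 1 - d + d * d" using d by (simp add: field_simps)
      finally show "exp (-d) - 1 + d \<le> d * d" by simp
    qed (use E ex in auto)
    finally have u1: "D a - D b \<le> d * d" by simp
    have "- (D a - D b) \<le> E * (1 - exp (-d) - d * exp (-d))"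
      using I2 DD by (simp add: algebra_simps)
    also have "\<dots> \<le> 1 * (d * d)"
    proof (rule mult_mono)
      have "d * (1 - d) \<le> d * exp (-d)" using ex d by (intro mult_left_mono) auto
      then show "1 - exp (-d) - d * exp (-d) \<le> d * d" using ex by (simp add: algebra_simps)
    qed (use E ex2 in auto)
    finally have "\<bar>D a - D b\<bar> \<le> d * d" using u1 by (simp add: abs_le_iff)
    also have "\<dots> \<le> (M * (b - a)) * (M * (b - a))" using d by (intro mult_mono) auto
    finally show ?thesis by (simp add: power2_eq_square ac_simps)
  qed
  have sq': "\<bar>D a - D b\<bar> \<le> M\<^sup>2 * (b - a)\<^sup>2" if "s \<le> a" "a \<le> t" "s \<le> b" "b \<le> t" for a b
    using sq[of a b] sq[of b a] that by (cases "a \<le> b") (auto simp: abs_minus_commute power2_commute)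
  have deriv: "(D has_real_derivative 0) (at x within {s..t})" if x: "x \<in> {s..t}" for x
    unfolding has_field_derivative_iff
  proof (rule Lim_null_comparison)
    show "\<forall>\<^sub>F y in at x within {s..t}. norm ((D y - D x) / (y - x)) \<le> M\<^sup>2 * \<bar>y - x\<bar>"
    proof (rule eventually_at_filter[THEN iffD2], intro always_eventually allI impI)
      fix y assume "y \<noteq> x" "y \<in> {s..t}"
      then show "norm ((D y - D x) / (y - x)) \<le> M\<^sup>2 * \<bar>y - x\<bar>"
        using sq'[of y x] x by (simp add: abs_divide divide_le_eq power2_eq_square abs_mult_self_eq mult.assoc
            flip: abs_mult) (simp add: abs_mult algebra_simps)
    qed
    have "((\<lambda>y. M\<^sup>2 * \<bar>y - x\<bar>) \<longlongrightarrow> M\<^sup>2 * \<bar>x - x\<bar>) (at x within {s..t})"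
      by (intro tendsto_intros)
    then show "((\<lambda>y. M\<^sup>2 * \<bar>y - x\<bar>) \<longlongrightarrow> 0) (at x within {s..t})" by simp
  qed
  have "D s = D t"
  proof -
    obtain c where c: "\<And>x. x \<in> {s..t} \<Longrightarrow> D x = c"
      using has_field_derivative_zero_constant[of "{s..t}" D] deriv by auto
    show ?thesis using c[of s] c[of t] s by simp
  qed
  then show ?thesis by (simp add: D_def tint_refl)
qed

text \<open>The integrand varies with x as well. Pushing \<open>L x\<close> forward under y
  \<mapsto> (x, y) leaves one fixed integrand on the product space, and its integral is a measurable
  function of the measure.\<close>

lemma integral_measurable_kernel:
  fixes f :: "'a \<Rightarrow> 'b \<Rightarrow> real"
  assumes f[measurable]: "(\<lambda>(x, y). f x y) \<in> borel_measurable (M \<Otimes>\<^sub>M N)"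
    and L: "L \<in> M \<rightarrow>\<^sub>M prob_algebra N"
  shows "(\<lambda>x. \<integral>y. f x y \<partial>L x) \<in> borel_measurable M"
proof -
  have L'[measurable]: "L \<in> measurable M (subprob_algebra N)"
    using L by (rule measurable_prob_algebraD)
  note measurable_distr2[measurable]
  have "(\<lambda>x. integral\<^sup>L (distr (L x) (M \<Otimes>\<^sub>M N) (\<lambda>y. (x, y))) (\<lambda>(x, y). f x y)) \<in> borel_measurable M"
    by measurable
  then show ?thesis
    by (rule measurable_cong[THEN iffD1, rotated])
       (simp add: integral_distr sets_kernel[OF L'])
qed

lemma integral_bind_bounded:
  fixes f :: "'b \<Rightarrow> real"
  assumes M: "prob_space M" "sets M = sets M'" and N: "N \<in> M' \<rightarrow>\<^sub>M prob_algebra R"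
    and f: "f \<in> borel_measurable R" "\<And>x. x \<in> space R \<Longrightarrow> \<bar>f x\<bar> \<le> B"
  shows "(\<integral>x. f x \<partial>(M \<bind> N)) = (\<integral>x. \<integral>y. f y \<partial>N x \<partial>M)"
proof -
  interpret prob_space M by fact
  have N': "N \<in> M \<rightarrow>\<^sub>M subprob_algebra R"
    using measurable_prob_algebraD[OF N] by (simp cong: measurable_cong_sets add: M(2))
  have "prob_space (N x)" if "x \<in> space M" for x
    using measurable_space[OF N, of x] that sets_eq_imp_space_eq[OF M(2)] by (simp add: space_prob_algebra)
  then have ae: "AE x in M. emeasure (N x) (space (N x)) \<le> ennreal 1"
    by (auto simp: prob_space.emeasure_space_1)
  show ?thesis
    by (rule integral_bind[OF f N' finite_measure_axioms ae])
qed

lemma prob_integral_abs_le: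
  fixes f :: "'a \<Rightarrow> real"
  assumes "prob_space M" "\<And>x. x \<in> space M \<Longrightarrow> \<bar>f x\<bar> \<le> B"
  shows "\<bar>\<integral>x. f x \<partial>M\<bar> \<le> B"
proof -
  interpret prob_space M by fact
  show ?thesis
  proof (cases "integrable M f")
    case True
    have "\<bar>\<integral>x. f x \<partial>M\<bar> \<le> (\<integral>x. \<bar>f x\<bar> \<partial>M)" by (rule integral_abs_bound)
    also have "\<dots> \<le> (\<integral>x. B \<partial>M)" using True assms by (intro integral_mono) auto
    finally show ?thesis by (simp add: prob_space)
  next
    \<comment> \<open>A non-integrable function has integral 0, and B \<ge> 0 because a probability
      space has a point. Hence the bound can be used before measurability is known.\<close>
    case False
    obtain x where "x \<in> space M" using not_empty by auto
    then show ?thesis using False assms(2)[of x] by (simp add: not_integrable_integral_eq)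
  qed
qed

lemma prob_integrable_bounded:
  fixes f :: "'a \<Rightarrow> real"
  assumes "prob_space M" "f \<in> borel_measurable M" "\<And>x. x \<in> space M \<Longrightarrow> \<bar>f x\<bar> \<le> B"
  shows "integrable M f"
proof -
  interpret prob_space M by fact
  show ?thesis by (rule integrable_const_bound[where B=B]) (use assms in auto)
qed

lemma prob_integral_swap:
  fixes f :: "'a \<Rightarrow> 'b \<Rightarrow> real"
  assumes "prob_space M" "prob_space N" "case_prod f \<in> borel_measurable (M \<Otimes>\<^sub>M N)"
    "\<And>x y. x \<in> space M \<Longrightarrow> y \<in> space N \<Longrightarrow> \<bar>f x y\<bar> \<le> B"
  shows "(\<integral>x. \<integral>y. f x y \<partial>N \<partial>M) = (\<integral>y. \<integral>x. f x y \<partial>M \<partial>N)"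
proof -
  interpret M: prob_space M by fact
  interpret N: prob_space N by fact
  interpret pair_prob_space M N ..
  have "integrable (M \<Otimes>\<^sub>M N) (case_prod f)"
    by (rule prob_integrable_bounded[where B=B]) (use assms P.prob_space_axioms in \<open>auto simp: space_pair_measure\<close>)
  then show ?thesis by (rule Fubini_integral[symmetric])
qed

lemma integral_kernel_swap:
  fixes f :: "'a \<Rightarrow> 'b \<Rightarrow> real"
  assumes "prob_space M" and [measurable]: "case_prod f \<in> borel_measurable (M \<Otimes>\<^sub>M N)"
    and "\<And>x y. x \<in> space M \<Longrightarrow> y \<in> space N \<Longrightarrow> \<bar>f x y\<bar> \<le> B"
    and "prob_space L" "sets L = sets N"
  shows "(\<integral>x. \<integral>y. f x y \<partial>L \<partial>M) = (\<integral>y. \<integral>x. f x y \<partial>M \<partial>L)"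
  using assms sets_eq_imp_space_eq[OF assms(5)]
  by (intro prob_integral_swap[where B=B]) (simp_all cong: measurable_cong_sets add: sets_pair_measure_cong[OF refl assms(5)])

section \<open>Path spaces and the product of independent copies of the Markov process\<close>

lemma in_space_path_space:
  "\<omega> \<in> space path_space \<longleftrightarrow> \<omega> \<in> extensional {0..} \<and> (\<forall>t\<ge>0. (\<omega> \<longlongrightarrow> \<omega> t) (at_right t))"
  by (auto simp: path_space_def space_restrict_space space_PiM PiE_def)

lemma path_space_coord: "0 \<le> u \<Longrightarrow> (\<lambda>\<omega>. \<omega> u) \<in> borel_measurable path_space"
  unfolding path_space_def by (intro measurable_restrict_space1 measurable_component_singleton) auto

lemma measurable_path_spaceI:
  assumes "\<And>x. x \<in> space M \<Longrightarrow> f x \<in> space path_space"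
    and "\<And>u. 0 \<le> u \<Longrightarrow> (\<lambda>x. f x u) \<in> borel_measurable M"
  shows "f \<in> M \<rightarrow>\<^sub>M path_space"
  unfolding path_space_def
proof (rule measurable_restrict_space2)
  show "f \<in> space M \<rightarrow> {\<omega>. \<forall>t\<ge>0. (\<omega> \<longlongrightarrow> \<omega> t) (at_right t)}"
    using assms(1) by (auto simp: in_space_path_space)
  show "f \<in> M \<rightarrow>\<^sub>M PiM {0..} (\<lambda>_. borel)"
  proof (rule measurable_PiM_single')
    show "f \<in> space M \<rightarrow> (\<Pi>\<^sub>E i\<in>{0..}. space borel)"
      using assms(1) by (auto simp: in_space_path_space PiE_def)
  qed (use assms(2) in auto)
qed

text \<open>Right-continuity makes \<omega> u the limit of \<omega> at grid points just to the right
  of u. For each mesh only countably many grid times occur, and evaluation at a fixed time is a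
  coordinate map.\<close>

lemma measurable_path_eval:
  "(\<lambda>(u, \<omega>). \<omega> (max 0 u)) \<in> borel \<Otimes>\<^sub>M path_space \<rightarrow>\<^sub>M (borel :: 'a::metric_space measure)"
proof (rule borel_measurable_LIMSEQ_metric)
  fix n :: nat
  have "(\<lambda>x. snd x (max 0 ((real_of_int \<lfloor>real (Suc n) * max 0 (fst x)\<rfloor> + 1) / real (Suc n))))
     \<in> borel \<Otimes>\<^sub>M path_space \<rightarrow>\<^sub>M (borel :: 'a measure)"
  proof (rule measurable_compose_countable[where g="\<lambda>x. \<lfloor>real (Suc n) * max 0 (fst x)\<rfloor>" and
        f="\<lambda>i x. snd x (max 0 ((real_of_int i + 1) / real (Suc n)))"])
    show "(\<lambda>x. snd x (max 0 ((real_of_int i + 1) / real (Suc n)))) \<in> borel \<Otimes>\<^sub>M path_space \<rightarrow>\<^sub>M (borel :: 'a measure)" for i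
      by (rule measurable_compose[OF measurable_snd path_space_coord]) simp
    show "(\<lambda>x. \<lfloor>real (Suc n) * max 0 (fst x)\<rfloor>) \<in> borel \<Otimes>\<^sub>M path_space \<rightarrow>\<^sub>M count_space UNIV"
      by measurable
  qed
  then show "(\<lambda>(u, \<omega>). \<omega> (max 0 ((real_of_int \<lfloor>real (Suc n) * max 0 u\<rfloor> + 1) / real (Suc n))))
    \<in> borel \<Otimes>\<^sub>M path_space \<rightarrow>\<^sub>M (borel :: 'a measure)"
    by (simp add: case_prod_beta')
next
  fix x :: "real \<times> (real \<Rightarrow> 'a)" assume x: "x \<in> space (borel \<Otimes>\<^sub>M path_space)"
  obtain u0 \<omega> where x_eq: "x = (u0, \<omega>)" by (cases x)
  define u where "u = max 0 u0"
  have u: "0 \<le> u" by (simp add: u_def)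
  have om: "(\<omega> \<longlongrightarrow> \<omega> u) (at_right u)"
    using x u by (auto simp: x_eq space_pair_measure in_space_path_space)
  define a where "a n = (real_of_int \<lfloor>real (Suc n) * u\<rfloor> + 1) / real (Suc n)" for n
  \<comment> \<open>The grid point lies strictly to the right of u (hence the + 1 after the floor),
    as the punctured filter \<open>at_right u\<close> requires.\<close>
  have a1: "u < a n" for n
    using floor_correct[of "real (Suc n) * u"] by (simp add: a_def pos_less_divide_eq mult.commute del: of_nat_Suc)
  have a2: "a n \<le> u + 1 / real (Suc n)" for n
  proof -
    have "real_of_int \<lfloor>real (Suc n) * u\<rfloor> \<le> real (Suc n) * u" by (rule of_int_floor_le)
    then have "a n \<le> (real (Suc n) * u + 1) / real (Suc n)"
      unfolding a_def by (intro divide_right_mono) auto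
    then show ?thesis by (simp add: add_divide_distrib del: of_nat_Suc)
  qed
  have lim: "a \<longlonglongrightarrow> u"
  proof (rule tendsto_sandwich)
    show "(\<lambda>n. u) \<longlonglongrightarrow> u" by simp
    show "(\<lambda>n. u + 1 / real (Suc n)) \<longlonglongrightarrow> u"
      using LIMSEQ_inverse_real_of_nat_add[of u] by (simp add: inverse_eq_divide)
  qed (use a1 a2 in \<open>auto intro!: always_eventually less_imp_le\<close>)
  have "filterlim a (at_right u) sequentially"
    unfolding filterlim_at using lim a1
    by (intro conjI always_eventually allI) (auto simp: less_imp_neq[OF a1, symmetric])
  then have "(\<lambda>n. \<omega> (a n)) \<longlonglongrightarrow> \<omega> u"
    by (rule filterlim_compose[OF om])
  moreover have "max 0 (a n) = a n" for n using a1[of n] u by simp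
  ultimately show "(\<lambda>n. case x of (u, \<omega>) \<Rightarrow> \<omega> (max 0 ((real_of_int \<lfloor>real (Suc n) * max 0 u\<rfloor> + 1) / real (Suc n))))
      \<longlonglongrightarrow> (case x of (u, \<omega>) \<Rightarrow> \<omega> (max 0 u))"
    by (simp add: x_eq a_def u_def)
qed

lemma measurable_path_eval':
  assumes "f \<in> borel_measurable M" "g \<in> M \<rightarrow>\<^sub>M path_space"
  shows "(\<lambda>x. g x (max 0 (f x))) \<in> borel_measurable M"
  using measurable_compose[OF measurable_Pair[OF assms] measurable_path_eval] by simp

text \<open>Times are clipped at 0, so that every function of time is measurable on all of \<open>\<real>\<close>.\<close>

definition pos :: "nat \<Rightarrow> (nat \<Rightarrow> real \<Rightarrow> 'a) \<Rightarrow> real \<Rightarrow> nat \<Rightarrow> 'a" where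
  "pos m z u = (\<lambda>i\<in>{..<m}. z i (max 0 u))"

definition prod_law ::
  "(real \<Rightarrow> 'a::metric_space \<Rightarrow> (real \<Rightarrow> 'a) measure) \<Rightarrow> nat \<Rightarrow> real \<Rightarrow> (nat \<Rightarrow> 'a) \<Rightarrow> (nat \<Rightarrow> real \<Rightarrow> 'a) measure" where
  "prod_law K m s x = PiM {..<m} (\<lambda>i. K (max 0 s) (x i))"

lemma measurable_paths_component:
  assumes "g \<in> M \<rightarrow>\<^sub>M paths m" "i < m" shows "(\<lambda>x. g x i) \<in> M \<rightarrow>\<^sub>M path_space"
  by (rule measurable_compose[OF assms(1)[unfolded paths_def] measurable_component_singleton]) (use assms in auto)

lemma measurable_state_component:
  assumes "g \<in> M \<rightarrow>\<^sub>M state_space m" "i < m" shows "(\<lambda>x. g x i) \<in> borel_measurable M"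
  by (rule measurable_compose[OF assms(1)[unfolded state_space_def] measurable_component_singleton]) (use assms in auto)

lemma measurable_state_spaceI [measurable (raw)]:
  assumes "\<And>i. i < m \<Longrightarrow> (\<lambda>x. f x i) \<in> borel_measurable M"
  shows "(\<lambda>x. \<lambda>i\<in>{..<m}. f x i) \<in> M \<rightarrow>\<^sub>M state_space m"
  unfolding state_space_def by (rule measurable_restrict) (use assms in auto)

lemma measurable_pathsI [measurable (raw)]:
  assumes "\<And>i. i < m \<Longrightarrow> (\<lambda>x. f x i) \<in> M \<rightarrow>\<^sub>M path_space"
  shows "(\<lambda>x. \<lambda>i\<in>{..<m}. f x i) \<in> M \<rightarrow>\<^sub>M paths m"
  unfolding paths_def by (rule measurable_restrict) (use assms in auto)

lemma measurable_pos [measurable (raw)]: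
  assumes [measurable]: "f \<in> borel_measurable M" "g \<in> M \<rightarrow>\<^sub>M paths m"
  shows "(\<lambda>x. pos m (g x) (f x)) \<in> M \<rightarrow>\<^sub>M state_space m"
  unfolding pos_def
  by (rule measurable_state_spaceI, rule measurable_path_eval'[OF assms(1) measurable_paths_component[OF assms(2)]])

lemma space_paths: "z \<in> space (paths m) \<longleftrightarrow> z \<in> extensional {..<m} \<and> (\<forall>i<m. z i \<in> space path_space)"
  by (auto simp: paths_def space_PiM PiE_def Pi_iff)

lemma space_state_space: "space (state_space m) = extensional {..<m}"
  by (auto simp: state_space_def space_PiM PiE_def)

lemma pos_in_space [simp]: "pos m z u \<in> space (state_space m)"
  by (simp add: pos_def space_state_space)

text \<open>The locale \<open>product_prob_space\<close> asks for a probability space at every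
  index, while kernels provide one at the indices in I. A point mass fills the other indices and
  does not affect the product over I.\<close>

lemma product_prob_space_extend:
  assumes "\<And>i. i \<in> I \<Longrightarrow> prob_space (M i)"
  shows "product_prob_space (\<lambda>i. if i \<in> I then M i else return (count_space UNIV) undefined)"
  by (rule product_prob_spaceI) (use assms in \<open>simp add: prob_space_return\<close>)

text \<open>It is enough to test the intersection-stable generator of boxes, where the value is a
  finite product of measurable functions.\<close>

lemma measurable_PiM_kernel:
  assumes I: "finite I" and L: "\<And>i. i \<in> I \<Longrightarrow> (\<lambda>x. L i x) \<in> M \<rightarrow>\<^sub>M prob_algebra (N i)"
  shows "(\<lambda>x. PiM I (\<lambda>i. L i x)) \<in> M \<rightarrow>\<^sub>M prob_algebra (PiM I N)"
proof (rule measurable_prob_algebra_generated[OF sets_PiM Int_stable_prod_algebra prod_algebra_sets_into_space])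
  have Lx: "prob_space (L i x)" "sets (L i x) = sets (N i)" if "x \<in> space M" "i \<in> I" for i x
    using measurable_space[OF L[OF that(2)] that(1)] by (auto simp: space_prob_algebra)
  show "prob_space (PiM I (\<lambda>i. L i x))" if "x \<in> space M" for x
    using that Lx by (intro prob_space_PiM) auto
  show "sets (PiM I (\<lambda>i. L i x)) = sets (PiM I N)" if "x \<in> space M" for x
    using that Lx by (intro sets_PiM_cong) auto
  fix A assume "A \<in> prod_algebra I N"
  then obtain X where A: "A = PiE I X" and X: "\<And>i. i \<in> I \<Longrightarrow> X i \<in> sets (N i)"
    using I by (auto simp: prod_algebra_eq_finite)
  have "emeasure (PiM I (\<lambda>i. L i x)) A = (\<Prod>i\<in>I. emeasure (L i x) (X i))" if x: "x \<in> space M" for x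
  proof -
    define L' where "L' i = (if i \<in> I then L i x else return (count_space UNIV) undefined)" for i
    interpret product_prob_space L' I
      unfolding L'_def by (rule product_prob_space_extend) (rule Lx(1)[OF x])
    have "PiM I (\<lambda>i. L i x) = PiM I L'" by (intro PiM_cong) (auto simp: L'_def)
    moreover have "emeasure (PiM I L') A = (\<Prod>i\<in>I. emeasure (L' i) (X i))"
      unfolding A by (rule emeasure_PiM) (use I X Lx[OF x] in \<open>auto simp: L'_def\<close>)
    ultimately show ?thesis by (simp add: L'_def)
  qed
  then show "(\<lambda>x. emeasure (PiM I (\<lambda>i. L i x)) A) \<in> borel_measurable M"
    by (subst measurable_cong) (auto intro!: borel_measurable_prod_ennreal measurable_emeasure_kernel[OF measurable_prob_algebraD[OF L]] X)
qed

lemma PiM_eqI_prob: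
  assumes I: "finite I" and M: "\<And>i. i \<in> I \<Longrightarrow> prob_space (M i)" and P: "sets P = sets (PiM I M)"
    and eq: "\<And>A. (\<And>i. i \<in> I \<Longrightarrow> A i \<in> sets (M i)) \<Longrightarrow> emeasure P (PiE I A) = (\<Prod>i\<in>I. emeasure (M i) (A i))"
  shows "P = PiM I M"
proof -
  define M' where "M' i = (if i \<in> I then M i else return (count_space UNIV) undefined)" for i
  interpret product_prob_space M' I
    unfolding M'_def by (rule product_prob_space_extend[OF M])
  have *: "PiM I M = PiM I M'" by (intro PiM_cong) (auto simp: M'_def)
  show ?thesis unfolding *
  proof (rule PiM_eqI[OF I])
    show "sets P = sets (PiM I M')" using assms(3) * by simp
    fix A assume A: "\<And>i. i \<in> I \<Longrightarrow> A i \<in> sets (M' i)"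
    show "emeasure P (PiE I A) = (\<Prod>i\<in>I. emeasure (M' i) (A i))"
      using assms(4)[of A] A by (simp add: M'_def)
  qed
qed

lemma nn_integral_PiM_prod:
  assumes I: "finite I" and M: "\<And>i. i \<in> I \<Longrightarrow> prob_space (M i)"
    and f: "\<And>i. i \<in> I \<Longrightarrow> f i \<in> borel_measurable (M i)"
  shows "(\<integral>\<^sup>+ x. (\<Prod>i\<in>I. f i (x i)) \<partial>PiM I M) = (\<Prod>i\<in>I. integral\<^sup>N (M i) (f i))"
proof -
  define M' where "M' i = (if i \<in> I then M i else return (count_space UNIV) undefined)" for i
  interpret product_prob_space M' I
    unfolding M'_def by (rule product_prob_space_extend[OF M])
  have "PiM I M = PiM I M'" by (intro PiM_cong) (auto simp: M'_def)
  then have "(\<integral>\<^sup>+ x. (\<Prod>i\<in>I. f i (x i)) \<partial>PiM I M) = (\<Prod>i\<in>I. integral\<^sup>N (M' i) (f i))"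
    using product_nn_integral_prod[of I f] I f by (simp add: M'_def)
  then show ?thesis by (simp add: M'_def)
qed

text \<open>Both sides are tested on boxes: the inner product measure factorises for each fixed x,
  and then the integral over independent coordinates factorises too. This carries the Markov
  property, and later the initial law, from one particle to several independent ones.\<close>

lemma PiM_bind:
  assumes I: "finite I" and M: "\<And>i. i \<in> I \<Longrightarrow> M i \<in> space (prob_algebra (M' i))"
    and L: "\<And>i. i \<in> I \<Longrightarrow> L i \<in> M' i \<rightarrow>\<^sub>M prob_algebra (N i)"
  shows "PiM I M \<bind> (\<lambda>x. PiM I (\<lambda>i. L i (x i))) = PiM I (\<lambda>i. M i \<bind> L i)"
proof (rule PiM_eqI_prob[OF I])
  have M1: "prob_space (M i)" "sets (M i) = sets (M' i)" if "i \<in> I" for i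
    using M[OF that] by (auto simp: space_prob_algebra)
  have PM: "PiM I M \<in> space (prob_algebra (PiM I M'))"
    using M1 by (auto simp: space_prob_algebra intro!: prob_space_PiM sets_PiM_cong)
  have LK: "(\<lambda>x. PiM I (\<lambda>i. L i (x i))) \<in> PiM I M' \<rightarrow>\<^sub>M prob_algebra (PiM I N)"
  proof (rule measurable_PiM_kernel[OF I])
    show "(\<lambda>x. L i (x i)) \<in> PiM I M' \<rightarrow>\<^sub>M prob_algebra (N i)" if i: "i \<in> I" for i
      by (rule measurable_compose[OF measurable_component_singleton[OF i, of M'] L[OF i]])
  qed
  have sb: "sets (M i \<bind> L i) = sets (N i)" if "i \<in> I" for i
    using sets_bind'[OF M[OF that] L[OF that]] .
  show "prob_space (M i \<bind> L i)" if "i \<in> I" for i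
    using prob_space_bind'[OF M[OF that] L[OF that]] .
  show "sets (PiM I M \<bind> (\<lambda>x. PiM I (\<lambda>i. L i (x i)))) = sets (PiM I (\<lambda>i. M i \<bind> L i))"
    using sets_bind'[OF PM LK] sb by (simp cong: sets_PiM_cong)
  fix A assume A: "\<And>i. i \<in> I \<Longrightarrow> A i \<in> sets (M i \<bind> L i)"
  then have A': "A i \<in> sets (N i)" if "i \<in> I" for i using that sb by auto
  have "emeasure (PiM I M \<bind> (\<lambda>x. PiM I (\<lambda>i. L i (x i)))) (PiE I A)
    = (\<integral>\<^sup>+x. emeasure (PiM I (\<lambda>i. L i (x i))) (PiE I A) \<partial>PiM I M)"
    by (rule emeasure_bind_prob_algebra[OF PM LK]) (use I A' in auto)
  also have "\<dots> = (\<integral>\<^sup>+x. (\<Prod>i\<in>I. emeasure (L i (x i)) (A i)) \<partial>PiM I M)"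
  proof (rule nn_integral_cong)
    fix x assume x: "x \<in> space (PiM I M)"
    have Lx: "prob_space (L i (x i))" "sets (L i (x i)) = sets (N i)" if "i \<in> I" for i
    proof -
      have "x i \<in> space (M' i)" using x that sets_eq_imp_space_eq[OF M1(2)[OF that]] by (auto simp: space_PiM)
      from measurable_space[OF L[OF that] this]
      show "prob_space (L i (x i))" "sets (L i (x i)) = sets (N i)" by (auto simp: space_prob_algebra)
    qed
    have e: "emeasure (PiM I (\<lambda>i. L i (x i))) (PiE I A) = (\<integral>\<^sup>+y. (\<Prod>i\<in>I. indicator (A i) (y i)) \<partial>PiM I (\<lambda>i. L i (x i)))"
    proof (subst nn_integral_indicator[symmetric])
      show "PiE I A \<in> sets (PiM I (\<lambda>i. L i (x i)))" using I A' Lx by (intro sets_PiM_I_finite) auto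
      show "integral\<^sup>N (PiM I (\<lambda>i. L i (x i))) (indicator (PiE I A)) =
          (\<integral>\<^sup>+y. (\<Prod>i\<in>I. indicator (A i) (y i)) \<partial>PiM I (\<lambda>i. L i (x i)))"
      proof (rule nn_integral_cong)
        fix y assume y: "y \<in> space (PiM I (\<lambda>i. L i (x i)))"
        then have "y \<in> extensional I" by (auto simp: space_PiM PiE_def)
        then have "y \<in> PiE I A \<longleftrightarrow> (\<forall>i\<in>I. y i \<in> A i)" by (auto simp: PiE_def Pi_iff)
        then show "indicator (PiE I A) y = (\<Prod>i\<in>I. indicator (A i) (y i) :: ennreal)"
          using I by (auto simp: indicator_def prod_zero_iff)
      qed
    qed
    also have "\<dots> = (\<Prod>i\<in>I. \<integral>\<^sup>+y. indicator (A i) y \<partial>L i (x i))"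
      by (rule nn_integral_PiM_prod[OF I Lx(1)])
         (use Lx A' in \<open>auto intro!: borel_measurable_indicator\<close>)
    also have "\<dots> = (\<Prod>i\<in>I. emeasure (L i (x i)) (A i))"
      by (intro prod.cong refl nn_integral_indicator) (use Lx A' in auto)
    finally show "emeasure (PiM I (\<lambda>i. L i (x i))) (PiE I A) = (\<Prod>i\<in>I. emeasure (L i (x i)) (A i))" .
  qed
  also have "\<dots> = (\<Prod>i\<in>I. \<integral>\<^sup>+x. emeasure (L i x) (A i) \<partial>M i)"
  proof (rule nn_integral_PiM_prod[OF I M1(1)])
    show "(\<lambda>x. emeasure (L i x) (A i)) \<in> borel_measurable (M i)" if "i \<in> I" for i
      using measurable_emeasure_kernel[OF measurable_prob_algebraD[OF L[OF that]] A'[OF that]] M1(2)[OF that]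
      by (simp cong: measurable_cong_sets)
  qed auto
  also have "\<dots> = (\<Prod>i\<in>I. emeasure (M i \<bind> L i) (A i))"
    by (intro prod.cong refl emeasure_bind_prob_algebra[OF M L, symmetric] A')
  finally show "emeasure (PiM I M \<bind> (\<lambda>x. PiM I (\<lambda>i. L i (x i)))) (PiE I A) = (\<Prod>i\<in>I. emeasure (M i \<bind> L i) (A i))" .
qed

lemma PiM_distr:
  assumes I: "finite I" and M: "\<And>i. i \<in> I \<Longrightarrow> prob_space (M i)"
    and f: "\<And>i. i \<in> I \<Longrightarrow> f i \<in> M i \<rightarrow>\<^sub>M N i"
  shows "distr (PiM I M) (PiM I N) (\<lambda>x. \<lambda>i\<in>I. f i (x i)) = PiM I (\<lambda>i. distr (M i) (N i) (f i))"
proof (rule PiM_eqI_prob[OF I])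
  show "prob_space (distr (M i) (N i) (f i))" if "i \<in> I" for i
    using M[OF that] f[OF that] by (rule prob_space.prob_space_distr)
  show "sets (distr (PiM I M) (PiM I N) (\<lambda>x. \<lambda>i\<in>I. f i (x i))) = sets (PiM I (\<lambda>i. distr (M i) (N i) (f i)))"
    by (simp cong: sets_PiM_cong)
  have fm: "(\<lambda>x. \<lambda>i\<in>I. f i (x i)) \<in> PiM I M \<rightarrow>\<^sub>M PiM I N"
  proof (rule measurable_restrict)
    show "(\<lambda>x. f i (x i)) \<in> PiM I M \<rightarrow>\<^sub>M N i" if i: "i \<in> I" for i
      by (rule measurable_compose[OF measurable_component_singleton[OF i, of M] f[OF i]])
  qed
  fix A assume "\<And>i. i \<in> I \<Longrightarrow> A i \<in> sets (distr (M i) (N i) (f i))"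
  then have A: "A i \<in> sets (N i)" if "i \<in> I" for i using that by simp
  have "emeasure (distr (PiM I M) (PiM I N) (\<lambda>x. \<lambda>i\<in>I. f i (x i))) (PiE I A)
      = emeasure (PiM I M) (PiE I (\<lambda>i. f i -` A i \<inter> space (M i)))"
  proof (subst emeasure_distr[OF fm])
    show "PiE I A \<in> sets (PiM I N)" using I A by auto
    show "emeasure (PiM I M) ((\<lambda>x. \<lambda>i\<in>I. f i (x i)) -` PiE I A \<inter> space (PiM I M)) =
      emeasure (PiM I M) (PiE I (\<lambda>i. f i -` A i \<inter> space (M i)))"
      by (intro arg_cong[where f="emeasure _"]) (auto simp: space_PiM PiE_def Pi_iff extensional_def)
  qed
  also have "\<dots> = (\<integral>\<^sup>+x. (\<Prod>i\<in>I. indicator (f i -` A i \<inter> space (M i)) (x i)) \<partial>PiM I M)"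
  proof (subst nn_integral_indicator[symmetric])
    show "PiE I (\<lambda>i. f i -` A i \<inter> space (M i)) \<in> sets (PiM I M)"
      using I A f by (intro sets_PiM_I_finite) (auto intro: measurable_sets)
    show "integral\<^sup>N (PiM I M) (indicator (PiE I (\<lambda>i. f i -` A i \<inter> space (M i)))) =
       (\<integral>\<^sup>+x. (\<Prod>i\<in>I. indicator (f i -` A i \<inter> space (M i)) (x i)) \<partial>PiM I M)"
    proof (rule nn_integral_cong)
      fix y assume y: "y \<in> space (PiM I M)"
      then have "y \<in> extensional I" by (auto simp: space_PiM PiE_def)
      then have "y \<in> PiE I (\<lambda>i. f i -` A i \<inter> space (M i)) \<longleftrightarrow> (\<forall>i\<in>I. y i \<in> f i -` A i \<inter> space (M i))"
        by (auto simp: PiE_def Pi_iff)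
      then show "indicator (PiE I (\<lambda>i. f i -` A i \<inter> space (M i))) y =
          (\<Prod>i\<in>I. indicator (f i -` A i \<inter> space (M i)) (y i) :: ennreal)"
        using I by (auto simp: indicator_def prod_zero_iff)
    qed
  qed
  also have "\<dots> = (\<Prod>i\<in>I. \<integral>\<^sup>+y. indicator (f i -` A i \<inter> space (M i)) y \<partial>M i)"
    by (rule nn_integral_PiM_prod) (use I M A f in \<open>auto intro: measurable_sets\<close>)
  also have "\<dots> = (\<Prod>i\<in>I. emeasure (distr (M i) (N i) (f i)) (A i))"
    using A f by (intro prod.cong refl) (simp add: emeasure_distr measurable_sets)
  finally show "emeasure (distr (PiM I M) (PiM I N) (\<lambda>x. \<lambda>i\<in>I. f i (x i))) (PiE I A) =
     (\<Prod>i\<in>I. emeasure (distr (M i) (N i) (f i)) (A i))" .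
qed

text \<open>The trajectory from r on, with its position at r frozen on [0, r]. Unlike a restriction
  to [r, \<infinity>) it stays in \<open>path_space\<close>, so the functionals of the future are
  those that \<open>cut_path r\<close> leaves unchanged.\<close>

definition cut_path :: "real \<Rightarrow> (real \<Rightarrow> 'a) \<Rightarrow> real \<Rightarrow> 'a" where
  "cut_path r \<omega> = (\<lambda>v\<in>{0..}. \<omega> (max v r))"

lemma cut_path_in_space:
  assumes r: "0 \<le> r" and w: "\<omega> \<in> space path_space" shows "cut_path r \<omega> \<in> space path_space"
  unfolding in_space_path_space
proof (intro conjI allI impI)
  show "cut_path r \<omega> \<in> extensional {0..}" by (simp add: cut_path_def)
  fix u :: real assume u: "0 \<le> u"
  have lim: "(\<omega> \<longlongrightarrow> \<omega> v) (at_right v)" if "0 \<le> v" for v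
    using w that by (auto simp: in_space_path_space)
  show "(cut_path r \<omega> \<longlongrightarrow> cut_path r \<omega> u) (at_right u)"
  proof (cases "u < r")
    case True
    have "\<forall>\<^sub>F v in at_right u. v < r"
      using True by (auto simp: eventually_at_right_field)
    then have "\<forall>\<^sub>F v in at_right u. cut_path r \<omega> v = \<omega> r"
      using eventually_at_right_less[of u]
      by eventually_elim (use u in \<open>auto simp: cut_path_def\<close>)
    then show ?thesis
      by (rule tendsto_eventually[THEN tendsto_cong_limit]) (use True u in \<open>auto simp: cut_path_def\<close>)
  next
    case False
    have "\<forall>\<^sub>F v in at_right u. \<omega> v = cut_path r \<omega> v"
      using eventually_at_right_less[of u]
      by eventually_elim (use u False in \<open>auto simp: cut_path_def max_def\<close>)
    moreover have "cut_path r \<omega> u = \<omega> u" using False u by (auto simp: cut_path_def max_def)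
    ultimately show ?thesis using lim[OF u] by (auto simp: tendsto_cong)
  qed
qed

lemma measurable_cut_path: "0 \<le> r \<Longrightarrow> cut_path r \<in> path_space \<rightarrow>\<^sub>M path_space"
  by (rule measurable_path_spaceI, simp_all add: cut_path_in_space)
     (auto simp: cut_path_def intro!: path_space_coord)

section \<open>The Markov property for one particle and for several independent ones\<close>

locale markov_kernel =
  fixes K :: "real \<Rightarrow> 'a::metric_space \<Rightarrow> (real \<Rightarrow> 'a) measure"
  assumes markov: "markov_family K"
begin

lemma measurable_K:
  assumes [measurable]: "s \<in> borel_measurable M" "x \<in> borel_measurable M"
  shows "(\<lambda>w. K (max 0 (s w)) (x w)) \<in> M \<rightarrow>\<^sub>M prob_algebra path_space"
proof -
  have k: "(\<lambda>(s, x). K s x) \<in> restrict_space borel {0..} \<Otimes>\<^sub>M borel \<rightarrow>\<^sub>M prob_algebra path_space"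
    using markov by (simp add: markov_family_def)
  have "(\<lambda>w. (max 0 (s w), x w)) \<in> M \<rightarrow>\<^sub>M restrict_space borel {0..} \<Otimes>\<^sub>M borel"
    by (intro measurable_Pair measurable_restrict_space2) auto
  from measurable_compose[OF this k] show ?thesis by simp
qed

lemma K_prob:
  assumes "0 \<le> s" shows "prob_space (K s x)" "sets (K s x) = sets path_space" "space (K s x) = space path_space"
proof -
  have "K (max 0 s) x \<in> space (prob_algebra path_space)"
    by (rule measurable_space[where M="borel :: real measure"]) (auto intro!: measurable_K)
  then show "prob_space (K s x)" "sets (K s x) = sets path_space" 
    using assms by (auto simp: space_prob_algebra)
  then show "space (K s x) = space path_space" by (intro sets_eq_imp_space_eq)
qed

lemma measurable_prod_law [measurable (raw)]:
  assumes [measurable]: "s \<in> borel_measurable M" "x \<in> M \<rightarrow>\<^sub>M state_space m"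
  shows "(\<lambda>w. prod_law K m (s w) (x w)) \<in> M \<rightarrow>\<^sub>M prob_algebra (paths m)"
  unfolding prod_law_def paths_def
  by (rule measurable_PiM_kernel) (auto intro!: measurable_K measurable_state_component assms)

lemma prod_law_prob:
  "prob_space (prod_law K m s x)" "sets (prod_law K m s x) = sets (paths m)" "space (prod_law K m s x) = space (paths m)"
proof -
  show "prob_space (prod_law K m s x)"
    unfolding prod_law_def by (intro prob_space_PiM K_prob) auto
  show *: "sets (prod_law K m s x) = sets (paths m)"
    unfolding prod_law_def paths_def by (intro sets_PiM_cong K_prob) auto
  show "space (prod_law K m s x) = space (paths m)" using * by (rule sets_eq_imp_space_eq)
qed

lemma AE_prod_law_start:
  assumes s: "0 \<le> s" and x: "x \<in> space (state_space m)"
  shows "AE z in prod_law K m s x. pos m z s = x"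
proof -
  have "AE z in prod_law K m s x. z i s = x i" if "i < m" for i
  proof -
    have "AE \<omega> in K s (x i). \<omega> s = x i \<and> continuous_on {s..} \<omega>"
      using markov s unfolding markov_family_def by blast
    then have "AE \<omega> in K s (x i). \<omega> s = x i"
      by eventually_elim simp
    moreover have "max 0 s = s" using s by simp
    ultimately have ae: "AE \<omega> in K (max 0 s) (x i). \<omega> s = x i" by (simp only:)
    show ?thesis
      unfolding prod_law_def
      by (rule AE_PiM_component) (use that ae in \<open>simp_all add: K_prob\<close>)
  qed
  then have "AE z in prod_law K m s x. \<forall>i\<in>{..<m}. z i s = x i"
    by (subst AE_finite_all) auto
  then show ?thesis
    by eventually_elim (use x s in \<open>auto simp: pos_def space_state_space extensional_def fun_eq_iff\<close>)
qed

text \<open>The Markov property in \<open>markov_family\<close> speaks of restrictions to [s, r] and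
  [r, \<infinity>). Here it becomes an equality of laws on one path space, in the form of a
  composition of kernels to which \<open>PiM_bind\<close> applies.\<close>

lemma K_cut_path:
  assumes s: "0 \<le> s" "s \<le> r"
  shows "distr (K s x) path_space (cut_path r) = K s x \<bind> (\<lambda>\<omega>. distr (K r (\<omega> r)) path_space (cut_path r))"
proof (rule measure_eqI)
  have r: "0 \<le> r" using s by simp
  have Ks: "K s x \<in> space (prob_algebra path_space)"
    using K_prob[OF s(1)] by (simp add: space_prob_algebra)
  have [measurable]: "cut_path r \<in> path_space \<rightarrow>\<^sub>M path_space" by (rule measurable_cut_path[OF r])
  have [measurable]: "(\<lambda>\<omega>. \<omega> r) \<in> borel_measurable path_space" by (rule path_space_coord[OF r])
  have Kr: "(\<lambda>\<omega>. K r (\<omega> r)) \<in> path_space \<rightarrow>\<^sub>M prob_algebra path_space"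
    using measurable_K[of "\<lambda>_. r" path_space "\<lambda>\<omega>. \<omega> r"] r by simp
  have L: "(\<lambda>\<omega>. distr (K r (\<omega> r)) path_space (cut_path r)) \<in> path_space \<rightarrow>\<^sub>M prob_algebra path_space"
    by (rule measurable_distr_prob_space2[OF Kr]) measurable
  show "sets (distr (K s x) path_space (cut_path r)) = sets (K s x \<bind> (\<lambda>\<omega>. distr (K r (\<omega> r)) path_space (cut_path r)))"
    using sets_bind'[OF Ks L] by simp
  fix A assume "A \<in> sets (distr (K s x) path_space (cut_path r))"
  then have A: "A \<in> sets path_space" by simp
  then obtain A1 where A1: "A1 \<in> sets (PiM {0..} (\<lambda>_. borel :: 'a measure))" "A = A1 \<inter> {\<omega>. \<forall>t\<ge>0. (\<omega> \<longlongrightarrow> \<omega> t) (at_right t)}"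
    by (auto simp: path_space_def sets_restrict_space)
  define ext where "ext \<eta> = (\<lambda>v\<in>{0..}. \<eta> (max v r))" for \<eta> :: "real \<Rightarrow> 'a"
  have ext: "ext \<in> PiM {r..} (\<lambda>_. borel) \<rightarrow>\<^sub>M PiM {0..} (\<lambda>_. borel :: 'a measure)"
    unfolding ext_def by (intro measurable_restrict measurable_component_singleton) auto
  define B where "B = ext -` A1 \<inter> space (PiM {r..} (\<lambda>_. borel :: 'a measure))"
  have B: "B \<in> sets (PiM {r..} (\<lambda>_. borel))" unfolding B_def by (rule measurable_sets[OF ext A1(1)])
  have AB: "cut_path r \<omega> \<in> A \<longleftrightarrow> restrict \<omega> {r..} \<in> B" if "\<omega> \<in> space path_space" for \<omega>
  proof -
    have "ext (restrict \<omega> {r..}) = cut_path r \<omega>" by (auto simp: ext_def cut_path_def fun_eq_iff)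
    then show ?thesis using cut_path_in_space[OF r that]
      by (auto simp: A1(2) B_def space_PiM in_space_path_space)
  qed
  have em: "emeasure (distr (K u y) path_space (cut_path r)) A = emeasure (K u y) {\<omega> \<in> space path_space. restrict \<omega> {r..} \<in> B}"
    if "0 \<le> u" for u y
  proof (subst emeasure_distr)
    show "cut_path r \<in> K u y \<rightarrow>\<^sub>M path_space" using K_prob[OF that] by (simp cong: measurable_cong_sets)
    show "emeasure (K u y) (cut_path r -` A \<inter> space (K u y)) = emeasure (K u y) {\<omega> \<in> space path_space. restrict \<omega> {r..} \<in> B}"
      using AB K_prob[OF that] by (intro arg_cong[where f="emeasure _"]) auto
  qed (rule A)
  \<comment> \<open>The event on the past is the whole space: only the law of the future given the
    present is kept.\<close>
  let ?S = "space (PiM {s..r} (\<lambda>_. borel :: 'a measure))"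
  have "emeasure (K s x) {\<omega> \<in> space path_space. restrict \<omega> {s..r} \<in> ?S \<and> restrict \<omega> {r..} \<in> B} =
      (\<integral>\<^sup>+ \<omega>. indicator ?S (restrict \<omega> {s..r}) *
          emeasure (K r (\<omega> r)) {\<omega>' \<in> space path_space. restrict \<omega>' {r..} \<in> B} \<partial>K s x)"
    using markov s B unfolding markov_family_def by blast
  moreover have "restrict \<omega> {s..r} \<in> ?S" for \<omega> :: "real \<Rightarrow> 'a" by (auto simp: space_PiM)
  ultimately have "emeasure (K s x) {\<omega> \<in> space path_space. restrict \<omega> {r..} \<in> B} =
      (\<integral>\<^sup>+ \<omega>. emeasure (K r (\<omega> r)) {\<omega>' \<in> space path_space. restrict \<omega>' {r..} \<in> B} \<partial>K s x)"
    by simp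
  then show "emeasure (distr (K s x) path_space (cut_path r)) A =
       emeasure (K s x \<bind> (\<lambda>\<omega>. distr (K r (\<omega> r)) path_space (cut_path r))) A"
    unfolding emeasure_bind_prob_algebra[OF Ks L A] em[OF r] em[OF s(1)] .
qed

text \<open>By \<open>cut\<close>, H depends only on the trajectories from r on, so it may be
  averaged over particles that restart at r from their current positions.\<close>

lemma prod_law_markov:
  fixes H :: "(nat \<Rightarrow> real \<Rightarrow> 'a) \<Rightarrow> real"
  assumes s: "0 \<le> s" "s \<le> r" and H[measurable]: "H \<in> borel_measurable (paths m)"
    and B: "\<And>z. z \<in> space (paths m) \<Longrightarrow> \<bar>H z\<bar> \<le> B"
    and cut: "\<And>z. z \<in> space (paths m) \<Longrightarrow> H (\<lambda>i\<in>{..<m}. cut_path r (z i)) = H z"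
  shows "(\<integral>z. H z \<partial>prod_law K m s x) = (\<integral>z. \<integral>z'. H z' \<partial>prod_law K m r (pos m z r) \<partial>prod_law K m s x)"
proof -
  have r: "0 \<le> r" using s by simp
  have [measurable]: "cut_path r \<in> path_space \<rightarrow>\<^sub>M path_space" by (rule measurable_cut_path[OF r])
  let ?cut = "\<lambda>z. \<lambda>i\<in>{..<m}. cut_path r (z i)"
  have cut_m[measurable]: "?cut \<in> paths m \<rightarrow>\<^sub>M paths m"
  proof (rule measurable_pathsI)
    fix i assume i: "i < m"
    have "(\<lambda>z. z i) \<in> paths m \<rightarrow>\<^sub>M path_space"
      unfolding paths_def by (rule measurable_component_singleton) (use i in simp)
    from measurable_compose[OF this measurable_cut_path[OF r]]
    show "(\<lambda>z. cut_path r (z i)) \<in> paths m \<rightarrow>\<^sub>M path_space" .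
  qed
  have D: "distr (prod_law K m u y) (paths m) ?cut = PiM {..<m} (\<lambda>i. distr (K (max 0 u) (y i)) path_space (cut_path r))" for u y
    unfolding prod_law_def paths_def
    by (rule PiM_distr) (use K_prob in \<open>auto cong: measurable_cong_sets\<close>)
  have ID: "(\<integral>z. H z \<partial>distr (prod_law K m u y) (paths m) ?cut) = (\<integral>z. H z \<partial>prod_law K m u y)" for u y
  proof (subst integral_distr)
    show "?cut \<in> prod_law K m u y \<rightarrow>\<^sub>M paths m" using cut_m prod_law_prob by (simp cong: measurable_cong_sets)
    show "(\<integral>z. H (?cut z) \<partial>prod_law K m u y) = (\<integral>z. H z \<partial>prod_law K m u y)"
      by (intro Bochner_Integration.integral_cong) (use cut prod_law_prob in auto)
  qed auto
  have Kr: "(\<lambda>\<omega>. K r (\<omega> r)) \<in> path_space \<rightarrow>\<^sub>M prob_algebra path_space"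
    using measurable_K[of "\<lambda>_. r" path_space "\<lambda>\<omega>. \<omega> r"] r path_space_coord[OF r] by simp
  have L: "(\<lambda>\<omega>. distr (K r (\<omega> r)) path_space (cut_path r)) \<in> path_space \<rightarrow>\<^sub>M prob_algebra path_space"
    by (rule measurable_distr_prob_space2[OF Kr]) measurable
  have "distr (prod_law K m s x) (paths m) ?cut =
     PiM {..<m} (\<lambda>i. K s (x i) \<bind> (\<lambda>\<omega>. distr (K r (\<omega> r)) path_space (cut_path r)))"
  proof -
    have "max 0 s = s" using s by simp
    then show ?thesis unfolding D by (simp only: K_cut_path[OF s])
  qed
  also have "\<dots> = PiM {..<m} (\<lambda>i. K s (x i)) \<bind> (\<lambda>z. PiM {..<m} (\<lambda>i. distr (K r (z i r)) path_space (cut_path r)))"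
    by (rule PiM_bind[symmetric, where M'="\<lambda>_. path_space" and N="\<lambda>_. path_space"])
       (use K_prob[OF s(1)] L in \<open>auto simp: space_prob_algebra\<close>)
  also have "\<dots> = prod_law K m s x \<bind> (\<lambda>z. distr (prod_law K m r (pos m z r)) (paths m) ?cut)"
    unfolding D using s r by (auto simp: prod_law_def pos_def intro!: arg_cong2[where f=bind] ext PiM_cong)
  finally have eq: "distr (prod_law K m s x) (paths m) ?cut = \<dots>" .
  have "(\<integral>z. H z \<partial>prod_law K m s x) = (\<integral>z. H z \<partial>(prod_law K m s x \<bind> (\<lambda>z. distr (prod_law K m r (pos m z r)) (paths m) ?cut)))"
    unfolding eq[symmetric] ID ..
  also have "\<dots> = (\<integral>z. \<integral>z'. H z' \<partial>distr (prod_law K m r (pos m z r)) (paths m) ?cut \<partial>prod_law K m s x)"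
  proof (rule integral_bind_bounded[where M'="paths m" and R="paths m" and B=B])
    show "(\<lambda>z. distr (prod_law K m r (pos m z r)) (paths m) ?cut) \<in> paths m \<rightarrow>\<^sub>M prob_algebra (paths m)"
      by (rule measurable_distr_prob_space2[where M="paths m"]) measurable
  qed (use prod_law_prob B in auto)
  finally show ?thesis unfolding ID .
qed

text \<open>Distinct particles are independent and move by the same K, so those picked by an
  injective f form a system of q particles of the same kind. This is what makes selection commute
  with the free motion.\<close>

lemma prod_law_reindex:
  fixes g :: "(nat \<Rightarrow> real \<Rightarrow> 'a) \<Rightarrow> real"
  assumes f: "inj_on f {..<q}" "f \<in> {..<q} \<rightarrow> {..<m}" and g: "g \<in> borel_measurable (paths q)"
  shows "(\<integral>z. g (\<lambda>j\<in>{..<q}. z (f j)) \<partial>prod_law K m s x) = (\<integral>z. g z \<partial>prod_law K q s (\<lambda>j\<in>{..<q}. x (f j)))"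
proof -
  have "prod_law K q s (\<lambda>j\<in>{..<q}. x (f j)) = PiM {..<q} (\<lambda>i. K (max 0 s) (x (f i)))"
    unfolding prod_law_def by (intro PiM_cong) auto
  also have "\<dots> = distr (prod_law K m s x) (PiM {..<q} (\<lambda>i. K (max 0 s) (x (f i)))) (\<lambda>\<omega>. \<lambda>n\<in>{..<q}. \<omega> (f n))"
    unfolding prod_law_def by (rule distr_PiM_reindex[symmetric]) (use f K_prob in auto)
  finally have eq: "prod_law K q s (\<lambda>j\<in>{..<q}. x (f j)) = distr (prod_law K m s x) (PiM {..<q} (\<lambda>i. K (max 0 s) (x (f i)))) (\<lambda>\<omega>. \<lambda>n\<in>{..<q}. \<omega> (f n))" .
  have sp: "sets (PiM {..<q} (\<lambda>i. K (max 0 s) (x (f i)))) = sets (paths q)"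
    unfolding paths_def by (intro sets_PiM_cong K_prob) auto
  have fm: "(\<lambda>\<omega>. \<lambda>n\<in>{..<q}. \<omega> (f n)) \<in> paths m \<rightarrow>\<^sub>M paths q"
  proof (rule measurable_pathsI)
    show "(\<lambda>\<omega>. \<omega> (f i)) \<in> paths m \<rightarrow>\<^sub>M path_space" if "i < q" for i
      unfolding paths_def by (rule measurable_component_singleton) (use f that in auto)
  qed
  show ?thesis
    unfolding eq
    by (subst integral_distr) (use fm g prod_law_prob sp in \<open>simp_all cong: measurable_cong_sets\<close>)
qed

end

section \<open>Regeneration of the clocks at the first ring\<close>

abbreviation exp_law :: "real \<Rightarrow> real measure" where
  "exp_law r \<equiv> density lborel (\<lambda>x. ennreal (exponential_density r x))"

lemma exp_law_memoryless:
  assumes r: "0 < r" and \<tau>: "0 \<le> \<tau>" and [measurable]: "g \<in> borel_measurable borel"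
  shows "(\<integral>\<^sup>+x. indicator {\<tau><..} x * g (x - \<tau>) \<partial>exp_law r) = ennreal (exp (- r * \<tau>)) * (\<integral>\<^sup>+x. g x \<partial>exp_law r)"
proof -
  have "(\<integral>\<^sup>+x. indicator {\<tau><..} x * g (x - \<tau>) \<partial>exp_law r)
      = (\<integral>\<^sup>+x. ennreal (exponential_density r x) * (indicator {\<tau><..} x * g (x - \<tau>)) \<partial>lborel)"
    by (subst nn_integral_density) auto
  also have "\<dots> = (\<integral>\<^sup>+x. ennreal (exponential_density r (\<tau> + 1 * x)) * (indicator {\<tau><..} (\<tau> + 1 * x) * g (\<tau> + 1 * x - \<tau>)) \<partial>lborel)"
    by (subst nn_integral_real_affine[where c=1 and t=\<tau>]) auto
  also have "\<dots> = (\<integral>\<^sup>+x. ennreal (exp (- r * \<tau>)) * (ennreal (exponential_density r x) * g x) \<partial>lborel)"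
  proof (rule nn_integral_cong_AE)
    show "AE x in lborel. ennreal (exponential_density r (\<tau> + 1 * x)) * (indicator {\<tau><..} (\<tau> + 1 * x) * g (\<tau> + 1 * x - \<tau>))
       = ennreal (exp (- r * \<tau>)) * (ennreal (exponential_density r x) * g x)"
      \<comment> \<open>At x = 0 the strict indicator kills the left-hand side while the density on
        the right equals r, hence an equality almost everywhere only.\<close>
      using AE_lborel_singleton[of 0]
    proof eventually_elim
      fix x :: real assume x: "x \<noteq> 0"
      show "ennreal (exponential_density r (\<tau> + 1 * x)) * (indicator {\<tau><..} (\<tau> + 1 * x) * g (\<tau> + 1 * x - \<tau>))
       = ennreal (exp (- r * \<tau>)) * (ennreal (exponential_density r x) * g x)"
      proof (cases "0 < x")
        case True
        have "exponential_density r (\<tau> + x) = exp (- r * \<tau>) * exponential_density r x"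
          using True \<tau> by (simp add: exponential_density_def exp_add[symmetric] algebra_simps)
        then have "ennreal (exponential_density r (\<tau> + x)) = ennreal (exp (- r * \<tau>)) * ennreal (exponential_density r x)"
          using r by (simp add: ennreal_mult' exponential_density_nonneg)
        then show ?thesis using True by (simp add: mult.assoc)
      next
        case False
        then show ?thesis using x by (simp add: exponential_density_def)
      qed
    qed
  qed
  also have "\<dots> = ennreal (exp (- r * \<tau>)) * (\<integral>\<^sup>+x. ennreal (exponential_density r x) * g x \<partial>lborel)"
    by (rule nn_integral_cmult) measurable
  finally show ?thesis by (subst nn_integral_density) auto
qed

text \<open>In the applications the index set is infinite, with infinitely many waiting times per
  clock, so a single coordinate is split off. Fixing the coordinate first serves the first-ring
  formula, integrating it first serves the memoryless property.\<close>

lemma nn_integral_PiM_split: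
  assumes E: "prob_space E" and d: "d \<in> I" and h: "h \<in> borel_measurable (PiM I (\<lambda>_. E))"
  shows "integral\<^sup>N (PiM I (\<lambda>_. E)) h = (\<integral>\<^sup>+x. \<integral>\<^sup>+\<rho>. h (\<rho>(d := x)) \<partial>PiM (I - {d}) (\<lambda>_. E) \<partial>E)" (is ?A)
    and "integral\<^sup>N (PiM I (\<lambda>_. E)) h = (\<integral>\<^sup>+\<rho>. \<integral>\<^sup>+x. h (\<rho>(d := x)) \<partial>E \<partial>PiM (I - {d}) (\<lambda>_. E))" (is ?B)
proof -
  interpret E: prob_space E by fact
  interpret R: prob_space "PiM (I - {d}) (\<lambda>_. E)" using E by (intro prob_space_PiM)
  interpret pair_sigma_finite E "PiM (I - {d}) (\<lambda>_. E)" ..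
  have ins: "insert d (I - {d}) = I" using d by auto
  have eq: "distr (E \<Otimes>\<^sub>M PiM (I - {d}) (\<lambda>_. E)) (PiM I (\<lambda>_. E)) (\<lambda>(x, X). X(d := x)) = PiM I (\<lambda>_. E)"
    using distr_pair_PiM_eq_PiM[of "I - {d}" "\<lambda>_. E" d] E ins by simp
  have m: "(\<lambda>(x, X). X(d := x)) \<in> E \<Otimes>\<^sub>M PiM (I - {d}) (\<lambda>_. E) \<rightarrow>\<^sub>M PiM I (\<lambda>_. E)"
    unfolding case_prod_beta' by (rule measurable_fun_upd[where J="I - {d}"]) (use d in auto)
  have hm: "(\<lambda>p. h (case p of (x, X) \<Rightarrow> X(d := x))) \<in> borel_measurable (E \<Otimes>\<^sub>M PiM (I - {d}) (\<lambda>_. E))"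
    by (rule measurable_compose[OF m h])
  have "integral\<^sup>N (PiM I (\<lambda>_. E)) h = (\<integral>\<^sup>+p. h (case p of (x, X) \<Rightarrow> X(d := x)) \<partial>(E \<Otimes>\<^sub>M PiM (I - {d}) (\<lambda>_. E)))"
    by (subst eq[symmetric], subst nn_integral_distr[OF m]) (use h in auto)
  then show ?A ?B
    using R.nn_integral_fst[OF hm] nn_integral_snd[OF hm] by simp_all
qed

lemma nn_integral_PiM_shift_one:
  assumes r: "0 < r" and \<tau>: "0 \<le> \<tau>" and d: "d \<in> I" and h[measurable]: "h \<in> borel_measurable (PiM I (\<lambda>_. exp_law r))"
  shows "(\<integral>\<^sup>+\<sigma>. indicator {\<tau><..} (\<sigma> d) * h (\<sigma>(d := \<sigma> d - \<tau>)) \<partial>PiM I (\<lambda>_. exp_law r))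
    = ennreal (exp (- r * \<tau>)) * integral\<^sup>N (PiM I (\<lambda>_. exp_law r)) h"
proof -
  let ?E = "exp_law r"
  have E: "prob_space ?E" using r by (rule prob_space_exponential_density)
  have [measurable]: "(\<lambda>\<sigma>. \<sigma> d) \<in> borel_measurable (PiM I (\<lambda>_. ?E))"
    using measurable_component_singleton[OF d, of "\<lambda>_. ?E"] by (simp cong: measurable_cong_sets)
  have upd: "(\<lambda>\<sigma>. \<sigma>(d := \<sigma> d - \<tau>)) \<in> PiM I (\<lambda>_. ?E) \<rightarrow>\<^sub>M PiM I (\<lambda>_. ?E)"
    by (rule measurable_fun_upd[where J=I]) (use d in auto)
  have hm: "(\<lambda>\<sigma>. indicator {\<tau><..} (\<sigma> d) * h (\<sigma>(d := \<sigma> d - \<tau>))) \<in> borel_measurable (PiM I (\<lambda>_. ?E))"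
    using measurable_compose[OF upd h] by measurable
  have "(\<integral>\<^sup>+\<sigma>. indicator {\<tau><..} (\<sigma> d) * h (\<sigma>(d := \<sigma> d - \<tau>)) \<partial>PiM I (\<lambda>_. ?E))
    = (\<integral>\<^sup>+\<rho>. \<integral>\<^sup>+x. indicator {\<tau><..} x * h (\<rho>(d := x - \<tau>)) \<partial>?E \<partial>PiM (I - {d}) (\<lambda>_. ?E))"
    using nn_integral_PiM_split(2)[OF E d hm] by simp
  also have "\<dots> = (\<integral>\<^sup>+\<rho>. ennreal (exp (- r * \<tau>)) * (\<integral>\<^sup>+x. h (\<rho>(d := x)) \<partial>?E) \<partial>PiM (I - {d}) (\<lambda>_. ?E))"
  proof (rule nn_integral_cong)
    fix \<rho> assume \<rho>: "\<rho> \<in> space (PiM (I - {d}) (\<lambda>_. ?E))"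
    have "(\<lambda>x. \<rho>(d := x)) \<in> borel \<rightarrow>\<^sub>M PiM I (\<lambda>_. ?E)"
      by (rule measurable_fun_upd[where J="I - {d}"]) (use d \<rho> in auto)
    from measurable_compose[OF this h]
    show "(\<integral>\<^sup>+x. indicator {\<tau><..} x * h (\<rho>(d := x - \<tau>)) \<partial>?E) = ennreal (exp (- r * \<tau>)) * (\<integral>\<^sup>+x. h (\<rho>(d := x)) \<partial>?E)"
      by (rule exp_law_memoryless[OF r \<tau>])
  qed
  also have "\<dots> = ennreal (exp (- r * \<tau>)) * (\<integral>\<^sup>+\<rho>. \<integral>\<^sup>+x. h (\<rho>(d := x)) \<partial>?E \<partial>PiM (I - {d}) (\<lambda>_. ?E))"
  proof (rule nn_integral_cmult)
    interpret E: prob_space ?E by fact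
    have "(\<lambda>(\<rho>, x). \<rho>(d := x)) \<in> PiM (I - {d}) (\<lambda>_. ?E) \<Otimes>\<^sub>M ?E \<rightarrow>\<^sub>M PiM I (\<lambda>_. ?E)"
      using d unfolding case_prod_beta' by (intro measurable_fun_upd[where J="I - {d}"]) auto
    from measurable_compose[OF this h]
    show "(\<lambda>\<rho>. \<integral>\<^sup>+x. h (\<rho>(d := x)) \<partial>?E) \<in> borel_measurable (PiM (I - {d}) (\<lambda>_. ?E))"
      by (intro E.borel_measurable_nn_integral) (simp add: case_prod_beta')
  qed
  also have "\<dots> = ennreal (exp (- r * \<tau>)) * integral\<^sup>N (PiM I (\<lambda>_. ?E)) h"
    using nn_integral_PiM_split(2)[OF E d h] by simp
  finally show ?thesis .
qed

text \<open>Each waiting time in D outlasts \<tau> with probability exp (- r * \<tau>), and its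
  residue is then again exponential and independent of the rest. So the coordinates can be treated
  one after the other.\<close>

lemma nn_integral_PiM_shift:
  assumes r: "0 < r" and \<tau>: "0 \<le> \<tau>" and D: "finite D" "D \<subseteq> I" and h: "h \<in> borel_measurable (PiM I (\<lambda>_. exp_law r))"
  shows "(\<integral>\<^sup>+\<sigma>. (\<Prod>d\<in>D. indicator {\<tau><..} (\<sigma> d)) * h (\<lambda>i. if i \<in> D then \<sigma> i - \<tau> else \<sigma> i) \<partial>PiM I (\<lambda>_. exp_law r))
    = ennreal (exp (- r * \<tau> * card D)) * integral\<^sup>N (PiM I (\<lambda>_. exp_law r)) h"
  using D
proof (induction D rule: finite_induct)
  case empty
  then show ?case by simp
next
  case (insert d D)
  let ?E = "exp_law r"
  let ?h = "\<lambda>\<sigma>. (\<Prod>d\<in>D. indicator {\<tau><..} (\<sigma> d)) * h (\<lambda>i. if i \<in> D then \<sigma> i - \<tau> else \<sigma> i)"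
  have comp: "(\<lambda>\<sigma>. \<sigma> i) \<in> borel_measurable (PiM I (\<lambda>_. ?E))" if "i \<in> I" for i
    using measurable_component_singleton[OF that, of "\<lambda>_. ?E"] by (simp cong: measurable_cong_sets)
  have sh: "(\<lambda>\<sigma>. \<lambda>i. if i \<in> D then \<sigma> i - \<tau> else \<sigma> i) \<in> PiM I (\<lambda>_. ?E) \<rightarrow>\<^sub>M PiM I (\<lambda>_. ?E)"
  proof (rule measurable_PiM_single')
    show "(\<lambda>\<sigma>. if i \<in> D then \<sigma> i - \<tau> else \<sigma> i) \<in> PiM I (\<lambda>_. ?E) \<rightarrow>\<^sub>M ?E" if "i \<in> I" for i
      using comp[OF that] by (auto cong: measurable_cong_sets)
    show "(\<lambda>\<sigma> i. if i \<in> D then \<sigma> i - \<tau> else \<sigma> i) \<in> space (PiM I (\<lambda>_. ?E)) \<rightarrow> (\<Pi>\<^sub>E i\<in>I. space ?E)"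
      using insert.prems by (auto simp: space_PiM PiE_def extensional_def)
  qed
  have hm: "?h \<in> borel_measurable (PiM I (\<lambda>_. ?E))"
    using measurable_compose[OF sh h] comp insert.prems
    by (intro borel_measurable_times_ennreal borel_measurable_prod_ennreal) (auto intro!: measurable_compose[OF comp])
  have "(\<integral>\<^sup>+\<sigma>. (\<Prod>d\<in>insert d D. indicator {\<tau><..} (\<sigma> d)) * h (\<lambda>i. if i \<in> insert d D then \<sigma> i - \<tau> else \<sigma> i) \<partial>PiM I (\<lambda>_. ?E))
     = (\<integral>\<^sup>+\<sigma>. indicator {\<tau><..} (\<sigma> d) * ?h (\<sigma>(d := \<sigma> d - \<tau>)) \<partial>PiM I (\<lambda>_. ?E))"
  proof (rule nn_integral_cong)
    fix \<sigma> :: "'a \<Rightarrow> real"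
    have 1: "(\<lambda>i. if i \<in> insert d D then \<sigma> i - \<tau> else \<sigma> i) = (\<lambda>i. if i \<in> D then (\<sigma>(d := \<sigma> d - \<tau>)) i - \<tau> else (\<sigma>(d := \<sigma> d - \<tau>)) i)"
      using insert.hyps by (auto simp: fun_eq_iff)
    have 2: "(\<Prod>e\<in>D. indicator {\<tau><..} ((\<sigma>(d := \<sigma> d - \<tau>)) e)) = (\<Prod>e\<in>D. indicator {\<tau><..} (\<sigma> e) :: ennreal)"
      using insert.hyps by (intro prod.cong) auto
    show "(\<Prod>d\<in>insert d D. indicator {\<tau><..} (\<sigma> d)) * h (\<lambda>i. if i \<in> insert d D then \<sigma> i - \<tau> else \<sigma> i)
      = indicator {\<tau><..} (\<sigma> d) * ?h (\<sigma>(d := \<sigma> d - \<tau>))"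
      unfolding 1 2 using insert.hyps by (simp add: mult.assoc)
  qed
  also have "\<dots> = ennreal (exp (- r * \<tau>)) * integral\<^sup>N (PiM I (\<lambda>_. ?E)) ?h"
    by (rule nn_integral_PiM_shift_one[OF r \<tau> _ hm]) (use insert.prems in auto)
  also have "\<dots> = ennreal (exp (- r * \<tau>)) * (ennreal (exp (- r * \<tau> * card D)) * integral\<^sup>N (PiM I (\<lambda>_. ?E)) h)"
    using insert by simp
  also have "\<dots> = ennreal (exp (- r * \<tau> * card (insert d D))) * integral\<^sup>N (PiM I (\<lambda>_. ?E)) h"
    using insert.hyps by (simp add: mult.assoc[symmetric] ennreal_mult[symmetric] exp_add[symmetric]) (simp add: algebra_simps)
  finally show ?case .
qed

text \<open>The clocks as seen from the first ring, if that is a ring of c: c moves on to its next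
  waiting time, and the other clocks keep the residue of their first one.\<close>

definition next_clocks :: "'c set \<Rightarrow> 'c \<Rightarrow> ('c \<times> nat \<Rightarrow> real) \<Rightarrow> 'c \<times> nat \<Rightarrow> real" where
  "next_clocks C c \<sigma> = (\<lambda>i\<in>C \<times> UNIV. if fst i = c then \<sigma> (c, Suc (snd i))
     else if snd i = 0 then \<sigma> i - \<sigma> (c, 0) else \<sigma> i)"

definition first_ring :: "'c set \<Rightarrow> 'c \<Rightarrow> ('c \<times> nat \<Rightarrow> real) \<Rightarrow> bool" where
  "first_ring C c \<sigma> \<longleftrightarrow> (\<forall>c'\<in>C - {c}. \<sigma> (c, 0) < \<sigma> (c', 0))"

text \<open>The sub-density of the time of the first ring on the event that a given clock is the one
  that rings: r * exp (- r * \<tau>) for that clock, times exp (- r * \<tau>) for each of the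
  others. For nonempty C and r > 0 its mass is 1 / card C.\<close>

definition first_density :: "'c set \<Rightarrow> real \<Rightarrow> real \<Rightarrow> real" where
  "first_density C r \<tau> = (if \<tau> < 0 then 0 else r * exp (- (real (card C) * r) * \<tau>))"

lemma measurable_first_density [measurable]: "first_density C r \<in> borel_measurable borel"
  unfolding first_density_def by measurable

lemma first_density_nonneg: "0 < r \<Longrightarrow> 0 \<le> first_density C r \<tau>"
  by (simp add: first_density_def)

lemma sets_clocks [measurable_cong]: "sets (clocks C r) = sets (PiM (C \<times> UNIV) (\<lambda>_. borel))"
  unfolding clocks_def by (intro sets_PiM_cong) auto

lemma prob_space_clocks: "0 < r \<Longrightarrow> prob_space (clocks C r)"
  unfolding clocks_def by (intro prob_space_PiM prob_space_exponential_density)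

lemma clocks_coord: "i \<in> C \<times> UNIV \<Longrightarrow> (\<lambda>\<sigma>. \<sigma> i) \<in> borel_measurable (clocks C r)"
  using measurable_component_singleton[of i "C \<times> UNIV" "\<lambda>_. borel"]
  by (simp cong: measurable_cong_sets add: sets_clocks)

lemma measurable_next_clocks:
  assumes "c \<in> C" shows "next_clocks C c \<in> clocks C r \<rightarrow>\<^sub>M clocks C r"
proof -
  have "next_clocks C c \<in> clocks C r \<rightarrow>\<^sub>M PiM (C \<times> UNIV) (\<lambda>_. borel)"
    unfolding next_clocks_def
  proof (rule measurable_restrict)
    fix i :: "'a \<times> nat" assume i: "i \<in> C \<times> UNIV"
    have [measurable]: "(\<lambda>\<sigma>. \<sigma> i) \<in> borel_measurable (clocks C r)"
      "(\<lambda>\<sigma>. \<sigma> (c, 0)) \<in> borel_measurable (clocks C r)" "(\<lambda>\<sigma>. \<sigma> (c, Suc (snd i))) \<in> borel_measurable (clocks C r)"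
      using i assms by (auto intro!: clocks_coord)
    show "(\<lambda>\<sigma>. if fst i = c then \<sigma> (c, Suc (snd i)) else if snd i = 0 then \<sigma> i - \<sigma> (c, 0) else \<sigma> i)
        \<in> borel_measurable (clocks C r)" by measurable
  qed
  then show ?thesis by (simp cong: measurable_cong_sets add: sets_clocks)
qed

lemma sets_first_ring [measurable]:
  assumes "c \<in> C" "finite C" shows "Measurable.pred (clocks C r) (first_ring C c)"
proof -
  have [measurable]: "(\<lambda>\<sigma>. \<sigma> (c', 0)) \<in> borel_measurable (clocks C r)" if "c' \<in> C" for c'
    using that by (auto intro!: clocks_coord)
  have [measurable]: "Measurable.pred (clocks C r) (\<lambda>\<sigma>. \<sigma> (c, 0) < \<sigma> (c', 0))" if "c' \<in> C - {c}" for c'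
    using that assms by (intro borel_measurable_pred_less) auto
  show ?thesis
    unfolding first_ring_def using assms by (intro pred_intros_finite) auto
qed

text \<open>Regeneration: on the event that c rings first, the restarted clocks are independent of
  the ring time and have the original law. The first waiting time x of c is fixed; the other
  coordinates, renumbered, are fresh clocks whose first waiting times, except that of c, are
  required to exceed x and then reduced by x.\<close>

lemma nn_integral_clocks_first:
  assumes r: "0 < r" and C: "finite C" "c \<in> C" and H[measurable]: "H \<in> borel_measurable (borel \<Otimes>\<^sub>M clocks C r)"
  shows "(\<integral>\<^sup>+\<sigma>. indicator {\<sigma>. first_ring C c \<sigma>} \<sigma> * H (\<sigma> (c, 0), next_clocks C c \<sigma>) \<partial>clocks C r)
    = (\<integral>\<^sup>+\<tau>. ennreal (first_density C r \<tau>) * (\<integral>\<^sup>+\<sigma>. H (\<tau>, \<sigma>) \<partial>clocks C r) \<partial>lborel)"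
proof -
  let ?E = "exp_law r" and ?I = "C \<times> (UNIV :: nat set)"
  let ?D = "(C - {c}) \<times> {0::nat}"
  \<comment> \<open>\<open>f\<close> renumbers the waiting times of c once the first has been split
    off, so the remaining coordinates are again indexed by all of C \<times> UNIV.\<close>
  define f where "f i = (if fst i = c then (c, Suc (snd i)) else i)" for i :: "'a \<times> nat"
  have E: "prob_space ?E" using r by (rule prob_space_exponential_density)
  have P: "prob_space (clocks C r)" using r by (rule prob_space_clocks)
  interpret P: prob_space "clocks C r" by fact
  have d: "(c, 0) \<in> ?I" using C by auto
  have cl: "clocks C r = PiM ?I (\<lambda>_. ?E)" by (simp add: clocks_def)
  have inj: "inj_on f ?I" by (auto simp: inj_on_def f_def split: if_splits)
  have fI: "f \<in> ?I \<rightarrow> ?I - {(c, 0)}" using C by (auto simp: f_def split: if_splits)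
  have [measurable]: "(\<lambda>\<sigma>. \<sigma> (c, 0)) \<in> borel_measurable (clocks C r)" using d by (rule clocks_coord)
  note measurable_next_clocks[OF C(2), measurable]
  note [measurable] = sets_first_ring[OF C(2,1), of r]
  let ?G = "\<lambda>\<sigma>. indicator {\<sigma>. first_ring C c \<sigma>} \<sigma> * H (\<sigma> (c, 0), next_clocks C c \<sigma>)"
  have G: "?G \<in> borel_measurable (PiM ?I (\<lambda>_. ?E))"
    unfolding cl[symmetric] by measurable
  have "integral\<^sup>N (clocks C r) ?G = (\<integral>\<^sup>+x. \<integral>\<^sup>+\<rho>. ?G (\<rho>((c, 0) := x)) \<partial>PiM (?I - {(c, 0)}) (\<lambda>_. ?E) \<partial>?E)"
    unfolding cl by (rule nn_integral_PiM_split(1)[OF E d G])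
  also have "\<dots> = (\<integral>\<^sup>+x. ennreal (exp (- r * x * card ?D)) * (\<integral>\<^sup>+\<sigma>. H (x, \<sigma>) \<partial>clocks C r) \<partial>?E)"
  proof (rule nn_integral_cong_AE)
    have "AE x in ?E. 0 \<le> x"
      by (subst AE_density) (auto simp: exponential_density_def)
    then show "AE x in ?E. (\<integral>\<^sup>+\<rho>. ?G (\<rho>((c, 0) := x)) \<partial>PiM (?I - {(c, 0)}) (\<lambda>_. ?E)) =
      ennreal (exp (- r * x * card ?D)) * (\<integral>\<^sup>+\<sigma>. H (x, \<sigma>) \<partial>clocks C r)"
    proof eventually_elim
      fix x :: real assume x: "0 \<le> x"
      have Hx: "(\<lambda>\<sigma>. H (x, \<sigma>)) \<in> borel_measurable (clocks C r)" by measurable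
      let ?Psi = "\<lambda>\<sigma>. (\<Prod>d\<in>?D. indicator {x<..} (\<sigma> d)) * H (x, \<lambda>i. if i \<in> ?D then \<sigma> i - x else \<sigma> i)"
      have comp: "(\<lambda>\<sigma>. \<sigma> i) \<in> borel_measurable (clocks C r)" if "i \<in> ?I" for i
        using that by (rule clocks_coord)
      have sh: "(\<lambda>\<sigma>. \<lambda>i. if i \<in> ?D then \<sigma> i - x else \<sigma> i) \<in> clocks C r \<rightarrow>\<^sub>M PiM ?I (\<lambda>_. borel)"
      proof (rule measurable_PiM_single')
        show "(\<lambda>\<sigma>. if i \<in> ?D then \<sigma> i - x else \<sigma> i) \<in> borel_measurable (clocks C r)" if "i \<in> ?I" for i
          using comp[OF that] by auto
        show "(\<lambda>\<sigma> i. if i \<in> ?D then \<sigma> i - x else \<sigma> i) \<in> space (clocks C r) \<rightarrow> (\<Pi>\<^sub>E i\<in>?I. space borel)"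
          by (auto simp: clocks_def space_PiM PiE_def extensional_def)
      qed
      then have sh': "(\<lambda>\<sigma>. \<lambda>i. if i \<in> ?D then \<sigma> i - x else \<sigma> i) \<in> clocks C r \<rightarrow>\<^sub>M clocks C r"
        by (simp cong: measurable_cong_sets add: sets_clocks)
      have Psi: "?Psi \<in> borel_measurable (clocks C r)"
        using measurable_compose[OF sh' Hx]
        by (intro borel_measurable_times_ennreal borel_measurable_prod_ennreal) (auto intro!: measurable_compose[OF comp])
      have "(\<integral>\<^sup>+\<rho>. ?G (\<rho>((c, 0) := x)) \<partial>PiM (?I - {(c, 0)}) (\<lambda>_. ?E)) =
          (\<integral>\<^sup>+\<rho>. ?Psi (\<lambda>i\<in>?I. \<rho> (f i)) \<partial>PiM (?I - {(c, 0)}) (\<lambda>_. ?E))"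
      proof (rule nn_integral_cong)
        fix \<rho> :: "'a \<times> nat \<Rightarrow> real"
        have 1: "first_ring C c (\<rho>((c, 0) := x)) \<longleftrightarrow> (\<forall>d\<in>?D. x < \<rho> d)"
          by (auto simp: first_ring_def)
        have 2: "next_clocks C c (\<rho>((c, 0) := x)) = (\<lambda>i. if i \<in> ?D then (\<lambda>i\<in>?I. \<rho> (f i)) i - x else (\<lambda>i\<in>?I. \<rho> (f i)) i)"
          by (auto simp: next_clocks_def f_def fun_eq_iff)
        have 3: "(\<Prod>d\<in>?D. indicator {x<..} ((\<lambda>i\<in>?I. \<rho> (f i)) d)) = (\<Prod>d\<in>?D. indicator {x<..} (\<rho> d) :: ennreal)"
          by (intro prod.cong) (auto simp: f_def)
        have 4: "(\<Prod>d\<in>?D. indicator {x<..} (\<rho> d) :: ennreal) = (if \<forall>d\<in>?D. x < \<rho> d then 1 else 0)"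
        proof (cases "\<forall>d\<in>?D. x < \<rho> d")
          case True
          then have "(\<Prod>d\<in>?D. indicator {x<..} (\<rho> d) :: ennreal) = (\<Prod>d\<in>?D. 1)"
            by (intro prod.cong refl) (auto simp: indicator_def)
          with True show ?thesis by simp
        next
          case False
          then show ?thesis using C by (auto simp: prod_zero_iff indicator_def)
        qed
        show "?G (\<rho>((c, 0) := x)) = ?Psi (\<lambda>i\<in>?I. \<rho> (f i))"
          unfolding 2 3 4 by (simp add: indicator_def 1)
      qed
      also have "\<dots> = integral\<^sup>N (distr (PiM (?I - {(c, 0)}) (\<lambda>_. ?E)) (PiM ?I (\<lambda>i. ?E)) (\<lambda>\<omega>. \<lambda>n\<in>?I. \<omega> (f n))) ?Psi"
      proof (rule nn_integral_distr[symmetric])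
        show "(\<lambda>\<omega>. \<lambda>n\<in>?I. \<omega> (f n)) \<in> PiM (?I - {(c, 0)}) (\<lambda>_. ?E) \<rightarrow>\<^sub>M PiM ?I (\<lambda>i. ?E)"
          by (rule measurable_restrict, rule measurable_component_singleton) (use fI in auto)
      qed (use Psi in \<open>simp add: cl\<close>)
      also have "\<dots> = integral\<^sup>N (clocks C r) ?Psi"
        using distr_PiM_reindex[OF E inj fI] by (simp add: cl)
      also have "\<dots> = ennreal (exp (- r * x * card ?D)) * (\<integral>\<^sup>+\<sigma>. H (x, \<sigma>) \<partial>clocks C r)"
        unfolding cl by (rule nn_integral_PiM_shift[OF r x]) (use C Hx in \<open>auto simp: cl\<close>)
      finally show "(\<integral>\<^sup>+\<rho>. ?G (\<rho>((c, 0) := x)) \<partial>PiM (?I - {(c, 0)}) (\<lambda>_. ?E)) =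
        ennreal (exp (- r * x * card ?D)) * (\<integral>\<^sup>+\<sigma>. H (x, \<sigma>) \<partial>clocks C r)" .
    qed
  qed
  also have "\<dots> = (\<integral>\<^sup>+x. ennreal (exponential_density r x) * (ennreal (exp (- r * x * card ?D)) * (\<integral>\<^sup>+\<sigma>. H (x, \<sigma>) \<partial>clocks C r)) \<partial>lborel)"
    by (rule nn_integral_density) auto
  also have "\<dots> = (\<integral>\<^sup>+\<tau>. ennreal (first_density C r \<tau>) * (\<integral>\<^sup>+\<sigma>. H (\<tau>, \<sigma>) \<partial>clocks C r) \<partial>lborel)"
  proof (rule nn_integral_cong)
    fix x :: real
    \<comment> \<open>The card C - 1 survival factors and the density of x combine to
      \<open>first_density\<close>.\<close>
    have "real (card ?D) = real (card C) - 1"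
    proof -
      have "1 \<le> card C" using C card_gt_0_iff[of C] by (auto simp: Suc_le_eq)
      then show ?thesis using C by (simp add: card_cartesian_product of_nat_diff)
    qed
    then have "exponential_density r x * exp (- r * x * card ?D) = first_density C r x"
      by (auto simp: exponential_density_def first_density_def exp_add[symmetric]) (simp add: algebra_simps)
    then show "ennreal (exponential_density r x) * (ennreal (exp (- r * x * card ?D)) * (\<integral>\<^sup>+\<sigma>. H (x, \<sigma>) \<partial>clocks C r)) =
      ennreal (first_density C r x) * (\<integral>\<^sup>+\<sigma>. H (x, \<sigma>) \<partial>clocks C r)"
      using r by (simp add: mult.assoc[symmetric] ennreal_mult[symmetric] exponential_density_nonneg)
  qed
  finally show ?thesis .
qed

lemma nn_integral_first_density:
  assumes r: "0 < r" and C: "finite C" "C \<noteq> {}"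
  shows "(\<integral>\<^sup>+\<tau>. ennreal (first_density C r \<tau>) \<partial>lborel) = ennreal (1 / card C)"
proof -
  have n: "0 < real (card C)" using C by (simp add: card_gt_0_iff)
  then have l: "0 < real (card C) * r" using r by simp
  interpret prob_space "exp_law (real (card C) * r)" using l by (rule prob_space_exponential_density)
  have 1: "(\<integral>\<^sup>+\<tau>. ennreal (exponential_density (real (card C) * r) \<tau>) \<partial>lborel) = 1"
    using emeasure_space_1 by (simp add: emeasure_density)
  have 2: "ennreal (first_density C r \<tau>) = ennreal (1 / card C) * ennreal (exponential_density (real (card C) * r) \<tau>)" for \<tau>
  proof -
    have "first_density C r \<tau> = (1 / card C) * exponential_density (real (card C) * r) \<tau>"
      using n by (auto simp: first_density_def exponential_density_def mult.commute)
    then show ?thesis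
      using n exponential_density_nonneg[OF l, of \<tau>] by (simp only: ennreal_mult[OF divide_nonneg_pos[OF zero_le_one n]])
  qed
  show ?thesis unfolding 2 by (subst nn_integral_cmult) (auto simp: 1)
qed

text \<open>The formula for nonnegative functions is an equality of two finite measures on ring
  times and restarted clocks, and bounded functions of either sign can be integrated against
  them.\<close>

lemma integral_clocks_first:
  fixes H :: "real \<times> ('c \<times> nat \<Rightarrow> real) \<Rightarrow> real"
  assumes r: "0 < r" and C: "finite C" "c \<in> C" and H[measurable]: "H \<in> borel_measurable (borel \<Otimes>\<^sub>M clocks C r)"
    and B: "\<And>\<tau> \<sigma>. \<sigma> \<in> space (clocks C r) \<Longrightarrow> \<bar>H (\<tau>, \<sigma>)\<bar> \<le> B"
  shows "(\<integral>\<sigma>. indicator {\<sigma>. first_ring C c \<sigma>} \<sigma> * H (\<sigma> (c, 0), next_clocks C c \<sigma>) \<partial>clocks C r)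
    = (\<integral>\<tau>. first_density C r \<tau> * (\<integral>\<sigma>. H (\<tau>, \<sigma>) \<partial>clocks C r) \<partial>lborel)"
proof -
  interpret P: prob_space "clocks C r" using r by (rule prob_space_clocks)
  let ?m = "\<lambda>\<sigma>. (\<sigma> (c, 0), next_clocks C c \<sigma>)"
  have [measurable]: "(\<lambda>\<sigma>. \<sigma> (c, 0)) \<in> borel_measurable (clocks C r)" using C by (intro clocks_coord) auto
  note measurable_next_clocks[OF C(2), measurable]
  note [measurable] = sets_first_ring[OF C(2,1), of r]
  define M1 where "M1 = density (clocks C r) (\<lambda>\<sigma>. ennreal (indicator {\<sigma>. first_ring C c \<sigma>} \<sigma>))"
  define M2 where "M2 = density lborel (\<lambda>\<tau>. ennreal (first_density C r \<tau>))"
  have C0: "C \<noteq> {}" using C by auto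
  have sM2: "sets M2 = sets borel" by (simp add: M2_def)
  interpret M2: finite_measure M2
    using nn_integral_first_density[OF r C(1)] C0
    by (intro finite_measureI) (auto simp: M2_def emeasure_density)
  interpret M2: pair_sigma_finite M2 "clocks C r" ..
  interpret M2C: finite_measure "M2 \<Otimes>\<^sub>M clocks C r"
    by (rule finite_measure_pair_measure) unfold_locales
  have mm: "?m \<in> M1 \<rightarrow>\<^sub>M borel \<Otimes>\<^sub>M clocks C r" unfolding M1_def by measurable
  have eq: "distr M1 (borel \<Otimes>\<^sub>M clocks C r) ?m = M2 \<Otimes>\<^sub>M clocks C r"
  proof (rule measure_eqI)
    show s: "sets (distr M1 (borel \<Otimes>\<^sub>M clocks C r) ?m) = sets (M2 \<Otimes>\<^sub>M clocks C r)"
      unfolding sets_distr by (rule sets_pair_measure_cong[OF sM2[symmetric] refl])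
    fix A assume "A \<in> sets (distr M1 (borel \<Otimes>\<^sub>M clocks C r) ?m)"
    then have A[measurable]: "A \<in> sets (borel \<Otimes>\<^sub>M clocks C r)" by simp
    have "emeasure (distr M1 (borel \<Otimes>\<^sub>M clocks C r) ?m) A = (\<integral>\<^sup>+\<sigma>. indicator A (?m \<sigma>) \<partial>M1)"
      by (subst nn_integral_indicator[symmetric], use A in simp, subst nn_integral_distr[OF mm]) auto
    also have "\<dots> = (\<integral>\<^sup>+\<sigma>. indicator {\<sigma>. first_ring C c \<sigma>} \<sigma> * indicator A (?m \<sigma>) \<partial>clocks C r)"
      unfolding M1_def by (subst nn_integral_density) (auto simp: ennreal_indicator)
    also have "\<dots> = (\<integral>\<^sup>+\<tau>. ennreal (first_density C r \<tau>) * (\<integral>\<^sup>+\<sigma>. indicator A (\<tau>, \<sigma>) \<partial>clocks C r) \<partial>lborel)"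
      by (rule nn_integral_clocks_first[OF r C]) measurable
    also have "\<dots> = (\<integral>\<^sup>+\<tau>. \<integral>\<^sup>+\<sigma>. indicator A (\<tau>, \<sigma>) \<partial>clocks C r \<partial>M2)"
      unfolding M2_def by (subst nn_integral_density) auto
    also have "\<dots> = emeasure (M2 \<Otimes>\<^sub>M clocks C r) A"
    proof (rule P.emeasure_pair_measure[symmetric])
      show "A \<in> sets (M2 \<Otimes>\<^sub>M clocks C r)" unfolding s[symmetric] using A by simp
    qed
    finally show "emeasure (distr M1 (borel \<Otimes>\<^sub>M clocks C r) ?m) A = emeasure (M2 \<Otimes>\<^sub>M clocks C r) A" .
  qed
  have "(\<integral>\<sigma>. indicator {\<sigma>. first_ring C c \<sigma>} \<sigma> * H (?m \<sigma>) \<partial>clocks C r) = (\<integral>\<sigma>. H (?m \<sigma>) \<partial>M1)"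
    unfolding M1_def by (subst integral_density) auto
  also have "\<dots> = (\<integral>x. H x \<partial>distr M1 (borel \<Otimes>\<^sub>M clocks C r) ?m)"
    by (rule integral_distr[symmetric, OF mm H])
  also have "\<dots> = (\<integral>x. H x \<partial>(M2 \<Otimes>\<^sub>M clocks C r))" unfolding eq ..
  also have "\<dots> = (\<integral>\<tau>. \<integral>\<sigma>. H (\<tau>, \<sigma>) \<partial>clocks C r \<partial>M2)"
  proof (rule M2.integral_fst'[symmetric])
    show "integrable (M2 \<Otimes>\<^sub>M clocks C r) H"
    proof (rule M2C.integrable_const_bound[where B=B])
      show "H \<in> borel_measurable (M2 \<Otimes>\<^sub>M clocks C r)"
        using H by (subst measurable_cong_sets[OF sets_pair_measure_cong[OF sM2 refl] refl])
      show "AE x in M2 \<Otimes>\<^sub>M clocks C r. norm (H x) \<le> B"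
        using B by (intro AE_I2) (auto simp: space_pair_measure)
    qed
  qed
  also have "\<dots> = (\<integral>\<tau>. first_density C r \<tau> * (\<integral>\<sigma>. H (\<tau>, \<sigma>) \<partial>clocks C r) \<partial>lborel)"
    unfolding M2_def by (subst integral_density) (use r first_density_nonneg in auto)
  finally show ?thesis .
qed

text \<open>Ties need no separate estimate: the events that c rings first are disjoint and have
  probability 1 / card C each, so together they exhaust the space up to a null set.\<close>

lemma AE_clocks_first_ring:
  assumes r: "0 < r" and C: "finite C" "C \<noteq> {}"
  shows "AE \<sigma> in clocks C r. \<exists>c\<in>C. first_ring C c \<sigma>"
proof -
  interpret P: prob_space "clocks C r" using r by (rule prob_space_clocks)
  let ?A = "\<lambda>c. {\<sigma> \<in> space (clocks C r). first_ring C c \<sigma>}"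
  have m: "?A c \<in> sets (clocks C r)" if "c \<in> C" for c
    using sets_first_ring[OF that C(1), of r] by measurable
  have "emeasure (clocks C r) (?A c) = ennreal (1 / card C)" if c: "c \<in> C" for c
  proof -
    have "emeasure (clocks C r) (?A c) = (\<integral>\<^sup>+\<sigma>. indicator {\<sigma>. first_ring C c \<sigma>} \<sigma> * 1 \<partial>clocks C r)"
      by (subst nn_integral_indicator[symmetric, OF m[OF c]]) (auto intro!: nn_integral_cong simp: indicator_def)
    also have "\<dots> = (\<integral>\<^sup>+\<tau>. ennreal (first_density C r \<tau>) * (\<integral>\<^sup>+\<sigma>. 1 \<partial>clocks C r) \<partial>lborel)"
      using nn_integral_clocks_first[OF r C(1) c, of "\<lambda>_. 1"] by simp
    finally show ?thesis using nn_integral_first_density[OF r C] by (simp add: P.emeasure_space_1)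
  qed
  then have p: "P.prob (?A c) = 1 / card C" if "c \<in> C" for c using that by (simp add: measure_def)
  have "P.prob (\<Union>c\<in>C. ?A c) = (\<Sum>c\<in>C. P.prob (?A c))"
  proof (rule P.finite_measure_finite_Union)
    show "disjoint_family_on ?A C"
      by (force simp: disjoint_family_on_def first_ring_def dest: bspec less_asym)
  qed (use C m in auto)
  also have "\<dots> = 1" using C p by simp
  finally have "P.prob (\<Union>c\<in>C. ?A c) = 1" .
  then have "AE \<sigma> in clocks C r. \<sigma> \<in> (\<Union>c\<in>C. ?A c)" by (rule P.AE_prob_1)
  then show ?thesis by eventually_elim auto
qed

lemma AE_clocks_pos:
  assumes r: "0 < r" and C: "finite C"
  shows "AE \<sigma> in clocks C r. \<forall>i\<in>C \<times> UNIV. 0 < \<sigma> i"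
proof -
  have E: "AE x in exp_law r. 0 < x"
    using AE_lborel_singleton[of 0]
    by (subst AE_density) (auto simp: exponential_density_def elim!: eventually_mono)
  have "AE \<sigma> in clocks C r. 0 < \<sigma> i" if "i \<in> C \<times> UNIV" for i
    unfolding clocks_def by (rule AE_PiM_component) (use that r E in \<open>auto intro: prob_space_exponential_density\<close>)
  moreover have "countable (C \<times> (UNIV :: nat set))" using C by (auto intro: countable_finite)
  ultimately show ?thesis by (subst AE_ball_countable) auto
qed


section \<open>Chronological lists of rings and their decomposition at the first ring\<close>

definition ordered_list :: "(real \<times> 'c) set \<Rightarrow> (real \<times> 'c) list \<Rightarrow> bool" where
  "ordered_list A l \<longleftrightarrow> sorted_wrt (<) (map fst l) \<and> set l = A"

lemma ordered_list_Nil: "ordered_list A [] \<longleftrightarrow> A = {}"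
  by (auto simp: ordered_list_def)

lemma ordered_list_Cons:
  "ordered_list A (a # l) \<longleftrightarrow> a \<in> A \<and> ordered_list (A - {a}) l \<and> (\<forall>b\<in>A - {a}. fst a < fst b)"
proof
  assume L: "ordered_list A (a # l)"
  then have lt: "\<forall>b\<in>set l. fst a < fst b" and A: "A = insert a (set l)" and so: "sorted_wrt (<) (map fst l)"
    by (auto simp: ordered_list_def)
  have "a \<notin> set l" using lt by auto
  then have "A - {a} = set l" using A by auto
  then show "a \<in> A \<and> ordered_list (A - {a}) l \<and> (\<forall>b\<in>A - {a}. fst a < fst b)"
    using lt so A by (auto simp: ordered_list_def)
next
  assume "a \<in> A \<and> ordered_list (A - {a}) l \<and> (\<forall>b\<in>A - {a}. fst a < fst b)"
  then show "ordered_list A (a # l)" by (auto simp: ordered_list_def)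
qed

lemma ordered_list_unique: "ordered_list A l \<Longrightarrow> ordered_list A l' \<Longrightarrow> l = l'"
proof (induction l arbitrary: A l')
  case Nil
  then show ?case by (auto simp: ordered_list_def)
next
  case (Cons a l)
  then obtain a' m where l': "l' = a' # m" by (cases l') (auto simp: ordered_list_def)
  have 1: "a \<in> A" "\<forall>b\<in>A - {a}. fst a < fst b" "ordered_list (A - {a}) l"
    using Cons.prems(1) by (auto simp: ordered_list_Cons)
  have 2: "a' \<in> A" "\<forall>b\<in>A - {a'}. fst a' < fst b" "ordered_list (A - {a'}) m"
    using Cons.prems(2) by (auto simp: l' ordered_list_Cons)
  have "a = a'"
    using 1(1,2) 2(1,2) by (metis DiffI less_asym singletonD)
  then show ?case using Cons.IH[OF 1(3)] 2(3) by (simp add: l')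
qed

lemma chronology_eq: "ordered_list A l \<Longrightarrow> chronology A = l"
  unfolding chronology_def ordered_list_def[symmetric]
  by (metis (mono_tags, lifting) ordered_list_unique the_equality)

lemma ordered_list_card: "ordered_list A l \<Longrightarrow> finite A \<and> card A = length l"
proof -
  assume l: "ordered_list A l"
  then have "distinct (map fst l)" by (auto simp: ordered_list_def strict_sorted_iff)
  then have "distinct l" by (simp add: distinct_map)
  then show ?thesis using l by (auto simp: ordered_list_def distinct_card)
qed

lemma ordered_list_shift:
  "ordered_list ((\<lambda>(\<tau>, c). (s + \<tau>, c)) ` A) (map (\<lambda>(\<tau>, c). (s + \<tau>, c)) l) \<longleftrightarrow> ordered_list A l"
proof -
  have "inj (\<lambda>(\<tau>, c). (s + \<tau>, c) :: real \<times> 'a)" by (auto simp: inj_on_def)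
  then have "(\<lambda>(\<tau>, c). (s + \<tau>, c)) ` set l = (\<lambda>(\<tau>, c). (s + \<tau>, c)) ` A \<longleftrightarrow> set l = A"
    by (rule inj_image_eq_iff)
  then show ?thesis
    by (auto simp: ordered_list_def sorted_wrt_map case_prod_beta')
qed

text \<open>Stronger than having k rings: simultaneous rings admit no strictly increasing list, so
  then no k qualifies. For the auxiliary system \<open>AE_ring_event\<close> shows that both
  readings agree almost surely.\<close>

definition nrings :: "'c set \<Rightarrow> real \<Rightarrow> ('c \<times> nat \<Rightarrow> real) \<Rightarrow> nat \<Rightarrow> bool" where
  "nrings C T \<sigma> k \<longleftrightarrow> (\<exists>l. length l = k \<and> ordered_list (rings C T \<sigma>) l)"

lemma ring_time_pos:
  assumes "\<forall>i\<in>C \<times> UNIV. 0 < \<sigma> i" "c \<in> C" shows "0 < ring_time \<sigma> c n"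
  unfolding ring_time_def by (rule sum_pos) (use assms in auto)

lemma ring_time_next_clocks:
  assumes "c \<in> C" "c' \<in> C"
  shows "ring_time \<sigma> c' (if c' = c then Suc n else n) = \<sigma> (c, 0) + ring_time (next_clocks C c \<sigma>) c' n"
proof (induction n)
  case 0
  then show ?case using assms by (auto simp: ring_time_def next_clocks_def)
next
  case (Suc n)
  then show ?case using assms by (auto simp: ring_time_def next_clocks_def)
qed

lemma rings_first:
  assumes pos: "\<forall>i\<in>C \<times> UNIV. 0 < \<sigma> i" and c: "c \<in> C" and first: "first_ring C c \<sigma>"
  defines "\<tau> \<equiv> \<sigma> (c, 0)" and "\<sigma>' \<equiv> next_clocks C c \<sigma>"
  shows "T < \<tau> \<Longrightarrow> rings C T \<sigma> = {}"
    and "\<tau> \<le> T \<Longrightarrow> rings C T \<sigma> = insert (\<tau>, c) ((\<lambda>(u, c). (\<tau> + u, c)) ` rings C (T - \<tau>) \<sigma>')"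
    and "\<forall>a\<in>rings C (T - \<tau>) \<sigma>'. 0 < fst a"
proof -
  have pos': "\<forall>i\<in>C \<times> UNIV. 0 < \<sigma>' i"
    using pos c first by (auto simp: \<sigma>'_def next_clocks_def first_ring_def)
  have \<tau>: "0 < \<tau>" using pos c by (auto simp: \<tau>_def)
  have A: "ring_time \<sigma> c 0 = \<tau>" by (simp add: ring_time_def \<tau>_def)
  have B: "ring_time \<sigma> c' (if c' = c then Suc n else n) = \<tau> + ring_time \<sigma>' c' n" if "c' \<in> C" for c' n
    unfolding \<tau>_def \<sigma>'_def by (rule ring_time_next_clocks[OF c that])
  \<comment> \<open>Apart from the first ring itself, every ring is a ring of the restarted clocks,
    with its number lowered by one if it belongs to c.\<close>
  have cases: "(c' = c \<and> n = 0) \<or> (\<exists>n'. n = (if c' = c then Suc n' else n'))" for c' n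
    by (cases n) auto
  show "\<forall>a\<in>rings C (T - \<tau>) \<sigma>'. 0 < fst a" by (auto simp: rings_def)
  show "rings C T \<sigma> = {}" if "T < \<tau>"
  proof -
    have "\<tau> \<le> ring_time \<sigma> c' n" if c': "c' \<in> C" for c' n
      using cases[of c' n]
    proof
      assume "\<exists>n'. n = (if c' = c then Suc n' else n')"
      then obtain n' where n: "n = (if c' = c then Suc n' else n')" ..
      show ?thesis unfolding n B[OF c'] using ring_time_pos[OF pos' c', of n'] by simp
    qed (auto simp: A)
    with that have "\<not> ring_time \<sigma> c' n \<le> T" if "c' \<in> C" for c' n
      using that by (simp add: not_le less_le_trans)
    then show ?thesis by (auto simp: rings_def)
  qed
  show "rings C T \<sigma> = insert (\<tau>, c) ((\<lambda>(u, c). (\<tau> + u, c)) ` rings C (T - \<tau>) \<sigma>')" if T: "\<tau> \<le> T"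
  proof (intro set_eqI iffI)
    fix a assume "a \<in> rings C T \<sigma>"
    then obtain c' n where a: "a = (ring_time \<sigma> c' n, c')" and c': "c' \<in> C" and le: "ring_time \<sigma> c' n \<le> T"
      by (auto simp: rings_def)
    from cases[of c' n] show "a \<in> insert (\<tau>, c) ((\<lambda>(u, c). (\<tau> + u, c)) ` rings C (T - \<tau>) \<sigma>')"
    proof
      assume "\<exists>n'. n = (if c' = c then Suc n' else n')"
      then obtain n' where n: "n = (if c' = c then Suc n' else n')" ..
      have "(ring_time \<sigma>' c' n', c') \<in> rings C (T - \<tau>) \<sigma>'"
        using le ring_time_pos[OF pos' c', of n'] c' unfolding n B[OF c'] rings_def by auto
      then show ?thesis unfolding a n B[OF c'] by (auto intro!: image_eqI[where x="(ring_time \<sigma>' c' n', c')"])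
    qed (simp add: a A)
  next
    fix a assume "a \<in> insert (\<tau>, c) ((\<lambda>(u, c). (\<tau> + u, c)) ` rings C (T - \<tau>) \<sigma>')"
    then show "a \<in> rings C T \<sigma>"
    proof
      assume "a = (\<tau>, c)"
      then show ?thesis using A \<tau> T c unfolding rings_def by (force intro!: exI[of _ c] exI[of _ 0])
    next
      assume "a \<in> (\<lambda>(u, c). (\<tau> + u, c)) ` rings C (T - \<tau>) \<sigma>'"
      then obtain c' n where c': "c' \<in> C" and a: "a = (\<tau> + ring_time \<sigma>' c' n, c')"
        and b: "0 < ring_time \<sigma>' c' n" "ring_time \<sigma>' c' n \<le> T - \<tau>"
        by (auto simp: rings_def)
      show ?thesis unfolding a B[OF c', symmetric] rings_def using b \<tau> c' B[OF c', of n]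
        by (auto intro!: exI[of _ "if c' = c then Suc n else n"])
    qed
  qed
qed

text \<open>The first ring strictly precedes all others, so it heads any chronological list, and the
  tail is a shifted list for the restarted clocks.\<close>

lemma ordered_rings_first:
  assumes pos: "\<forall>i\<in>C \<times> UNIV. 0 < \<sigma> i" and c: "c \<in> C" and first: "first_ring C c \<sigma>"
  defines "\<tau> \<equiv> \<sigma> (c, 0)" and "\<sigma>' \<equiv> next_clocks C c \<sigma>"
  shows "\<tau> \<le> T \<Longrightarrow> ordered_list (rings C T \<sigma>) ((\<tau>, c) # map (\<lambda>(u, c). (\<tau> + u, c)) l) \<longleftrightarrow> ordered_list (rings C (T - \<tau>) \<sigma>') l"
    and "\<tau> \<le> T \<Longrightarrow> ordered_list (rings C T \<sigma>) m \<Longrightarrow>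
      \<exists>l. m = (\<tau>, c) # map (\<lambda>(u, c). (\<tau> + u, c)) l \<and> ordered_list (rings C (T - \<tau>) \<sigma>') l"
proof -
  note R = rings_first[OF pos c first, folded \<tau>_def \<sigma>'_def]
  let ?S = "(\<lambda>(u, c). (\<tau> + u, c)) ` rings C (T - \<tau>) \<sigma>'"
  have lt: "\<forall>b\<in>?S. \<tau> < fst b" using R(3)[of T] by auto
  then have ni: "(\<tau>, c) \<notin> ?S" by auto
  show iff: "ordered_list (rings C T \<sigma>) ((\<tau>, c) # map (\<lambda>(u, c). (\<tau> + u, c)) l) \<longleftrightarrow> ordered_list (rings C (T - \<tau>) \<sigma>') l"
    if T: "\<tau> \<le> T" for l
  proof -
    have "insert (\<tau>, c) ?S - {(\<tau>, c)} = ?S" using ni by auto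
    then show ?thesis
      unfolding R(2)[OF T] ordered_list_Cons using lt by (simp add: ordered_list_shift)
  qed
  assume T: "\<tau> \<le> T" and m: "ordered_list (rings C T \<sigma>) m"
  have ne: "(\<tau>, c) \<in> rings C T \<sigma>" using R(2)[OF T] by simp
  then obtain a m' where m': "m = a # m'" using m by (cases m) (auto simp: ordered_list_def)
  have a: "a \<in> rings C T \<sigma>" "\<forall>b\<in>rings C T \<sigma> - {a}. fst a < fst b" "ordered_list (rings C T \<sigma> - {a}) m'"
    using m by (auto simp: m' ordered_list_Cons)
  have "a = (\<tau>, c)"
  proof (rule ccontr)
    assume n: "a \<noteq> (\<tau>, c)"
    then have "fst a < \<tau>" using bspec[OF a(2), of "(\<tau>, c)"] ne by simp
    moreover have "a \<in> ?S" using a(1) n R(2)[OF T] by auto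
    ultimately show False using lt by force
  qed
  then have "ordered_list ?S m'" using a(3) ni unfolding R(2)[OF T] by (simp add: insert_Diff_if)
  define l where "l = map (\<lambda>(u, c). (- \<tau> + u, c)) m'"
  have "m' = map (\<lambda>(u, c). (\<tau> + u, c)) l" by (auto simp: l_def map_idI case_prod_beta' comp_def)
  with \<open>ordered_list ?S m'\<close> \<open>a = (\<tau>, c)\<close> show
    "\<exists>l. m = (\<tau>, c) # map (\<lambda>(u, c). (\<tau> + u, c)) l \<and> ordered_list (rings C (T - \<tau>) \<sigma>') l"
    by (auto simp: m' ordered_list_shift intro!: exI[of _ l])
qed

text \<open>The recursion for the count and for the chronology. The last equation supposes that the
  restarted rings have a chronology: without one, \<open>chronology\<close> takes its default value
  [] for both sets of rings and the lists would not match.\<close>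

lemma nrings_first:
  assumes pos: "\<forall>i\<in>C \<times> UNIV. 0 < \<sigma> i" and c: "c \<in> C" and first: "first_ring C c \<sigma>"
  defines "\<tau> \<equiv> \<sigma> (c, 0)" and "\<sigma>' \<equiv> next_clocks C c \<sigma>"
  shows "nrings C T \<sigma> 0 \<longleftrightarrow> T < \<tau>"
    and "nrings C T \<sigma> (Suc k) \<longleftrightarrow> \<tau> \<le> T \<and> nrings C (T - \<tau>) \<sigma>' k"
    and "\<tau> \<le> T \<Longrightarrow> nrings C (T - \<tau>) \<sigma>' k \<Longrightarrow>
      chronology (rings C T \<sigma>) = (\<tau>, c) # map (\<lambda>(u, c). (\<tau> + u, c)) (chronology (rings C (T - \<tau>) \<sigma>'))"
proof -
  note R = rings_first[OF pos c first, folded \<tau>_def \<sigma>'_def]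
  note O = ordered_rings_first[OF pos c first, folded \<tau>_def \<sigma>'_def]
  show "nrings C T \<sigma> 0 \<longleftrightarrow> T < \<tau>"
    using R(1,2)[of T] by (cases "T < \<tau>") (auto simp: nrings_def ordered_list_Nil)
  show "nrings C T \<sigma> (Suc k) \<longleftrightarrow> \<tau> \<le> T \<and> nrings C (T - \<tau>) \<sigma>' k"
  proof (cases "\<tau> \<le> T")
    case True
    show ?thesis
    proof
      assume "nrings C T \<sigma> (Suc k)"
      then obtain m where m: "length m = Suc k" "ordered_list (rings C T \<sigma>) m" by (auto simp: nrings_def)
      from O(2)[OF True m(2)] m(1) show "\<tau> \<le> T \<and> nrings C (T - \<tau>) \<sigma>' k"
        using True by (auto simp: nrings_def)
    next
      assume "\<tau> \<le> T \<and> nrings C (T - \<tau>) \<sigma>' k"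
      then obtain l where l: "length l = k" "ordered_list (rings C (T - \<tau>) \<sigma>') l" by (auto simp: nrings_def)
      then show "nrings C T \<sigma> (Suc k)"
        unfolding nrings_def using O(1)[OF True, of l]
        by (intro exI[of _ "(\<tau>, c) # map (\<lambda>(u, c). (\<tau> + u, c)) l"]) simp
    qed
  next
    case False
    then show ?thesis using R(1)[of T] by (auto simp: nrings_def ordered_list_def)
  qed
  assume T: "\<tau> \<le> T" and n: "nrings C (T - \<tau>) \<sigma>' k"
  then obtain l where l: "ordered_list (rings C (T - \<tau>) \<sigma>') l" by (auto simp: nrings_def)
  show "chronology (rings C T \<sigma>) = (\<tau>, c) # map (\<lambda>(u, c). (\<tau> + u, c)) (chronology (rings C (T - \<tau>) \<sigma>'))"
    using chronology_eq[OF l] chronology_eq[OF O(1)[OF T, THEN iffD2, OF l]] by simp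
qed

lemma nrings_empty: "nrings {} T \<sigma> k \<longleftrightarrow> k = 0"
  by (auto simp: nrings_def rings_def ordered_list_def)

text \<open>The rings are selected by a list of indices; only countably many lists occur, so
  functions of the chronology are measurable.\<close>

definition ring_list :: "('c \<times> nat) list \<Rightarrow> ('c \<times> nat \<Rightarrow> real) \<Rightarrow> (real \<times> 'c) list" where
  "ring_list is \<sigma> = map (\<lambda>i. (ring_time \<sigma> (fst i) (snd i), fst i)) is"

text \<open>The equality of sets is broken up into comparisons of ring times, finitely many for the
  list and countably many for the clocks, each of which is measurable.\<close>

lemma rings_eq_ring_list_iff:
  assumes "set is \<subseteq> C \<times> UNIV"
  shows "set (ring_list is \<sigma>) = rings C T \<sigma> \<longleftrightarrow>
    (\<forall>i\<in>set is. 0 < ring_time \<sigma> (fst i) (snd i) \<and> ring_time \<sigma> (fst i) (snd i) \<le> T) \<and>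
    (\<forall>c\<in>C. \<forall>n. 0 < ring_time \<sigma> c n \<longrightarrow> ring_time \<sigma> c n \<le> T \<longrightarrow>
      (\<exists>i\<in>set is. ring_time \<sigma> (fst i) (snd i) = ring_time \<sigma> c n \<and> fst i = c))"
    (is "?L \<longleftrightarrow> ?A \<and> ?B")
proof -
  have "set (ring_list is \<sigma>) \<subseteq> rings C T \<sigma> \<longleftrightarrow> ?A"
  proof
    assume sub: "set (ring_list is \<sigma>) \<subseteq> rings C T \<sigma>"
    show ?A
    proof
      fix i assume "i \<in> set is"
      then have "(ring_time \<sigma> (fst i) (snd i), fst i) \<in> rings C T \<sigma>"
        using sub by (auto simp: ring_list_def)
      then show "0 < ring_time \<sigma> (fst i) (snd i) \<and> ring_time \<sigma> (fst i) (snd i) \<le> T"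
        by (auto simp: rings_def)
    qed
  next
    assume a: ?A
    show "set (ring_list is \<sigma>) \<subseteq> rings C T \<sigma>"
    proof
      fix b assume "b \<in> set (ring_list is \<sigma>)"
      then obtain i where i: "i \<in> set is" "b = (ring_time \<sigma> (fst i) (snd i), fst i)" by (auto simp: ring_list_def)
      moreover have "fst i \<in> C" using i assms by auto
      ultimately show "b \<in> rings C T \<sigma>" using a unfolding rings_def by blast
    qed
  qed
  moreover have "rings C T \<sigma> \<subseteq> set (ring_list is \<sigma>) \<longleftrightarrow> ?B"
  proof
    assume sub: "rings C T \<sigma> \<subseteq> set (ring_list is \<sigma>)"
    show ?B
    proof (intro ballI allI impI)
      fix c n assume "c \<in> C" "0 < ring_time \<sigma> c n" "ring_time \<sigma> c n \<le> T"
      then have "(ring_time \<sigma> c n, c) \<in> set (ring_list is \<sigma>)" using sub by (auto simp: rings_def)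
      then obtain i where "i \<in> set is" "ring_time \<sigma> c n = ring_time \<sigma> (fst i) (snd i)" "c = fst i"
        by (auto simp: ring_list_def)
      then show "\<exists>i\<in>set is. ring_time \<sigma> (fst i) (snd i) = ring_time \<sigma> c n \<and> fst i = c"
        by (intro bexI[of _ i]) auto
    qed
  next
    assume b: ?B
    show "rings C T \<sigma> \<subseteq> set (ring_list is \<sigma>)"
    proof
      fix a assume "a \<in> rings C T \<sigma>"
      then obtain c n where a: "a = (ring_time \<sigma> c n, c)" and c: "c \<in> C" "0 < ring_time \<sigma> c n" "ring_time \<sigma> c n \<le> T"
        by (auto simp: rings_def)
      then obtain i where "i \<in> set is" "ring_time \<sigma> (fst i) (snd i) = ring_time \<sigma> c n" "fst i = c"
        using b by metis
      then show "a \<in> set (ring_list is \<sigma>)"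
        unfolding a ring_list_def set_map by (intro image_eqI[of _ _ i]) auto
    qed
  qed
  ultimately show ?thesis by blast
qed

lemma rings_in_ring_list:
  assumes "set l = rings C T \<sigma>"
  shows "\<exists>is\<in>lists (C \<times> UNIV). l = ring_list is \<sigma>"
proof -
  have "set l \<subseteq> rings C T \<sigma>" using assms by simp
  then show ?thesis
  proof (induction l)
    case Nil
    then show ?case by (auto simp: ring_list_def intro!: bexI[of _ "[]"])
  next
    case (Cons a l)
    then obtain "is" where "is": "is \<in> lists (C \<times> UNIV)" "l = ring_list is \<sigma>" by auto
    obtain c n where "a = (ring_time \<sigma> c n, c)" "c \<in> C" using Cons.prems by (auto simp: rings_def)
    then show ?case using "is" by (intro bexI[of _ "(c, n) # is"]) (auto simp: ring_list_def)
  qed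
qed

lemma measurable_ring_time [measurable (raw)]:
  assumes [measurable]: "f \<in> M \<rightarrow>\<^sub>M clocks C r" and c: "c \<in> C"
  shows "(\<lambda>x. ring_time (f x) c n) \<in> borel_measurable M"
  unfolding ring_time_def
  by (intro borel_measurable_sum measurable_compose[OF assms(1) clocks_coord]) (use c in auto)

lemma pred_rings_eq_ring_list:
  assumes [measurable]: "f \<in> M \<rightarrow>\<^sub>M clocks C r" "T \<in> borel_measurable M"
    and "is": "is \<in> lists (C \<times> UNIV)" and C: "finite C"
  shows "Measurable.pred M (\<lambda>x. set (ring_list is (f x)) = rings C (T x) (f x))"
proof -
  have "set is \<subseteq> C \<times> UNIV" using "is" by auto
  then have 1[measurable]: "(\<lambda>x. ring_time (f x) (fst i) (snd i)) \<in> borel_measurable M" if "i \<in> set is" for i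
    using that by (intro measurable_ring_time[OF assms(1)]) auto
  have 2[measurable]: "(\<lambda>x. ring_time (f x) c n) \<in> borel_measurable M" if "c \<in> C" for c n
    using that by (intro measurable_ring_time[OF assms(1)]) auto
  have 3: "Measurable.pred M (\<lambda>x. 0 < ring_time (f x) (fst i) (snd i) \<and> ring_time (f x) (fst i) (snd i) \<le> T x)"
    if "i \<in> set is" for i
    using 1[OF that] by measurable
  have 4: "Measurable.pred M (\<lambda>x. 0 < ring_time (f x) c n \<longrightarrow> ring_time (f x) c n \<le> T x \<longrightarrow>
      (\<exists>i\<in>set is. ring_time (f x) (fst i) (snd i) = ring_time (f x) c n \<and> fst i = c))" if "c \<in> C" for c n
  proof -
    have "Measurable.pred M (\<lambda>x. ring_time (f x) (fst i) (snd i) = ring_time (f x) c n \<and> fst i = c)" if "i \<in> set is" for i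
      using 1[OF that] 2[OF \<open>c \<in> C\<close>, of n] by measurable
    then have "Measurable.pred M (\<lambda>x. \<exists>i\<in>set is. ring_time (f x) (fst i) (snd i) = ring_time (f x) c n \<and> fst i = c)"
      by (intro pred_intros_finite) auto
    then show ?thesis using 2[OF \<open>c \<in> C\<close>, of n] by measurable
  qed
  show ?thesis
    unfolding rings_eq_ring_list_iff[OF \<open>set is \<subseteq> C \<times> UNIV\<close>]
    using 3 4 C by (intro pred_intros_logic pred_intros_finite pred_intros_countable) auto
qed

lemma pred_ordered_ring_list:
  assumes f[measurable]: "f \<in> M \<rightarrow>\<^sub>M clocks C r" and T: "T \<in> borel_measurable M"
    and "is": "is \<in> lists (C \<times> UNIV)" and C: "finite C"
  shows "Measurable.pred M (\<lambda>x. ordered_list (rings C (T x) (f x)) (ring_list is (f x)))"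
proof -
  have "Measurable.pred M (\<lambda>x. sorted_wrt (<) (map fst (ring_list is (f x))))"
    using "is"
  proof (induction "is")
    case Nil
    then show ?case by (simp add: ring_list_def)
  next
    case (Cons i "is")
    have [measurable]: "(\<lambda>x. ring_time (f x) (fst i) (snd i)) \<in> borel_measurable M"
      using Cons.hyps by (intro measurable_ring_time[OF f]) auto
    have "Measurable.pred M (\<lambda>x. ring_time (f x) (fst i) (snd i) < ring_time (f x) (fst j) (snd j))" if "j \<in> set is" for j
    proof -
      have "(\<lambda>x. ring_time (f x) (fst j) (snd j)) \<in> borel_measurable M"
        using Cons.hyps that by (intro measurable_ring_time[OF f]) auto
      then show ?thesis by measurable
    qed
    then have "Measurable.pred M (\<lambda>x. \<forall>j\<in>set is. ring_time (f x) (fst i) (snd i) < ring_time (f x) (fst j) (snd j))"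
      by (intro pred_intros_finite) auto
    then show ?case using Cons.IH by (simp add: ring_list_def) 
  qed
  with pred_rings_eq_ring_list[OF f T "is" C] show ?thesis
    unfolding ordered_list_def by (intro pred_intros_logic)
qed

lemma pred_Bex_countable:
  assumes "countable X" "\<And>i. i \<in> X \<Longrightarrow> Measurable.pred M (P i)"
  shows "Measurable.pred M (\<lambda>x. \<exists>i\<in>X. P i x)"
proof -
  have "{x \<in> space M. \<exists>i\<in>X. P i x} = (\<Union>i\<in>X. {x \<in> space M. P i x})" by auto
  also have "\<dots> \<in> sets M"
    using assms by (intro sets.countable_UN') (auto simp: pred_def)
  finally show ?thesis by (simp add: pred_def)
qed

lemma pred_nrings [measurable (raw)]:
  assumes f: "f \<in> M \<rightarrow>\<^sub>M clocks C r" and T: "T \<in> borel_measurable M" and C: "finite C"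
  shows "Measurable.pred M (\<lambda>x. nrings C (T x) (f x) k)"
proof -
  have eq: "nrings C (T x) (f x) k \<longleftrightarrow> (\<exists>is\<in>{is\<in>lists (C \<times> UNIV). length is = k}. ordered_list (rings C (T x) (f x)) (ring_list is (f x)))" for x
  proof
    assume "nrings C (T x) (f x) k"
    then obtain l where l: "length l = k" "ordered_list (rings C (T x) (f x)) l" by (auto simp: nrings_def)
    then obtain "is" where "is \<in> lists (C \<times> UNIV)" "l = ring_list is (f x)"
      using rings_in_ring_list[of l C "T x" "f x"] by (auto simp: ordered_list_def)
    then show "\<exists>is\<in>{is\<in>lists (C \<times> UNIV). length is = k}. ordered_list (rings C (T x) (f x)) (ring_list is (f x))"
      using l by (auto simp: ring_list_def)
  next
    assume "\<exists>is\<in>{is\<in>lists (C \<times> UNIV). length is = k}. ordered_list (rings C (T x) (f x)) (ring_list is (f x))"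
    then obtain "is" where "length is = k" "ordered_list (rings C (T x) (f x)) (ring_list is (f x))" by auto
    then show "nrings C (T x) (f x) k"
      unfolding nrings_def by (intro exI[of _ "ring_list is (f x)"]) (simp add: ring_list_def)
  qed
  have "countable {is\<in>lists (C \<times> (UNIV::nat set)). length is = k}"
  proof (rule countable_subset[of _ "lists (C \<times> UNIV)"])
    show "countable (lists (C \<times> (UNIV::nat set)))"
      using countable_finite[OF C] by (intro countable_lists countable_SIGMA) auto
  qed auto
  then show ?thesis
    unfolding eq using pred_ordered_ring_list[OF f T _ C] by (intro pred_Bex_countable) auto
qed

text \<open>The conditioning event counts rings and says nothing about their order, so it is
  expressed through distinct instead of increasing lists.\<close>

lemma pred_card_rings:
  assumes f: "f \<in> M \<rightarrow>\<^sub>M clocks C r" and C: "finite C"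
  shows "Measurable.pred M (\<lambda>x. finite (rings C T (f x)) \<and> card (rings C T (f x)) = k)"
proof -
  have eq: "finite (rings C T (f x)) \<and> card (rings C T (f x)) = k \<longleftrightarrow>
     (\<exists>is\<in>{is\<in>lists (C \<times> UNIV). length is = k}. distinct (ring_list is (f x)) \<and> set (ring_list is (f x)) = rings C T (f x))" for x
  proof
    assume fc: "finite (rings C T (f x)) \<and> card (rings C T (f x)) = k"
    then obtain l where l: "distinct l" "set l = rings C T (f x)" using finite_distinct_list by auto
    then have "length l = k" using fc by (auto dest: distinct_card)
    moreover obtain "is" where "is \<in> lists (C \<times> UNIV)" "l = ring_list is (f x)"
      using rings_in_ring_list[OF l(2)] by auto
    ultimately show "\<exists>is\<in>{is\<in>lists (C \<times> UNIV). length is = k}. distinct (ring_list is (f x)) \<and> set (ring_list is (f x)) = rings C T (f x)"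
      using l by (auto simp: ring_list_def)
  next
    assume "\<exists>is\<in>{is\<in>lists (C \<times> UNIV). length is = k}. distinct (ring_list is (f x)) \<and> set (ring_list is (f x)) = rings C T (f x)"
    then obtain "is" where i: "length is = k" "distinct (ring_list is (f x))" "set (ring_list is (f x)) = rings C T (f x)" by auto
    from distinct_card[OF i(2)] i(1,3) show "finite (rings C T (f x)) \<and> card (rings C T (f x)) = k"
      by (metis List.finite_set length_map ring_list_def)
  qed
  have d: "Measurable.pred M (\<lambda>x. distinct (ring_list is (f x)))" if "is \<in> lists (C \<times> UNIV)" for "is"
    using that
  proof (induction "is")
    case Nil
    then show ?case by (simp add: ring_list_def)
  next
    case (Cons i "is")
    have [measurable]: "(\<lambda>x. ring_time (f x) (fst i) (snd i)) \<in> borel_measurable M"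
      using Cons.hyps by (intro measurable_ring_time[OF f]) auto
    have "Measurable.pred M (\<lambda>x. (ring_time (f x) (fst i) (snd i), fst i) \<noteq> (ring_time (f x) (fst j) (snd j), fst j))" if "j \<in> set is" for j
    proof -
      have [measurable]: "(\<lambda>x. ring_time (f x) (fst j) (snd j)) \<in> borel_measurable M"
        using Cons.hyps that by (intro measurable_ring_time[OF f]) auto
      show ?thesis unfolding prod.inject by measurable
    qed
    then have "Measurable.pred M (\<lambda>x. \<forall>j\<in>set is. (ring_time (f x) (fst i) (snd i), fst i) \<noteq> (ring_time (f x) (fst j) (snd j), fst j))"
      by (intro pred_intros_finite) auto
    moreover have "(ring_time (f x) (fst i) (snd i), fst i) \<notin> set (ring_list is (f x)) \<longleftrightarrow>
      (\<forall>j\<in>set is. (ring_time (f x) (fst i) (snd i), fst i) \<noteq> (ring_time (f x) (fst j) (snd j), fst j))" for x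
      by (auto simp: ring_list_def)
    ultimately have "Measurable.pred M (\<lambda>x. (ring_time (f x) (fst i) (snd i), fst i) \<notin> set (ring_list is (f x)))"
      by simp
    with Cons.IH have "Measurable.pred M (\<lambda>x. (ring_time (f x) (fst i) (snd i), fst i) \<notin> set (ring_list is (f x)) \<and> distinct (ring_list is (f x)))"
      unfolding pred_def by (intro sets.sets_Collect_conj)
    then show ?case by (simp add: ring_list_def)
  qed
  have "countable {is\<in>lists (C \<times> (UNIV::nat set)). length is = k}"
  proof (rule countable_subset[of _ "lists (C \<times> UNIV)"])
    show "countable (lists (C \<times> (UNIV::nat set)))"
      using countable_finite[OF C] by (intro countable_lists countable_SIGMA) auto
  qed auto
  then show ?thesis
    unfolding eq using pred_rings_eq_ring_list[OF f borel_measurable_const _ C] d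
    by (intro pred_Bex_countable pred_intros_logic) auto
qed

section \<open>Feynman--Kac semigroups of the independent particles\<close>

text \<open>The Feynman-Kac propagator from s to \<tau> of m independent particles with killing rate
  a. \<open>PE\<close> is the propagator without killing.\<close>

definition PK :: "(real \<Rightarrow> 'a::metric_space \<Rightarrow> (real \<Rightarrow> 'a) measure) \<Rightarrow> nat \<Rightarrow> (real \<Rightarrow> (nat \<Rightarrow> 'a) \<Rightarrow> real) \<Rightarrow>
   real \<Rightarrow> real \<Rightarrow> ((nat \<Rightarrow> 'a) \<Rightarrow> real) \<Rightarrow> (nat \<Rightarrow> 'a) \<Rightarrow> real" where
  "PK K m a s \<tau> g x = (\<integral>z. g (pos m z \<tau>) * exp (- tint s \<tau> (\<lambda>v. a v (pos m z v))) \<partial>prod_law K m s x)"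

definition PE :: "(real \<Rightarrow> 'a::metric_space \<Rightarrow> (real \<Rightarrow> 'a) measure) \<Rightarrow> nat \<Rightarrow>
   real \<Rightarrow> real \<Rightarrow> ((nat \<Rightarrow> 'a) \<Rightarrow> real) \<Rightarrow> (nat \<Rightarrow> 'a) \<Rightarrow> real" where
  "PE K m s \<tau> g x = (\<integral>z. g (pos m z \<tau>) \<partial>prod_law K m s x)"

definition bounded_fun :: "nat \<Rightarrow> ((nat \<Rightarrow> 'a::metric_space) \<Rightarrow> real) \<Rightarrow> real \<Rightarrow> bool" where
  "bounded_fun m g B \<longleftrightarrow> g \<in> borel_measurable (state_space m) \<and> (\<forall>x\<in>space (state_space m). \<bar>g x\<bar> \<le> B)"

text \<open>The bound is an explicit argument because the estimates need its value. It is asked at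
  all real times, negative ones included, which the clipping of times makes harmless.\<close>

definition bounded_tfun :: "nat \<Rightarrow> (real \<Rightarrow> (nat \<Rightarrow> 'a::metric_space) \<Rightarrow> real) \<Rightarrow> real \<Rightarrow> bool" where
  "bounded_tfun m g B \<longleftrightarrow> case_prod g \<in> borel_measurable (borel \<Otimes>\<^sub>M state_space m) \<and>
     (\<forall>s. \<forall>x\<in>space (state_space m). \<bar>g s x\<bar> \<le> B)"

lemma bounded_tfun_measurable: "bounded_tfun m g B \<Longrightarrow> case_prod g \<in> borel_measurable (borel \<Otimes>\<^sub>M state_space m)"
  by (simp add: bounded_tfun_def)

lemma bounded_tfun_le: "bounded_tfun m g B \<Longrightarrow> x \<in> space (state_space m) \<Longrightarrow> \<bar>g s x\<bar> \<le> B"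
  by (simp add: bounded_tfun_def)

lemma bounded_fun_measurable: "bounded_fun m g B \<Longrightarrow> g \<in> borel_measurable (state_space m)"
  by (simp add: bounded_fun_def)

lemma bounded_fun_le: "bounded_fun m g B \<Longrightarrow> x \<in> space (state_space m) \<Longrightarrow> \<bar>g x\<bar> \<le> B"
  by (simp add: bounded_fun_def)

lemma bounded_fun_bound_nonneg: "bounded_fun m g B \<Longrightarrow> 0 \<le> B"
  using bounded_fun_le[of m g B "\<lambda>i\<in>{..<m}. undefined"] by (force simp: space_state_space)

lemma bounded_tfun_bound_nonneg: "bounded_tfun m g B \<Longrightarrow> 0 \<le> B"
  using bounded_tfun_le[of m g B "\<lambda>i\<in>{..<m}. undefined" 0] by (force simp: space_state_space)

lemma bounded_tfun_imp_fun: "bounded_tfun m g B \<Longrightarrow> bounded_fun m (g s) B"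
  unfolding bounded_fun_def bounded_tfun_def by (auto intro: measurable_Pair2)

lemma bounded_tfun_add: "bounded_tfun m g B \<Longrightarrow> bounded_tfun m h B' \<Longrightarrow> bounded_tfun m (\<lambda>s x. g s x + h s x) (B + B')"
  unfolding bounded_tfun_def by (auto simp: case_prod_beta' intro: order_trans[OF abs_triangle_ineq add_mono])

lemma bounded_tfun_diff: "bounded_tfun m g B \<Longrightarrow> bounded_tfun m h B' \<Longrightarrow> bounded_tfun m (\<lambda>s x. g s x - h s x) (B + B')"
  unfolding bounded_tfun_def by (auto simp: case_prod_beta' intro: order_trans[OF abs_triangle_ineq4 add_mono])

lemma bounded_tfun_mult: "bounded_tfun m g B \<Longrightarrow> bounded_tfun m h B' \<Longrightarrow> bounded_tfun m (\<lambda>s x. g s x * h s x) (B * B')"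
  using bounded_tfun_bound_nonneg[of m g B] unfolding bounded_tfun_def
  by (auto simp: case_prod_beta' abs_mult intro: mult_mono)

lemma bounded_tfun_cmult: "bounded_tfun m h B' \<Longrightarrow> bounded_tfun m (\<lambda>s x. c * h s x) (\<bar>c\<bar> * B')"
  unfolding bounded_tfun_def
  by (auto simp: case_prod_beta' abs_mult intro: mult_left_mono)

lemma bounded_tfun_sum:
  assumes "\<And>i. i \<in> I \<Longrightarrow> bounded_tfun m (g i) B"
  shows "bounded_tfun m (\<lambda>s x. \<Sum>i\<in>I. g i s x) (real (card I) * B)"
  using assms unfolding bounded_tfun_def
  by (auto simp: case_prod_beta' intro!: order_trans[OF sum_abs sum_bounded_above] borel_measurable_sum)

context markov_kernel begin

lemma measurable_PK:
  assumes a[measurable]: "case_prod a \<in> borel_measurable (borel \<Otimes>\<^sub>M state_space m)"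
    and g[measurable]: "case_prod g \<in> borel_measurable (M \<Otimes>\<^sub>M state_space m)"
    and [measurable]: "s \<in> borel_measurable M" "\<tau> \<in> borel_measurable M" "x \<in> M \<rightarrow>\<^sub>M state_space m"
  shows "(\<lambda>w. PK K m a (s w) (\<tau> w) (g w) (x w)) \<in> borel_measurable M"
  unfolding PK_def
  by (rule integral_measurable_kernel[where N="paths m"]) measurable

lemma measurable_PE:
  assumes g[measurable]: "case_prod g \<in> borel_measurable (M \<Otimes>\<^sub>M state_space m)"
    and [measurable]: "s \<in> borel_measurable M" "\<tau> \<in> borel_measurable M" "x \<in> M \<rightarrow>\<^sub>M state_space m"
  shows "(\<lambda>w. PE K m (s w) (\<tau> w) (g w) (x w)) \<in> borel_measurable M"
  unfolding PE_def
  by (rule integral_measurable_kernel[where N="paths m"]) measurable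

lemma PE_bound:
  assumes "bounded_fun m g B" shows "\<bar>PE K m s \<tau> g x\<bar> \<le> B"
  unfolding PE_def by (rule prob_integral_abs_le[OF prod_law_prob(1)]) (auto intro: bounded_fun_le[OF assms])

lemma PK_bound:
  assumes g: "bounded_fun m g B" and a: "\<And>v x. x \<in> space (state_space m) \<Longrightarrow> 0 \<le> a v x"
  shows "\<bar>PK K m a s \<tau> g x\<bar> \<le> B"
  unfolding PK_def
proof (rule prob_integral_abs_le[OF prod_law_prob(1)])
  fix z
  have "0 \<le> tint s \<tau> (\<lambda>v. a v (pos m z v))" using a by (intro tint_nonneg) auto
  then have "\<bar>g (pos m z \<tau>)\<bar> * exp (- tint s \<tau> (\<lambda>v. a v (pos m z v))) \<le> B * 1"
    using bounded_fun_le[OF g] bounded_fun_bound_nonneg[OF g] by (intro mult_mono) auto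
  then show "\<bar>g (pos m z \<tau>) * exp (- tint s \<tau> (\<lambda>v. a v (pos m z v)))\<bar> \<le> B" by (simp add: abs_mult)
qed

lemma integrable_prod_law:
  fixes f :: "(nat \<Rightarrow> real \<Rightarrow> 'a) \<Rightarrow> real"
  assumes "f \<in> borel_measurable (paths m)" "\<And>z. z \<in> space (paths m) \<Longrightarrow> \<bar>f z\<bar> \<le> B"
  shows "integrable (prod_law K m s x) f"
  by (rule prob_integrable_bounded[OF prod_law_prob(1), where B=B])
     (use assms in \<open>auto simp: prod_law_prob cong: measurable_cong_sets\<close>)

lemma PE_integrable:
  assumes "bounded_fun m g B" shows "integrable (prod_law K m s x) (\<lambda>z. g (pos m z \<tau>))"
proof -
  have [measurable]: "g \<in> borel_measurable (state_space m)" using assms by (rule bounded_fun_measurable)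
  show ?thesis
  proof (rule integrable_prod_law[where B=B])
    show "(\<lambda>z. g (pos m z \<tau>)) \<in> borel_measurable (paths m)" by measurable
  qed (use bounded_fun_le[OF assms] in auto)
qed

lemma PE_diff:
  assumes "bounded_fun m g B" "bounded_fun m h B'"
  shows "PE K m s \<tau> (\<lambda>y. g y - h y) x = PE K m s \<tau> g x - PE K m s \<tau> h x"
  unfolding PE_def by (rule Bochner_Integration.integral_diff[OF PE_integrable[OF assms(1)] PE_integrable[OF assms(2)]])

lemma PE_sum:
  assumes "\<And>i. i \<in> I \<Longrightarrow> bounded_fun m (g i) B"
  shows "PE K m s \<tau> (\<lambda>y. \<Sum>i\<in>I. g i y) x = (\<Sum>i\<in>I. PE K m s \<tau> (g i) x)"
  unfolding PE_def by (rule Bochner_Integration.integral_sum) (rule PE_integrable[OF assms])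

lemma PE_cmult: "PE K m s \<tau> (\<lambda>y. c * g y) x = c * PE K m s \<tau> g x"
  unfolding PE_def by simp

lemma PE_cong:
  assumes "\<And>y. y \<in> space (state_space m) \<Longrightarrow> g y = h y" shows "PE K m s \<tau> g x = PE K m s \<tau> h x"
  unfolding PE_def by (intro Bochner_Integration.integral_cong) (auto simp: assms)

lemma PK_cong:
  assumes "\<And>y. y \<in> space (state_space m) \<Longrightarrow> g y = h y" shows "PK K m a s \<tau> g x = PK K m a s \<tau> h x"
  unfolding PK_def by (intro Bochner_Integration.integral_cong) (auto simp: assms)

lemma pos_cut:
  assumes "0 \<le> r" "r \<le> v" shows "pos m (\<lambda>i\<in>{..<m}. cut_path r (z i)) v = pos m z v"
  using assms by (auto simp: pos_def cut_path_def fun_eq_iff max_def)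

text \<open>\<open>exp_tint_duhamel\<close> is applied along each trajectory. The integrand at
  \<rho> involves the path from \<rho> on only, and the Markov property turns its mean into
  \<open>PK\<close> started at \<rho>, preceded by the motion without killing up to \<rho>.\<close>

lemma PK_duhamel:
  assumes a: "bounded_tfun m a A" and a0: "\<And>v x. x \<in> space (state_space m) \<Longrightarrow> 0 \<le> a v x"
    and f: "bounded_fun m f B" and s: "0 \<le> s" "s \<le> t"
  shows "PK K m a s t f x = PE K m s t f x - tint s t (\<lambda>\<rho>. PE K m s \<rho> (\<lambda>y. a \<rho> y * PK K m a \<rho> t f y) x)"
proof -
  note bounded_tfun_measurable[OF a, measurable] bounded_fun_measurable[OF f, measurable]
  have A0: "0 \<le> A" using a by (rule bounded_tfun_bound_nonneg)
  have B0: "0 \<le> B" using f by (rule bounded_fun_bound_nonneg)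
  have alt: "a v (pos m z v) \<le> A" for v z using bounded_tfun_le[OF a pos_in_space, of v z v] by linarith
  define h where "h z \<rho> = f (pos m z t) * (a \<rho> (pos m z \<rho>) * exp (- tint \<rho> t (\<lambda>v. a v (pos m z v))))" for z \<rho>
  have hm[measurable]: "case_prod h \<in> borel_measurable (paths m \<Otimes>\<^sub>M borel)"
    unfolding h_def by measurable
  have hm2[measurable]: "case_prod h \<in> borel_measurable (prod_law K m s x \<Otimes>\<^sub>M borel)"
    using hm by (subst measurable_cong_sets[OF sets_pair_measure_cong[OF prod_law_prob(2) refl] refl])
  have hb: "\<bar>h z \<rho>\<bar> \<le> B * A" for z \<rho>
  proof -
    have "0 \<le> tint \<rho> t (\<lambda>v. a v (pos m z v))" using a0 by (intro tint_nonneg) auto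
    then have "\<bar>a \<rho> (pos m z \<rho>)\<bar> * exp (- tint \<rho> t (\<lambda>v. a v (pos m z v))) \<le> A * 1"
      using bounded_tfun_le[OF a pos_in_space, of \<rho> z \<rho>] A0 by (intro mult_mono) auto
    then show ?thesis unfolding h_def abs_mult
      using bounded_fun_le[OF f pos_in_space, of z t] B0 by (intro mult_mono) auto
  qed
  have path: "f (pos m z t) * exp (- tint s t (\<lambda>v. a v (pos m z v))) = f (pos m z t) - tint s t (h z)"
    if z: "z \<in> space (paths m)" for z
  proof -
    have "(\<lambda>v. a v (pos m z v)) \<in> borel_measurable borel" using z by measurable
    from exp_tint_duhamel[OF this, of s t A] a0 alt s
    have *: "exp (- tint s t (\<lambda>v. a v (pos m z v))) =
        1 - tint s t (\<lambda>\<rho>. a \<rho> (pos m z \<rho>) * exp (- tint \<rho> t (\<lambda>v. a v (pos m z v))))" by auto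
    show ?thesis unfolding h_def tint_cmult by (subst *) (simp only: right_diff_distrib mult_1_right)
  qed
  have "PK K m a s t f x = (\<integral>z. f (pos m z t) - tint s t (h z) \<partial>prod_law K m s x)"
    unfolding PK_def by (rule Bochner_Integration.integral_cong) (auto simp: path prod_law_prob)
  also have "\<dots> = PE K m s t f x - (\<integral>z. tint s t (h z) \<partial>prod_law K m s x)"
    unfolding PE_def
  proof (rule Bochner_Integration.integral_diff[OF PE_integrable[OF f]])
    show "integrable (prod_law K m s x) (\<lambda>z. tint s t (h z))"
    proof (rule integrable_prod_law[where B="B * A * (t - s)"])
      show "\<bar>tint s t (h z)\<bar> \<le> B * A * (t - s)" if z: "z \<in> space (paths m)" for z
        by (rule tint_bound_const) (use s hb measurable_Pair2[OF hm z] in \<open>auto\<close>)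
    qed measurable
  qed
  also have "(\<integral>z. tint s t (h z) \<partial>prod_law K m s x) = tint s t (\<lambda>\<rho>. \<integral>z. h z \<rho> \<partial>prod_law K m s x)"
    by (rule integral_tint_swap[where B="B * A"])
       (use hm2 hb prod_law_prob(1)[THEN prob_space_imp_subprob_space] in
         \<open>auto simp: prob_space.finite_measure prod_law_prob\<close>)
  also have "\<dots> = tint s t (\<lambda>\<rho>. PE K m s \<rho> (\<lambda>y. a \<rho> y * PK K m a \<rho> t f y) x)"
  proof (rule tint_cong)
    fix \<rho> assume r: "s \<le> \<rho>" "\<rho> \<le> t"
    then have r0: "0 \<le> \<rho>" using s by simp
    have cut: "h (\<lambda>i\<in>{..<m}. cut_path \<rho> (z i)) \<rho> = h z \<rho>" for z
      unfolding h_def using r0 r by (simp add: pos_cut cong: tint_cong)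
    have "(\<integral>z. h z \<rho> \<partial>prod_law K m s x) = (\<integral>z. \<integral>z'. h z' \<rho> \<partial>prod_law K m \<rho> (pos m z \<rho>) \<partial>prod_law K m s x)"
      by (rule prod_law_markov[where B="B * A"]) (use s r hb cut in \<open>auto simp: measurable_Pair1[OF hm]\<close>)
    also have "\<dots> = PE K m s \<rho> (\<lambda>y. a \<rho> y * PK K m a \<rho> t f y) x"
      unfolding PE_def
    proof (rule Bochner_Integration.integral_cong[OF refl])
      fix z
      have "(\<integral>z'. h z' \<rho> \<partial>prod_law K m \<rho> (pos m z \<rho>)) =
         (\<integral>z'. a \<rho> (pos m z \<rho>) * (f (pos m z' t) * exp (- tint \<rho> t (\<lambda>v. a v (pos m z' v)))) \<partial>prod_law K m \<rho> (pos m z \<rho>))"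
      \<comment> \<open>The restarted particles are at \<open>pos m z \<rho>\<close> at time \<rho>
        almost surely, so the factor a is constant under the inner integral.\<close>
      proof (rule integral_cong_AE)
        show "(\<lambda>z'. h z' \<rho>) \<in> borel_measurable (prod_law K m \<rho> (pos m z \<rho>))"
          using measurable_Pair1[OF hm, of \<rho>] by (simp add: prod_law_prob cong: measurable_cong_sets)
        have "(\<lambda>z'. a \<rho> (pos m z \<rho>) * (f (pos m z' t) * exp (- tint \<rho> t (\<lambda>v. a v (pos m z' v))))) \<in> borel_measurable (paths m)"
          by measurable
        then show "(\<lambda>z'. a \<rho> (pos m z \<rho>) * (f (pos m z' t) * exp (- tint \<rho> t (\<lambda>v. a v (pos m z' v))))) \<in> borel_measurable (prod_law K m \<rho> (pos m z \<rho>))"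
          by (simp add: prod_law_prob cong: measurable_cong_sets)
        show "AE z' in prod_law K m \<rho> (pos m z \<rho>). h z' \<rho> = a \<rho> (pos m z \<rho>) * (f (pos m z' t) * exp (- tint \<rho> t (\<lambda>v. a v (pos m z' v))))"
          using AE_prod_law_start[OF r0 pos_in_space, of m z \<rho>]
          by eventually_elim (simp add: h_def)
      qed
      then show "(\<integral>z'. h z' \<rho> \<partial>prod_law K m \<rho> (pos m z \<rho>)) = a \<rho> (pos m z \<rho>) * PK K m a \<rho> t f (pos m z \<rho>)"
        unfolding PK_def by simp
    qed
    finally show "(\<integral>z. h z \<rho> \<partial>prod_law K m s x) = PE K m s \<rho> (\<lambda>y. a \<rho> y * PK K m a \<rho> t f y) x" .
  qed
  finally show ?thesis .
qed

text \<open>Trades the killing in the propagators for the source term - a u. Duhamel's formula is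
  inserted for both \<open>PK\<close> terms; once the time integrals are exchanged, the equation for
  u at the intermediate time gathers all corrections into a u.\<close>

lemma mild_equation:
  assumes a: "bounded_tfun m a A" and a0: "\<And>v x. x \<in> space (state_space m) \<Longrightarrow> 0 \<le> a v x"
    and f: "bounded_fun m f B" and g: "bounded_tfun m g G" and u: "bounded_tfun m u U"
    and eq: "\<And>s x. 0 \<le> s \<Longrightarrow> s \<le> t \<Longrightarrow> x \<in> space (state_space m) \<Longrightarrow>
       u s x = PK K m a s t f x + tint s t (\<lambda>\<tau>. PK K m a s \<tau> (g \<tau>) x)"
    and s: "0 \<le> s" "s \<le> t" and x: "x \<in> space (state_space m)"
  shows "u s x = PE K m s t f x + tint s t (\<lambda>\<rho>. PE K m s \<rho> (\<lambda>y. g \<rho> y - a \<rho> y * u \<rho> y) x)"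
proof -
  note ma = bounded_tfun_measurable[OF a] and mg = bounded_tfun_measurable[OF g] and mf = bounded_fun_measurable[OF f]
    and mu = bounded_tfun_measurable[OF u]
  note ma[measurable] mg[measurable] mf[measurable] mu[measurable]
  have A0: "0 \<le> A" using a by (rule bounded_tfun_bound_nonneg)
  have gf: "bounded_fun m (g \<tau>) G" for \<tau> using g by (rule bounded_tfun_imp_fun)
  have G0: "0 \<le> G" using g by (rule bounded_tfun_bound_nonneg)
  have PKm: "(\<lambda>(w, y). PK K m a (fst w) (snd w) (g (snd w)) y) \<in> borel_measurable ((borel \<Otimes>\<^sub>M borel) \<Otimes>\<^sub>M state_space m)"
    unfolding case_prod_beta' by (rule measurable_PK[OF ma]) measurable
  have PKf: "bounded_tfun m (\<lambda>\<rho> y. PK K m a \<rho> t f y) B"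
    unfolding bounded_tfun_def case_prod_beta'
    by (auto intro!: measurable_PK[OF ma] PK_bound[OF f a0])
  have PKgm: "(\<lambda>(w, y). a (fst w) y * PK K m a (fst w) (snd w) (g (snd w)) y) \<in> borel_measurable ((borel \<Otimes>\<^sub>M borel) \<Otimes>\<^sub>M state_space m)"
    unfolding case_prod_beta' by (intro borel_measurable_times measurable_PK[OF ma]) measurable
  define h where "h \<rho> \<tau> = PE K m s \<rho> (\<lambda>y. a \<rho> y * PK K m a \<rho> \<tau> (g \<tau>) y) x" for \<rho> \<tau>
  have bfun: "bounded_fun m (\<lambda>y. a \<rho> y * PK K m a \<rho> \<tau> (g \<tau>) y) (A * G)" for \<rho> \<tau>
  proof -
    have "(\<lambda>y. a \<rho> y * PK K m a \<rho> \<tau> (g \<tau>) y) \<in> borel_measurable (state_space m)"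
      using measurable_Pair2[OF PKgm, of "(\<rho>, \<tau>)"] by (simp add: space_pair_measure)
    then show ?thesis
      unfolding bounded_fun_def abs_mult
      using bounded_tfun_le[OF a] PK_bound[OF gf a0] A0 by (auto intro!: mult_mono)
  qed
  have hb: "\<bar>h \<rho> \<tau>\<bar> \<le> A * G" for \<rho> \<tau> unfolding h_def by (rule PE_bound[OF bfun])
  have hm: "case_prod h \<in> borel_measurable (borel \<Otimes>\<^sub>M borel)"
    unfolding h_def case_prod_beta'
    by (rule measurable_PE) (use PKgm x in \<open>auto\<close>)
  have e1: "PK K m a s t f x = PE K m s t f x - tint s t (\<lambda>\<rho>. PE K m s \<rho> (\<lambda>y. a \<rho> y * PK K m a \<rho> t f y) x)"
    by (rule PK_duhamel[OF a a0 f s])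
  have m1: "(\<lambda>\<tau>. PE K m s \<tau> (g \<tau>) x) \<in> borel_measurable borel"
    by (rule measurable_PE) (use x in auto)
  have m2: "(\<lambda>\<tau>. tint s \<tau> (\<lambda>\<rho>. h \<rho> \<tau>)) \<in> borel_measurable borel"
    using hm by measurable
  have b2: "\<bar>tint s \<tau> (\<lambda>\<rho>. h \<rho> \<tau>)\<bar> \<le> A * G * (t - s)" if "s \<le> \<tau>" "\<tau> \<le> t" for \<tau>
  proof -
    have "\<bar>tint s \<tau> (\<lambda>\<rho>. h \<rho> \<tau>)\<bar> \<le> A * G * (\<tau> - s)"
      by (rule tint_bound_const) (use hb that measurable_Pair1[OF hm] in auto)
    also have "\<dots> \<le> A * G * (t - s)" using that A0 G0 by (intro mult_left_mono) auto
    finally show ?thesis .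
  qed
  have "tint s t (\<lambda>\<tau>. PK K m a s \<tau> (g \<tau>) x) = tint s t (\<lambda>\<tau>. PE K m s \<tau> (g \<tau>) x - tint s \<tau> (\<lambda>\<rho>. h \<rho> \<tau>))"
    by (rule tint_cong) (use PK_duhamel[OF a a0 gf] s in \<open>auto simp: h_def\<close>)
  also have "\<dots> = tint s t (\<lambda>\<tau>. PE K m s \<tau> (g \<tau>) x) - tint s t (\<lambda>\<tau>. tint s \<tau> (\<lambda>\<rho>. h \<rho> \<tau>))"
    by (rule tint_diff[OF m1 _ m2 b2]) (auto intro: PE_bound[OF gf])
  also have "tint s t (\<lambda>\<tau>. tint s \<tau> (\<lambda>\<rho>. h \<rho> \<tau>)) = tint s t (\<lambda>\<rho>. tint \<rho> t (h \<rho>))"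
    by (rule tint_triangle[OF hm hb s(2)])
  finally have e2: "tint s t (\<lambda>\<tau>. PK K m a s \<tau> (g \<tau>) x) = tint s t (\<lambda>\<tau>. PE K m s \<tau> (g \<tau>) x) - tint s t (\<lambda>\<rho>. tint \<rho> t (h \<rho>))" .
  have f1: "bounded_tfun m (\<lambda>\<rho> y. a \<rho> y * PK K m a \<rho> t f y) (A * B)" by (rule bounded_tfun_mult[OF a PKf])
  have f2: "bounded_tfun m (\<lambda>\<rho> y. a \<rho> y * u \<rho> y) (A * U)" by (rule bounded_tfun_mult[OF a u])
  \<comment> \<open>By \<open>eq\<close> at time \<rho>, the sources after \<rho>, propagated with
    killing, amount to u minus the propagated final value f.\<close>
  have key: "tint \<rho> t (h \<rho>) = PE K m s \<rho> (\<lambda>y. a \<rho> y * u \<rho> y) x - PE K m s \<rho> (\<lambda>y. a \<rho> y * PK K m a \<rho> t f y) x"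
    if r: "s \<le> \<rho>" "\<rho> \<le> t" for \<rho>
  proof -
    have r0: "0 \<le> \<rho>" using r s by simp
    have m3: "(\<lambda>(z, \<tau>). a \<rho> (pos m z \<rho>) * PK K m a \<rho> \<tau> (g \<tau>) (pos m z \<rho>)) \<in> borel_measurable (prod_law K m s x \<Otimes>\<^sub>M borel)"
      (is "?f \<in> _")
    proof -
      have "?f \<in> borel_measurable (paths m \<Otimes>\<^sub>M borel)"
        unfolding case_prod_beta' by (intro borel_measurable_times measurable_PK[OF ma]) measurable
      then show ?thesis by (subst measurable_cong_sets[OF sets_pair_measure_cong[OF prod_law_prob(2) refl] refl])
    qed
    have "tint \<rho> t (h \<rho>) = (\<integral>z. tint \<rho> t (\<lambda>\<tau>. a \<rho> (pos m z \<rho>) * PK K m a \<rho> \<tau> (g \<tau>) (pos m z \<rho>)) \<partial>prod_law K m s x)"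
      unfolding h_def PE_def
      by (rule integral_tint_swap[symmetric, where B="A * G"])
         (use m3 bounded_fun_le[OF bfun] in \<open>auto intro: prob_space.finite_measure[OF prod_law_prob(1)]\<close>)
    also have "\<dots> = PE K m s \<rho> (\<lambda>y. a \<rho> y * u \<rho> y - a \<rho> y * PK K m a \<rho> t f y) x"
      unfolding PE_def tint_cmult
      by (rule Bochner_Integration.integral_cong) (use eq[OF r0 r(2) pos_in_space] in \<open>auto simp: algebra_simps\<close>)
    also have "\<dots> = PE K m s \<rho> (\<lambda>y. a \<rho> y * u \<rho> y) x - PE K m s \<rho> (\<lambda>y. a \<rho> y * PK K m a \<rho> t f y) x"
      by (rule PE_diff[OF bounded_tfun_imp_fun[OF f2] bounded_tfun_imp_fun[OF f1]])
    finally show ?thesis .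
  qed
  have mPE: "(\<lambda>\<rho>. PE K m s \<rho> (w \<rho>) x) \<in> borel_measurable borel" if "bounded_tfun m w C" for w C
    by (rule measurable_PE) (use x bounded_tfun_measurable[OF that] in auto)
  have bPE: "\<bar>PE K m s \<rho> (w \<rho>) x\<bar> \<le> C" if "bounded_tfun m w C" for w C \<rho>
    by (rule PE_bound[OF bounded_tfun_imp_fun[OF that]])
  have "tint s t (\<lambda>\<rho>. tint \<rho> t (h \<rho>)) = tint s t (\<lambda>\<rho>. PE K m s \<rho> (\<lambda>y. a \<rho> y * u \<rho> y) x - PE K m s \<rho> (\<lambda>y. a \<rho> y * PK K m a \<rho> t f y) x)"
    by (rule tint_cong) (rule key)
  also have "\<dots> = tint s t (\<lambda>\<rho>. PE K m s \<rho> (\<lambda>y. a \<rho> y * u \<rho> y) x) - tint s t (\<lambda>\<rho>. PE K m s \<rho> (\<lambda>y. a \<rho> y * PK K m a \<rho> t f y) x)"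
    by (rule tint_diff[OF mPE[OF f2] bPE[OF f2] mPE[OF f1] bPE[OF f1]])
  finally have e3: "tint s t (\<lambda>\<rho>. tint \<rho> t (h \<rho>)) = \<dots>" .
  have "tint s t (\<lambda>\<rho>. PE K m s \<rho> (\<lambda>y. g \<rho> y - a \<rho> y * u \<rho> y) x) =
     tint s t (\<lambda>\<rho>. PE K m s \<rho> (g \<rho>) x - PE K m s \<rho> (\<lambda>y. a \<rho> y * u \<rho> y) x)"
    by (rule tint_cong) (rule PE_diff[OF gf bounded_tfun_imp_fun[OF f2]])
  also have "\<dots> = tint s t (\<lambda>\<rho>. PE K m s \<rho> (g \<rho>) x) - tint s t (\<lambda>\<rho>. PE K m s \<rho> (\<lambda>y. a \<rho> y * u \<rho> y) x)"
    by (rule tint_diff[OF mPE[OF g] bPE[OF g] mPE[OF f2] bPE[OF f2]])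
  finally show ?thesis
    unfolding eq[OF s x] e1 e2 e3 by simp
qed

text \<open>Picard iteration: the difference of two solutions solves the equation without the term
  f, and n iterations bound it by \<open>(U + U') * (c * (t - s)) ^ n / fact n\<close>, which tends
  to 0. \<open>Gloc\<close> is stated at a single time so that the induction hypothesis, a bound
  that varies with \<rho>, can be inserted under the integral.\<close>

lemma mild_equation_unique:
  assumes u: "bounded_tfun m u U" and v: "bounded_tfun m v U'"
    and G: "\<And>w B. bounded_tfun m w B \<Longrightarrow> bounded_tfun m (G w) (c * B)"
    and Gloc: "\<And>w s x B. x \<in> space (state_space m) \<Longrightarrow> (\<And>y. y \<in> space (state_space m) \<Longrightarrow> \<bar>w s y\<bar> \<le> B) \<Longrightarrow> \<bar>G w s x\<bar> \<le> c * B"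
    and Gdiff: "\<And>s x. x \<in> space (state_space m) \<Longrightarrow> G u s x - G v s x = G (\<lambda>s x. u s x - v s x) s x"
    and c: "0 \<le> c"
    and equ: "\<And>s x. 0 \<le> s \<Longrightarrow> s \<le> t \<Longrightarrow> x \<in> space (state_space m) \<Longrightarrow>
       u s x = f s x + tint s t (\<lambda>\<rho>. PE K m s \<rho> (G u \<rho>) x)"
    and eqv: "\<And>s x. 0 \<le> s \<Longrightarrow> s \<le> t \<Longrightarrow> x \<in> space (state_space m) \<Longrightarrow>
       v s x = f s x + tint s t (\<lambda>\<rho>. PE K m s \<rho> (G v \<rho>) x)"
    and s: "0 \<le> s" "s \<le> t" and x: "x \<in> space (state_space m)"
  shows "u s x = v s x"
proof -
  define d where "d s x = u s x - v s x" for s x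
  have d: "bounded_tfun m d (U + U')" unfolding d_def by (rule bounded_tfun_diff[OF u v])
  have D0: "0 \<le> U + U'" using d by (rule bounded_tfun_bound_nonneg)
  have Gd: "bounded_tfun m (G d) (c * (U + U'))" by (rule G[OF d])
  have mPE: "(\<lambda>\<rho>. PE K m s \<rho> (w \<rho>) x) \<in> borel_measurable borel"
    if "bounded_tfun m w C" "x \<in> space (state_space m)" for w C s x
    by (rule measurable_PE) (use bounded_tfun_measurable[OF that(1)] that(2) in auto)
  have bPE: "\<bar>PE K m s \<rho> (w \<rho>) x\<bar> \<le> C" if "bounded_tfun m w C" for w C \<rho> s x
    by (rule PE_bound[OF bounded_tfun_imp_fun[OF that]])
  have eqd: "d s x = tint s t (\<lambda>\<rho>. PE K m s \<rho> (G d \<rho>) x)" if "0 \<le> s" "s \<le> t" "x \<in> space (state_space m)" for s x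
  proof -
    have "d s x = tint s t (\<lambda>\<rho>. PE K m s \<rho> (G u \<rho>) x) - tint s t (\<lambda>\<rho>. PE K m s \<rho> (G v \<rho>) x)"
      unfolding d_def equ[OF that] eqv[OF that] by simp
    also have "\<dots> = tint s t (\<lambda>\<rho>. PE K m s \<rho> (G u \<rho>) x - PE K m s \<rho> (G v \<rho>) x)"
      by (rule tint_diff[OF mPE[OF G[OF u] that(3)] bPE[OF G[OF u]] mPE[OF G[OF v] that(3)] bPE[OF G[OF v]], symmetric])
    also have "\<dots> = tint s t (\<lambda>\<rho>. PE K m s \<rho> (G d \<rho>) x)"
      unfolding PE_diff[OF bounded_tfun_imp_fun[OF G[OF u]] bounded_tfun_imp_fun[OF G[OF v]], symmetric]
      by (intro tint_cong PE_cong) (simp add: Gdiff d_def[abs_def])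
    finally show ?thesis .
  qed
  have bound: "\<bar>d s x\<bar> \<le> (U + U') * (c ^ n * (t - s) ^ n / fact n)" if "0 \<le> s" "s \<le> t" "x \<in> space (state_space m)" for n s x
    using that
  proof (induction n arbitrary: s x)
    case 0
    then show ?case using bounded_tfun_le[OF d] by simp
  next
    case (Suc n)
    have pw: "\<bar>PE K m s \<rho> (G d \<rho>) x\<bar> \<le> c * ((U + U') * (c ^ n * (t - \<rho>) ^ n / fact n))" if "s \<le> \<rho>" "\<rho> \<le> t" for \<rho>
    proof (rule PE_bound)
      show "bounded_fun m (G d \<rho>) (c * ((U + U') * (c ^ n * (t - \<rho>) ^ n / fact n)))"
        unfolding bounded_fun_def
      proof (intro conjI ballI Gloc)
        show "\<bar>d \<rho> y\<bar> \<le> (U + U') * (c ^ n * (t - \<rho>) ^ n / fact n)" if "y \<in> space (state_space m)" for y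
          using Suc.IH[of \<rho> y] \<open>s \<le> \<rho>\<close> \<open>\<rho> \<le> t\<close> Suc.prems(1) that by simp
      qed (use bounded_fun_measurable[OF bounded_tfun_imp_fun[OF Gd]] in auto)
    qed
    have "\<bar>d s x\<bar> \<le> tint s t (\<lambda>\<rho>. c * ((U + U') * (c ^ n * (t - \<rho>) ^ n / fact n)))"
      unfolding eqd[OF Suc.prems]
    proof (rule tint_bound[OF mPE[OF Gd Suc.prems(3)] pw])
      show "c * ((U + U') * (c ^ n * (t - \<rho>) ^ n / fact n)) \<le> c * ((U + U') * (c ^ n * (t - s) ^ n / fact n))"
        if "s \<le> \<rho>" "\<rho> \<le> t" for \<rho>
        using that c D0 by (intro mult_left_mono divide_right_mono power_mono mult_nonneg_nonneg) auto
    qed auto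
    also have "\<dots> = tint s t (\<lambda>\<rho>. (c * (U + U') * c ^ n / fact n) * (t - \<rho>) ^ n)"
      by (rule tint_cong) simp
    also have "\<dots> = (c * (U + U') * c ^ n / fact n) * ((t - s) ^ Suc n / Suc n)"
      unfolding tint_cmult using Suc.prems by (subst tint_power) auto
    also have "\<dots> = (U + U') * (c ^ Suc n * (t - s) ^ Suc n / fact (Suc n))"
      by (simp add: field_simps)
    finally show ?case .
  qed
  have "(\<lambda>n. (U + U') * ((c * (t - s)) ^ n / fact n)) \<longlonglongrightarrow> (U + U') * 0"
    using summable_LIMSEQ_zero[OF summable_exp[of "c * (t - s)"]]
    by (intro tendsto_intros) (simp add: divide_inverse mult.commute)
  moreover have "\<bar>d s x\<bar> \<le> (U + U') * ((c * (t - s)) ^ n / fact n)" for n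
    using bound[OF s x, of n] by (simp add: power_mult_distrib)
  ultimately have "\<bar>d s x\<bar> \<le> 0"
    by (intro LIMSEQ_le_const[where X="\<lambda>n. (U + U') * ((c * (t - s)) ^ n / fact n)"]) auto
  then show ?thesis by (simp add: d_def)
qed

lemma PE_reindex:
  assumes f: "inj_on f {..<q}" "f \<in> {..<q} \<rightarrow> {..<m}" and g: "g \<in> borel_measurable (state_space q)"
  shows "PE K m s \<tau> (\<lambda>y. g (\<lambda>j\<in>{..<q}. y (f j))) x = PE K q s \<tau> g (\<lambda>j\<in>{..<q}. x (f j))"
proof -
  have p: "pos q (\<lambda>j\<in>{..<q}. z (f j)) \<tau> = (\<lambda>j\<in>{..<q}. pos m z \<tau> (f j))" for z
    using f by (auto simp: pos_def fun_eq_iff)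
  have "(\<lambda>z. g (pos q z \<tau>)) \<in> borel_measurable (paths q)" using g by measurable
  from prod_law_reindex[OF f this] show ?thesis unfolding PE_def p .
qed

end

section \<open>Particle systems driven by clocks\<close>

text \<open>The pasting of trajectories in \<open>evolve\<close>. At time a the new trajectory
  already counts, so a jump at a leaves the path right-continuous.\<close>

definition splice :: "nat \<Rightarrow> real \<Rightarrow> (nat \<Rightarrow> real \<Rightarrow> 'a) \<Rightarrow> (nat \<Rightarrow> real \<Rightarrow> 'a) \<Rightarrow> nat \<Rightarrow> real \<Rightarrow> 'a" where
  "splice m a z z' = (\<lambda>i\<in>{..<m}. \<lambda>u. if u < a then z i u else z' i u)"

lemma splice_path:
  fixes \<omega> \<omega>' :: "real \<Rightarrow> 'a::metric_space"
  assumes a: "0 \<le> a" and w: "\<omega> \<in> space path_space" "\<omega>' \<in> space path_space"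
  shows "(\<lambda>u. if u < a then \<omega> u else \<omega>' u) \<in> space path_space"
  unfolding in_space_path_space
proof (intro conjI allI impI)
  show "(\<lambda>u. if u < a then \<omega> u else \<omega>' u) \<in> extensional {0..}"
    using a w by (auto simp: in_space_path_space extensional_def)
  fix v :: real assume v: "0 \<le> v"
  have lim: "(\<omega> \<longlongrightarrow> \<omega> v) (at_right v)" "(\<omega>' \<longlongrightarrow> \<omega>' v) (at_right v)"
    using w v by (auto simp: in_space_path_space)
  show "((\<lambda>u. if u < a then \<omega> u else \<omega>' u) \<longlongrightarrow> (if v < a then \<omega> v else \<omega>' v)) (at_right v)"
  proof (cases "v < a")
    case True
    have "\<forall>\<^sub>F u in at_right v. u < a" using True by (auto simp: eventually_at_right_field)
    then have "\<forall>\<^sub>F u in at_right v. \<omega> u = (if u < a then \<omega> u else \<omega>' u)" by eventually_elim auto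
    with lim(1) True show ?thesis by (auto simp: tendsto_cong)
  next
    case False
    have "\<forall>\<^sub>F u in at_right v. \<omega>' u = (if u < a then \<omega> u else \<omega>' u)"
      using eventually_at_right_less[of v] by eventually_elim (use False in auto)
    with lim(2) False show ?thesis by (auto simp: tendsto_cong)
  qed
qed

lemma measurable_splice [measurable (raw)]:
  assumes a[measurable]: "a \<in> borel_measurable M" and g: "g \<in> M \<rightarrow>\<^sub>M paths m" and h: "h \<in> M \<rightarrow>\<^sub>M paths m"
  shows "(\<lambda>x. splice m (max 0 (a x)) (g x) (h x)) \<in> M \<rightarrow>\<^sub>M paths m"
  unfolding splice_def
proof (rule measurable_pathsI)
  fix i assume i: "i < m"
  show "(\<lambda>x u. if u < max 0 (a x) then g x i u else h x i u) \<in> M \<rightarrow>\<^sub>M path_space"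
  proof (rule measurable_path_spaceI)
    fix x assume x: "x \<in> space M"
    show "(\<lambda>u. if u < max 0 (a x) then g x i u else h x i u) \<in> space path_space"
      using measurable_space[OF g x] measurable_space[OF h x] i by (intro splice_path) (auto simp: space_paths)
  next
    fix u :: real assume u: "0 \<le> u"
    have [measurable]: "(\<lambda>x. g x i u) \<in> borel_measurable M"
      using measurable_compose[OF measurable_paths_component[OF g i] path_space_coord[OF u]] .
    have [measurable]: "(\<lambda>x. h x i u) \<in> borel_measurable M"
      using measurable_compose[OF measurable_paths_component[OF h i] path_space_coord[OF u]] .
    show "(\<lambda>x. if u < max 0 (a x) then g x i u else h x i u) \<in> borel_measurable M" by measurable
  qed
qed

lemma pos_splice:
  shows "0 \<le> a \<Longrightarrow> a \<le> v \<Longrightarrow> pos m (splice m a z z') v = pos m z' v"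
    and "0 \<le> v \<Longrightarrow> v < a \<Longrightarrow> pos m (splice m a z z') v = pos m z v"
  by (auto simp: pos_def splice_def fun_eq_iff)

text \<open>One locale for both systems. The N-particle system has m = N, C = {..<N}, r = Vinf and J
  = \<open>jump_N V Vinf N\<close>; the auxiliary one has m = q, C = \<open>aux_clocks q\<close>, r
  = Vinf / N and J = \<open>jump_aux V Vinf q\<close>.\<close>

locale particle_system = markov_kernel K
  for K :: "real \<Rightarrow> 'a::metric_space \<Rightarrow> (real \<Rightarrow> 'a) measure" +
  fixes m :: nat and C :: "'c set" and r :: real and J :: "real \<Rightarrow> 'c \<Rightarrow> (nat \<Rightarrow> 'a) \<Rightarrow> (nat \<Rightarrow> 'a) measure" and t :: real
  assumes finite_C: "finite C" and r_pos: "0 < r" and t_pos: "0 < t"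
    and J_kernel: "\<And>c. c \<in> C \<Longrightarrow> (\<lambda>(\<tau>, x). J (max 0 \<tau>) c x) \<in> borel \<Otimes>\<^sub>M state_space m \<rightarrow>\<^sub>M prob_algebra (state_space m)"
begin

abbreviation "S \<equiv> state_space m :: (nat \<Rightarrow> 'a) measure"
abbreviation "Cl \<equiv> clocks C r"

definition lam :: real where "lam = real (card C) * r"

lemma measurable_J:
  assumes "c \<in> C" "\<tau> \<in> borel_measurable M" "x \<in> M \<rightarrow>\<^sub>M S"
  shows "(\<lambda>w. J (max 0 (\<tau> w)) c (x w)) \<in> M \<rightarrow>\<^sub>M prob_algebra S"
  using measurable_compose[OF measurable_Pair[OF assms(2,3)] J_kernel[OF assms(1)]] by simp

lemma J_prob:
  assumes "c \<in> C" "0 \<le> \<tau>" "x \<in> space S" shows "prob_space (J \<tau> c x)" "sets (J \<tau> c x) = sets S"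
proof -
  have "J (max 0 \<tau>) c x \<in> space (prob_algebra S)"
    by (rule measurable_space[where M="borel :: real measure"], rule measurable_J) (use assms in auto)
  then show "prob_space (J \<tau> c x)" "sets (J \<tau> c x) = sets S"
    using assms(2) by (auto simp: space_prob_algebra)
qed

lemma evolve_Nil: "evolve K m J [] (max 0 s) x = prod_law K m s x"
  by (simp add: prod_law_def)

lemma evolve_Cons:
  "evolve K m J ((max 0 \<tau>, c) # as) (max 0 s) x = prod_law K m s x \<bind> (\<lambda>z.
     J (max 0 \<tau>) c (pos m z \<tau>) \<bind> (\<lambda>y.
       distr (evolve K m J as (max 0 \<tau>) y) (paths m) (splice m (max 0 \<tau>) z)))"
  by (simp add: prod_law_def pos_def splice_def[abs_def])

text \<open>For a fixed list of labels the ring times enter as coordinates of a product space. Joint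
  measurability in times, start and position then follows by induction on the list, the time of the
  head being the start of the tail.\<close>

lemma measurable_evolve_index:
  assumes "(is :: ('c \<times> nat) list) \<in> lists (C \<times> UNIV)"
  shows "(\<lambda>p. evolve K m J (map (\<lambda>i. (max 0 (fst p i), fst i)) is) (max 0 (fst (snd p))) (snd (snd p)))
    \<in> (PiM (C \<times> UNIV) (\<lambda>_. borel)) \<Otimes>\<^sub>M (borel \<Otimes>\<^sub>M S) \<rightarrow>\<^sub>M prob_algebra (paths m)"
  using assms
proof (induction "is")
  case Nil
  show ?case unfolding list.map evolve_Nil by measurable
next
  case (Cons i "is")
  let ?P = "PiM (C \<times> UNIV :: ('c \<times> nat) set) (\<lambda>_. borel :: real measure)"
  let ?M = "?P \<Otimes>\<^sub>M (borel \<Otimes>\<^sub>M S)"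
  have i: "i \<in> C \<times> UNIV" and c: "fst i \<in> C" using Cons.hyps by auto
  have ti[measurable]: "(\<lambda>\<tau>. \<tau> i) \<in> borel_measurable ?P"
    by (rule measurable_component_singleton[OF i])
  show ?case
    unfolding list.map evolve_Cons
  proof (rule measurable_bind_prob_space2[where N="paths m"])
    show "(\<lambda>p. prod_law K m (fst (snd p)) (snd (snd p))) \<in> ?M \<rightarrow>\<^sub>M prob_algebra (paths m)" by measurable
    have J: "(\<lambda>w. J (max 0 (fst (fst w) i)) (fst i) (pos m (snd w) (fst (fst w) i))) \<in> ?M \<Otimes>\<^sub>M paths m \<rightarrow>\<^sub>M prob_algebra S"
      by (rule measurable_J[OF c]) measurable
    have e: "(\<lambda>w. (fst (fst (fst w)), fst (fst (fst w)) i, snd w)) \<in> (?M \<Otimes>\<^sub>M paths m) \<Otimes>\<^sub>M S \<rightarrow>\<^sub>M ?M" by measurable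
    have E: "(\<lambda>w. evolve K m J (map (\<lambda>j. (max 0 (fst (fst (fst w)) j), fst j)) is) (max 0 (fst (fst (fst w)) i)) (snd w))
       \<in> (?M \<Otimes>\<^sub>M paths m) \<Otimes>\<^sub>M S \<rightarrow>\<^sub>M prob_algebra (paths m)"
      using measurable_compose[OF e Cons.IH] by simp
    have D: "(\<lambda>w. distr (evolve K m J (map (\<lambda>j. (max 0 (fst (fst (fst w)) j), fst j)) is) (max 0 (fst (fst (fst w)) i)) (snd w))
       (paths m) (splice m (max 0 (fst (fst (fst w)) i)) (snd (fst w)))) \<in> (?M \<Otimes>\<^sub>M paths m) \<Otimes>\<^sub>M S \<rightarrow>\<^sub>M prob_algebra (paths m)"
      by (rule measurable_distr_prob_space2[OF E]) measurable
    show "(\<lambda>(x, y). J (max 0 (fst x i)) (fst i) (pos m y (fst x i)) \<bind>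
           (\<lambda>ya. distr (evolve K m J (map (\<lambda>i. (max 0 (fst x i), fst i)) is) (max 0 (fst x i)) ya) (paths m)
              (splice m (max 0 (fst x i)) y))) \<in> ?M \<Otimes>\<^sub>M paths m \<rightarrow>\<^sub>M prob_algebra (paths m)"
      unfolding case_prod_beta'
      by (rule measurable_bind_prob_space2[OF J]) (use D in \<open>simp add: case_prod_beta'\<close>)
  qed
qed

lemma measurable_evolve_list:
  assumes l: "set l \<subseteq> {0..} \<times> C" and s: "0 \<le> s"
  shows "evolve K m J l s \<in> S \<rightarrow>\<^sub>M prob_algebra (paths m)"
proof -
  \<comment> \<open>Each entry of l gets its position as second index, so repeated rings of one
    clock occupy different coordinates.\<close>
  define "is" where "is = map (\<lambda>n. (snd (l ! n), n)) [0..<length l]"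
  define \<tau> where "\<tau> = (\<lambda>i\<in>C \<times> UNIV. if snd i < length l then fst (l ! snd i) else 0)"
  have nth: "l ! n \<in> {0..} \<times> C" if "n < length l" for n using l that by (meson nth_mem subsetD)
  have "is": "is \<in> lists (C \<times> UNIV)" using nth by (fastforce simp: is_def)
  have t: "\<tau> \<in> space (PiM (C \<times> UNIV) (\<lambda>_. borel))" by (auto simp: \<tau>_def space_PiM)
  have "map (\<lambda>i. (max 0 (\<tau> i), fst i)) is = map (\<lambda>n. l ! n) [0..<length l]"
    unfolding is_def map_map
  proof (rule map_cong[OF refl])
    fix n assume "n \<in> set [0..<length l]"
    then have n: "n < length l" by simp
    obtain u c where u: "l ! n = (u, c)" by (cases "l ! n")
    have "0 \<le> u" "c \<in> C" using nth[OF n] u by auto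
    then show "((\<lambda>i. (max 0 (\<tau> i), fst i)) \<circ> (\<lambda>n. (snd (l ! n), n))) n = l ! n"
      using n u by (simp add: \<tau>_def)
  qed
  then have l_eq: "map (\<lambda>i. (max 0 (\<tau> i), fst i)) is = l" by (simp add: map_nth)
  have "(\<lambda>x. (\<tau>, s, x)) \<in> S \<rightarrow>\<^sub>M PiM (C \<times> UNIV) (\<lambda>_. borel) \<Otimes>\<^sub>M (borel \<Otimes>\<^sub>M S)"
    using t by measurable
  from measurable_compose[OF this measurable_evolve_index[OF "is"]]
  show ?thesis using s by (simp add: l_eq)
qed

text \<open>Here \<sigma> are clocks started at time s: the horizon is t - s, and the ring times are
  moved to absolute time.\<close>

definition chron :: "real \<Rightarrow> ('c \<times> nat \<Rightarrow> real) \<Rightarrow> (real \<times> 'c) list" where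
  "chron s \<sigma> = map (\<lambda>(\<tau>, c). (s + \<tau>, c)) (chronology (rings C (t - s) \<sigma>))"

text \<open>The list of rings is random, but only countably many index lists can produce it. The
  space is covered by the measurable pieces on which a given index list orders the rings, and by the
  piece \<open>A 0\<close> without chronology, where the list is empty by default. On each piece the
  labels are fixed.\<close>

lemma measurable_evolve_chron:
  "(\<lambda>p. evolve K m J (chron (max 0 (fst p)) (fst (snd p))) (max 0 (fst p)) (snd (snd p)))
    \<in> borel \<Otimes>\<^sub>M (Cl \<Otimes>\<^sub>M S) \<rightarrow>\<^sub>M prob_algebra (paths m)"
proof -
  let ?M = "borel \<Otimes>\<^sub>M (Cl \<Otimes>\<^sub>M S) :: (real \<times> ('c \<times> nat \<Rightarrow> real) \<times> (nat \<Rightarrow> 'a)) measure"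
  let ?X = "lists (C \<times> UNIV) :: ('c \<times> nat) list set"
  have cX: "countable ?X" using countable_finite[OF finite_C] by (intro countable_lists countable_SIGMA) auto
  have neX: "?X \<noteq> {}" by (auto intro!: exI[of _ "[]"])
  let ?ol = "\<lambda>is p. ordered_list (rings C (t - max 0 (fst p)) (fst (snd p))) (ring_list is (fst (snd p)))"
  define A where "A n = (case n of 0 \<Rightarrow> {p \<in> space ?M. \<not> (\<exists>is\<in>?X. ?ol is p)}
    | Suc k \<Rightarrow> {p \<in> space ?M. ?ol (from_nat_into ?X k) p})" for n
  have pr: "Measurable.pred ?M (?ol is)" if "is \<in> ?X" for "is"
    by (rule pred_ordered_ring_list[where r=r]) (use that finite_C in auto)
  have pr2: "Measurable.pred ?M (\<lambda>p. \<exists>is\<in>?X. ?ol is p)"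
    using cX pr by (rule pred_Bex_countable)
  show ?thesis
  proof (rule measurable_piecewise_restrict2[where A=A])
    show "A n \<in> sets ?M" for n
    proof (cases n)
      case 0
      have "{p \<in> space ?M. \<not> (\<exists>is\<in>?X. ?ol is p)} \<in> sets ?M"
        using pr2 unfolding pred_def by (rule sets.sets_Collect_neg)
      then show ?thesis unfolding A_def 0 by (simp only: nat.case)
    next
      case (Suc k)
      then show ?thesis using pr[OF from_nat_into[OF neX, of k]] by (simp add: A_def pred_def)
    qed
    show "space ?M = (\<Union>n. A n)"
    proof (intro set_eqI iffI)
      fix p assume p: "p \<in> space ?M"
      show "p \<in> (\<Union>n. A n)"
      proof (cases "\<exists>is\<in>?X. ?ol is p")
        case True
        then obtain "is" where "is \<in> ?X" "?ol is p" by auto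
        moreover obtain k where "from_nat_into ?X k = is" using from_nat_into_surj[OF cX \<open>is \<in> ?X\<close>] by auto
        ultimately have "p \<in> A (Suc k)" using p by (simp add: A_def)
        then show ?thesis by auto
      next
        case False
        then have "p \<in> A 0" using p by (simp add: A_def)
        then show ?thesis by auto
      qed
    next
      fix p assume "p \<in> (\<Union>n. A n)"
      then obtain n where "p \<in> A n" by auto
      then show "p \<in> space ?M" by (cases n) (auto simp: A_def)
    qed
    fix n
    show "\<exists>h\<in>?M \<rightarrow>\<^sub>M prob_algebra (paths m). \<forall>p\<in>A n.
       evolve K m J (chron (max 0 (fst p)) (fst (snd p))) (max 0 (fst p)) (snd (snd p)) = h p"
    proof (cases n)
      case 0
      have "chron (max 0 (fst p)) (fst (snd p)) = []" if p: "p \<in> A 0" for p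
      proof -
        have "\<not> (\<exists>l. ordered_list (rings C (t - max 0 (fst p)) (fst (snd p))) l)"
        proof
          assume "\<exists>l. ordered_list (rings C (t - max 0 (fst p)) (fst (snd p))) l"
          then obtain l where l: "ordered_list (rings C (t - max 0 (fst p)) (fst (snd p))) l" ..
          then obtain "is" where "is \<in> ?X" "l = ring_list is (fst (snd p))"
            using rings_in_ring_list[of l C "t - max 0 (fst p)" "fst (snd p)"] by (auto simp: ordered_list_def)
          then show False using l p by (auto simp: A_def)
        qed
        then show ?thesis by (auto simp: chron_def chronology_def ordered_list_def)
      qed
      moreover have "(\<lambda>p. prod_law K m (fst p) (snd (snd p))) \<in> ?M \<rightarrow>\<^sub>M prob_algebra (paths m)" by measurable
      ultimately show ?thesis
        by (intro bexI[of _ "\<lambda>p. prod_law K m (fst p) (snd (snd p))"]) (simp_all add: 0 prod_law_def)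
    next
      case (Suc k)
      define "is" where "is = from_nat_into ?X k"
      have "is": "is \<in> ?X" unfolding is_def by (rule from_nat_into[OF neX])
      define T where "T p = (\<lambda>i\<in>C \<times> UNIV. max 0 (fst p) + ring_time (fst (snd p)) (fst i) (snd i))"
        for p :: "real \<times> ('c \<times> nat \<Rightarrow> real) \<times> (nat \<Rightarrow> 'a)"
      have Tm: "T \<in> ?M \<rightarrow>\<^sub>M PiM (C \<times> UNIV) (\<lambda>_. borel)"
        unfolding T_def
      proof (rule measurable_restrict)
        fix i :: "'c \<times> nat" assume "i \<in> C \<times> UNIV"
        then have [measurable]: "(\<lambda>p. ring_time (fst (snd p)) (fst i) (snd i)) \<in> borel_measurable ?M"
          by (intro measurable_ring_time[where C=C and r=r]) auto
        show "(\<lambda>p. max 0 (fst p) + ring_time (fst (snd p)) (fst i) (snd i)) \<in> borel_measurable ?M" by measurable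
      qed
      have "(\<lambda>p. (T p, fst p, snd (snd p))) \<in> ?M \<rightarrow>\<^sub>M PiM (C \<times> UNIV) (\<lambda>_. borel) \<Otimes>\<^sub>M (borel \<Otimes>\<^sub>M S)"
        using Tm by measurable
      from measurable_compose[OF this measurable_evolve_index[OF "is"]]
      have hm: "(\<lambda>p. evolve K m J (map (\<lambda>i. (max 0 (T p i), fst i)) is) (max 0 (fst p)) (snd (snd p))) \<in> ?M \<rightarrow>\<^sub>M prob_algebra (paths m)"
        by simp
      have "chron (max 0 (fst p)) (fst (snd p)) = map (\<lambda>i. (max 0 (T p i), fst i)) is" if p: "p \<in> A (Suc k)" for p
      proof -
        have ol: "?ol is p" using p by (simp add: A_def is_def)
        have rpos: "0 < ring_time (fst (snd p)) (fst i) (snd i)" if "i \<in> set is" for i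
          using ol that "is" rings_eq_ring_list_iff[of "is" C "fst (snd p)" "t - max 0 (fst p)"]
          by (auto simp: ordered_list_def)
        have "chron (max 0 (fst p)) (fst (snd p)) = map (\<lambda>(\<tau>, c). (max 0 (fst p) + \<tau>, c)) (ring_list is (fst (snd p)))"
          unfolding chron_def chronology_eq[OF ol] ..
        also have "\<dots> = map (\<lambda>i. (max 0 (T p i), fst i)) is"
          unfolding ring_list_def map_map
        proof (rule map_cong[OF refl])
          fix i assume i: "i \<in> set is"
          have "0 \<le> max 0 (fst p) + ring_time (fst (snd p)) (fst i) (snd i)"
            using rpos[OF i] by (intro add_nonneg_nonneg) auto
          moreover have "i \<in> C \<times> UNIV" using i "is" by auto
          ultimately have "max 0 (T p i) = max 0 (fst p) + ring_time (fst (snd p)) (fst i) (snd i)"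
            unfolding T_def by (simp only: restrict_apply' max_absorb2)
          then show "((\<lambda>(\<tau>, c). (max 0 (fst p) + \<tau>, c)) \<circ> (\<lambda>i. (ring_time (fst (snd p)) (fst i) (snd i), fst i))) i =
              (max 0 (T p i), fst i)" by simp
        qed
        finally show ?thesis .
      qed
      with hm show ?thesis by (intro bexI[OF _ hm]) (auto simp: Suc)
    qed
  qed
qed

text \<open>The jump operator of the clock c at time \<tau>.\<close>

definition JJ :: "'c \<Rightarrow> real \<Rightarrow> ((nat \<Rightarrow> 'a) \<Rightarrow> real) \<Rightarrow> (nat \<Rightarrow> 'a) \<Rightarrow> real" where
  "JJ c \<tau> g x = (\<integral>y. g y \<partial>J (max 0 \<tau>) c x)"

lemma measurable_JJ:
  assumes c: "c \<in> C" and g[measurable]: "case_prod g \<in> borel_measurable (M \<Otimes>\<^sub>M S)"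
    and [measurable]: "\<tau> \<in> borel_measurable M" "x \<in> M \<rightarrow>\<^sub>M S"
  shows "(\<lambda>w. JJ c (\<tau> w) (g w) (x w)) \<in> borel_measurable M"
  unfolding JJ_def
  by (rule integral_measurable_kernel[where N=S, OF _ measurable_J[OF c]]) (use g in auto)

lemma JJ_bound:
  assumes "c \<in> C" "x \<in> space S" "\<And>y. y \<in> space S \<Longrightarrow> \<bar>g y\<bar> \<le> B"
  shows "\<bar>JJ c \<tau> g x\<bar> \<le> B"
proof -
  have j: "prob_space (J (max 0 \<tau>) c x)" "sets (J (max 0 \<tau>) c x) = sets S" using J_prob[OF assms(1) _ assms(2)] by auto
  show ?thesis unfolding JJ_def
    by (rule prob_integral_abs_le[OF j(1)]) (use assms(3) sets_eq_imp_space_eq[OF j(2)] in auto)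
qed

lemma JJ_integrable:
  assumes "c \<in> C" "x \<in> space S" "bounded_fun m g B"
  shows "integrable (J (max 0 \<tau>) c x) g"
proof -
  have j: "prob_space (J (max 0 \<tau>) c x)" "sets (J (max 0 \<tau>) c x) = sets S" using J_prob[OF assms(1) _ assms(2)] by auto
  show ?thesis
    by (rule prob_integrable_bounded[OF j(1)])
       (use assms(3) sets_eq_imp_space_eq[OF j(2)] in \<open>auto simp: bounded_fun_def j(2) cong: measurable_cong_sets\<close>)
qed

lemma JJ_diff:
  assumes "c \<in> C" "x \<in> space S" "bounded_fun m g B" "bounded_fun m h B'"
  shows "JJ c \<tau> (\<lambda>y. g y - h y) x = JJ c \<tau> g x - JJ c \<tau> h x"
  unfolding JJ_def
  by (rule Bochner_Integration.integral_diff[OF JJ_integrable[OF assms(1,2,3)] JJ_integrable[OF assms(1,2,4)]])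

lemma JJ_tfun:
  assumes "c \<in> C" "bounded_tfun m w B" shows "bounded_tfun m (\<lambda>\<tau> y. JJ c \<tau> (w \<tau>) y) B"
  unfolding bounded_tfun_def case_prod_beta'
proof (intro conjI allI ballI)
  have "(\<lambda>(p, y). w (fst p) y) \<in> borel_measurable ((borel \<Otimes>\<^sub>M S) \<Otimes>\<^sub>M S)"
    using bounded_tfun_measurable[OF assms(2)] by measurable
  then show "(\<lambda>p. JJ c (fst p) (w (fst p)) (snd p)) \<in> borel_measurable (borel \<Otimes>\<^sub>M S)"
    by (intro measurable_JJ[OF assms(1)]) auto
  show "\<bar>JJ c \<tau> (w \<tau>) x\<bar> \<le> B" if "x \<in> space S" for \<tau> x
    using that bounded_tfun_le[OF assms(2)] by (intro JJ_bound[OF assms(1)]) auto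
qed

end

text \<open>The functional is F of the final positions times the exponential of minus the time
  integral of W. For the N-particle system W is q times the empirical mean of V and F is an average
  over injections; for the auxiliary system W is the sum of V over the q particles.\<close>

locale particle_functional = particle_system K m C r J t
  for K :: "real \<Rightarrow> 'a::metric_space \<Rightarrow> (real \<Rightarrow> 'a) measure" and m and C :: "'c set" and r J t +
  fixes W :: "real \<Rightarrow> (nat \<Rightarrow> 'a) \<Rightarrow> real" and F :: "(nat \<Rightarrow> 'a) \<Rightarrow> real" and BW BF :: real
  assumes W: "bounded_tfun m W BW" and W0: "\<And>s x. x \<in> space (state_space m) \<Longrightarrow> 0 \<le> W s x"
    and F: "bounded_fun m F BF"
begin

lemma W_measurable [measurable]: "case_prod W \<in> borel_measurable (borel \<Otimes>\<^sub>M S)"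
  using W by (rule bounded_tfun_measurable)

lemma F_measurable [measurable]: "F \<in> borel_measurable S"
  using F by (rule bounded_fun_measurable)

definition wt :: "real \<Rightarrow> real \<Rightarrow> (nat \<Rightarrow> real \<Rightarrow> 'a) \<Rightarrow> real" where
  "wt s u z = exp (- tint s u (\<lambda>v. W v (pos m z v)))"

lemma measurable_wt [measurable (raw)]:
  assumes [measurable]: "s \<in> borel_measurable M" "u \<in> borel_measurable M" "z \<in> M \<rightarrow>\<^sub>M paths m"
  shows "(\<lambda>x. wt (s x) (u x) (z x)) \<in> borel_measurable M"
  unfolding wt_def by measurable

lemma wt_le: "0 \<le> wt s u z" "wt s u z \<le> 1"
  using tint_nonneg[of s u "\<lambda>v. W v (pos m z v)"] W0 by (auto simp: wt_def)

lemma wt_splice: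
  assumes s: "0 \<le> s" "s \<le> \<tau>" "\<tau> \<le> t" and z: "z \<in> space (paths m)" "z' \<in> space (paths m)"
  shows "wt s t (splice m \<tau> z z') = wt s \<tau> z * wt \<tau> t z'"
proof -
  have \<tau>: "0 \<le> \<tau>" using s by simp
  have "(\<lambda>_::real. splice m (max 0 \<tau>) z z') \<in> borel \<rightarrow>\<^sub>M paths m" using z by measurable
  then have sp: "splice m \<tau> z z' \<in> space (paths m)"
    using measurable_space[of "\<lambda>_::real. splice m (max 0 \<tau>) z z'" borel "paths m" 0] \<tau> by simp
  have mw: "(\<lambda>v. W v (pos m y v)) \<in> borel_measurable borel" if "y \<in> space (paths m)" for y
    using that by measurable
  have "tint s t (\<lambda>v. W v (pos m (splice m \<tau> z z') v)) = tint s \<tau> (\<lambda>v. W v (pos m (splice m \<tau> z z') v))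
     + tint \<tau> t (\<lambda>v. W v (pos m (splice m \<tau> z z') v))"
    by (rule tint_split[OF mw[OF sp], where B=BW]) (use s bounded_tfun_le[OF W] in auto)
  moreover have "tint \<tau> t (\<lambda>v. W v (pos m (splice m \<tau> z z') v)) = tint \<tau> t (\<lambda>v. W v (pos m z' v))"
    by (rule tint_cong) (use \<tau> in \<open>simp add: pos_splice\<close>)
  moreover have "tint s \<tau> (\<lambda>v. W v (pos m (splice m \<tau> z z') v)) = tint s \<tau> (\<lambda>v. W v (pos m z v))"
    unfolding tint_def
  \<comment> \<open>On [s, \<tau>] the two paths can differ only at \<tau>, where the spliced one
    has already jumped.\<close>
  proof (rule integral_cong_AE)
    show "AE v in lborel. indicator {s..\<tau>} v * W v (pos m (splice m \<tau> z z') v) = indicator {s..\<tau>} v * W v (pos m z v)"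
      using AE_lborel_singleton[of \<tau>]
    proof eventually_elim
      fix v assume "v \<noteq> \<tau>"
      then show "indicator {s..\<tau>} v * W v (pos m (splice m \<tau> z z') v) = indicator {s..\<tau>} v * W v (pos m z v)"
        using s by (cases "v \<in> {s..\<tau>}") (auto simp: pos_splice)
    qed
  qed (use mw[OF sp] mw[OF z(1)] in auto)
  ultimately show ?thesis by (simp add: wt_def exp_add[symmetric])
qed

definition Phi :: "real \<Rightarrow> (real \<times> 'c) list \<Rightarrow> (nat \<Rightarrow> 'a) \<Rightarrow> real" where
  "Phi s l x = (\<integral>z. F (pos m z t) * wt s t z \<partial>evolve K m J l s x)"

lemma F_wt_bound: "\<bar>F (pos m z t) * wt s u z\<bar> \<le> BF"
proof -
  have "\<bar>F (pos m z t)\<bar> * wt s u z \<le> BF * 1"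
    using bounded_fun_le[OF F] wt_le bounded_fun_bound_nonneg[OF F] by (intro mult_mono) auto
  then show ?thesis using wt_le by (simp add: abs_mult)
qed

lemma Phi_Nil: "0 \<le> s \<Longrightarrow> Phi s [] x = PK K m W s t F x"
  unfolding Phi_def PK_def wt_def using evolve_Nil[of s x] by (simp add: max_absorb2)

lemma evolve_list_prob:
  assumes "set l \<subseteq> {0..} \<times> C" "0 \<le> s" "x \<in> space S"
  shows "prob_space (evolve K m J l s x)" "sets (evolve K m J l s x) = sets (paths m)"
  using measurable_space[OF measurable_evolve_list[OF assms(1,2)] assms(3)] by (auto simp: space_prob_algebra)

lemma Phi_bound:
  assumes "set l \<subseteq> {0..} \<times> C" "0 \<le> s" "x \<in> space S" shows "\<bar>Phi s l x\<bar> \<le> BF"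
  unfolding Phi_def by (rule prob_integral_abs_le[OF evolve_list_prob(1)[OF assms]]) (rule F_wt_bound)

text \<open>The weight splits at \<tau> by \<open>wt_splice\<close>, and F sees only the path after
  \<tau>. So the mean decomposes into the killed motion up to the first ring, the jump, and the
  remaining rings from the new configuration.\<close>

lemma Phi_Cons:
  assumes s: "0 \<le> s" "s \<le> \<tau>" "\<tau> \<le> t" and c: "c \<in> C" and l: "set l \<subseteq> {0..} \<times> C" and x: "x \<in> space S"
  shows "Phi s ((\<tau>, c) # l) x = PK K m W s \<tau> (JJ c \<tau> (Phi \<tau> l)) x"
proof -
  have \<tau>: "0 \<le> \<tau>" "max 0 \<tau> = \<tau>" "max 0 s = s" using s by auto
  let ?f = "\<lambda>z. F (pos m z t) * wt s t z"
  let ?D = "\<lambda>z y. distr (evolve K m J l \<tau> y) (paths m) (splice m \<tau> z)"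
  have E: "evolve K m J l \<tau> \<in> S \<rightarrow>\<^sub>M prob_algebra (paths m)" by (rule measurable_evolve_list[OF l \<tau>(1)])
  have spl: "(\<lambda>p. splice m \<tau> (fst p) (snd p)) \<in> paths m \<Otimes>\<^sub>M paths m \<rightarrow>\<^sub>M paths m"
    using measurable_splice[of "\<lambda>_. \<tau>" "paths m \<Otimes>\<^sub>M paths m" fst m snd] \<tau> by simp
  have spl1: "splice m \<tau> z \<in> paths m \<rightarrow>\<^sub>M paths m" if "z \<in> space (paths m)" for z
    using measurable_Pair2[OF spl that] by simp
  have Dm: "(\<lambda>(z, y). ?D z y) \<in> paths m \<Otimes>\<^sub>M S \<rightarrow>\<^sub>M prob_algebra (paths m)"
    unfolding case_prod_beta'
  proof (rule measurable_distr_prob_space2)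
    show "(\<lambda>p. evolve K m J l \<tau> (snd p)) \<in> paths m \<Otimes>\<^sub>M S \<rightarrow>\<^sub>M prob_algebra (paths m)"
      by (rule measurable_compose[OF measurable_snd E])
    have "(\<lambda>p. (fst (fst p), snd p)) \<in> (paths m \<Otimes>\<^sub>M S) \<Otimes>\<^sub>M paths m \<rightarrow>\<^sub>M paths m \<Otimes>\<^sub>M paths m" by measurable
    from measurable_compose[OF this spl]
    show "(\<lambda>(x, y). splice m \<tau> (fst x) y) \<in> (paths m \<Otimes>\<^sub>M S) \<Otimes>\<^sub>M paths m \<rightarrow>\<^sub>M paths m"
      by (simp add: case_prod_beta')
  qed
  have Jm: "(\<lambda>z. J \<tau> c (pos m z \<tau>)) \<in> paths m \<rightarrow>\<^sub>M prob_algebra S"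
    using measurable_J[OF c, of "\<lambda>_. \<tau>" "paths m" "\<lambda>z. pos m z \<tau>"] \<tau> by simp
  have inner: "(\<lambda>z. J \<tau> c (pos m z \<tau>) \<bind> ?D z) \<in> paths m \<rightarrow>\<^sub>M prob_algebra (paths m)"
    by (rule measurable_bind_prob_space2[OF Jm Dm])
  have ev: "evolve K m J ((\<tau>, c) # l) s x = prod_law K m s x \<bind> (\<lambda>z. J \<tau> c (pos m z \<tau>) \<bind> ?D z)"
    using evolve_Cons[of \<tau> c l s x] \<tau> by simp
  have "Phi s ((\<tau>, c) # l) x = (\<integral>z. \<integral>z''. ?f z'' \<partial>(J \<tau> c (pos m z \<tau>) \<bind> ?D z) \<partial>prod_law K m s x)"
    unfolding Phi_def ev
    by (rule integral_bind_bounded[OF prod_law_prob(1,2) inner _ F_wt_bound]) simp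
  also have "\<dots> = (\<integral>z. JJ c \<tau> (Phi \<tau> l) (pos m z \<tau>) * wt s \<tau> z \<partial>prod_law K m s x)"
  proof (rule Bochner_Integration.integral_cong[OF refl])
    fix z assume "z \<in> space (prod_law K m s x)"
    then have z: "z \<in> space (paths m)" by (simp add: prod_law_prob)
    have j: "prob_space (J \<tau> c (pos m z \<tau>))" "sets (J \<tau> c (pos m z \<tau>)) = sets S"
      using J_prob[OF c \<tau>(1) pos_in_space] by auto
    have Dz: "?D z \<in> S \<rightarrow>\<^sub>M prob_algebra (paths m)" using measurable_Pair2[OF Dm z] by simp
    have "(\<integral>z''. ?f z'' \<partial>(J \<tau> c (pos m z \<tau>) \<bind> ?D z)) = (\<integral>y. \<integral>z''. ?f z'' \<partial>?D z y \<partial>J \<tau> c (pos m z \<tau>))"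
      by (rule integral_bind_bounded[OF j Dz _ F_wt_bound]) simp
    also have "\<dots> = (\<integral>y. wt s \<tau> z * Phi \<tau> l y \<partial>J \<tau> c (pos m z \<tau>))"
    proof (rule Bochner_Integration.integral_cong[OF refl])
      fix y assume "y \<in> space (J \<tau> c (pos m z \<tau>))"
      then have y: "y \<in> space S" using sets_eq_imp_space_eq[OF j(2)] by simp
      note ep = evolve_list_prob[OF l \<tau>(1) y]
      have "(\<integral>z''. ?f z'' \<partial>?D z y) = (\<integral>z'. ?f (splice m \<tau> z z') \<partial>evolve K m J l \<tau> y)"
        by (rule integral_distr) (use spl1[OF z] ep(2) in \<open>auto cong: measurable_cong_sets\<close>)
      also have "\<dots> = (\<integral>z'. wt s \<tau> z * (F (pos m z' t) * wt \<tau> t z') \<partial>evolve K m J l \<tau> y)"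
        by (rule Bochner_Integration.integral_cong[OF refl])
           (use s z \<tau> sets_eq_imp_space_eq[OF ep(2)] in \<open>simp add: wt_splice pos_splice ac_simps\<close>)
      finally show "(\<integral>z''. ?f z'' \<partial>?D z y) = wt s \<tau> z * Phi \<tau> l y" by (simp add: Phi_def)
    qed
    finally show "(\<integral>z''. ?f z'' \<partial>(J \<tau> c (pos m z \<tau>) \<bind> ?D z)) = JJ c \<tau> (Phi \<tau> l) (pos m z \<tau>) * wt s \<tau> z"
      using \<tau> by (simp add: JJ_def mult.commute)
  qed
  finally show ?thesis unfolding PK_def wt_def .
qed

end

section \<open>First-ring decomposition of a particle functional\<close>

lemma set_chronology: "set (chronology A) \<subseteq> A"
proof (cases "\<exists>l. ordered_list A l")
  case True
  then obtain l where l: "ordered_list A l" ..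
  show ?thesis unfolding chronology_eq[OF l] using l by (simp add: ordered_list_def)
next
  case False
  then show ?thesis unfolding chronology_def ordered_list_def by auto
qed

context particle_functional begin

lemma PK_cmult: "PK K m a s \<tau> (\<lambda>y. c * g y) x = c * PK K m a s \<tau> g x"
  unfolding PK_def by (simp add: mult.assoc)

lemma JJ_cmult: "JJ c \<tau> (\<lambda>y. b * g y) x = b * JJ c \<tau> g x"
  unfolding JJ_def by simp

lemma JJ_cong:
  assumes "c \<in> C" "x \<in> space S" "\<And>y. y \<in> space S \<Longrightarrow> g y = h y" shows "JJ c \<tau> g x = JJ c \<tau> h x"
proof -
  have "sets (J (max 0 \<tau>) c x) = sets S" using J_prob[OF assms(1) _ assms(2)] by auto
  from sets_eq_imp_space_eq[OF this] show ?thesis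
    unfolding JJ_def by (intro Bochner_Integration.integral_cong) (auto simp: assms(3))
qed

lemma set_chron: "0 \<le> s \<Longrightarrow> set (chron s \<sigma>) \<subseteq> {0..} \<times> C"
  using set_chronology[of "rings C (t - s) \<sigma>"] by (force simp: chron_def rings_def)

definition PhiC :: "real \<Rightarrow> ('c \<times> nat \<Rightarrow> real) \<Rightarrow> (nat \<Rightarrow> 'a) \<Rightarrow> real" where
  "PhiC s \<sigma> x = Phi (max 0 s) (chron (max 0 s) \<sigma>) x"

lemma measurable_PhiC: "(\<lambda>p. PhiC (fst p) (fst (snd p)) (snd (snd p))) \<in> borel_measurable (borel \<Otimes>\<^sub>M (Cl \<Otimes>\<^sub>M S))"
  unfolding PhiC_def Phi_def
  by (rule integral_measurable_kernel[OF _ measurable_evolve_chron]) measurable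

lemma PhiC_bound: "x \<in> space S \<Longrightarrow> \<bar>PhiC s \<sigma> x\<bar> \<le> BF"
  unfolding PhiC_def by (rule Phi_bound[OF set_chron]) auto

text \<open>For A = UNIV this is the almost sure event that the rings have a chronology. Carrying it
  along keeps the default value of \<open>chronology\<close> out of all means.\<close>

definition some_nrings :: "nat set \<Rightarrow> real \<Rightarrow> ('c \<times> nat \<Rightarrow> real) \<Rightarrow> bool" where
  "some_nrings A T \<sigma> \<longleftrightarrow> (\<exists>k\<in>A. nrings C T \<sigma> k)"

lemma pred_some_nrings [measurable (raw)]:
  assumes [measurable]: "f \<in> M \<rightarrow>\<^sub>M Cl" "T \<in> borel_measurable M"
  shows "Measurable.pred M (\<lambda>x. some_nrings A (T x) (f x))"
  unfolding some_nrings_def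
  by (rule pred_Bex_countable) (auto intro!: pred_nrings[OF assms finite_C])

definition phi :: "nat set \<Rightarrow> real \<Rightarrow> ('c \<times> nat \<Rightarrow> real) \<Rightarrow> (nat \<Rightarrow> 'a) \<Rightarrow> real" where
  "phi A s \<sigma> x = (if some_nrings A (t - max 0 s) \<sigma> then PhiC s \<sigma> x else 0)"

lemma measurable_phi: "(\<lambda>p. phi A (fst p) (fst (snd p)) (snd (snd p))) \<in> borel_measurable (borel \<Otimes>\<^sub>M (Cl \<Otimes>\<^sub>M S))"
proof -
  note measurable_PhiC[measurable]
  have "Measurable.pred (borel \<Otimes>\<^sub>M (Cl \<Otimes>\<^sub>M S)) (\<lambda>p. some_nrings A (t - max 0 (fst p)) (fst (snd p)))"
    by measurable
  then show ?thesis unfolding phi_def using measurable_PhiC by (intro measurable_If) (auto simp: pred_def)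
qed

lemma measurable_phi' [measurable (raw)]:
  assumes "s \<in> borel_measurable M" "\<sigma> \<in> M \<rightarrow>\<^sub>M Cl" "x \<in> M \<rightarrow>\<^sub>M S"
  shows "(\<lambda>w. phi A (s w) (\<sigma> w) (x w)) \<in> borel_measurable M"
  using measurable_compose[OF measurable_Pair[OF assms(1) measurable_Pair[OF assms(2,3)]] measurable_phi] by simp

lemma phi_bound: "x \<in> space S \<Longrightarrow> \<bar>phi A s \<sigma> x\<bar> \<le> BF"
  using PhiC_bound bounded_fun_bound_nonneg[OF F] by (auto simp: phi_def)

text \<open>Mean of the functional from time \<open>s\<close> on, on the event that the number of rings lies in \<open>A\<close>.\<close>

definition mean_on :: "nat set \<Rightarrow> real \<Rightarrow> (nat \<Rightarrow> 'a) \<Rightarrow> real" where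
  "mean_on A s x = (\<integral>\<sigma>. phi A s \<sigma> x \<partial>Cl)"

lemma prob_Cl: "prob_space Cl"
  using r_pos by (rule prob_space_clocks)

lemma bounded_mean_on: "bounded_tfun m (mean_on A) BF"
  unfolding bounded_tfun_def mean_on_def case_prod_beta'
proof (intro conjI allI ballI)
  interpret prob_space Cl by (rule prob_Cl)
  show "(\<lambda>p. \<integral>\<sigma>. phi A (fst p) \<sigma> (snd p) \<partial>Cl) \<in> borel_measurable (borel \<Otimes>\<^sub>M S)" by measurable
  show "\<bar>\<integral>\<sigma>. phi A s \<sigma> x \<partial>Cl\<bar> \<le> BF" if "x \<in> space S" for s x
    by (rule prob_integral_abs_le[OF prob_Cl]) (use that phi_bound in auto)
qed

lemma PK_JJ_measurable:
  assumes c: "c \<in> C" and g[measurable]: "case_prod g \<in> borel_measurable (M \<Otimes>\<^sub>M S)"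
    and [measurable]: "s \<in> borel_measurable M" "\<tau> \<in> borel_measurable M" "x \<in> M \<rightarrow>\<^sub>M S"
  shows "(\<lambda>w. PK K m W (s w) (\<tau> w) (JJ c (\<tau> w) (g w)) (x w)) \<in> borel_measurable M"
proof (rule measurable_PK[OF W_measurable])
  show "(\<lambda>(w, y). JJ c (\<tau> w) (g w) y) \<in> borel_measurable (M \<Otimes>\<^sub>M S)"
    unfolding case_prod_beta' by (rule measurable_JJ[OF c]) measurable
qed auto

lemma PK_JJ_bound:
  assumes c: "c \<in> C" and g: "bounded_fun m g B"
  shows "\<bar>PK K m W s \<tau> (JJ c \<tau> g) x\<bar> \<le> B"
proof (rule PK_bound[OF _ W0])
  have "(\<lambda>y. JJ c \<tau> g y) \<in> borel_measurable S"
    by (rule measurable_JJ[OF c]) (use bounded_fun_measurable[OF g] in auto)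
  then show "bounded_fun m (JJ c \<tau> g) B"
    unfolding bounded_fun_def using JJ_bound[OF c] bounded_fun_le[OF g] by auto
qed

text \<open>Two exchanges of integrals, with the trajectories and then with the jump kernel, bring
  the average over the restarted clocks inside.\<close>

lemma integral_PK_JJ:
  assumes c: "c \<in> C" and g[measurable]: "case_prod g \<in> borel_measurable (Cl \<Otimes>\<^sub>M S)"
    and B: "\<And>\<sigma> y. y \<in> space S \<Longrightarrow> \<bar>g \<sigma> y\<bar> \<le> B"
  shows "(\<integral>\<sigma>. PK K m W s \<tau> (JJ c \<tau> (g \<sigma>)) x \<partial>Cl) = PK K m W s \<tau> (JJ c \<tau> (\<lambda>y. \<integral>\<sigma>. g \<sigma> y \<partial>Cl)) x"
proof -
  have B0: "0 \<le> B" using B[OF pos_in_space] abs_ge_zero order_trans by blast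
  have m1: "(\<lambda>(\<sigma>, z). JJ c \<tau> (g \<sigma>) (pos m z \<tau>) * wt s \<tau> z) \<in> borel_measurable (Cl \<Otimes>\<^sub>M paths m)"
    unfolding case_prod_beta'
    by (intro borel_measurable_times measurable_JJ[OF c]) measurable
  have "(\<integral>\<sigma>. PK K m W s \<tau> (JJ c \<tau> (g \<sigma>)) x \<partial>Cl) =
      (\<integral>z. \<integral>\<sigma>. JJ c \<tau> (g \<sigma>) (pos m z \<tau>) * wt s \<tau> z \<partial>Cl \<partial>prod_law K m s x)"
    unfolding PK_def wt_def[symmetric]
  proof (rule integral_kernel_swap[OF prob_Cl, where N="paths m" and B=B])
    show "\<bar>JJ c \<tau> (g \<sigma>) (pos m z \<tau>) * wt s \<tau> z\<bar> \<le> B" for \<sigma> z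
    proof -
      have "\<bar>JJ c \<tau> (g \<sigma>) (pos m z \<tau>)\<bar> * wt s \<tau> z \<le> B * 1"
        using JJ_bound[OF c pos_in_space B] wt_le B0 by (intro mult_mono) auto
      then show ?thesis using wt_le by (simp add: abs_mult)
    qed
  qed (use m1 prod_law_prob in auto)
  also have "\<dots> = PK K m W s \<tau> (JJ c \<tau> (\<lambda>y. \<integral>\<sigma>. g \<sigma> y \<partial>Cl)) x"
    unfolding PK_def wt_def[symmetric]
  proof (rule Bochner_Integration.integral_cong[OF refl])
    fix z
    have j: "prob_space (J (max 0 \<tau>) c (pos m z \<tau>))" "sets (J (max 0 \<tau>) c (pos m z \<tau>)) = sets S"
      using J_prob[OF c _ pos_in_space] by auto
    have "(\<integral>\<sigma>. JJ c \<tau> (g \<sigma>) (pos m z \<tau>) \<partial>Cl) = JJ c \<tau> (\<lambda>y. \<integral>\<sigma>. g \<sigma> y \<partial>Cl) (pos m z \<tau>)"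
      unfolding JJ_def by (rule integral_kernel_swap[OF prob_Cl g B j])
    then show "(\<integral>\<sigma>. JJ c \<tau> (g \<sigma>) (pos m z \<tau>) * wt s \<tau> z \<partial>Cl) = JJ c \<tau> (\<lambda>y. \<integral>\<sigma>. g \<sigma> y \<partial>Cl) (pos m z \<tau>) * wt s \<tau> z"
      by simp
  qed
  finally show ?thesis .
qed

text \<open>On the event that the clock \<open>c\<close> rings first, at the time \<open>s + \<tau>\<close>, and that all waiting times
  are positive, the functional is \<open>first_part A s x c (\<tau>, \<sigma>')\<close> with \<open>\<sigma>'\<close> the restarted clocks.\<close>

definition first_part :: "nat set \<Rightarrow> real \<Rightarrow> (nat \<Rightarrow> 'a) \<Rightarrow> 'c \<Rightarrow> real \<times> ('c \<times> nat \<Rightarrow> real) \<Rightarrow> real" where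
  "first_part A s x c p = (if fst p \<le> 0 then 0 else if t - s < fst p then (if 0 \<in> A then PK K m W s t F x else 0)
     else PK K m W s (s + fst p) (JJ c (s + fst p) (phi {k. Suc k \<in> A} (s + fst p) (snd p))) x)"

text \<open>The first ring uses up one of the k rings, so the restarted clocks are left with the
  counts {k. Suc k \<in> A}. If it comes after the horizon there is no ring, and the functional
  counts only when 0 \<in> A.\<close>

lemma first_part_eq:
  assumes s: "0 \<le> s" "s \<le> t" and x: "x \<in> space S" and c: "c \<in> C"
    and pos: "\<forall>i\<in>C \<times> UNIV. 0 < \<sigma> i" and first: "first_ring C c \<sigma>"
  shows "phi A s \<sigma> x = first_part A s x c (\<sigma> (c, 0), next_clocks C c \<sigma>)"
proof -
  define \<tau> where "\<tau> = \<sigma> (c, 0)"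
  define \<sigma>' where "\<sigma>' = next_clocks C c \<sigma>"
  note R = rings_first[OF pos c first, folded \<tau>_def \<sigma>'_def]
  note N = nrings_first[OF pos c first, folded \<tau>_def \<sigma>'_def]
  have \<tau>: "0 < \<tau>" using pos c by (auto simp: \<tau>_def)
  show ?thesis
  proof (cases "t - s < \<tau>")
    case True
    have n: "nrings C (t - s) \<sigma> k \<longleftrightarrow> k = 0" for k
      using N(1,2)[of "t - s"] True by (cases k) auto
    have "chronology (rings C (t - s) \<sigma>) = []"
      by (rule chronology_eq) (simp add: R(1)[OF True] ordered_list_Nil)
    then have "PhiC s \<sigma> x = PK K m W s t F x"
      using s by (simp add: PhiC_def chron_def Phi_Nil)
    moreover have "some_nrings A (t - s) \<sigma> \<longleftrightarrow> 0 \<in> A" by (auto simp: some_nrings_def n)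
    ultimately show ?thesis using True \<tau> s unfolding phi_def first_part_def \<tau>_def[symmetric] by simp
  next
    case False
    then have le: "\<tau> \<le> t - s" by simp
    have d: "t - s - \<tau> = t - (s + \<tau>)" by simp
    have iff: "some_nrings A (t - s) \<sigma> \<longleftrightarrow> some_nrings {k. Suc k \<in> A} (t - (s + \<tau>)) \<sigma>'"
    proof
      assume "some_nrings A (t - s) \<sigma>"
      then obtain k where k: "k \<in> A" "nrings C (t - s) \<sigma> k" by (auto simp: some_nrings_def)
      then obtain k' where "k = Suc k'" using N(1)[of "t - s"] False by (cases k) auto
      then show "some_nrings {k. Suc k \<in> A} (t - (s + \<tau>)) \<sigma>'"
        using k N(2)[of "t - s" k'] by (auto simp: some_nrings_def d)
    qed (use N(2)[of "t - s"] le in \<open>auto simp: some_nrings_def d\<close>)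
    have "PhiC s \<sigma> x = PK K m W s (s + \<tau>) (JJ c (s + \<tau>) (PhiC (s + \<tau>) \<sigma>')) x" if sn: "some_nrings {k. Suc k \<in> A} (t - (s + \<tau>)) \<sigma>'"
    proof -
      from sn obtain k where "nrings C (t - s - \<tau>) \<sigma>' k" by (auto simp: some_nrings_def d)
      from N(3)[OF le this]
      have ch: "chron s \<sigma> = (s + \<tau>, c) # chron (s + \<tau>) \<sigma>'"
        by (simp add: chron_def d comp_def case_prod_beta' add.assoc)
      have "Phi s (chron s \<sigma>) x = PK K m W s (s + \<tau>) (JJ c (s + \<tau>) (Phi (s + \<tau>) (chron (s + \<tau>) \<sigma>'))) x"
        unfolding ch by (rule Phi_Cons) (use s \<tau> le c x set_chron[of "s + \<tau>" \<sigma>'] in auto)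
      then show ?thesis using s \<tau> by (simp add: PhiC_def[abs_def])
    qed
    moreover have "PK K m W s (s + \<tau>) (JJ c (s + \<tau>) (\<lambda>y. 0)) x = 0" by (simp add: PK_def JJ_def)
    ultimately show ?thesis
      using False \<tau> s iff unfolding phi_def[abs_def] first_part_def \<tau>_def[symmetric] \<sigma>'_def[symmetric]
      by (auto simp: fun_eq_iff)
  qed
qed

lemma measurable_first_part:
  assumes c: "c \<in> C" and x: "x \<in> space S" shows "first_part A s x c \<in> borel_measurable (borel \<Otimes>\<^sub>M Cl)"
proof -
  have [measurable]: "(\<lambda>p. PK K m W s (s + fst p) (JJ c (s + fst p) (phi {k. Suc k \<in> A} (s + fst p) (snd p))) x)
      \<in> borel_measurable (borel \<Otimes>\<^sub>M Cl)"
    by (rule PK_JJ_measurable[OF c]) (use x in measurable)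
  show ?thesis unfolding first_part_def[abs_def] by measurable
qed

lemma first_part_bound: "c \<in> C \<Longrightarrow> x \<in> space S \<Longrightarrow> \<sigma> \<in> space Cl \<Longrightarrow> \<bar>first_part A s x c (\<tau>, \<sigma>)\<bar> \<le> BF"
proof -
  assume c: "c \<in> C" and x: "x \<in> space S" and \<sigma>: "\<sigma> \<in> space Cl"
  have "bounded_fun m (phi A' u \<sigma>) BF" for A' u
    unfolding bounded_fun_def using phi_bound \<sigma> by (auto intro!: measurable_phi')
  from PK_JJ_bound[OF c this] show ?thesis
    using PK_bound[OF F W0] bounded_fun_bound_nonneg[OF F] by (auto simp: first_part_def)
qed

lemma integral_first_density_tail:
  assumes "C \<noteq> {}" "0 \<le> T"
  shows "(\<integral>\<tau>. first_density C r \<tau> * indicator {T<..} \<tau> \<partial>lborel) = exp (- lam * T) / card C"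
    and "integrable lborel (\<lambda>\<tau>. first_density C r \<tau> * indicator {T<..} \<tau>)"
proof -
  have n: "0 < real (card C)" using assms finite_C by (simp add: card_gt_0_iff)
  have l: "0 < lam" using n r_pos by (simp add: lam_def)
  define D where "D = density lborel (exponential_density lam)"
  interpret D: prob_space D unfolding D_def using l by (rule prob_space_exponential_density)
  have dis: "distributed D lborel (\<lambda>x. x) (exponential_density lam)"
    unfolding distributed_def D_def by (auto simp: distr_id2)
  have fd: "first_density C r \<tau> = exponential_density lam \<tau> / card C" for \<tau>
    using n by (auto simp: first_density_def exponential_density_def lam_def mult.commute)
  have "D.prob {x \<in> space D. T < x} = exp (- T * lam)"
    using D.exponential_distributedD_gt[OF dis assms(2) l] .
  moreover have "D.prob {x \<in> space D. T < x} = (\<integral>x. indicator {T<..} x \<partial>D)"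
    by (simp add: D_def greaterThan_def)
  moreover have "(\<integral>x. indicator {T<..} x \<partial>D) = (\<integral>x. exponential_density lam x * indicator {T<..} x \<partial>lborel)"
    unfolding D_def by (subst integral_density) (use l in \<open>auto simp: exponential_density_nonneg\<close>)
  ultimately have i: "(\<integral>x. exponential_density lam x * indicator {T<..} x \<partial>lborel) = exp (- T * lam)" by simp
  have "(\<integral>\<tau>. first_density C r \<tau> * indicator {T<..} \<tau> \<partial>lborel)
      = (\<integral>\<tau>. (exponential_density lam \<tau> * indicator {T<..} \<tau>) / card C \<partial>lborel)"
    unfolding fd by (rule Bochner_Integration.integral_cong) auto
  then show "(\<integral>\<tau>. first_density C r \<tau> * indicator {T<..} \<tau> \<partial>lborel) = exp (- lam * T) / card C"
    using i by (simp add: mult.commute)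
  \<comment> \<open>Integrability is read off from a nonzero integral, since a non-integrable
    function has integral 0.\<close>
  have "(\<integral>x. exponential_density lam x * indicator {T<..} x \<partial>lborel) \<noteq> 0" using i by simp
  then have "integrable lborel (\<lambda>x. exponential_density lam x * indicator {T<..} x)"
    by (metis not_integrable_integral_eq)
  then have "integrable lborel (\<lambda>x. exponential_density lam x * indicator {T<..} x / card C)"
    by simp
  then show "integrable lborel (\<lambda>\<tau>. first_density C r \<tau> * indicator {T<..} \<tau>)"
    unfolding fd by (simp add: divide_inverse ac_simps)
qed

lemma tint_shift:
  assumes [measurable]: "g \<in> borel_measurable borel"
  shows "tint s t g = (\<integral>\<tau>. indicator {0<..t - s} \<tau> * g (s + \<tau>) \<partial>lborel)"
proof -
  have "tint s t g = (\<integral>\<tau>. indicator {s..t} (s + 1 * \<tau>) * g (s + 1 * \<tau>) \<partial>lborel)"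
    unfolding tint_def by (subst lborel_integral_real_affine[where c=1 and t=s]) auto
  also have "\<dots> = (\<integral>\<tau>. indicator {0<..t - s} \<tau> * g (s + \<tau>) \<partial>lborel)"
  proof (rule integral_cong_AE)
    show "AE \<tau> in lborel. indicator {s..t} (s + 1 * \<tau>) * g (s + 1 * \<tau>) = indicator {0<..t - s} \<tau> * g (s + \<tau>)"
      using AE_lborel_singleton[of 0] by eventually_elim (auto simp: indicator_def)
  qed auto
  finally show ?thesis .
qed

text \<open>The renewal equation at the first ring: exp (- lam * (\<tau> - s)) is the probability
  that no clock has rung before \<tau>, and r is the rate at which c then rings. The case C = {}
  (the auxiliary system with q = 1) is separate because there is no first ring to split at.\<close>

lemma mean_on_first:
  assumes s: "0 \<le> s" "s \<le> t" and x: "x \<in> space S"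
  shows "mean_on A s x = (if 0 \<in> A then exp (- lam * (t - s)) * PK K m W s t F x else 0) +
    tint s t (\<lambda>\<tau>. \<Sum>c\<in>C. r * exp (- lam * (\<tau> - s)) * PK K m W s \<tau> (JJ c \<tau> (mean_on {k. Suc k \<in> A} \<tau>)) x)"
proof (cases "C = {}")
  case True
  interpret prob_space Cl by (rule prob_Cl)
  have n: "nrings C T \<sigma> k \<longleftrightarrow> k = 0" for T \<sigma> k using nrings_empty[of T \<sigma> k] unfolding True .
  have "chronology (rings C (t - s) \<sigma>) = []" for \<sigma>
    by (rule chronology_eq) (simp add: ordered_list_Nil rings_def True)
  then have "PhiC s \<sigma> x = PK K m W s t F x" for \<sigma>
    using s by (simp add: PhiC_def chron_def Phi_Nil)
  then have "phi A s \<sigma> x = (if 0 \<in> A then PK K m W s t F x else 0)" for \<sigma>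
    by (auto simp: phi_def some_nrings_def n)
  moreover have "lam = 0" unfolding lam_def using True by simp
  moreover have "(\<Sum>c\<in>C. g c) = 0" for g :: "'c \<Rightarrow> real" using True by simp
  ultimately show ?thesis by (simp add: mean_on_def prob_space tint_def)
next
  case False
  define A' where "A' = {k. Suc k \<in> A}"
  define Q where "Q c \<tau> = PK K m W s \<tau> (JJ c \<tau> (mean_on A' \<tau>)) x" for c \<tau>
  define P0 where "P0 = (if 0 \<in> A then PK K m W s t F x else 0)"
  interpret P: prob_space Cl by (rule prob_Cl)
  have phim: "(\<lambda>\<sigma>. phi A s \<sigma> x) \<in> borel_measurable Cl" using x by measurable
  have intphi: "integrable Cl (\<lambda>\<sigma>. phi A s \<sigma> x)"
    by (rule prob_integrable_bounded[OF prob_Cl phim]) (rule phi_bound[OF x])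
  have fm: "(\<lambda>\<sigma>. indicator {\<sigma>. first_ring C c \<sigma>} \<sigma> :: real) \<in> borel_measurable Cl" if "c \<in> C" for c
    using sets_first_ring[OF that finite_C, of r] by measurable
  have Qm: "Q c \<in> borel_measurable borel" if c: "c \<in> C" for c
    unfolding Q_def[abs_def] by (rule PK_JJ_measurable[OF c]) (use bounded_tfun_measurable[OF bounded_mean_on] x in measurable)
  have Qb: "\<bar>Q c \<tau>\<bar> \<le> BF" if c: "c \<in> C" for c \<tau>
    unfolding Q_def by (rule PK_JJ_bound[OF c bounded_tfun_imp_fun[OF bounded_mean_on]])
  have "mean_on A s x = (\<integral>\<sigma>. (\<Sum>c\<in>C. indicator {\<sigma>. first_ring C c \<sigma>} \<sigma> * first_part A s x c (\<sigma> (c, 0), next_clocks C c \<sigma>)) \<partial>Cl)"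
    unfolding mean_on_def
  proof (rule integral_cong_AE[OF phim])
    show "(\<lambda>\<sigma>. \<Sum>c\<in>C. indicator {\<sigma>. first_ring C c \<sigma>} \<sigma> * first_part A s x c (\<sigma> (c, 0), next_clocks C c \<sigma>)) \<in> borel_measurable Cl"
    proof (rule borel_measurable_sum)
      fix c assume c: "c \<in> C"
      have [measurable]: "(\<lambda>\<sigma>. \<sigma> (c, 0)) \<in> borel_measurable Cl" using c by (intro clocks_coord) auto
      note [measurable] = measurable_next_clocks[OF c, of r] measurable_first_part[OF c x, of A s] fm[OF c]
      show "(\<lambda>\<sigma>. indicator {\<sigma>. first_ring C c \<sigma>} \<sigma> * first_part A s x c (\<sigma> (c, 0), next_clocks C c \<sigma>)) \<in> borel_measurable Cl"
        by measurable
    qed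
    show "AE \<sigma> in Cl. phi A s \<sigma> x = (\<Sum>c\<in>C. indicator {\<sigma>. first_ring C c \<sigma>} \<sigma> * first_part A s x c (\<sigma> (c, 0), next_clocks C c \<sigma>))"
      using AE_clocks_first_ring[OF r_pos finite_C False] AE_clocks_pos[OF r_pos finite_C]
    proof eventually_elim
      fix \<sigma> assume ex: "\<exists>c\<in>C. first_ring C c \<sigma>" and pos: "\<forall>i\<in>C \<times> UNIV. 0 < \<sigma> i"
      then obtain c where c: "c \<in> C" "first_ring C c \<sigma>" by auto
      have un: "\<not> first_ring C c' \<sigma>" if c': "c' \<in> C" "c' \<noteq> c" for c'
      proof
        assume "first_ring C c' \<sigma>"
        then have "\<sigma> (c', 0) < \<sigma> (c, 0)" using c c' by (auto simp: first_ring_def)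
        moreover have "\<sigma> (c, 0) < \<sigma> (c', 0)" using c c' by (auto simp: first_ring_def)
        ultimately show False by simp
      qed
      have "(\<Sum>c'\<in>C. indicator {\<sigma>. first_ring C c' \<sigma>} \<sigma> * first_part A s x c' (\<sigma> (c', 0), next_clocks C c' \<sigma>))
        = (\<Sum>c'\<in>{c}. indicator {\<sigma>. first_ring C c' \<sigma>} \<sigma> * first_part A s x c' (\<sigma> (c', 0), next_clocks C c' \<sigma>))"
        by (rule sum.mono_neutral_right) (use finite_C c un in auto)
      then show "phi A s \<sigma> x = (\<Sum>c\<in>C. indicator {\<sigma>. first_ring C c \<sigma>} \<sigma> * first_part A s x c (\<sigma> (c, 0), next_clocks C c \<sigma>))"
        using first_part_eq[OF s x c(1) pos c(2), of A] c(2) by simp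
    qed
  qed
  also have "\<dots> = (\<Sum>c\<in>C. \<integral>\<sigma>. indicator {\<sigma>. first_ring C c \<sigma>} \<sigma> * first_part A s x c (\<sigma> (c, 0), next_clocks C c \<sigma>) \<partial>Cl)"
  proof (rule Bochner_Integration.integral_sum)
    fix c assume c: "c \<in> C"
    have [measurable]: "(\<lambda>\<sigma>. \<sigma> (c, 0)) \<in> borel_measurable Cl" using c by (intro clocks_coord) auto
    note [measurable] = measurable_next_clocks[OF c, of r] measurable_first_part[OF c x, of A s] fm[OF c]
    show "integrable Cl (\<lambda>\<sigma>. indicator {\<sigma>. first_ring C c \<sigma>} \<sigma> * first_part A s x c (\<sigma> (c, 0), next_clocks C c \<sigma>))"
    proof (rule prob_integrable_bounded[OF prob_Cl, where B=BF])
      fix \<sigma> assume \<sigma>: "\<sigma> \<in> space Cl"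
      have "next_clocks C c \<sigma> \<in> space Cl" by (rule measurable_space[OF measurable_next_clocks[OF c] \<sigma>])
      from first_part_bound[OF c x this] bounded_fun_bound_nonneg[OF F]
      show "\<bar>indicator {\<sigma>. first_ring C c \<sigma>} \<sigma> * first_part A s x c (\<sigma> (c, 0), next_clocks C c \<sigma>)\<bar> \<le> BF"
        by (auto simp: indicator_def)
    qed measurable
  qed
  \<comment> \<open>The event without rings is shared out among the clocks according to which one
    rings first after the horizon; each gets the fraction 1 / card C.\<close>
  also have "\<dots> = (\<Sum>c\<in>C. P0 * (exp (- lam * (t - s)) / card C) + tint s t (\<lambda>\<tau>. r * exp (- lam * (\<tau> - s)) * Q c \<tau>))"
  proof (rule sum.cong[OF refl])
    fix c assume c: "c \<in> C"
    note [measurable] = Qm[OF c]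
    have inner: "(\<integral>\<sigma>. first_part A s x c (\<tau>, \<sigma>) \<partial>Cl) = (if \<tau> \<le> 0 then 0 else if t - s < \<tau> then P0 else Q c (s + \<tau>))" for \<tau>
    proof -
      have "(\<lambda>(\<sigma>, y). phi A' (s + \<tau>) \<sigma> y) \<in> borel_measurable (Cl \<Otimes>\<^sub>M S)"
        unfolding case_prod_beta' by measurable
      from integral_PK_JJ[OF c this phi_bound, of s "s + \<tau>" x]
      have "(\<integral>\<sigma>. PK K m W s (s + \<tau>) (JJ c (s + \<tau>) (phi A' (s + \<tau>) \<sigma>)) x \<partial>Cl) = Q c (s + \<tau>)"
        by (simp add: Q_def mean_on_def[abs_def])
      then show ?thesis by (simp add: first_part_def A'_def P0_def P.prob_space)
    qed
    have "(\<integral>\<sigma>. indicator {\<sigma>. first_ring C c \<sigma>} \<sigma> * first_part A s x c (\<sigma> (c, 0), next_clocks C c \<sigma>) \<partial>Cl)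
       = (\<integral>\<tau>. first_density C r \<tau> * (if \<tau> \<le> 0 then 0 else if t - s < \<tau> then P0 else Q c (s + \<tau>)) \<partial>lborel)"
      unfolding inner[symmetric]
      by (rule integral_clocks_first[OF r_pos finite_C c measurable_first_part[OF c x] first_part_bound[OF c x]])
    also have "\<dots> = (\<integral>\<tau>. P0 * (first_density C r \<tau> * indicator {t - s<..} \<tau>) +
        indicator {0<..t - s} \<tau> * (r * exp (- lam * ((s + \<tau>) - s)) * Q c (s + \<tau>)) \<partial>lborel)"
      by (rule Bochner_Integration.integral_cong) (use s in \<open>auto simp: indicator_def first_density_def lam_def\<close>)
    also have "\<dots> = (\<integral>\<tau>. P0 * (first_density C r \<tau> * indicator {t - s<..} \<tau>) \<partial>lborel) +
        (\<integral>\<tau>. indicator {0<..t - s} \<tau> * (r * exp (- lam * ((s + \<tau>) - s)) * Q c (s + \<tau>)) \<partial>lborel)"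
    proof (rule Bochner_Integration.integral_add)
      show "integrable lborel (\<lambda>\<tau>. P0 * (first_density C r \<tau> * indicator {t - s<..} \<tau>))"
        using integral_first_density_tail(2)[OF False, of "t - s"] s by simp
      have i2: "integrable lborel (\<lambda>\<tau>. indicator {0..t - s} \<tau> * (indicator {0<..t-s} \<tau> * (r * exp (- lam * ((s + \<tau>) - s)) * Q c (s + \<tau>))))"
      proof (rule tint_integrable[where B="r * BF"])
        fix u assume u: "0 \<le> u" "u \<le> t - s"
        have "0 \<le> lam" using r_pos by (simp add: lam_def)
        then have "exp (- lam * u) \<le> 1" using u by simp
        then have "r * exp (- lam * u) * \<bar>Q c (s + u)\<bar> \<le> (r * 1) * BF"
          using r_pos Qb[OF c, of "s + u"] by (intro mult_mono) auto
        then show "\<bar>indicator {0<..t - s} u * (r * exp (- lam * (s + u - s)) * Q c (s + u))\<bar> \<le> r * BF"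
          using r_pos bounded_fun_bound_nonneg[OF F] by (auto simp: indicator_def abs_mult)
      qed measurable
      have "(\<lambda>\<tau>. indicator {0..t - s} \<tau> * (indicator {0<..t-s} \<tau> * (r * exp (- lam * ((s + \<tau>) - s)) * Q c (s + \<tau>)))) =
        (\<lambda>\<tau>. indicator {0<..t-s} \<tau> * (r * exp (- lam * ((s + \<tau>) - s)) * Q c (s + \<tau>)))"
        by (auto simp: indicator_def fun_eq_iff)
      with i2 show "integrable lborel (\<lambda>\<tau>. indicator {0<..t - s} \<tau> * (r * exp (- lam * ((s + \<tau>) - s)) * Q c (s + \<tau>)))"
        by (simp only:)
    qed
    also have "(\<integral>\<tau>. P0 * (first_density C r \<tau> * indicator {t - s<..} \<tau>) \<partial>lborel) = P0 * (exp (- lam * (t - s)) / card C)"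
      using integral_first_density_tail(1)[OF False, of "t - s"] s by simp
    also have "(\<integral>\<tau>. indicator {0<..t - s} \<tau> * (r * exp (- lam * ((s + \<tau>) - s)) * Q c (s + \<tau>)) \<partial>lborel) =
        tint s t (\<lambda>\<tau>. r * exp (- lam * (\<tau> - s)) * Q c \<tau>)"
      by (rule tint_shift[symmetric]) measurable
    finally show "(\<integral>\<sigma>. indicator {\<sigma>. first_ring C c \<sigma>} \<sigma> * first_part A s x c (\<sigma> (c, 0), next_clocks C c \<sigma>) \<partial>Cl) =
      P0 * (exp (- lam * (t - s)) / card C) + tint s t (\<lambda>\<tau>. r * exp (- lam * (\<tau> - s)) * Q c \<tau>)" .
  qed
  also have "\<dots> = P0 * exp (- lam * (t - s)) + (\<Sum>c\<in>C. tint s t (\<lambda>\<tau>. r * exp (- lam * (\<tau> - s)) * Q c \<tau>))"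
    using False finite_C by (simp add: sum.distrib)
  also have "(\<Sum>c\<in>C. tint s t (\<lambda>\<tau>. r * exp (- lam * (\<tau> - s)) * Q c \<tau>)) = tint s t (\<lambda>\<tau>. \<Sum>c\<in>C. r * exp (- lam * (\<tau> - s)) * Q c \<tau>)"
  proof (rule tint_sum[symmetric, where B="r * 1 * BF"])
    show "(\<lambda>\<tau>. r * exp (- lam * (\<tau> - s)) * Q c \<tau>) \<in> borel_measurable borel" if "c \<in> C" for c
      using Qm[OF that] by measurable
    fix c u assume c: "c \<in> C" and u: "s \<le> u" "u \<le> t"
    have "0 \<le> lam" using r_pos by (simp add: lam_def)
    then have "exp (- lam * (u - s)) \<le> 1" using u by simp
    then have "r * exp (- lam * (u - s)) * \<bar>Q c u\<bar> \<le> (r * 1) * BF"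
      using r_pos Qb[OF c, of u] by (intro mult_mono) auto
    then show "\<bar>r * exp (- lam * (u - s)) * Q c u\<bar> \<le> r * 1 * BF"
      using r_pos by (simp add: abs_mult)
  qed
  finally show ?thesis by (simp add: P0_def Q_def A'_def mult.commute)
qed

end

lemma bounded_tfun_const: "bounded_tfun m (\<lambda>s x. c) \<bar>c\<bar>"
  by (simp add: bounded_tfun_def)

context particle_functional begin

text \<open>The contribution of \<open>k\<close> rings, stripped of the factors that depend on the rate of the clocks.\<close>

primrec ring_term :: "nat \<Rightarrow> real \<Rightarrow> (nat \<Rightarrow> 'a) \<Rightarrow> real" where
  "ring_term 0 s x = PK K m W s t F x"
| "ring_term (Suc k) s x = tint s t (\<lambda>\<tau>. \<Sum>c\<in>C. PK K m W s \<tau> (JJ c \<tau> (ring_term k \<tau>)) x)"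

lemma mean_on_empty: "mean_on {} s x = 0"
  by (simp add: mean_on_def phi_def some_nrings_def)

text \<open>Each ring contributes a factor r, and the survival factors before and after it multiply
  to exp (- lam * (t - s)) whatever the ring time. Hence the rate leaves the time integrals, which
  is the source of the independence of N.\<close>

lemma mean_on_singleton:
  "0 \<le> s \<Longrightarrow> s \<le> t \<Longrightarrow> x \<in> space S \<Longrightarrow> mean_on {k} s x = exp (- lam * (t - s)) * r ^ k * ring_term k s x"
proof (induction k arbitrary: s x)
  case 0
  have "{k. Suc k \<in> {0}} = {}" by auto
  moreover have "PK K m W s \<tau> (JJ c \<tau> (\<lambda>y. 0)) x = 0" for c \<tau> by (simp add: PK_def JJ_def)
  ultimately show ?case
    using mean_on_first[OF 0, of "{0}"] by (simp add: mean_on_empty[abs_def] tint_def)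
next
  case (Suc k)
  have A: "{j. Suc j \<in> {Suc k}} = {k}" by auto
  have "mean_on {Suc k} s x = tint s t (\<lambda>\<tau>. \<Sum>c\<in>C. r * exp (- lam * (\<tau> - s)) * PK K m W s \<tau> (JJ c \<tau> (mean_on {k} \<tau>)) x)"
    using mean_on_first[OF Suc.prems, of "{Suc k}"] unfolding A by simp
  also have "\<dots> = tint s t (\<lambda>\<tau>. (exp (- lam * (t - s)) * r ^ Suc k) * (\<Sum>c\<in>C. PK K m W s \<tau> (JJ c \<tau> (ring_term k \<tau>)) x))"
  proof (rule tint_cong)
    fix \<tau> assume \<tau>: "s \<le> \<tau>" "\<tau> \<le> t"
    have "PK K m W s \<tau> (JJ c \<tau> (mean_on {k} \<tau>)) x = (exp (- lam * (t - \<tau>)) * r ^ k) * PK K m W s \<tau> (JJ c \<tau> (ring_term k \<tau>)) x"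
      if c: "c \<in> C" for c
    proof -
      have "PK K m W s \<tau> (JJ c \<tau> (mean_on {k} \<tau>)) x = PK K m W s \<tau> (\<lambda>y. (exp (- lam * (t - \<tau>)) * r ^ k) * JJ c \<tau> (ring_term k \<tau>) y) x"
      proof (rule PK_cong)
        fix y assume y: "y \<in> space S"
        have "JJ c \<tau> (mean_on {k} \<tau>) y = JJ c \<tau> (\<lambda>y. (exp (- lam * (t - \<tau>)) * r ^ k) * ring_term k \<tau> y) y"
          by (rule JJ_cong[OF c y]) (use Suc.IH[of \<tau>] Suc.prems \<tau> in auto)
        then show "JJ c \<tau> (mean_on {k} \<tau>) y = (exp (- lam * (t - \<tau>)) * r ^ k) * JJ c \<tau> (ring_term k \<tau>) y"
          unfolding JJ_cmult .
      qed
      then show ?thesis unfolding PK_cmult .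
    qed
    then have "(\<Sum>c\<in>C. r * exp (- lam * (\<tau> - s)) * PK K m W s \<tau> (JJ c \<tau> (mean_on {k} \<tau>)) x) =
      (\<Sum>c\<in>C. (r * exp (- lam * (\<tau> - s)) * (exp (- lam * (t - \<tau>)) * r ^ k)) * PK K m W s \<tau> (JJ c \<tau> (ring_term k \<tau>)) x)"
      by (intro sum.cong) auto
    moreover have "r * exp (- lam * (\<tau> - s)) * (exp (- lam * (t - \<tau>)) * r ^ k) = exp (- lam * (t - s)) * r ^ Suc k"
    proof -
      have "exp (- lam * (t - s)) = exp (- lam * (\<tau> - s)) * exp (- lam * (t - \<tau>))"
        by (simp add: exp_add[symmetric] algebra_simps)
      then show ?thesis by simp
    qed
    ultimately show "(\<Sum>c\<in>C. r * exp (- lam * (\<tau> - s)) * PK K m W s \<tau> (JJ c \<tau> (mean_on {k} \<tau>)) x) =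
       (exp (- lam * (t - s)) * r ^ Suc k) * (\<Sum>c\<in>C. PK K m W s \<tau> (JJ c \<tau> (ring_term k \<tau>)) x)"
      by (simp only: sum_distrib_left)
  qed
  finally show ?case by (simp only: tint_cmult ring_term.simps)
qed

text \<open>The bounded part of the backward generator: jumps at the rings, minus the total rate
  \<open>lam\<close> of rings and the killing W on the diagonal. The motion between rings is left to
  \<open>PE\<close>.\<close>

definition gen :: "(real \<Rightarrow> (nat \<Rightarrow> 'a) \<Rightarrow> real) \<Rightarrow> real \<Rightarrow> (nat \<Rightarrow> 'a) \<Rightarrow> real" where
  "gen w s y = r * (\<Sum>c\<in>C. JJ c s (w s) y) - (lam + W s y) * w s y"

lemma lam_nonneg: "0 \<le> lam"
  using r_pos by (simp add: lam_def)

lemma BW_nonneg: "0 \<le> BW"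
  using W by (rule bounded_tfun_bound_nonneg)

text \<open>In the constant 2 * lam + BW, one lam comes from the card C jump operators at rate r
  each, and lam + BW from the diagonal term.\<close>

lemma gen_bounded:
  assumes w: "bounded_tfun m w B" shows "bounded_tfun m (gen w) ((2 * lam + BW) * B)"
proof -
  have "bounded_tfun m (gen w) (\<bar>r\<bar> * (card C * B) + (\<bar>lam\<bar> + BW) * B)"
    unfolding gen_def[abs_def]
    by (intro bounded_tfun_diff bounded_tfun_cmult bounded_tfun_sum JJ_tfun bounded_tfun_mult bounded_tfun_add
        bounded_tfun_const W w)
  moreover have "\<bar>r\<bar> * (card C * B) + (\<bar>lam\<bar> + BW) * B = (2 * lam + BW) * B"
    using lam_nonneg r_pos by (simp add: lam_def algebra_simps)
  ultimately show ?thesis by simp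
qed

lemma gen_local:
  assumes x: "x \<in> space S" and B: "\<And>y. y \<in> space S \<Longrightarrow> \<bar>w s y\<bar> \<le> B"
  shows "\<bar>gen w s x\<bar> \<le> (2 * lam + BW) * B"
proof -
  have "\<bar>\<Sum>c\<in>C. JJ c s (w s) x\<bar> \<le> real (card C) * B"
    by (rule order_trans[OF sum_abs sum_bounded_above]) (rule JJ_bound[OF _ x B])
  then have "r * \<bar>\<Sum>c\<in>C. JJ c s (w s) x\<bar> \<le> r * (real (card C) * B)" using r_pos by (intro mult_left_mono) auto
  then have 1: "\<bar>r * (\<Sum>c\<in>C. JJ c s (w s) x)\<bar> \<le> lam * B" using r_pos by (simp add: abs_mult lam_def ac_simps)
  have "\<bar>lam + W s x\<bar> \<le> lam + BW" using bounded_tfun_le[OF W x, of s] lam_nonneg by simp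
  then have 2: "\<bar>(lam + W s x) * w s x\<bar> \<le> (lam + BW) * B"
    unfolding abs_mult using B[OF x] by (intro mult_mono) (use lam_nonneg BW_nonneg in auto)
  have "\<bar>gen w s x\<bar> \<le> lam * B + (lam + BW) * B"
    unfolding gen_def by (rule order_trans[OF abs_triangle_ineq4 add_mono[OF 1 2]])
  then show ?thesis by (simp add: algebra_simps)
qed

lemma gen_diff:
  assumes x: "x \<in> space S" and u: "bounded_tfun m u B" and v: "bounded_tfun m v B'"
  shows "gen u s x - gen v s x = gen (\<lambda>s x. u s x - v s x) s x"
proof -
  have "JJ c s (\<lambda>y. u s y - v s y) x = JJ c s (u s) x - JJ c s (v s) x" if "c \<in> C" for c
    by (rule JJ_diff[OF that x bounded_tfun_imp_fun[OF u] bounded_tfun_imp_fun[OF v]])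
  then have "(\<Sum>c\<in>C. JJ c s (\<lambda>y. u s y - v s y) x) = (\<Sum>c\<in>C. JJ c s (u s) x) - (\<Sum>c\<in>C. JJ c s (v s) x)"
    by (simp add: sum_subtractf)
  then show ?thesis unfolding gen_def by (simp only:) (simp add: algebra_simps)
qed

text \<open>For A = UNIV the renewal equation is closed, since {k. Suc k \<in> UNIV} is UNIV again.
  The survival factor is read as additional killing at the constant rate lam, and
  \<open>mild_equation\<close> removes the total killing lam + W.\<close>

lemma mean_on_UNIV_mild:
  assumes s: "0 \<le> s" "s \<le> t" and x: "x \<in> space S"
  shows "mean_on UNIV s x = PE K m s t F x + tint s t (\<lambda>\<rho>. PE K m s \<rho> (gen (mean_on UNIV) \<rho>) x)"
proof -
  let ?u = "mean_on UNIV"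
  let ?a = "\<lambda>s y. lam + W s y"
  let ?g = "\<lambda>s y. r * (\<Sum>c\<in>C. JJ c s (?u s) y)"
  have a: "bounded_tfun m ?a (\<bar>lam\<bar> + BW)" by (rule bounded_tfun_add[OF bounded_tfun_const W])
  have a0: "0 \<le> ?a v y" if "y \<in> space S" for v y using W0[OF that] lam_nonneg by simp
  have g: "bounded_tfun m ?g (\<bar>r\<bar> * (card C * BF))"
    by (intro bounded_tfun_cmult bounded_tfun_sum JJ_tfun[OF _ bounded_mean_on])
  have PKa: "PK K m ?a s \<tau> h x = exp (- lam * (\<tau> - s)) * PK K m W s \<tau> h x" if "s \<le> \<tau>" for s \<tau> h x
  proof -
    have "exp (- tint s \<tau> (\<lambda>v. lam + W v (pos m z v))) = exp (- lam * (\<tau> - s)) * exp (- tint s \<tau> (\<lambda>v. W v (pos m z v)))"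
      if z: "z \<in> space (paths m)" for z
    proof -
      have "(\<lambda>v. W v (pos m z v)) \<in> borel_measurable borel" using z by measurable
      then have "tint s \<tau> (\<lambda>v. lam + W v (pos m z v)) = tint s \<tau> (\<lambda>v. lam) + tint s \<tau> (\<lambda>v. W v (pos m z v))"
        by (intro tint_add[where B="\<bar>lam\<bar>" and B'=BW]) (use bounded_tfun_le[OF W pos_in_space] in auto)
      then show ?thesis using tint_const[OF \<open>s \<le> \<tau>\<close>, of lam] by (simp add: exp_add[symmetric])
    qed
    then have "PK K m ?a s \<tau> h x = (\<integral>z. exp (- lam * (\<tau> - s)) * (h (pos m z \<tau>) * exp (- tint s \<tau> (\<lambda>v. W v (pos m z v)))) \<partial>prod_law K m s x)"
      unfolding PK_def by (intro Bochner_Integration.integral_cong) (auto simp: prod_law_prob)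
    then show ?thesis unfolding PK_def by simp
  qed
  have PKsum: "PK K m W s \<tau> (?g \<tau>) x = r * (\<Sum>c\<in>C. PK K m W s \<tau> (JJ c \<tau> (?u \<tau>)) x)" for s \<tau> x
  proof -
    have int: "integrable (prod_law K m s x) (\<lambda>z. JJ c \<tau> (?u \<tau>) (pos m z \<tau>) * wt s \<tau> z)" if c: "c \<in> C" for c
    proof (rule integrable_prod_law[where B=BF])
      have jb: "bounded_fun m (JJ c \<tau> (?u \<tau>)) BF"
        using bounded_tfun_imp_fun[OF JJ_tfun[OF c bounded_mean_on[of UNIV]], of \<tau>] .
      note bounded_fun_measurable[OF jb, measurable]
      show "(\<lambda>z. JJ c \<tau> (?u \<tau>) (pos m z \<tau>) * wt s \<tau> z) \<in> borel_measurable (paths m)" by measurable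
      fix z
      have "\<bar>JJ c \<tau> (?u \<tau>) (pos m z \<tau>)\<bar> * wt s \<tau> z \<le> BF * 1"
        using bounded_fun_le[OF jb pos_in_space] wt_le bounded_fun_bound_nonneg[OF F] by (intro mult_mono) auto
      then show "\<bar>JJ c \<tau> (?u \<tau>) (pos m z \<tau>) * wt s \<tau> z\<bar> \<le> BF" using wt_le by (simp add: abs_mult)
    qed
    have "(\<integral>z. (\<Sum>c\<in>C. JJ c \<tau> (?u \<tau>) (pos m z \<tau>) * wt s \<tau> z) \<partial>prod_law K m s x) =
        (\<Sum>c\<in>C. PK K m W s \<tau> (JJ c \<tau> (?u \<tau>)) x)"
      unfolding PK_def wt_def[symmetric] by (rule Bochner_Integration.integral_sum) (rule int)
    then show ?thesis unfolding PK_cmult unfolding PK_def wt_def[symmetric] sum_distrib_right by simp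
  qed
  have "?u s x = PE K m s t F x + tint s t (\<lambda>\<rho>. PE K m s \<rho> (\<lambda>y. ?g \<rho> y - ?a \<rho> y * ?u \<rho> y) x)"
  proof (rule mild_equation[OF a a0 F g bounded_mean_on _ s x])
    fix s x assume s: "0 \<le> s" "s \<le> t" and x: "x \<in> space S"
    have "?u s x = exp (- lam * (t - s)) * PK K m W s t F x +
      tint s t (\<lambda>\<tau>. \<Sum>c\<in>C. r * exp (- lam * (\<tau> - s)) * PK K m W s \<tau> (JJ c \<tau> (?u \<tau>)) x)"
      using mean_on_first[OF s x, of UNIV] by simp
    also have "tint s t (\<lambda>\<tau>. \<Sum>c\<in>C. r * exp (- lam * (\<tau> - s)) * PK K m W s \<tau> (JJ c \<tau> (?u \<tau>)) x) =
        tint s t (\<lambda>\<tau>. PK K m ?a s \<tau> (?g \<tau>) x)"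
    proof (rule tint_cong)
      fix \<tau> assume \<tau>: "s \<le> \<tau>" "\<tau> \<le> t"
      show "(\<Sum>c\<in>C. r * exp (- lam * (\<tau> - s)) * PK K m W s \<tau> (JJ c \<tau> (?u \<tau>)) x) = PK K m ?a s \<tau> (?g \<tau>) x"
        unfolding PKa[OF \<tau>(1)] PKsum sum_distrib_left[symmetric] by (simp only: ac_simps)
    qed
    finally show "?u s x = PK K m ?a s t F x + tint s t (\<lambda>\<tau>. PK K m ?a s \<tau> (?g \<tau>) x)"
      using PKa[OF s(2)] by simp
  qed
  then show ?thesis unfolding gen_def[abs_def] .
qed

lemma mean_on_UNIV_unique:
  assumes v: "bounded_tfun m v B"
    and eqv: "\<And>s x. 0 \<le> s \<Longrightarrow> s \<le> t \<Longrightarrow> x \<in> space S \<Longrightarrow>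
       v s x = PE K m s t F x + tint s t (\<lambda>\<rho>. PE K m s \<rho> (gen v \<rho>) x)"
    and s: "0 \<le> s" "s \<le> t" and x: "x \<in> space S"
  shows "mean_on UNIV s x = v s x"
  by (rule mild_equation_unique[where G=gen and c="2 * lam + BW" and f="\<lambda>s x. PE K m s t F x",
        OF bounded_mean_on v gen_bounded gen_local gen_diff[OF _ bounded_mean_on v] _ mean_on_UNIV_mild eqv s x])
     (use lam_nonneg BW_nonneg in auto)

end

section \<open>The number of rings and the joint law of clocks and trajectories\<close>

context particle_system begin

lemma nrings_unique: "nrings D T \<sigma> j \<Longrightarrow> nrings D T \<sigma> k \<Longrightarrow> j = k"
  by (auto simp: nrings_def dest: ordered_list_unique)

text \<open>The first-ring recursion itself yields the Poisson law: for W = 0 and F = 1 the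
  functional is 1, and the term with k rings is \<open>(card C * (t - s)) ^ k / fact k\<close>, a
  choice of clocks times the volume of a simplex of ring times.\<close>

lemma prob_nrings:
  "measure Cl {\<sigma> \<in> space Cl. nrings C t \<sigma> k} = exp (- lam * t) * (lam * t) ^ k / fact k"
proof -
  interpret one: particle_functional K m C r J t "\<lambda>_ _. 0" "\<lambda>_. 1" 0 1
    by unfold_locales (auto simp: bounded_tfun_def bounded_fun_def)
  interpret P: prob_space Cl by (rule one.prob_Cl)
  let ?x = "\<lambda>i\<in>{..<m}. undefined :: 'a"
  have x: "?x \<in> space S" by (simp add: space_state_space)
  have PKc: "PK K m (\<lambda>_ _. 0) s \<tau> (\<lambda>_. b) y = b" for s \<tau> b y
  proof -
    interpret p: prob_space "prod_law K m s y" by (rule prod_law_prob)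
    show ?thesis by (simp add: PK_def tint_def p.prob_space)
  qed
  have JJc: "JJ c \<tau> (\<lambda>_. b) y = b" if "c \<in> C" "y \<in> space S" for c \<tau> b y
  proof -
    interpret p: prob_space "J (max 0 \<tau>) c y" using J_prob[OF that(1) _ that(2)] by auto
    show ?thesis by (simp add: JJ_def p.prob_space)
  qed
  have w: "one.ring_term k s y = real (card C) ^ k * (t - s) ^ k / fact k" if "0 \<le> s" "s \<le> t" "y \<in> space S" for s y
    using that
  proof (induction k arbitrary: s y)
    case 0
    then show ?case by (simp add: PKc)
  next
    case (Suc k)
    have "one.ring_term (Suc k) s y = tint s t (\<lambda>\<tau>. \<Sum>c\<in>C. real (card C) ^ k * (t - \<tau>) ^ k / fact k)"
      unfolding one.ring_term.simps
    proof (rule tint_cong, rule sum.cong[OF refl])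
      fix \<tau> c assume \<tau>: "s \<le> \<tau>" "\<tau> \<le> t" and c: "c \<in> C"
      have "PK K m (\<lambda>_ _. 0) s \<tau> (JJ c \<tau> (one.ring_term k \<tau>)) y = PK K m (\<lambda>_ _. 0) s \<tau> (\<lambda>_. real (card C) ^ k * (t - \<tau>) ^ k / fact k) y"
      proof (rule PK_cong)
        fix y assume y: "y \<in> space S"
        have "JJ c \<tau> (one.ring_term k \<tau>) y = JJ c \<tau> (\<lambda>_. real (card C) ^ k * (t - \<tau>) ^ k / fact k) y"
          by (rule one.JJ_cong[OF c y]) (use Suc.IH[of \<tau>] \<tau> Suc.prems in auto)
        then show "JJ c \<tau> (one.ring_term k \<tau>) y = real (card C) ^ k * (t - \<tau>) ^ k / fact k"
          unfolding JJc[OF c y] .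
      qed
      then show "PK K m (\<lambda>_ _. 0) s \<tau> (JJ c \<tau> (one.ring_term k \<tau>)) y = real (card C) ^ k * (t - \<tau>) ^ k / fact k"
        unfolding PKc .
    qed
    also have "\<dots> = tint s t (\<lambda>\<tau>. (real (card C) * real (card C) ^ k / fact k) * (t - \<tau>) ^ k)"
      by (rule tint_cong) simp
    also have "\<dots> = (real (card C) * real (card C) ^ k / fact k) * ((t - s) ^ Suc k / Suc k)"
      unfolding tint_cmult using Suc.prems by (subst tint_power) auto
    finally show ?case by (simp add: field_simps)
  qed
  have "one.phi {k} 0 \<sigma> ?x = indicator {\<sigma> \<in> space Cl. nrings C t \<sigma> k} \<sigma>" if "\<sigma> \<in> space Cl" for \<sigma>
  proof -
    have "prob_space (evolve K m J (chron 0 \<sigma>) 0 ?x)"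
      by (rule one.evolve_list_prob(1)[OF one.set_chron _ x]) auto
    then have "one.PhiC 0 \<sigma> ?x = 1"
      by (simp add: one.PhiC_def one.Phi_def one.wt_def tint_def prob_space.prob_space)
    then show ?thesis using that by (auto simp: one.phi_def one.some_nrings_def indicator_def)
  qed
  then have "one.mean_on {k} 0 ?x = (\<integral>\<sigma>. indicator {\<sigma> \<in> space Cl. nrings C t \<sigma> k} \<sigma> \<partial>Cl)"
    unfolding one.mean_on_def by (intro Bochner_Integration.integral_cong) auto
  also have "\<dots> = measure Cl {\<sigma> \<in> space Cl. nrings C t \<sigma> k}"
    unfolding Bochner_Integration.integral_indicator by (rule arg_cong[where f="measure _"]) auto
  finally have "measure Cl {\<sigma> \<in> space Cl. nrings C t \<sigma> k} = exp (- lam * t) * r ^ k * (real (card C) ^ k * t ^ k / fact k)"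
    using one.mean_on_singleton[of 0 ?x k] w[of 0 ?x] x t_pos by simp
  then show ?thesis by (simp add: lam_def power_mult_distrib)
qed

lemma sets_nrings: "{\<sigma> \<in> space Cl. nrings C t \<sigma> k} \<in> sets Cl"
  using pred_nrings[of "\<lambda>\<sigma>. \<sigma>" Cl C r "\<lambda>_. t" k] finite_C by (simp add: pred_def)

text \<open>The Poisson probabilities add up to 1, which rules out simultaneous rings and infinitely
  many rings at one stroke.\<close>

lemma AE_nrings: "AE \<sigma> in Cl. \<exists>k. nrings C t \<sigma> k"
proof -
  interpret P: prob_space Cl using r_pos by (rule prob_space_clocks)
  let ?A = "\<lambda>k. {\<sigma> \<in> space Cl. nrings C t \<sigma> k}"
  have "(\<lambda>k. P.prob (?A k)) sums P.prob (\<Union>k. ?A k)"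
    by (rule P.finite_measure_UNION) (use sets_nrings in \<open>auto simp: disjoint_family_on_def dest: nrings_unique\<close>)
  moreover have "(\<lambda>k. exp (- lam * t) * ((lam * t) ^ k / fact k)) sums (exp (- lam * t) * exp (lam * t))"
    using exp_converges[of "lam * t"] by (intro sums_mult) (simp add: divide_inverse mult.commute)
  ultimately have "P.prob (\<Union>k. ?A k) = exp (- lam * t) * exp (lam * t)"
    unfolding prob_nrings by (intro sums_unique2) auto
  then have "P.prob (\<Union>k. ?A k) = 1" by (simp add: exp_add[symmetric])
  then have "AE \<sigma> in Cl. \<sigma> \<in> (\<Union>k. ?A k)" by (rule P.AE_prob_1)
  then show ?thesis by eventually_elim auto
qed

lemma chron_0: "chron 0 \<sigma> = chronology (rings C t \<sigma>)"
  by (simp add: chron_def map_idI)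

context
  fixes \<eta>0 :: "'a measure"
  assumes eta: "prob_space \<eta>0" "sets \<eta>0 = sets borel"
begin

abbreviation "Init \<equiv> PiM {..<m} (\<lambda>_. \<eta>0)"

lemma Init_prob: "prob_space Init" "sets Init = sets S"
  using eta by (auto simp: state_space_def intro!: prob_space_PiM sets_PiM_cong)

lemma evolve_0_kernel: "(\<lambda>p. evolve K m J (chron 0 (fst p)) 0 (snd p)) \<in> Cl \<Otimes>\<^sub>M S \<rightarrow>\<^sub>M prob_algebra (paths m)"
proof -
  have "(\<lambda>p. (0, fst p, snd p)) \<in> Cl \<Otimes>\<^sub>M S \<rightarrow>\<^sub>M borel \<Otimes>\<^sub>M (Cl \<Otimes>\<^sub>M S)" by measurable
  from measurable_compose[OF this measurable_evolve_chron] show ?thesis by simp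
qed

lemma system_inner_kernel:
  "(\<lambda>p. distr (evolve K m J (chron 0 (fst p)) 0 (snd p)) (Cl \<Otimes>\<^sub>M paths m) (\<lambda>z. (fst p, z)))
    \<in> Cl \<Otimes>\<^sub>M S \<rightarrow>\<^sub>M prob_algebra (Cl \<Otimes>\<^sub>M paths m)"
  by (rule measurable_distr_prob_space2[OF evolve_0_kernel]) measurable

lemma system_kernel:
  "(\<lambda>\<sigma>. Init \<bind> (\<lambda>x. distr (evolve K m J (chronology (rings C t \<sigma>)) 0 x) (Cl \<Otimes>\<^sub>M paths m) (\<lambda>z. (\<sigma>, z))))
    \<in> Cl \<rightarrow>\<^sub>M prob_algebra (Cl \<Otimes>\<^sub>M paths m)"
  unfolding chron_0[symmetric]
proof (rule measurable_bind_prob_space2)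
  show "(\<lambda>\<sigma>. Init) \<in> Cl \<rightarrow>\<^sub>M prob_algebra S"
    using Init_prob by (intro measurable_const) (simp add: space_prob_algebra)
qed (use system_inner_kernel in \<open>simp add: case_prod_beta'\<close>)

lemma system_prob:
  "prob_space (system_law K \<eta>0 m C r J t)" "sets (system_law K \<eta>0 m C r J t) = sets (Cl \<Otimes>\<^sub>M paths m)"
proof -
  have "Cl \<in> space (prob_algebra Cl)" using prob_space_clocks[OF r_pos] by (simp add: space_prob_algebra)
  from prob_space_bind'[OF this system_kernel] sets_bind'[OF this system_kernel]
  show "prob_space (system_law K \<eta>0 m C r J t)" "sets (system_law K \<eta>0 m C r J t) = sets (Cl \<Otimes>\<^sub>M paths m)"
    unfolding system_law_def by auto
qed

lemma integral_system_law:
  fixes Psi :: "('c \<times> nat \<Rightarrow> real) \<times> (nat \<Rightarrow> real \<Rightarrow> 'a) \<Rightarrow> real"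
  assumes Psi[measurable]: "Psi \<in> borel_measurable (Cl \<Otimes>\<^sub>M paths m)"
    and B: "\<And>\<sigma> z. \<sigma> \<in> space Cl \<Longrightarrow> z \<in> space (paths m) \<Longrightarrow> \<bar>Psi (\<sigma>, z)\<bar> \<le> B"
  shows "(\<integral>\<omega>. Psi \<omega> \<partial>system_law K \<eta>0 m C r J t) =
    (\<integral>\<sigma>. \<integral>x. \<integral>z. Psi (\<sigma>, z) \<partial>evolve K m J (chron 0 \<sigma>) 0 x \<partial>Init \<partial>Cl)"
proof -
  have B': "\<bar>Psi \<omega>\<bar> \<le> B" if "\<omega> \<in> space (Cl \<Otimes>\<^sub>M paths m)" for \<omega>
    using that B by (cases \<omega>) (auto simp: space_pair_measure)
  have "(\<integral>\<omega>. Psi \<omega> \<partial>system_law K \<eta>0 m C r J t) = (\<integral>\<sigma>. \<integral>\<omega>. Psi \<omega> \<partial>(Init \<bind>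
     (\<lambda>x. distr (evolve K m J (chronology (rings C t \<sigma>)) 0 x) (Cl \<Otimes>\<^sub>M paths m) (\<lambda>z. (\<sigma>, z)))) \<partial>Cl)"
    unfolding system_law_def
    by (rule integral_bind_bounded[OF prob_space_clocks[OF r_pos] refl system_kernel Psi B'])
  also have "\<dots> = (\<integral>\<sigma>. \<integral>x. \<integral>z. Psi (\<sigma>, z) \<partial>evolve K m J (chron 0 \<sigma>) 0 x \<partial>Init \<partial>Cl)"
    unfolding chron_0[symmetric]
  proof (rule Bochner_Integration.integral_cong[OF refl])
    fix \<sigma> assume \<sigma>: "\<sigma> \<in> space Cl"
    have k: "(\<lambda>x. distr (evolve K m J (chron 0 \<sigma>) 0 x) (Cl \<Otimes>\<^sub>M paths m) (\<lambda>z. (\<sigma>, z))) \<in> S \<rightarrow>\<^sub>M prob_algebra (Cl \<Otimes>\<^sub>M paths m)"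
      using measurable_Pair2[OF system_inner_kernel \<sigma>] by simp
    have "(\<integral>\<omega>. Psi \<omega> \<partial>(Init \<bind> (\<lambda>x. distr (evolve K m J (chron 0 \<sigma>) 0 x) (Cl \<Otimes>\<^sub>M paths m) (\<lambda>z. (\<sigma>, z))))) =
      (\<integral>x. \<integral>\<omega>. Psi \<omega> \<partial>distr (evolve K m J (chron 0 \<sigma>) 0 x) (Cl \<Otimes>\<^sub>M paths m) (\<lambda>z. (\<sigma>, z)) \<partial>Init)"
      by (rule integral_bind_bounded[OF Init_prob k Psi B'])
    also have "\<dots> = (\<integral>x. \<integral>z. Psi (\<sigma>, z) \<partial>evolve K m J (chron 0 \<sigma>) 0 x \<partial>Init)"
    proof (rule Bochner_Integration.integral_cong[OF refl])
      fix x assume "x \<in> space Init"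
      then have x: "x \<in> space S" using sets_eq_imp_space_eq[OF Init_prob(2)] by simp
      have "(\<sigma>, x) \<in> space (Cl \<Otimes>\<^sub>M S)" using \<sigma> x by (simp add: space_pair_measure)
      from measurable_space[OF evolve_0_kernel this]
      have "sets (evolve K m J (chron 0 \<sigma>) 0 x) = sets (paths m)" by (simp add: space_prob_algebra)
      moreover have "(\<lambda>z. (\<sigma>, z)) \<in> paths m \<rightarrow>\<^sub>M Cl \<Otimes>\<^sub>M paths m" using \<sigma> by measurable
      ultimately show "(\<integral>\<omega>. Psi \<omega> \<partial>distr (evolve K m J (chron 0 \<sigma>) 0 x) (Cl \<Otimes>\<^sub>M paths m) (\<lambda>z. (\<sigma>, z))) =
         (\<integral>z. Psi (\<sigma>, z) \<partial>evolve K m J (chron 0 \<sigma>) 0 x)"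
        by (intro integral_distr) (auto cong: measurable_cong_sets)
    qed
    finally show "(\<integral>\<omega>. Psi \<omega> \<partial>(Init \<bind> (\<lambda>x. distr (evolve K m J (chron 0 \<sigma>) 0 x) (Cl \<Otimes>\<^sub>M paths m) (\<lambda>z. (\<sigma>, z))))) =
      (\<integral>x. \<integral>z. Psi (\<sigma>, z) \<partial>evolve K m J (chron 0 \<sigma>) 0 x \<partial>Init)" .
  qed
  finally show ?thesis .
qed

text \<open>Given the clocks, positions and trajectories follow probability kernels, so the clocks
  keep their law in the system and almost sure statements about rings carry over.\<close>

lemma measure_system_fst:
  assumes Q[measurable]: "Measurable.pred Cl Q"
  shows "measure (system_law K \<eta>0 m C r J t) {\<omega> \<in> space (system_law K \<eta>0 m C r J t). Q (fst \<omega>)} =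
    measure Cl {\<sigma> \<in> space Cl. Q \<sigma>}"
proof -
  interpret I: prob_space Init by (rule Init_prob)
  let ?L = "system_law K \<eta>0 m C r J t"
  have sp: "space ?L = space (Cl \<Otimes>\<^sub>M paths m)" using system_prob(2) by (rule sets_eq_imp_space_eq)
  have "measure ?L {\<omega> \<in> space ?L. Q (fst \<omega>)} = (\<integral>\<omega>. indicator {\<omega> \<in> space ?L. Q (fst \<omega>)} \<omega> \<partial>?L)"
    unfolding Bochner_Integration.integral_indicator by (rule arg_cong[where f="measure _"]) auto
  also have "\<dots> = (\<integral>\<omega>. indicator {\<omega> \<in> space (Cl \<Otimes>\<^sub>M paths m). Q (fst \<omega>)} \<omega> \<partial>?L)" unfolding sp ..
  also have "\<dots> = (\<integral>\<sigma>. \<integral>x. \<integral>z. indicator {\<omega> \<in> space (Cl \<Otimes>\<^sub>M paths m). Q (fst \<omega>)} (\<sigma>, z) \<partial>evolve K m J (chron 0 \<sigma>) 0 x \<partial>Init \<partial>Cl)"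
  proof (rule integral_system_law[where B=1])
    show "(indicator {\<omega> \<in> space (Cl \<Otimes>\<^sub>M paths m). Q (fst \<omega>)} :: _ \<Rightarrow> real) \<in> borel_measurable (Cl \<Otimes>\<^sub>M paths m)"
      by measurable
  qed (auto simp: indicator_def)
  also have "\<dots> = (\<integral>\<sigma>. indicator {\<sigma> \<in> space Cl. Q \<sigma>} \<sigma> \<partial>Cl)"
  proof (rule Bochner_Integration.integral_cong[OF refl])
    fix \<sigma> assume \<sigma>: "\<sigma> \<in> space Cl"
    have "(\<integral>x. \<integral>z. indicator {\<omega> \<in> space (Cl \<Otimes>\<^sub>M paths m). Q (fst \<omega>)} (\<sigma>, z) \<partial>evolve K m J (chron 0 \<sigma>) 0 x \<partial>Init) =
      (\<integral>x. (indicator {\<sigma> \<in> space Cl. Q \<sigma>} \<sigma> :: real) \<partial>Init)"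
    proof (rule Bochner_Integration.integral_cong[OF refl])
      fix x assume "x \<in> space Init"
      then have x: "x \<in> space S" using sets_eq_imp_space_eq[OF Init_prob(2)] by simp
      have "(\<sigma>, x) \<in> space (Cl \<Otimes>\<^sub>M S)" using \<sigma> x by (simp add: space_pair_measure)
      from measurable_space[OF evolve_0_kernel this]
      have e: "sets (evolve K m J (chron 0 \<sigma>) 0 x) = sets (paths m)" "prob_space (evolve K m J (chron 0 \<sigma>) 0 x)"
        by (auto simp: space_prob_algebra)
      interpret e: prob_space "evolve K m J (chron 0 \<sigma>) 0 x" by (rule e)
      have "(\<integral>z. indicator {\<omega> \<in> space (Cl \<Otimes>\<^sub>M paths m). Q (fst \<omega>)} (\<sigma>, z) \<partial>evolve K m J (chron 0 \<sigma>) 0 x) =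
        (\<integral>z. (indicator {\<sigma> \<in> space Cl. Q \<sigma>} \<sigma> :: real) \<partial>evolve K m J (chron 0 \<sigma>) 0 x)"
        using sets_eq_imp_space_eq[OF e(1)] \<sigma>
        by (intro Bochner_Integration.integral_cong) (auto simp: indicator_def space_pair_measure)
      then show "(\<integral>z. indicator {\<omega> \<in> space (Cl \<Otimes>\<^sub>M paths m). Q (fst \<omega>)} (\<sigma>, z) \<partial>evolve K m J (chron 0 \<sigma>) 0 x) =
        (indicator {\<sigma> \<in> space Cl. Q \<sigma>} \<sigma> :: real)"
        by (simp add: e.prob_space)
    qed
    then show "(\<integral>x. \<integral>z. indicator {\<omega> \<in> space (Cl \<Otimes>\<^sub>M paths m). Q (fst \<omega>)} (\<sigma>, z) \<partial>evolve K m J (chron 0 \<sigma>) 0 x \<partial>Init) =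
      (indicator {\<sigma> \<in> space Cl. Q \<sigma>} \<sigma> :: real)" by (simp add: I.prob_space)
  qed
  also have "\<dots> = measure Cl {\<sigma> \<in> space Cl. Q \<sigma>}"
    unfolding Bochner_Integration.integral_indicator by (rule arg_cong[where f="measure _"]) auto
  finally show ?thesis .
qed

lemma AE_system_nrings: "AE \<omega> in system_law K \<eta>0 m C r J t. \<exists>k. nrings C t (fst \<omega>) k"
proof -
  interpret L: prob_space "system_law K \<eta>0 m C r J t" by (rule system_prob)
  interpret P: prob_space Cl using r_pos by (rule prob_space_clocks)
  have pr: "Measurable.pred Cl (\<lambda>\<sigma>. \<exists>k. nrings C t \<sigma> k)"
    by (intro pred_intros_countable pred_nrings[where r=r]) (use finite_C in auto)
  then have "{\<sigma> \<in> space Cl. \<exists>k. nrings C t \<sigma> k} \<in> sets Cl" by (simp add: pred_def)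
  then have "measure Cl {\<sigma> \<in> space Cl. \<exists>k. nrings C t \<sigma> k} = 1"
    using AE_nrings by (subst P.prob_eq_1) auto
  then have "AE \<omega> in system_law K \<eta>0 m C r J t. \<omega> \<in> {\<omega> \<in> space (system_law K \<eta>0 m C r J t). \<exists>k. nrings C t (fst \<omega>) k}"
    using measure_system_fst[OF pr] by (intro L.AE_prob_1) simp
  then show ?thesis by eventually_elim auto
qed

end

end

context particle_functional begin

lemma integral_system_mean_on:
  assumes eta: "prob_space \<eta>0" "sets \<eta>0 = sets borel"
  shows "(\<integral>\<omega>. (if some_nrings A t (fst \<omega>) then F (pos m (snd \<omega>) t) * wt 0 t (snd \<omega>) else 0) \<partial>system_law K \<eta>0 m C r J t)
    = (\<integral>x. mean_on A 0 x \<partial>PiM {..<m} (\<lambda>_. \<eta>0))"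
proof -
  let ?I = "PiM {..<m} (\<lambda>_. \<eta>0)"
  note I = Init_prob[OF eta]
  have [measurable]: "(\<lambda>\<omega>. F (pos m (snd \<omega>) t) * wt 0 t (snd \<omega>)) \<in> borel_measurable (Cl \<Otimes>\<^sub>M paths m)" by measurable
  have mp: "Measurable.pred (Cl \<Otimes>\<^sub>M paths m) (\<lambda>\<omega>. some_nrings A t (fst \<omega>))" by measurable
  define Psi where "Psi \<omega> = (if some_nrings A t (fst \<omega>) then F (pos m (snd \<omega>) t) * wt 0 t (snd \<omega>) else 0)"
    for \<omega> :: "('c \<times> nat \<Rightarrow> real) \<times> (nat \<Rightarrow> real \<Rightarrow> 'a)"
  have "(\<integral>\<omega>. Psi \<omega> \<partial>system_law K \<eta>0 m C r J t) = (\<integral>\<sigma>. \<integral>x. \<integral>z. Psi (\<sigma>, z) \<partial>evolve K m J (chron 0 \<sigma>) 0 x \<partial>?I \<partial>Cl)"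
  proof (rule integral_system_law[OF eta, where B=BF])
    show "Psi \<in> borel_measurable (Cl \<Otimes>\<^sub>M paths m)"
      unfolding Psi_def[abs_def] using mp by measurable
  qed (use F_wt_bound bounded_fun_bound_nonneg[OF F] in \<open>auto simp: Psi_def\<close>)
  also have "\<dots> = (\<integral>\<sigma>. \<integral>x. phi A 0 \<sigma> x \<partial>?I \<partial>Cl)"
  proof (intro Bochner_Integration.integral_cong refl)
    fix \<sigma> x
    show "(\<integral>z. Psi (\<sigma>, z) \<partial>evolve K m J (chron 0 \<sigma>) 0 x) = phi A 0 \<sigma> x"
      by (cases "some_nrings A t \<sigma>") (simp_all add: Psi_def phi_def PhiC_def Phi_def)
  qed
  also have "\<dots> = (\<integral>x. \<integral>\<sigma>. phi A 0 \<sigma> x \<partial>Cl \<partial>?I)"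
  proof (rule integral_kernel_swap[OF prob_Cl _ phi_bound I])
    show "(\<lambda>(\<sigma>, x). phi A 0 \<sigma> x) \<in> borel_measurable (Cl \<Otimes>\<^sub>M S)"
      unfolding case_prod_beta' by measurable
  qed
  finally show ?thesis unfolding mean_on_def Psi_def .
qed

lemma integral_system_UNIV:
  assumes eta: "prob_space \<eta>0" "sets \<eta>0 = sets borel"
  shows "(\<integral>\<omega>. F (pos m (snd \<omega>) t) * wt 0 t (snd \<omega>) \<partial>system_law K \<eta>0 m C r J t) = (\<integral>x. mean_on UNIV 0 x \<partial>PiM {..<m} (\<lambda>_. \<eta>0))"
proof -
  have m1: "(\<lambda>\<omega>. F (pos m (snd \<omega>) t) * wt 0 t (snd \<omega>)) \<in> borel_measurable (Cl \<Otimes>\<^sub>M paths m)" by measurable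
  have mp: "Measurable.pred (Cl \<Otimes>\<^sub>M paths m) (\<lambda>\<omega>. some_nrings UNIV t (fst \<omega>))" by measurable
  have m2: "(\<lambda>\<omega>. if some_nrings UNIV t (fst \<omega>) then F (pos m (snd \<omega>) t) * wt 0 t (snd \<omega>) else 0) \<in> borel_measurable (Cl \<Otimes>\<^sub>M paths m)"
    using m1 mp by measurable
  note c = measurable_cong_sets[OF system_prob(2)[OF eta] refl]
  show ?thesis
    unfolding integral_system_mean_on[OF eta, symmetric]
  proof (rule integral_cong_AE)
    show "AE \<omega> in system_law K \<eta>0 m C r J t. F (pos m (snd \<omega>) t) * wt 0 t (snd \<omega>) =
       (if some_nrings UNIV t (fst \<omega>) then F (pos m (snd \<omega>) t) * wt 0 t (snd \<omega>) else 0)"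
      using AE_system_nrings[OF eta] by eventually_elim (auto simp: some_nrings_def)
  qed (use m1 m2 in \<open>simp_all only: c\<close>)
qed

text \<open>The number of rings is unique, so for each outcome at most one term of the series is
  nonzero. The integrated norms are at most BF times the Poisson weights, which permits integration
  term by term.\<close>

lemma integral_system_sums:
  assumes eta: "prob_space \<eta>0" "sets \<eta>0 = sets borel"
  shows "(\<lambda>k. \<integral>x. mean_on {k} 0 x \<partial>PiM {..<m} (\<lambda>_. \<eta>0)) sums (\<integral>x. mean_on UNIV 0 x \<partial>PiM {..<m} (\<lambda>_. \<eta>0))"
proof -
  let ?L = "system_law K \<eta>0 m C r J t"
  interpret L: prob_space ?L by (rule system_prob[OF eta])
  note c = measurable_cong_sets[OF system_prob(2)[OF eta] refl]
  define f where "f A \<omega> = (if some_nrings A t (fst \<omega>) then F (pos m (snd \<omega>) t) * wt 0 t (snd \<omega>) else 0)"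
    for A and \<omega> :: "('c \<times> nat \<Rightarrow> real) \<times> (nat \<Rightarrow> real \<Rightarrow> 'a)"
  have BF0: "0 \<le> BF" using F by (rule bounded_fun_bound_nonneg)
  have fm: "f A \<in> borel_measurable ?L" for A
  proof -
    have m1[measurable]: "(\<lambda>\<omega>. F (pos m (snd \<omega>) t) * wt 0 t (snd \<omega>)) \<in> borel_measurable (Cl \<Otimes>\<^sub>M paths m)" by measurable
    have mp[measurable]: "Measurable.pred (Cl \<Otimes>\<^sub>M paths m) (\<lambda>\<omega>. some_nrings A t (fst \<omega>))" by measurable
    have "f A \<in> borel_measurable (Cl \<Otimes>\<^sub>M paths m)" unfolding f_def[abs_def] by measurable
    then show ?thesis by (simp only: c)
  qed
  have fb: "\<bar>f A \<omega>\<bar> \<le> BF" for A \<omega> using F_wt_bound BF0 by (auto simp: f_def)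
  have sing: "f {k} \<omega> = (if nrings C t (fst \<omega>) k then f UNIV \<omega> else 0)" for k \<omega>
    by (auto simp: f_def some_nrings_def)
  have sm: "(\<lambda>k. f {k} \<omega>) sums f UNIV \<omega>" for \<omega>
  proof (cases "\<exists>k. nrings C t (fst \<omega>) k")
    case True
    then obtain k where k: "nrings C t (fst \<omega>) k" ..
    have iff: "nrings C t (fst \<omega>) j \<longleftrightarrow> j = k" for j
      using k nrings_unique by blast
    have "f {j} \<omega> = (if j = k then f UNIV \<omega> else 0)" for j
      unfolding sing iff ..
    then show ?thesis using sums_single[of k "\<lambda>_. f UNIV \<omega>"] by simp
  next
    case False
    then have "f UNIV \<omega> = 0" "\<And>k. f {k} \<omega> = 0" by (auto simp: f_def some_nrings_def)
    then show ?thesis by simp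
  qed
  have smn: "summable (\<lambda>k. norm (f {k} \<omega>))" for \<omega>
  proof (cases "\<exists>k. nrings C t (fst \<omega>) k")
    case True
    then obtain k where k: "nrings C t (fst \<omega>) k" ..
    have iff: "nrings C t (fst \<omega>) j \<longleftrightarrow> j = k" for j
      using k nrings_unique by blast
    have "norm (f {j} \<omega>) = (if j = k then norm (f UNIV \<omega>) else 0)" for j
      unfolding sing iff by simp
    then show ?thesis using sums_single[of k "\<lambda>_. norm (f UNIV \<omega>)"] by (simp add: sums_iff)
  next
    case False
    then have "f {k} \<omega> = 0" for k by (auto simp: f_def some_nrings_def)
    then show ?thesis by simp
  qed
  have fi: "integrable ?L (f A)" for A
    by (rule prob_integrable_bounded[OF system_prob(1)[OF eta] fm fb])
  have nb: "\<bar>\<integral>\<omega>. norm (f {k} \<omega>) \<partial>?L\<bar> \<le> BF * (exp (- lam * t) * (lam * t) ^ k / fact k)" for k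
  proof -
    have pr: "Measurable.pred Cl (\<lambda>\<sigma>. nrings C t \<sigma> k)"
      by (intro pred_nrings[where r=r]) (use finite_C in auto)
    have A: "{\<omega> \<in> space ?L. nrings C t (fst \<omega>) k} \<in> sets ?L"
    proof -
      have "Measurable.pred (Cl \<Otimes>\<^sub>M paths m) (\<lambda>\<omega>. nrings C t (fst \<omega>) k)" using pr by measurable
      then show ?thesis using system_prob(2)[OF eta] sets_eq_imp_space_eq[OF system_prob(2)[OF eta]] by (simp add: pred_def)
    qed
    have "(\<integral>\<omega>. norm (f {k} \<omega>) \<partial>?L) \<le> (\<integral>\<omega>. BF * indicator {\<omega> \<in> space ?L. nrings C t (fst \<omega>) k} \<omega> \<partial>?L)"
    proof (rule integral_mono)
      show "integrable ?L (\<lambda>\<omega>. norm (f {k} \<omega>))" using fi by (rule integrable_norm)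
      show "integrable ?L (\<lambda>\<omega>. BF * indicator {\<omega> \<in> space ?L. nrings C t (fst \<omega>) k} \<omega>)"
        using A by (intro integrable_mult_right) (simp add: L.emeasure_eq_measure)
    qed (use fb in \<open>auto simp: sing indicator_def\<close>)
    also have "\<dots> = BF * measure ?L {\<omega> \<in> space ?L. nrings C t (fst \<omega>) k}"
      using A by (simp add: Int_absorb2 sets.sets_into_space)
    also have "\<dots> = BF * (exp (- lam * t) * (lam * t) ^ k / fact k)"
      unfolding measure_system_fst[OF eta pr] prob_nrings ..
    finally show ?thesis by simp
  qed
  have "(\<lambda>k. \<integral>\<omega>. f {k} \<omega> \<partial>?L) sums (\<integral>\<omega>. (\<Sum>k. f {k} \<omega>) \<partial>?L)"
  proof (rule sums_integral[OF fi])
    show "AE \<omega> in ?L. summable (\<lambda>k. norm (f {k} \<omega>))" using smn by simp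
    have "summable (\<lambda>k. BF * exp (- lam * t) * ((lam * t) ^ k / fact k))"
      by (intro summable_mult) (use summable_exp[of "lam * t"] in \<open>simp add: divide_inverse mult.commute\<close>)
    then show "summable (\<lambda>k. \<integral>\<omega>. norm (f {k} \<omega>) \<partial>?L)"
      by (rule summable_comparison_test'[where N=0]) (use nb in \<open>simp add: mult.assoc\<close>)
  qed
  moreover have "(\<Sum>k. f {k} \<omega>) = f UNIV \<omega>" for \<omega> using sm by (rule sums_unique[symmetric])
  ultimately have "(\<lambda>k. \<integral>\<omega>. f {k} \<omega> \<partial>?L) sums (\<integral>\<omega>. f UNIV \<omega> \<partial>?L)" by simp
  then show ?thesis
    unfolding f_def integral_system_mean_on[OF eta] .
qed

lemma integral_mean_on_bound:
  assumes eta: "prob_space \<eta>0" "sets \<eta>0 = sets borel"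
  shows "\<bar>\<integral>x. mean_on {k} 0 x \<partial>PiM {..<m} (\<lambda>_. \<eta>0)\<bar> \<le> BF * (exp (- lam * t) * (lam * t) ^ k / fact k)"
proof (rule prob_integral_abs_le[OF Init_prob(1)[OF eta]])
  fix x assume "x \<in> space (PiM {..<m} (\<lambda>_. \<eta>0))"
  then have x: "x \<in> space S" using sets_eq_imp_space_eq[OF Init_prob(2)[OF eta]] by simp
  interpret P: prob_space Cl by (rule prob_Cl)
  have "\<bar>mean_on {k} 0 x\<bar> \<le> (\<integral>\<sigma>. \<bar>phi {k} 0 \<sigma> x\<bar> \<partial>Cl)"
    unfolding mean_on_def by (rule integral_abs_bound)
  also have "\<dots> \<le> (\<integral>\<sigma>. BF * indicator {\<sigma> \<in> space Cl. nrings C t \<sigma> k} \<sigma> \<partial>Cl)"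
  proof (rule integral_mono)
    show "integrable Cl (\<lambda>\<sigma>. \<bar>phi {k} 0 \<sigma> x\<bar>)"
      by (rule prob_integrable_bounded[OF prob_Cl, where B=BF]) (use x phi_bound[OF x] in auto)
    show "integrable Cl (\<lambda>\<sigma>. BF * indicator {\<sigma> \<in> space Cl. nrings C t \<sigma> k} \<sigma>)"
      using sets_nrings by (intro integrable_mult_right) (simp add: P.emeasure_eq_measure)
  qed (use PhiC_bound[OF x] bounded_fun_bound_nonneg[OF F] in \<open>auto simp: phi_def some_nrings_def indicator_def\<close>)
  also have "\<dots> = BF * (exp (- lam * t) * (lam * t) ^ k / fact k)"
    using sets_nrings by (simp add: Int_absorb2 sets.sets_into_space prob_nrings)
  finally show "\<bar>mean_on {k} 0 x\<bar> \<le> BF * (exp (- lam * t) * (lam * t) ^ k / fact k)" .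
qed

end

section \<open>Comparison of the generators of the two particle systems\<close>

definition injections :: "nat \<Rightarrow> nat \<Rightarrow> (nat \<Rightarrow> nat) set" where
  "injections q N = {s \<in> {..<q} \<rightarrow>\<^sub>E {..<N}. inj_on s {..<q}}"

definition sel :: "nat \<Rightarrow> (nat \<Rightarrow> nat) \<Rightarrow> (nat \<Rightarrow> 'b) \<Rightarrow> nat \<Rightarrow> 'b" where
  "sel q s y = (\<lambda>j\<in>{..<q}. y (s j))"

lemma finite_injections: "finite (injections q N)"
  unfolding injections_def by (rule finite_subset[of _ "{..<q} \<rightarrow>\<^sub>E {..<N}"]) (auto intro: finite_PiE)

lemma card_injections: "q \<le> N \<Longrightarrow> real (card (injections q N)) = fact N / fact (N - q)"
proof -
  assume q: "q \<le> N"
  have "card (injections q N) = prod ((-) N) {0..<q}"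
    unfolding injections_def using card_inj_on_subset_funcset[of "{..<q}" "{..<N}" "{..<q}"] by simp
  also have "real \<dots> = fact N / fact (N - q)"
    using q
  proof (induction q)
    case (Suc q)
    have "fact (N - q) = real (N - q) * fact (N - Suc q)"
      using Suc.prems fact_reduce[of "N - q", where ?'a=real] by (simp add: Suc_diff_Suc)
    moreover have "real (N - q) \<noteq> 0" using Suc.prems by simp
    ultimately show ?case using Suc by simp
  qed simp
  finally show ?thesis .
qed

lemma injections_lt: "s \<in> injections q N \<Longrightarrow> a < q \<Longrightarrow> s a < N"
  by (auto simp: injections_def PiE_def)

lemma injections_inj: "s \<in> injections q N \<Longrightarrow> a < q \<Longrightarrow> b < q \<Longrightarrow> s a = s b \<longleftrightarrow> a = b"
  by (auto simp: injections_def inj_on_def)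

lemma sel_upd:
  assumes s: "s \<in> injections q N"
  shows "a < q \<Longrightarrow> sel q s (y(s a := z)) = (sel q s y)(a := z)"
    and "i \<notin> s ` {..<q} \<Longrightarrow> sel q s (y(i := z)) = sel q s y"
  using injections_inj[OF s] by (auto simp: sel_def fun_eq_iff)

text \<open>At most one slot a holds the particle i. Written as a sum over slots, the change allows
  the later sum over i to collapse to i = s a.\<close>

lemma sum_sel_upd:
  fixes u :: "(nat \<Rightarrow> 'b) \<Rightarrow> real"
  assumes s: "s \<in> injections q N"
  shows "u (sel q s (y(i := z))) - u (sel q s y) = (\<Sum>a<q. if s a = i then u ((sel q s y)(a := z)) - u (sel q s y) else 0)"
proof (cases "i \<in> s ` {..<q}")
  case True
  then obtain a where a: "a < q" "i = s a" by auto
  have "(\<Sum>b<q. if s b = i then u ((sel q s y)(b := z)) - u (sel q s y) else 0) =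
     (\<Sum>b<q. if b = a then u ((sel q s y)(b := z)) - u (sel q s y) else 0)"
    by (rule sum.cong) (use injections_inj[OF s] a in auto)
  then show ?thesis using a(1) sel_upd(1)[OF s a(1), of y z] by (simp add: a(2))
next
  case False
  then have "(\<Sum>b<q. if s b = i then u ((sel q s y)(b := z)) - u (sel q s y) else 0) = 0"
    by (intro sum.neutral) auto
  then show ?thesis using sel_upd(2)[OF s False, of y z] by simp
qed

text \<open>The map (s, j) \<mapsto> (s(a := j), s a) exchanges the particle in slot a with the
  unselected particle j. It is an involution on the pairs of an injection and an unselected
  particle. Under it the configuration after a jump onto j becomes an undisturbed selection, and the
  potential passes from the jumping particle to the unselected one.\<close>

lemma injection_swap:
  fixes V :: "nat \<Rightarrow> real" and u :: "(nat \<Rightarrow> 'b) \<Rightarrow> real"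
  assumes a: "a < q"
  shows "(\<Sum>s\<in>injections q N. \<Sum>j\<in>{..<N} - s ` {..<q}. V (s a) * u ((sel q s y)(a := y j))) =
    (\<Sum>s\<in>injections q N. \<Sum>j\<in>{..<N} - s ` {..<q}. V j * u (sel q s y))"
proof -
  let ?X = "SIGMA s:injections q N. {..<N} - s ` {..<q}"
  have step: "(s(a := j), s a) \<in> ?X \<and> (s(a := j))(a := s a) = s" if "(s, j) \<in> ?X" for s j
  proof -
    have s: "s \<in> injections q N" and j: "j < N" "j \<notin> s ` {..<q}" using that by auto
    have "s(a := j) \<in> injections q N"
      using s j a by (auto simp: injections_def PiE_def extensional_def inj_on_def)
    moreover have "s a < N" using injections_lt[OF s a] .
    moreover have "s a \<notin> (s(a := j)) ` {..<q}" using injections_inj[OF s a] a j by (auto split: if_splits)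
    ultimately show ?thesis by auto
  qed
  have "(\<Sum>(s, j)\<in>?X. V (s a) * u ((sel q s y)(a := y j))) = (\<Sum>(s, j)\<in>?X. V j * u (sel q s y))"
  proof (rule sum.reindex_bij_witness[where i="\<lambda>(s, j). (s(a := j), s a)" and j="\<lambda>(s, j). (s(a := j), s a)"])
    fix p assume p: "p \<in> ?X"
    obtain s j where sj: "p = (s, j)" by (cases p)
    have "sel q (s(a := j)) y = (sel q s y)(a := y j)" using a by (auto simp: sel_def fun_eq_iff)
    then show "(case (case p of (s, j) \<Rightarrow> (s(a := j), s a)) of (s, j) \<Rightarrow> V j * u (sel q s y)) =
        (case p of (s, j) \<Rightarrow> V (s a) * u ((sel q s y)(a := y j)))" by (simp add: sj)
    show "(case p of (s, j) \<Rightarrow> (s(a := j), s a)) \<in> ?X" using step[of s j] p unfolding sj prod.case by blast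
    then show "(case p of (s, j) \<Rightarrow> (s(a := j), s a)) \<in> ?X" .
  qed auto
  then show ?thesis by (simp add: sum.Sigma finite_injections)
qed

text \<open>A jump of i changes only the selections that contain i. Selected targets give the jumps
  of the auxiliary system. Unselected targets give, after \<open>injection_swap\<close> and for each
  slot, the potential of all unselected particles minus (N - q) times that of the slot. Over all
  slots this is q (SV - Vs) - (N - q) Vs = q SV - N Vs, and division by N replaces the weight q SV /
  N by Vs.\<close>

lemma generator_identity:
  fixes V :: "'b \<Rightarrow> real" and u :: "(nat \<Rightarrow> 'b) \<Rightarrow> real" and y :: "nat \<Rightarrow> 'b"
  assumes N: "0 < N" "q \<le> N"
  defines "G \<equiv> \<lambda>y. \<Sum>s\<in>injections q N. u (sel q s y)"
  shows "(\<Sum>i<N. V (y i) * ((\<Sum>j<N. G (y(i := y j))) / N - G y)) - (q * (\<Sum>i<N. V (y i)) / N) * G y =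
    (\<Sum>s\<in>injections q N. 1 / N * (\<Sum>(a, b)\<in>aux_clocks q. V (sel q s y a) * (u ((sel q s y)(a := sel q s y b)) - u (sel q s y)))
       - (\<Sum>a<q. V (sel q s y a)) * u (sel q s y))"
proof -
  let ?I = "injections q N"
  define d where "d s a z = u ((sel q s y)(a := z)) - u (sel q s y)" for s a z
  define SV where "SV = (\<Sum>i<N. V (y i))"
  define Vs where "Vs s = (\<Sum>a<q. V (y (s a)))" for s
  define Au where "Au s = (\<Sum>(a, b)\<in>aux_clocks q. V (y (s a)) * d s a (y (s b)))" for s
  define T where "T = (\<Sum>i<N. \<Sum>j<N. V (y i) * (G (y(i := y j)) - G y))"
  define R where "R s = {..<N} - s ` {..<q}" for s :: "nat \<Rightarrow> nat"
  have selv: "sel q s y a = y (s a)" if "a < q" for s a using that by (simp add: sel_def)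
  have cardR: "real (card (R s)) = real N - real q" and SVR: "(\<Sum>j\<in>R s. V (y j)) = SV - Vs s"
    and split: "\<And>f :: nat \<Rightarrow> real. (\<Sum>j<N. f j) = (\<Sum>b<q. f (s b)) + (\<Sum>j\<in>R s. f j)" if s: "s \<in> ?I" for s
  proof -
    have inj: "inj_on s {..<q}" using s by (simp add: injections_def)
    have sub: "s ` {..<q} \<subseteq> {..<N}" using injections_lt[OF s] by auto
    show sp: "(\<Sum>j<N. f j) = (\<Sum>b<q. f (s b)) + (\<Sum>j\<in>R s. f j)" for f :: "nat \<Rightarrow> real"
      using sum.subset_diff[OF sub, of f] sum.reindex[OF inj, of f] by (simp add: R_def)
    show "(\<Sum>j\<in>R s. V (y j)) = SV - Vs s" using sp[of "\<lambda>j. V (y j)"] by (simp add: SV_def Vs_def)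
    show "real (card (R s)) = real N - real q" using sp[of "\<lambda>_. 1"] by simp
  qed
  have "T = (\<Sum>i<N. \<Sum>j<N. \<Sum>s\<in>?I. \<Sum>a<q. if s a = i then V (y i) * d s a (y j) else 0)"
    unfolding T_def
  proof (intro sum.cong refl)
    fix i j
    have "G (y(i := y j)) - G y = (\<Sum>s\<in>?I. \<Sum>a<q. if s a = i then d s a (y j) else 0)"
      unfolding G_def d_def sum_subtractf[symmetric] by (intro sum.cong refl sum_sel_upd)
    then show "V (y i) * (G (y(i := y j)) - G y) = (\<Sum>s\<in>?I. \<Sum>a<q. if s a = i then V (y i) * d s a (y j) else 0)"
      by (simp add: sum_distrib_left if_distrib cong: if_cong)
  qed
  also have "\<dots> = (\<Sum>s\<in>?I. \<Sum>a<q. \<Sum>j<N. \<Sum>i<N. if s a = i then V (y i) * d s a (y j) else 0)"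
    by (subst sum.swap, subst sum.swap[of _ "{..<N}" "{..<N}"], subst sum.swap[of _ ?I "{..<N}"])
       (simp only: sum.swap[of _ "{..<q}" "{..<N}"] sum.swap[of _ ?I "{..<N}"])
  also have "\<dots> = (\<Sum>s\<in>?I. \<Sum>a<q. \<Sum>j<N. V (y (s a)) * d s a (y j))"
    by (intro sum.cong refl) (use injections_lt in auto)
  also have "\<dots> = (\<Sum>s\<in>?I. Au s + (\<Sum>a<q. \<Sum>j\<in>R s. V (y (s a)) * d s a (y j)))"
  proof (rule sum.cong[OF refl])
    fix s assume s: "s \<in> ?I"
    \<comment> \<open>A selected particle that jumps onto itself changes nothing, so the diagonal a
      = b may be added to the ordered pairs of distinct slots.\<close>
    have d0: "d s a (y (s a)) = 0" if "a < q" for a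
      using that by (simp add: d_def) (simp add: sel_def fun_upd_idem)
    have "(\<Sum>a<q. \<Sum>b<q. V (y (s a)) * d s a (y (s b))) = (\<Sum>(a, b)\<in>{..<q} \<times> {..<q}. V (y (s a)) * d s a (y (s b)))"
      by (rule sum.cartesian_product)
    also have "\<dots> = Au s"
      unfolding Au_def by (rule sum.mono_neutral_right) (auto simp: aux_clocks_def d0)
    finally show "(\<Sum>a<q. \<Sum>j<N. V (y (s a)) * d s a (y j)) = Au s + (\<Sum>a<q. \<Sum>j\<in>R s. V (y (s a)) * d s a (y j))"
      by (simp add: split[OF s] sum.distrib)
  qed
  also have "\<dots> = (\<Sum>s\<in>?I. Au s) + (\<Sum>a<q. \<Sum>s\<in>?I. \<Sum>j\<in>R s. V (y (s a)) * d s a (y j))"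
    by (simp add: sum.distrib sum.swap[of _ "{..<q}" ?I])
  also have "(\<Sum>a<q. \<Sum>s\<in>?I. \<Sum>j\<in>R s. V (y (s a)) * d s a (y j)) =
     (\<Sum>a<q. \<Sum>s\<in>?I. u (sel q s y) * ((SV - Vs s) - (real N - real q) * V (y (s a))))"
  proof (rule sum.cong[OF refl])
    fix a assume "a \<in> {..<q}"
    then have a: "a < q" by simp
    have "(\<Sum>s\<in>?I. \<Sum>j\<in>R s. V (y (s a)) * d s a (y j)) =
      (\<Sum>s\<in>?I. \<Sum>j\<in>R s. V (y (s a)) * u ((sel q s y)(a := y j))) - (\<Sum>s\<in>?I. \<Sum>j\<in>R s. V (y (s a)) * u (sel q s y))"
      by (simp add: d_def right_diff_distrib sum_subtractf)
    also have "(\<Sum>s\<in>?I. \<Sum>j\<in>R s. V (y (s a)) * u ((sel q s y)(a := y j))) = (\<Sum>s\<in>?I. \<Sum>j\<in>R s. V (y j) * u (sel q s y))"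
      unfolding R_def using injection_swap[OF a, of "\<lambda>i. V (y i)"] .
    also have "\<dots> - (\<Sum>s\<in>?I. \<Sum>j\<in>R s. V (y (s a)) * u (sel q s y)) =
      (\<Sum>s\<in>?I. u (sel q s y) * ((SV - Vs s) - (real N - real q) * V (y (s a))))"
    proof (subst sum_subtractf[symmetric], rule sum.cong[OF refl])
      fix s assume s: "s \<in> ?I"
      have "(\<Sum>j\<in>R s. V (y j) * u (sel q s y)) = (SV - Vs s) * u (sel q s y)"
        unfolding sum_distrib_right[symmetric] SVR[OF s] ..
      then show "(\<Sum>j\<in>R s. V (y j) * u (sel q s y)) - (\<Sum>j\<in>R s. V (y (s a)) * u (sel q s y)) =
          u (sel q s y) * ((SV - Vs s) - (real N - real q) * V (y (s a)))"
        by (simp add: cardR[OF s] algebra_simps)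
    qed
    finally show "(\<Sum>s\<in>?I. \<Sum>j\<in>R s. V (y (s a)) * d s a (y j)) =
      (\<Sum>s\<in>?I. u (sel q s y) * ((SV - Vs s) - (real N - real q) * V (y (s a))))" .
  qed
  also have "\<dots> = (\<Sum>s\<in>?I. u (sel q s y) * (q * (SV - Vs s) - (real N - real q) * Vs s))"
  proof (subst sum.swap, rule sum.cong[OF refl])
    fix s
    show "(\<Sum>a<q. u (sel q s y) * ((SV - Vs s) - (real N - real q) * V (y (s a)))) =
        u (sel q s y) * (q * (SV - Vs s) - (real N - real q) * Vs s)"
      unfolding sum_distrib_left[symmetric] sum_subtractf by (simp add: Vs_def algebra_simps)
  qed
  also have "\<dots> = q * SV * G y - N * (\<Sum>s\<in>?I. Vs s * u (sel q s y))"
    unfolding G_def sum_distrib_left sum_subtractf[symmetric]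
    by (rule sum.cong[OF refl]) (simp add: algebra_simps)
  finally have T: "T = (\<Sum>s\<in>?I. Au s) + (q * SV * G y - N * (\<Sum>s\<in>?I. Vs s * u (sel q s y)))" .
  have L: "(\<Sum>i<N. V (y i) * ((\<Sum>j<N. G (y(i := y j))) / N - G y)) = T / N"
    unfolding T_def sum_divide_distrib
    by (rule sum.cong[OF refl])
       (use N in \<open>simp add: sum_distrib_left[symmetric] sum_subtractf sum_divide_distrib[symmetric] field_simps\<close>)
  have RR: "(\<Sum>s\<in>?I. 1 / N * (\<Sum>(a, b)\<in>aux_clocks q. V (sel q s y a) * (u ((sel q s y)(a := sel q s y b)) - u (sel q s y)))
       - (\<Sum>a<q. V (sel q s y a)) * u (sel q s y)) = (\<Sum>s\<in>?I. 1 / N * Au s - Vs s * u (sel q s y))"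
  proof (rule sum.cong[OF refl])
    fix s
    have "(\<Sum>(a, b)\<in>aux_clocks q. V (sel q s y a) * (u ((sel q s y)(a := sel q s y b)) - u (sel q s y))) = Au s"
      unfolding Au_def d_def by (rule sum.cong) (auto simp: aux_clocks_def selv)
    moreover have "(\<Sum>a<q. V (sel q s y a)) = Vs s" unfolding Vs_def by (rule sum.cong) (auto simp: selv)
    ultimately show "1 / N * (\<Sum>(a, b)\<in>aux_clocks q. V (sel q s y a) * (u ((sel q s y)(a := sel q s y b)) - u (sel q s y)))
       - (\<Sum>a<q. V (sel q s y a)) * u (sel q s y) = 1 / N * Au s - Vs s * u (sel q s y)" by simp
  qed
  have "T / N - (q * SV / N) * G y = (\<Sum>s\<in>?I. 1 / N * Au s - Vs s * u (sel q s y))"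
    unfolding T sum_subtractf sum_distrib_left[symmetric] using N by (simp add: field_simps)
  then show ?thesis unfolding L RR SV_def .
qed

section \<open>The jump kernels\<close>

text \<open>The mass of a set is a combination of two indicators with weights h and 1 - h, hence
  measurable in w.\<close>

lemma measurable_bernoulli_kernel:
  assumes h[measurable]: "h \<in> borel_measurable M" and h01: "\<And>w. w \<in> space M \<Longrightarrow> 0 \<le> h w \<and> h w \<le> 1"
    and f[measurable]: "f \<in> M \<rightarrow>\<^sub>M R" and g[measurable]: "g \<in> M \<rightarrow>\<^sub>M R"
  shows "(\<lambda>w. distr (measure_pmf (bernoulli_pmf (h w))) R (\<lambda>b. if b then f w else g w)) \<in> M \<rightarrow>\<^sub>M prob_algebra R"
proof (rule measurable_prob_algebraI)
  have m: "(\<lambda>b. if b then f w else g w) \<in> measure_pmf p \<rightarrow>\<^sub>M R" if "w \<in> space M" for w p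
    using measurable_space[OF f that] measurable_space[OF g that] by simp
  show "prob_space (distr (measure_pmf (bernoulli_pmf (h w))) R (\<lambda>b. if b then f w else g w))" if "w \<in> space M" for w
    by (rule prob_space.prob_space_distr[OF _ m[OF that]]) (rule measure_pmf.prob_space_axioms)
  then have sp: "subprob_space (distr (measure_pmf (bernoulli_pmf (h w))) R (\<lambda>b. if b then f w else g w))" if "w \<in> space M" for w
    using that by (intro prob_space_imp_subprob_space)
  show "(\<lambda>w. distr (measure_pmf (bernoulli_pmf (h w))) R (\<lambda>b. if b then f w else g w)) \<in> M \<rightarrow>\<^sub>M subprob_algebra R"
  proof (rule measurable_subprob_algebra[OF sp])
    fix A assume A[measurable]: "A \<in> sets R"
    have "emeasure (distr (measure_pmf (bernoulli_pmf (h w))) R (\<lambda>b. if b then f w else g w)) A =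
      indicator A (f w) * ennreal (h w) + indicator A (g w) * ennreal (1 - h w)" if w: "w \<in> space M" for w
    proof -
      have "emeasure (distr (measure_pmf (bernoulli_pmf (h w))) R (\<lambda>b. if b then f w else g w)) A =
        (\<integral>\<^sup>+b. indicator A (if b then f w else g w) \<partial>measure_pmf (bernoulli_pmf (h w)))"
        by (subst nn_integral_indicator[symmetric], simp, subst nn_integral_distr[OF m[OF w]]) auto
      then show ?thesis using h01[OF w] by simp
    qed
    then show "(\<lambda>w. emeasure (distr (measure_pmf (bernoulli_pmf (h w))) R (\<lambda>b. if b then f w else g w)) A) \<in> borel_measurable M"
      by (subst measurable_cong) auto
  qed auto
qed

text \<open>The map that is pushed forward is defined for every index j, although the uniform law
  charges only j < N; this is why f' covers all j while f is asked for j < N.\<close>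

lemma measurable_bernoulli_uniform_kernel:
  assumes h[measurable]: "h \<in> borel_measurable M" and h01: "\<And>w. w \<in> space M \<Longrightarrow> 0 \<le> h w \<and> h w \<le> 1"
    and f: "\<And>j. j < N \<Longrightarrow> f j \<in> M \<rightarrow>\<^sub>M R" and f': "\<And>j w. w \<in> space M \<Longrightarrow> f j w \<in> space R"
    and g[measurable]: "g \<in> M \<rightarrow>\<^sub>M R" and N: "0 < (N::nat)"
  shows "(\<lambda>w. distr (measure_pmf (pair_pmf (bernoulli_pmf (h w)) (pmf_of_set {..<N}))) R (\<lambda>(b, j). if b then f j w else g w)) \<in> M \<rightarrow>\<^sub>M prob_algebra R"
    (is "?D \<in> _")
proof (rule measurable_prob_algebraI)
  have m: "(\<lambda>(b, j). if b then f j w else g w) \<in> measure_pmf p \<rightarrow>\<^sub>M R" if "w \<in> space M" for w p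
    using f'[OF that] measurable_space[OF g that] by auto
  show "prob_space (?D w)" if "w \<in> space M" for w
    by (rule prob_space.prob_space_distr[OF _ m[OF that]]) (rule measure_pmf.prob_space_axioms)
  then have sp: "subprob_space (?D w)" if "w \<in> space M" for w
    using that by (intro prob_space_imp_subprob_space)
  show "?D \<in> M \<rightarrow>\<^sub>M subprob_algebra R"
  proof (rule measurable_subprob_algebra[OF sp])
    fix A assume A[measurable]: "A \<in> sets R"
    have eq: "emeasure (?D w) A =
      (\<Sum>j<N. indicator A (f j w)) / of_nat N * ennreal (h w) + indicator A (g w) * ennreal (1 - h w)" if w: "w \<in> space M" for w
    proof -
      have "emeasure (?D w) A = (\<integral>\<^sup>+p. indicator A (case p of (b, j) \<Rightarrow> if b then f j w else g w)
         \<partial>measure_pmf (pair_pmf (bernoulli_pmf (h w)) (pmf_of_set {..<N})))"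
        by (subst nn_integral_indicator[symmetric], simp, subst nn_integral_distr[OF m[OF w]]) auto
      also have "\<dots> = (\<integral>\<^sup>+b. \<integral>\<^sup>+j. indicator A (if b then f j w else g w) \<partial>pmf_of_set {..<N} \<partial>bernoulli_pmf (h w))"
        by (subst nn_integral_pair_pmf') simp
      also have "\<dots> = (\<integral>\<^sup>+j. indicator A (f j w) \<partial>pmf_of_set {..<N}) * ennreal (h w) + indicator A (g w) * ennreal (1 - h w)"
        using h01[OF w] by simp
      finally show ?thesis using N by (subst (asm) nn_integral_pmf_of_set) auto
    qed
    have [measurable]: "(\<lambda>w. (\<Sum>j<N. indicator A (f j w) :: ennreal)) \<in> borel_measurable M"
      using f A by (intro borel_measurable_sum) (auto intro!: measurable_compose[OF f] borel_measurable_indicator)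
    show "(\<lambda>w. emeasure (?D w) A) \<in> borel_measurable M"
      by (subst measurable_cong[OF eq]) measurable
  qed auto
qed

lemma integral_bernoulli_uniform:
  fixes g :: "bool \<Rightarrow> nat \<Rightarrow> real"
  assumes p: "0 \<le> p" "p \<le> 1" and N: "0 < N"
  shows "(\<integral>(b, j). g b j \<partial>measure_pmf (pair_pmf (bernoulli_pmf p) (pmf_of_set {..<N}))) =
    p * (\<Sum>j<N. g True j) / N + (1 - p) * (\<Sum>j<N. g False j) / N"
proof -
  have ne: "{..<N} \<noteq> {}" using N by auto
  have "(\<integral>(b, j). g b j \<partial>measure_pmf (pair_pmf (bernoulli_pmf p) (pmf_of_set {..<N}))) =
    (\<Sum>x\<in>UNIV \<times> {..<N}. pmf (pair_pmf (bernoulli_pmf p) (pmf_of_set {..<N})) x *\<^sub>R (case x of (b, j) \<Rightarrow> g b j))"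
    by (rule integral_measure_pmf) (use ne in auto)
  also have "\<dots> = (\<Sum>b\<in>UNIV. \<Sum>j<N. pmf (bernoulli_pmf p) b * (1 / N) * g b j)"
    unfolding sum.cartesian_product by (rule sum.cong) (auto simp: pmf_pair pmf_of_set[OF ne])
  also have "\<dots> = p * (\<Sum>j<N. g True j) / N + (1 - p) * (\<Sum>j<N. g False j) / N"
    using p by (simp add: UNIV_bool sum_distrib_left sum_divide_distrib)
  finally show ?thesis .
qed

lemma measurable_state_upd:
  assumes "y \<in> M \<rightarrow>\<^sub>M state_space m" "i < m" "g \<in> borel_measurable M"
  shows "(\<lambda>w. (y w)(i := g w)) \<in> M \<rightarrow>\<^sub>M state_space m"
  using assms unfolding state_space_def by (intro measurable_fun_upd[where J="{..<m}"]) auto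

section \<open>The N-particle and the auxiliary system as instances\<close>

locale feynman_kac = markov_kernel K
  for K :: "real \<Rightarrow> 'a::metric_space \<Rightarrow> (real \<Rightarrow> 'a) measure" +
  fixes \<eta>0 :: "'a measure" and V :: "real \<Rightarrow> 'a \<Rightarrow> real" and Vinf t :: real and q :: nat
  assumes model: "feynman_kac_model K \<eta>0 V Vinf" and q1: "1 \<le> q" and t0: "0 < t"
begin

lemma eta: "prob_space \<eta>0" "sets \<eta>0 = sets borel"
  using model by (auto simp: feynman_kac_model_def)

lemma Vinf_pos: "0 < Vinf"
  using model by (auto simp: feynman_kac_model_def)

lemma V_bounds: "0 \<le> V (max 0 s) x" "V (max 0 s) x \<le> Vinf"
  using model by (auto simp: feynman_kac_model_def)

lemma measurable_V:
  assumes [measurable]: "s \<in> borel_measurable M" "x \<in> borel_measurable M"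
  shows "(\<lambda>w. V (max 0 (s w)) (x w)) \<in> borel_measurable M"
proof -
  have v: "(\<lambda>(s, x). V s x) \<in> borel_measurable (restrict_space borel {0..} \<Otimes>\<^sub>M borel)"
    using model by (simp add: feynman_kac_model_def)
  have "(\<lambda>w. (max 0 (s w), x w)) \<in> M \<rightarrow>\<^sub>M restrict_space borel {0..} \<Otimes>\<^sub>M borel"
    by (intro measurable_Pair measurable_restrict_space2) auto
  from measurable_compose[OF this v] show ?thesis by simp
qed

lemma V_ratio: "0 \<le> V (max 0 s) x / Vinf \<and> V (max 0 s) x / Vinf \<le> 1"
  using V_bounds[of s x] Vinf_pos by simp

definition Waux :: "real \<Rightarrow> (nat \<Rightarrow> 'a) \<Rightarrow> real" where
  "Waux s y = (\<Sum>i<q. V (max 0 s) (y i))"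

text \<open>The killing rate q \<eta>(V) with the empirical measure \<eta> of the configuration:
  integrated over time, it produces the q-th power of the mass of the unnormalised empirical
  measure.\<close>

definition WN :: "nat \<Rightarrow> real \<Rightarrow> (nat \<Rightarrow> 'a) \<Rightarrow> real" where
  "WN N s y = q * (\<Sum>i<N. V (max 0 s) (y i)) / N"

text \<open>The empirical functional over q distinct particles, as a function of the
  configuration.\<close>

definition odot :: "nat \<Rightarrow> ((nat \<Rightarrow> 'a) \<Rightarrow> real) \<Rightarrow> (nat \<Rightarrow> 'a) \<Rightarrow> real" where
  "odot N F y = (\<Sum>s\<in>injections q N. F (sel q s y)) / (fact N / fact (N - q))"

lemma measurable_sum_V: "(\<lambda>p. \<Sum>i<m. V (max 0 (fst p)) (snd p i)) \<in> borel_measurable (borel \<Otimes>\<^sub>M state_space m)"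
  by (rule borel_measurable_sum, rule measurable_V)
     (auto intro!: measurable_state_component[where m=m])

lemma sum_V_bounds: "0 \<le> (\<Sum>i<m. V (max 0 s) (y i))" "(\<Sum>i<m. V (max 0 s) (y i)) \<le> real m * Vinf"
proof -
  show "0 \<le> (\<Sum>i<m. V (max 0 s) (y i))" using V_bounds by (intro sum_nonneg) auto
  show "(\<Sum>i<m. V (max 0 s) (y i)) \<le> real m * Vinf"
    using sum_bounded_above[of "{..<m}" "\<lambda>i. V (max 0 s) (y i)" Vinf] V_bounds by simp
qed

lemma aux_functional:
  assumes N: "0 < N" and F: "bounded_fun q F BF"
  shows "particle_functional K q (aux_clocks q) (Vinf / real N) (jump_aux V Vinf q) t Waux F (real q * Vinf) BF"
proof unfold_locales
  show "finite (aux_clocks q)"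
    by (rule finite_subset[of _ "{..<q} \<times> {..<q}"]) (auto simp: aux_clocks_def)
  show "0 < Vinf / real N" using Vinf_pos N by simp
  show "0 < t" by (rule t0)
  show "bounded_fun q F BF" by (rule F)
  show "bounded_tfun q Waux (real q * Vinf)"
    using sum_V_bounds measurable_sum_V by (auto simp: bounded_tfun_def Waux_def case_prod_beta')
  show "0 \<le> Waux s x" for s x using sum_V_bounds by (auto simp: Waux_def)
  fix c assume "c \<in> aux_clocks q"
  then obtain i j where c: "c = (i, j)" "i < q" "j < q" by (auto simp: aux_clocks_def)
  have mi: "(\<lambda>p. snd p i) \<in> borel_measurable (borel \<Otimes>\<^sub>M state_space q)" "(\<lambda>p. snd p j) \<in> borel_measurable (borel \<Otimes>\<^sub>M state_space q)"
    using c by (auto intro!: measurable_state_component[where m=q])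
  show "(\<lambda>(\<tau>, x). jump_aux V Vinf q (max 0 \<tau>) c x) \<in> borel \<Otimes>\<^sub>M state_space q \<rightarrow>\<^sub>M prob_algebra (state_space q)"
    unfolding jump_aux_def c prod.case case_prod_beta'
    by (rule measurable_bernoulli_kernel)
       (use V_ratio c mi in \<open>auto intro!: borel_measurable_divide measurable_V measurable_state_upd\<close>)
qed

lemma measurable_sel:
  assumes "s \<in> injections q N" shows "sel q s \<in> state_space N \<rightarrow>\<^sub>M state_space q"
  unfolding sel_def[abs_def]
  by (rule measurable_state_spaceI, rule measurable_state_component[where m=N]) (use injections_lt[OF assms] in auto)

lemma injections_pos: "q \<le> N \<Longrightarrow> 0 < fact N / (fact (N - q) :: real)"
  by simp

lemma bounded_odot:
  assumes N: "q \<le> N" and F: "bounded_fun q F BF" shows "bounded_fun N (odot N F) BF"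
  unfolding bounded_fun_def
proof (intro conjI ballI)
  show "odot N F \<in> borel_measurable (state_space N)"
    unfolding odot_def[abs_def]
    by (intro borel_measurable_divide borel_measurable_sum measurable_compose[OF measurable_sel bounded_fun_measurable[OF F]]) auto
  fix x :: "nat \<Rightarrow> 'a"
  define D :: real where "D = fact N / fact (N - q)"
  have D: "0 < D" unfolding D_def by (rule injections_pos[OF N])
  have "\<bar>\<Sum>s\<in>injections q N. F (sel q s x)\<bar> \<le> real (card (injections q N)) * BF"
    by (rule order_trans[OF sum_abs sum_bounded_above])
       (rule bounded_fun_le[OF F], simp add: sel_def space_state_space)
  then show "\<bar>odot N F x\<bar> \<le> BF"
    using D unfolding odot_def card_injections[OF N] D_def[symmetric] by (simp add: abs_divide pos_divide_le_eq mult.commute)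
qed

lemma N_functional:
  assumes N: "q \<le> N" and F: "bounded_fun q F BF"
  shows "particle_functional K N {..<N} Vinf (jump_N V Vinf N) t (WN N) (odot N F) (real q * Vinf) BF"
proof unfold_locales
  have N0: "0 < N" using N q1 by simp
  show "finite {..<N}" by simp
  show "0 < Vinf" by (rule Vinf_pos)
  show "0 < t" by (rule t0)
  show "bounded_fun N (odot N F) BF" by (rule bounded_odot[OF N F])
  have WN: "0 \<le> WN N s y" "WN N s y \<le> real q * Vinf" for s y
  proof -
    show "0 \<le> WN N s y" unfolding WN_def using sum_V_bounds by (intro divide_nonneg_nonneg mult_nonneg_nonneg) auto
    have "real q * (\<Sum>i<N. V (max 0 s) (y i)) \<le> real q * (real N * Vinf)"
      using sum_V_bounds by (intro mult_left_mono) auto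
    then show "WN N s y \<le> real q * Vinf" unfolding WN_def using N0 by (simp add: divide_le_eq ac_simps)
  qed
  show "0 \<le> WN N s x" for s x by (rule WN)
  have "(\<lambda>p. WN N (fst p) (snd p)) \<in> borel_measurable (borel \<Otimes>\<^sub>M state_space N)"
    unfolding WN_def using measurable_sum_V[of N] by (intro borel_measurable_divide borel_measurable_times) auto
  then show "bounded_tfun N (WN N) (real q * Vinf)"
    using WN by (auto simp: bounded_tfun_def case_prod_beta')
  fix c assume c: "c \<in> {..<N}"
  have mi: "(\<lambda>p. snd p i) \<in> borel_measurable (borel \<Otimes>\<^sub>M state_space N)" if "i < N" for i
    using that by (auto intro!: measurable_state_component[where m=N])
  show "(\<lambda>(\<tau>, x). jump_N V Vinf N (max 0 \<tau>) c x) \<in> borel \<Otimes>\<^sub>M state_space N \<rightarrow>\<^sub>M prob_algebra (state_space N)"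
    unfolding jump_N_def case_prod_beta'
  proof -
    have "(\<lambda>w. distr (measure_pmf (pair_pmf (bernoulli_pmf (V (max 0 (fst w)) (snd w c) / Vinf)) (pmf_of_set {..<N}))) (state_space N)
       (\<lambda>(b, j). if b then (snd w)(c := snd w j) else snd w)) \<in> borel \<Otimes>\<^sub>M state_space N \<rightarrow>\<^sub>M prob_algebra (state_space N)"
      by (rule measurable_bernoulli_uniform_kernel)
         (use V_ratio c mi N0 in \<open>auto intro!: borel_measurable_divide measurable_V measurable_state_upd
            simp: space_pair_measure space_state_space extensional_def\<close>)
    then show "(\<lambda>p. distr (measure_pmf (pair_pmf (bernoulli_pmf (V (max 0 (fst p)) (snd p c) / Vinf)) (pmf_of_set {..<N}))) (state_space N)
       (\<lambda>pa. if fst pa then (snd p)(c := snd p (snd pa)) else snd p)) \<in> borel \<Otimes>\<^sub>M state_space N \<rightarrow>\<^sub>M prob_algebra (state_space N)"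
      by (simp add: case_prod_beta')
  qed
qed

end

context feynman_kac begin

lemma JJ_aux:
  fixes F :: "(nat \<Rightarrow> 'a) \<Rightarrow> real" and N :: nat
  assumes N: "0 < N" and F: "bounded_fun q F BF" and c: "(i, j) \<in> aux_clocks q" and y: "y \<in> space (state_space q)"
    and g: "g \<in> borel_measurable (state_space q)"
  shows "particle_system.JJ (jump_aux V Vinf q) (i, j) s g y =
    g y + V (max 0 s) (y i) / Vinf * (g (y(i := y j)) - g y)"
proof -
  interpret aux: particle_functional K q "aux_clocks q" "Vinf / real N" "jump_aux V Vinf q" t Waux F "real q * Vinf" BF
    by (rule aux_functional[OF N F])
  have ij: "i < q" "j < q" using c by (auto simp: aux_clocks_def)
  have m: "(\<lambda>b. if b then y(i := y j) else y) \<in> measure_pmf p \<rightarrow>\<^sub>M state_space q" for p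
    using y ij by (auto simp: space_state_space extensional_def)
  have "aux.JJ (i, j) s g y = (\<integral>b. g (if b then y(i := y j) else y) \<partial>measure_pmf (bernoulli_pmf (V (max 0 s) (y i) / Vinf)))"
    unfolding aux.JJ_def jump_aux_def prod.case by (rule integral_distr[OF m g])
  also have "\<dots> = g (y(i := y j)) * (V (max 0 s) (y i) / Vinf) + g y * (1 - V (max 0 s) (y i) / Vinf)"
    using V_ratio[of s "y i"] by (subst integral_bernoulli_pmf) auto
  finally show ?thesis by (simp add: algebra_simps)
qed

text \<open>A ring that is not accepted leaves the configuration unchanged and cancels against lam.
  An accepted one has rate Vinf / N times V / Vinf, that is V / N, so Vinf drops out.\<close>

lemma gen_aux:
  fixes F :: "(nat \<Rightarrow> 'a) \<Rightarrow> real" and N :: nat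
  assumes N: "0 < N" and F: "bounded_fun q F BF" and y: "y \<in> space (state_space q)"
    and w: "w s \<in> borel_measurable (state_space q)"
  shows "particle_functional.gen (aux_clocks q) (Vinf / real N) (jump_aux V Vinf q) Waux w s y =
    1 / N * (\<Sum>(a, b)\<in>aux_clocks q. V (max 0 s) (y a) * (w s (y(a := y b)) - w s y)) - (\<Sum>a<q. V (max 0 s) (y a)) * w s y"
proof -
  interpret aux: particle_functional K q "aux_clocks q" "Vinf / real N" "jump_aux V Vinf q" t Waux F "real q * Vinf" BF
    by (rule aux_functional[OF N F])
  have "(\<Sum>c\<in>aux_clocks q. aux.JJ c s (w s) y) =
     (\<Sum>c\<in>aux_clocks q. w s y + (case c of (a, b) \<Rightarrow> V (max 0 s) (y a) / Vinf * (w s (y(a := y b)) - w s y)))"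
    by (rule sum.cong[OF refl]) (use JJ_aux[OF N F _ y w] in auto)
  also have "\<dots> = real (card (aux_clocks q)) * w s y + (\<Sum>(a, b)\<in>aux_clocks q. V (max 0 s) (y a) * (w s (y(a := y b)) - w s y)) / Vinf"
    by (simp add: sum.distrib sum_divide_distrib case_prod_beta')
  finally show ?thesis
    using Vinf_pos N by (simp add: aux.gen_def aux.lam_def Waux_def field_simps)
qed

lemma JJ_N:
  fixes F :: "(nat \<Rightarrow> 'a) \<Rightarrow> real" and N :: nat
  assumes N: "q \<le> N" and F: "bounded_fun q F BF" and i: "i < N" and y: "y \<in> space (state_space N)"
    and g: "g \<in> borel_measurable (state_space N)"
  shows "particle_system.JJ (jump_N V Vinf N) i s g y =
    g y + V (max 0 s) (y i) / Vinf * ((\<Sum>j<N. g (y(i := y j))) / N - g y)"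
proof -
  interpret n: particle_functional K N "{..<N}" Vinf "jump_N V Vinf N" t "WN N" "odot N F" "real q * Vinf" BF
    by (rule N_functional[OF N F])
  have N0: "0 < N" using N q1 by simp
  have m: "(\<lambda>(b, j). if b then y(i := y j) else y) \<in> measure_pmf p \<rightarrow>\<^sub>M state_space N" for p
    using y i by (auto simp: space_state_space extensional_def)
  have "n.JJ i s g y = (\<integral>p. g (case p of (b, j) \<Rightarrow> if b then y(i := y j) else y)
      \<partial>measure_pmf (pair_pmf (bernoulli_pmf (V (max 0 s) (y i) / Vinf)) (pmf_of_set {..<N})))"
    unfolding n.JJ_def jump_N_def by (rule integral_distr[OF m g])
  also have "\<dots> = (\<integral>(b, j). g (if b then y(i := y j) else y)
      \<partial>measure_pmf (pair_pmf (bernoulli_pmf (V (max 0 s) (y i) / Vinf)) (pmf_of_set {..<N})))"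
    by (simp add: case_prod_beta')
  also have "\<dots> = V (max 0 s) (y i) / Vinf * (\<Sum>j<N. g (y(i := y j))) / N + (1 - V (max 0 s) (y i) / Vinf) * g y"
    using V_ratio[of s "y i"] N0 by (subst integral_bernoulli_uniform) auto
  finally show ?thesis by (simp add: algebra_simps)
qed

lemma gen_N:
  fixes F :: "(nat \<Rightarrow> 'a) \<Rightarrow> real" and N :: nat
  assumes N: "q \<le> N" and F: "bounded_fun q F BF" and y: "y \<in> space (state_space N)"
    and w: "w s \<in> borel_measurable (state_space N)"
  shows "particle_functional.gen {..<N} Vinf (jump_N V Vinf N) (WN N) w s y =
    (\<Sum>i<N. V (max 0 s) (y i) * ((\<Sum>j<N. w s (y(i := y j))) / N - w s y)) - (q * (\<Sum>i<N. V (max 0 s) (y i)) / N) * w s y"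
proof -
  interpret n: particle_functional K N "{..<N}" Vinf "jump_N V Vinf N" t "WN N" "odot N F" "real q * Vinf" BF
    by (rule N_functional[OF N F])
  have "(\<Sum>i<N. n.JJ i s (w s) y) = (\<Sum>i<N. w s y + V (max 0 s) (y i) / Vinf * ((\<Sum>j<N. w s (y(i := y j))) / N - w s y))"
    by (rule sum.cong[OF refl]) (use JJ_N[OF N F _ y w] in auto)
  also have "\<dots> = real N * w s y + (\<Sum>i<N. V (max 0 s) (y i) * ((\<Sum>j<N. w s (y(i := y j))) / N - w s y)) / Vinf"
    by (simp add: sum.distrib sum_divide_distrib)
  finally have J: "(\<Sum>i<N. n.JJ i s (w s) y) = \<dots>" .
  show ?thesis
    using Vinf_pos unfolding n.gen_def n.lam_def WN_def J by (simp add: algebra_simps)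
qed

text \<open>The backward equation of the \<open>N\<close>-particle system is solved by the average of the functional of
  the auxiliary system over all ways to select \<open>q\<close> of the \<open>N\<close> particles.\<close>

lemma mean_on_N_eq_aux:
  assumes N: "q \<le> N" and F: "bounded_fun q F BF" and s: "0 \<le> s" "s \<le> t" and x: "x \<in> space (state_space N)"
  shows "particle_functional.mean_on K N {..<N} Vinf (jump_N V Vinf N) t (WN N) (odot N F) UNIV s x =
    odot N (particle_functional.mean_on K q (aux_clocks q) (Vinf / real N) (jump_aux V Vinf q) t Waux F UNIV s) x"
proof -
  have N0: "0 < N" using N q1 by simp
  interpret aux: particle_functional K q "aux_clocks q" "Vinf / real N" "jump_aux V Vinf q" t Waux F "real q * Vinf" BF
    by (rule aux_functional[OF N0 F])
  interpret n: particle_functional K N "{..<N}" Vinf "jump_N V Vinf N" t "WN N" "odot N F" "real q * Vinf" BF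
    by (rule N_functional[OF N F])
  let ?I = "injections q N"
  let ?u = "aux.mean_on UNIV"
  define D :: real where "D = fact N / fact (N - q)"
  define v where "v s y = odot N (?u s) y" for s y
  have D: "0 < D" unfolding D_def by (rule injections_pos[OF N])
  have u: "bounded_tfun q ?u BF" by (rule aux.bounded_mean_on)
  have uf: "bounded_fun q (?u s) BF" for s using u by (rule bounded_tfun_imp_fun)
  have v: "bounded_tfun N v BF"
    unfolding bounded_tfun_def v_def case_prod_beta'
  proof (intro conjI allI ballI)
    note bounded_tfun_measurable[OF u, measurable]
    have "(\<lambda>p. ?u (fst p) (sel q s (snd p))) \<in> borel_measurable (borel \<Otimes>\<^sub>M state_space N)" if "s \<in> ?I" for s
    proof -
      note measurable_sel[OF that, measurable]
      show ?thesis by measurable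
    qed
    then show "(\<lambda>p. odot N (?u (fst p)) (snd p)) \<in> borel_measurable (borel \<Otimes>\<^sub>M state_space N)"
      unfolding odot_def by (intro borel_measurable_divide borel_measurable_sum) auto
    show "\<bar>odot N (?u s) y\<bar> \<le> BF" if "y \<in> space (state_space N)" for s y
      using bounded_fun_le[OF bounded_odot[OF N uf] that] .
  qed
  have gb: "bounded_tfun q (aux.gen ?u) ((2 * aux.lam + real q * Vinf) * BF)" (is "bounded_tfun q _ ?B")
    by (rule aux.gen_bounded[OF u])
  have gfun: "bounded_fun q (aux.gen ?u \<rho>) ?B" for \<rho> using gb by (rule bounded_tfun_imp_fun)
  have selS: "sel q s y \<in> space (state_space q)" for s and y :: "nat \<Rightarrow> 'a" by (simp add: sel_def space_state_space)
  have comp: "bounded_fun N (\<lambda>y. g (sel q s y)) B" if "bounded_fun q g B" "s \<in> ?I" for g :: "(nat \<Rightarrow> 'a) \<Rightarrow> real" and s B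
    unfolding bounded_fun_def
    using measurable_compose[OF measurable_sel[OF that(2)] bounded_fun_measurable[OF that(1)]] bounded_fun_le[OF that(1) selS]
    by auto
  have PEsel: "PE K q s \<tau> g (sel q \<sigma> x) = PE K N s \<tau> (\<lambda>y. g (sel q \<sigma> y)) x"
    if "\<sigma> \<in> ?I" "bounded_fun q g B" for \<sigma> g B s \<tau> x
    unfolding sel_def
    by (rule PE_reindex[symmetric]) (use that in \<open>auto simp: injections_def bounded_fun_def\<close>)
  \<comment> \<open>Averaging over selections commutes with the free motion: each selection is a
    system of q particles by \<open>PE_reindex\<close>, and the average is a finite linear
    combination.\<close>
  have PEavg: "(\<Sum>\<sigma>\<in>?I. PE K q s \<tau> g (sel q \<sigma> x)) / D = PE K N s \<tau> (odot N g) x" if g: "bounded_fun q g B" for g B s \<tau> x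
  proof -
    have "PE K N s \<tau> (odot N g) x = PE K N s \<tau> (\<lambda>y. 1 / D * (\<Sum>\<sigma>\<in>?I. g (sel q \<sigma> y))) x"
      by (rule PE_cong) (simp add: odot_def D_def[symmetric])
    also have "\<dots> = 1 / D * (\<Sum>\<sigma>\<in>?I. PE K N s \<tau> (\<lambda>y. g (sel q \<sigma> y)) x)"
      unfolding PE_cmult by (subst PE_sum) (use comp[OF g] in auto)
    finally show ?thesis using PEsel[OF _ g] by simp
  qed
  \<comment> \<open>The intertwining: averaging the auxiliary operator over selections gives the
    operator of the N-particle system applied to the average.\<close>
  have gen_v: "odot N (aux.gen ?u \<rho>) y = n.gen v \<rho> y" if y: "y \<in> space (state_space N)" for \<rho> y
  proof -
    have um: "?u \<rho> \<in> borel_measurable (state_space q)" by (rule bounded_fun_measurable[OF uf])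
    have vm: "v \<rho> \<in> borel_measurable (state_space N)" by (rule bounded_fun_measurable[OF bounded_tfun_imp_fun[OF v]])
    let ?G = "\<lambda>y. \<Sum>\<sigma>\<in>?I. ?u \<rho> (sel q \<sigma> y)"
    have vG: "v \<rho> y = ?G y / D" for y by (simp add: v_def odot_def D_def)
    have "n.gen v \<rho> y = (\<Sum>i<N. V (max 0 \<rho>) (y i) * ((\<Sum>j<N. v \<rho> (y(i := y j))) / N - v \<rho> y)) - (q * (\<Sum>i<N. V (max 0 \<rho>) (y i)) / N) * v \<rho> y"
      by (rule gen_N[where w=v and s=\<rho>, OF N F y vm])
    also have "\<dots> = ((\<Sum>i<N. V (max 0 \<rho>) (y i) * ((\<Sum>j<N. ?G (y(i := y j))) / N - ?G y)) - (q * (\<Sum>i<N. V (max 0 \<rho>) (y i)) / N) * ?G y) / D"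
    proof -
      have "V (max 0 \<rho>) (y i) * ((\<Sum>j<N. ?G (y(i := y j)) / D) / N - ?G y / D) =
          V (max 0 \<rho>) (y i) * ((\<Sum>j<N. ?G (y(i := y j))) / N - ?G y) / D" for i
        unfolding sum_divide_distrib[symmetric] by (simp add: diff_divide_distrib right_diff_distrib mult.commute)
      then show ?thesis unfolding vG by (simp only: sum_divide_distrib[symmetric] diff_divide_distrib) simp
    qed
    also have "\<dots> = (\<Sum>\<sigma>\<in>?I. aux.gen ?u \<rho> (sel q \<sigma> y)) / D"
      unfolding generator_identity[OF N0 N] gen_aux[where w="?u" and s=\<rho>, OF N0 F selS um] ..
    finally show ?thesis by (simp add: odot_def D_def)
  qed
  have "n.mean_on UNIV s x = v s x"
  proof (rule n.mean_on_UNIV_unique[OF v _ s x])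
    fix s and x :: "nat \<Rightarrow> 'a" assume s: "0 \<le> s" "s \<le> t" and x: "x \<in> space (state_space N)"
    have "v s x = (\<Sum>\<sigma>\<in>?I. PE K q s t F (sel q \<sigma> x) + tint s t (\<lambda>\<rho>. PE K q s \<rho> (aux.gen ?u \<rho>) (sel q \<sigma> x))) / D"
      unfolding v_def odot_def D_def using aux.mean_on_UNIV_mild[OF s selS] by simp
    also have "\<dots> = PE K N s t (odot N F) x + (\<Sum>\<sigma>\<in>?I. tint s t (\<lambda>\<rho>. PE K q s \<rho> (aux.gen ?u \<rho>) (sel q \<sigma> x))) / D"
      unfolding sum.distrib add_divide_distrib PEavg[OF F] ..
    also have "(\<Sum>\<sigma>\<in>?I. tint s t (\<lambda>\<rho>. PE K q s \<rho> (aux.gen ?u \<rho>) (sel q \<sigma> x))) =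
        tint s t (\<lambda>\<rho>. \<Sum>\<sigma>\<in>?I. PE K q s \<rho> (aux.gen ?u \<rho>) (sel q \<sigma> x))"
    proof (rule tint_sum[symmetric, where B="?B"])
      show "(\<lambda>\<rho>. PE K q s \<rho> (aux.gen ?u \<rho>) (sel q \<sigma> x)) \<in> borel_measurable borel" for \<sigma>
        by (rule measurable_PE) (use bounded_tfun_measurable[OF gb] selS in auto)
      show "\<bar>PE K q s u (aux.gen ?u u) (sel q \<sigma> x)\<bar> \<le> ?B" for \<sigma> u
        by (rule PE_bound[OF gfun])
    qed
    also have "tint s t (\<lambda>\<rho>. \<Sum>\<sigma>\<in>?I. PE K q s \<rho> (aux.gen ?u \<rho>) (sel q \<sigma> x)) / D =
        tint s t (\<lambda>\<rho>. (\<Sum>\<sigma>\<in>?I. PE K q s \<rho> (aux.gen ?u \<rho>) (sel q \<sigma> x)) / D)"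
      using tint_cmult[of s t "1 / D"] by simp
    also have "\<dots> = tint s t (\<lambda>\<rho>. PE K N s \<rho> (n.gen v \<rho>) x)"
      unfolding PEavg[OF gfun] by (intro tint_cong PE_cong gen_v)
    finally show "v s x = PE K N s t (odot N F) x + tint s t (\<lambda>\<rho>. PE K N s \<rho> (n.gen v \<rho>) x)" .
  qed
  then show ?thesis by (simp add: v_def)
qed

text \<open>The initial positions are independent with a common law, so every selection of q of them
  has the product law and contributes the same integral. The number of injections cancels the
  normalisation.\<close>

lemma Q_N_eq:
  assumes N: "q \<le> N" and F: "bounded_fun q F BF"
  shows "Q_N K \<eta>0 V Vinf t q N F =
    (\<integral>x. particle_functional.mean_on K q (aux_clocks q) (Vinf / real N) (jump_aux V Vinf q) t Waux F UNIV 0 x \<partial>PiM {..<q} (\<lambda>_. \<eta>0))"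
proof -
  have N0: "0 < N" using N q1 by simp
  interpret aux: particle_functional K q "aux_clocks q" "Vinf / real N" "jump_aux V Vinf q" t Waux F "real q * Vinf" BF
    by (rule aux_functional[OF N0 F])
  interpret n: particle_functional K N "{..<N}" Vinf "jump_N V Vinf N" t "WN N" "odot N F" "real q * Vinf" BF
    by (rule N_functional[OF N F])
  let ?I = "injections q N"
  let ?u = "aux.mean_on UNIV 0"
  have g: "gamma_N_odot V q N z t F = odot N F (pos N z t) * n.wt 0 t z" for z
  proof -
    have "gamma_N_mass V N z t ^ q = n.wt 0 t z"
    proof -
      have "(LINT s:{0..t}|lborel. eta_N N z s (V s)) = tint 0 t (\<lambda>s. (\<Sum>i<N. V (max 0 s) (pos N z s i)) / N)"
        unfolding tint_eq_set_integral[symmetric] eta_N_def by (rule tint_cong) (simp add: pos_def)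
      then have "gamma_N_mass V N z t ^ q = exp (real q * - tint 0 t (\<lambda>s. (\<Sum>i<N. V (max 0 s) (pos N z s i)) / N))"
        unfolding gamma_N_mass_def exp_of_nat_mult by simp
      also have "\<dots> = n.wt 0 t z"
        unfolding n.wt_def WN_def using tint_cmult[of 0 t "real q" "\<lambda>s. (\<Sum>i<N. V (max 0 s) (pos N z s i)) / N"] by simp
      finally show ?thesis .
    qed
    moreover have "eta_N_odot q N z t F = odot N F (pos N z t)"
    proof -
      have "(\<lambda>j\<in>{..<q}. z (s j) t) = sel q s (pos N z t)" if "s \<in> ?I" for s
        using injections_lt[OF that] t0 by (auto simp: sel_def pos_def fun_eq_iff)
      then show ?thesis unfolding eta_N_odot_def odot_def injections_def[symmetric] by simp
    qed
    ultimately show ?thesis by (simp add: gamma_N_odot_def)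
  qed
  let ?D = "fact N / fact (N - q) :: real"
  have uf: "bounded_fun q ?u BF" by (rule bounded_tfun_imp_fun[OF aux.bounded_mean_on])
  have fmS: "borel_measurable (PiM {..<m} (\<lambda>_. \<eta>0)) = borel_measurable (state_space m)" for m
    by (rule measurable_cong_sets) (use eta in \<open>auto simp: state_space_def intro!: sets_PiM_cong\<close>)
  have int: "(\<integral>y. ?u (sel q s y) \<partial>PiM {..<N} (\<lambda>_. \<eta>0)) = (\<integral>x. ?u x \<partial>PiM {..<q} (\<lambda>_. \<eta>0))"
    and integ: "integrable (PiM {..<N} (\<lambda>_. \<eta>0)) (\<lambda>y. ?u (sel q s y))" if s: "s \<in> ?I" for s
  proof -
    have d: "distr (PiM {..<N} (\<lambda>_. \<eta>0)) (PiM {..<q} (\<lambda>_. \<eta>0)) (sel q s) = PiM {..<q} (\<lambda>_. \<eta>0)"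
      unfolding sel_def[abs_def] by (rule distr_PiM_reindex) (use s eta in \<open>auto simp: injections_def\<close>)
    have ms: "sel q s \<in> PiM {..<N} (\<lambda>_. \<eta>0) \<rightarrow>\<^sub>M PiM {..<q} (\<lambda>_. \<eta>0)"
      using measurable_sel[OF s] eta by (auto simp: state_space_def cong: measurable_cong_sets sets_PiM_cong)
    have um: "?u \<in> borel_measurable (PiM {..<q} (\<lambda>_. \<eta>0))" unfolding fmS by (rule bounded_fun_measurable[OF uf])
    show "(\<integral>y. ?u (sel q s y) \<partial>PiM {..<N} (\<lambda>_. \<eta>0)) = (\<integral>x. ?u x \<partial>PiM {..<q} (\<lambda>_. \<eta>0))"
      using integral_distr[OF ms um] by (simp add: d)
    show "integrable (PiM {..<N} (\<lambda>_. \<eta>0)) (\<lambda>y. ?u (sel q s y))"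
      by (rule prob_integrable_bounded[where B=BF])
         (use measurable_compose[OF ms um] bounded_fun_le[OF uf] eta in
           \<open>auto intro!: prob_space_PiM simp: sel_def space_state_space\<close>)
  qed
  have "Q_N K \<eta>0 V Vinf t q N F = (\<integral>\<omega>. odot N F (pos N (snd \<omega>) t) * n.wt 0 t (snd \<omega>) \<partial>system_law K \<eta>0 N {..<N} Vinf (jump_N V Vinf N) t)"
    unfolding Q_N_def N_system_def g ..
  also have "\<dots> = (\<integral>y. n.mean_on UNIV 0 y \<partial>PiM {..<N} (\<lambda>_. \<eta>0))"
    by (rule n.integral_system_UNIV[OF eta])
  also have "\<dots> = (\<integral>y. odot N ?u y \<partial>PiM {..<N} (\<lambda>_. \<eta>0))"
  proof (rule Bochner_Integration.integral_cong[OF refl])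
    fix y assume "y \<in> space (PiM {..<N} (\<lambda>_. \<eta>0))"
    then have "y \<in> space (state_space N)" by (auto simp: space_PiM space_state_space PiE_def)
    then show "n.mean_on UNIV 0 y = odot N ?u y" using mean_on_N_eq_aux[OF N F, of 0 y] t0 by simp
  qed
  also have "\<dots> = (\<Sum>s\<in>?I. \<integral>y. ?u (sel q s y) \<partial>PiM {..<N} (\<lambda>_. \<eta>0)) / ?D"
    unfolding odot_def integral_divide_zero using integ by (subst Bochner_Integration.integral_sum) auto
  also have "\<dots> = (\<integral>x. ?u x \<partial>PiM {..<q} (\<lambda>_. \<eta>0))"
    using int card_injections[OF N] injections_pos[OF N] by simp
  finally show ?thesis .
qed

end

section \<open>Conditioning on the number of rings\<close>

text \<open>If A is a null set, \<open>uniform_measure\<close> is the zero measure and the quotient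
  is 0 by the convention for division, so the formula also covers conditioning on an impossible
  number of rings.\<close>

lemma integral_uniform_measure:
  fixes f :: "'b \<Rightarrow> real"
  assumes M: "prob_space M" and A[measurable]: "A \<in> sets M" and f[measurable]: "f \<in> borel_measurable M"
  shows "(\<integral>x. f x \<partial>uniform_measure M A) = (\<integral>x. indicator A x * f x \<partial>M) / measure M A"
proof -
  interpret prob_space M by fact
  show ?thesis
  proof (cases "measure M A = 0")
    case True
    then have "emeasure (uniform_measure M A) (space M) = 0"
      using emeasure_uniform_measure[OF A sets.top] sets.sets_into_space[OF A]
      by (simp add: emeasure_eq_measure Int_absorb2)
    then have "AE x in uniform_measure M A. f x = 0"
      by (intro AE_I[where N="space M"]) (auto simp: uniform_measure_def)
    then have "(\<integral>x. f x \<partial>uniform_measure M A) = 0" by (rule integral_eq_zero_AE)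
    with True show ?thesis by simp
  next
    case False
    then have pos: "0 < measure M A" using measure_nonneg[of M A] by linarith
    have "uniform_measure M A = density M (\<lambda>x. ennreal (indicator A x / measure M A))"
      unfolding uniform_measure_def emeasure_eq_measure using pos
      by (intro arg_cong[where f="density M"] ext) (simp add: ennreal_indicator[symmetric] divide_ennreal)
    then show ?thesis using pos by (simp add: integral_density)
  qed
qed

lemma card_aux_clocks: "1 \<le> q \<Longrightarrow> real (card (aux_clocks q)) = real q * (real q - 1)"
proof -
  assume q: "1 \<le> q"
  have "aux_clocks q = {..<q} \<times> {..<q} - (\<lambda>i. (i, i)) ` {..<q}" by (auto simp: aux_clocks_def)
  then have "card (aux_clocks q) = q * q - q"
    by (simp add: card_Diff_subset image_subset_iff card_image inj_on_def)
  moreover have "q \<le> q * q" using q by simp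
  ultimately show ?thesis by (simp add: of_nat_diff algebra_simps)
qed

context feynman_kac begin

lemma F_e_eq: "F_e V q t F z = F (pos q z t) * exp (- tint 0 t (\<lambda>v. Waux v (pos q z v)))"
proof -
  have "(\<lambda>i\<in>{..<q}. z i t) = pos q z t" using t0 by (simp add: pos_def)
  moreover have "(LINT s:{0..t}|lborel. (\<Sum>i<q. V s (z i s))) = tint 0 t (\<lambda>v. Waux v (pos q z v))"
    unfolding tint_eq_set_integral[symmetric] Waux_def by (rule tint_cong) (simp add: pos_def)
  ultimately show ?thesis by (simp add: F_e_def)
qed

context
  fixes N :: nat
  assumes N: "0 < N"
begin

abbreviation "aux_law \<equiv> aux_system K \<eta>0 V Vinf q N t"

definition ring_event :: "nat \<Rightarrow> (((nat \<times> nat) \<times> nat \<Rightarrow> real) \<times> (nat \<Rightarrow> real \<Rightarrow> 'a)) set" where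
  "ring_event k = {\<omega> \<in> space aux_law. finite (rings (aux_clocks q) t (fst \<omega>)) \<and> card (rings (aux_clocks q) t (fst \<omega>)) = k}"

definition poisson_wt :: "nat \<Rightarrow> real" where
  "poisson_wt k = exp (- (real (card (aux_clocks q)) * (Vinf / real N)) * t) * (real (card (aux_clocks q)) * (Vinf / real N) * t) ^ k / fact k"

lemma aux_one: "particle_functional K q (aux_clocks q) (Vinf / real N) (jump_aux V Vinf q) t Waux (\<lambda>_. 1) (real q * Vinf) 1"
  by (rule aux_functional[OF N]) (simp add: bounded_fun_def)

lemma aux_law_prob: "prob_space aux_law" "sets aux_law = sets (clocks (aux_clocks q) (Vinf / real N) \<Otimes>\<^sub>M paths q)"
proof -
  interpret aux: particle_functional K q "aux_clocks q" "Vinf / real N" "jump_aux V Vinf q" t Waux "\<lambda>_. 1" "real q * Vinf" 1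
    by (rule aux_one)
  show "prob_space aux_law" "sets aux_law = sets (clocks (aux_clocks q) (Vinf / real N) \<Otimes>\<^sub>M paths q)"
    unfolding aux_system_def by (rule aux.system_prob[OF eta])+
qed

lemma sets_ring_event: "ring_event k \<in> sets aux_law"
proof -
  interpret aux: particle_functional K q "aux_clocks q" "Vinf / real N" "jump_aux V Vinf q" t Waux "\<lambda>_. 1" "real q * Vinf" 1
    by (rule aux_one)
  have "Measurable.pred (aux.Cl \<Otimes>\<^sub>M paths q :: (_ \<times> (nat \<Rightarrow> real \<Rightarrow> 'a)) measure)
     (\<lambda>\<omega>. finite (rings (aux_clocks q) t (fst \<omega>)) \<and> card (rings (aux_clocks q) t (fst \<omega>)) = k)"
    by (rule pred_card_rings[OF measurable_fst aux.finite_C])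
  then show ?thesis
    unfolding ring_event_def pred_def using aux_law_prob(2) sets_eq_imp_space_eq[OF aux_law_prob(2)] by simp
qed

text \<open>The conditioning event counts rings, the recursion uses chronologies. Both give the same
  number as soon as a chronology exists, which is almost surely the case.\<close>

lemma AE_ring_event: "AE \<omega> in aux_law. \<forall>k. \<omega> \<in> ring_event k \<longleftrightarrow> nrings (aux_clocks q) t (fst \<omega>) k"
proof -
  interpret aux: particle_functional K q "aux_clocks q" "Vinf / real N" "jump_aux V Vinf q" t Waux "\<lambda>_. 1" "real q * Vinf" 1
    by (rule aux_one)
  have "AE \<omega> in aux_law. \<exists>k. nrings (aux_clocks q) t (fst \<omega>) k"
    unfolding aux_system_def by (rule aux.AE_system_nrings[OF eta])
  moreover have "AE \<omega> in aux_law. \<omega> \<in> space aux_law" by (rule AE_space)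
  ultimately show ?thesis
  proof eventually_elim
    fix \<omega> assume ex: "\<exists>k. nrings (aux_clocks q) t (fst \<omega>) k" and sp: "\<omega> \<in> space aux_law"
    then obtain j where j: "nrings (aux_clocks q) t (fst \<omega>) j" by auto
    then have "finite (rings (aux_clocks q) t (fst \<omega>)) \<and> card (rings (aux_clocks q) t (fst \<omega>)) = j"
      unfolding nrings_def using ordered_list_card by blast
    then have "\<omega> \<in> ring_event k \<longleftrightarrow> k = j" for k using sp by (auto simp: ring_event_def)
    moreover have "nrings (aux_clocks q) t (fst \<omega>) k \<longleftrightarrow> k = j" for k using j aux.nrings_unique by blast
    ultimately show "\<forall>k. \<omega> \<in> ring_event k \<longleftrightarrow> nrings (aux_clocks q) t (fst \<omega>) k" by simp
  qed
qed

lemma measure_ring_event: "measure aux_law (ring_event k) = poisson_wt k"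
proof -
  interpret aux: particle_functional K q "aux_clocks q" "Vinf / real N" "jump_aux V Vinf q" t Waux "\<lambda>_. 1" "real q * Vinf" 1
    by (rule aux_one)
  interpret L: prob_space aux_law by (rule aux_law_prob)
  have pr: "Measurable.pred aux.Cl (\<lambda>\<sigma>. nrings (aux_clocks q) t \<sigma> k)"
    by (intro pred_nrings[where r="Vinf / real N"]) (use aux.finite_C in auto)
  have "Measurable.pred (aux.Cl \<Otimes>\<^sub>M paths q :: (_ \<times> (nat \<Rightarrow> real \<Rightarrow> 'a)) measure) (\<lambda>\<omega>. nrings (aux_clocks q) t (fst \<omega>) k)"
    using pr by measurable
  then have s: "{\<omega> \<in> space aux_law. nrings (aux_clocks q) t (fst \<omega>) k} \<in> sets aux_law"
    unfolding pred_def using aux_law_prob(2) sets_eq_imp_space_eq[OF aux_law_prob(2)] by simp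
  have "measure aux_law (ring_event k) = measure aux_law {\<omega> \<in> space aux_law. nrings (aux_clocks q) t (fst \<omega>) k}"
    by (rule L.finite_measure_eq_AE[OF _ sets_ring_event s]) (use AE_ring_event in \<open>auto elim!: eventually_mono\<close>)
  also have "\<dots> = poisson_wt k"
    unfolding aux_system_def aux.measure_system_fst[OF eta pr] aux.prob_nrings poisson_wt_def aux.lam_def ..
  finally show ?thesis .
qed

context
  fixes F :: "(nat \<Rightarrow> 'a) \<Rightarrow> real" and BF :: real
  assumes F: "bounded_fun q F BF"
begin

interpretation aux: particle_functional K q "aux_clocks q" "Vinf / real N" "jump_aux V Vinf q" t Waux F "real q * Vinf" BF
  by (rule aux_functional[OF N F])

lemma measurable_F_e: "(\<lambda>\<omega>. F_e V q t F (snd \<omega>)) \<in> borel_measurable aux_law"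
proof -
  have "(\<lambda>\<omega>. F (pos q (snd \<omega>) t) * aux.wt 0 t (snd \<omega>)) \<in> borel_measurable (aux.Cl \<Otimes>\<^sub>M paths q)" by measurable
  then show ?thesis unfolding F_e_eq aux.wt_def measurable_cong_sets[OF aux_law_prob(2) refl] .
qed

lemma integral_ring_event:
  "(\<integral>\<omega>. indicator (ring_event k) \<omega> * F_e V q t F (snd \<omega>) \<partial>aux_law) = (\<integral>x. aux.mean_on {k} 0 x \<partial>PiM {..<q} (\<lambda>_. \<eta>0))"
proof -
  have mp: "Measurable.pred (aux.Cl \<Otimes>\<^sub>M paths q :: (_ \<times> (nat \<Rightarrow> real \<Rightarrow> 'a)) measure) (\<lambda>\<omega>. aux.some_nrings {k} t (fst \<omega>))" by measurable
  have m1: "(\<lambda>\<omega>. F (pos q (snd \<omega>) t) * aux.wt 0 t (snd \<omega>)) \<in> borel_measurable (aux.Cl \<Otimes>\<^sub>M paths q)" by measurable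
  have m2: "(\<lambda>\<omega>. if aux.some_nrings {k} t (fst \<omega>) then F (pos q (snd \<omega>) t) * aux.wt 0 t (snd \<omega>) else 0) \<in> borel_measurable (aux.Cl \<Otimes>\<^sub>M paths q)"
    using m1 mp by measurable
  have "(\<integral>\<omega>. indicator (ring_event k) \<omega> * F_e V q t F (snd \<omega>) \<partial>aux_law) =
    (\<integral>\<omega>. (if aux.some_nrings {k} t (fst \<omega>) then F (pos q (snd \<omega>) t) * aux.wt 0 t (snd \<omega>) else 0) \<partial>aux_law)"
  proof (rule integral_cong_AE)
    show "(\<lambda>\<omega>. indicator (ring_event k) \<omega> * F_e V q t F (snd \<omega>)) \<in> borel_measurable aux_law"
      using measurable_F_e sets_ring_event by measurable
    show "(\<lambda>\<omega>. if aux.some_nrings {k} t (fst \<omega>) then F (pos q (snd \<omega>) t) * aux.wt 0 t (snd \<omega>) else 0) \<in> borel_measurable aux_law"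
      using m2 unfolding measurable_cong_sets[OF aux_law_prob(2) refl] .
    show "AE \<omega> in aux_law. indicator (ring_event k) \<omega> * F_e V q t F (snd \<omega>) =
       (if aux.some_nrings {k} t (fst \<omega>) then F (pos q (snd \<omega>) t) * aux.wt 0 t (snd \<omega>) else 0)"
      using AE_ring_event by eventually_elim (auto simp: aux.some_nrings_def F_e_eq aux.wt_def indicator_def)
  qed
  also have "\<dots> = (\<integral>x. aux.mean_on {k} 0 x \<partial>PiM {..<q} (\<lambda>_. \<eta>0))"
    unfolding aux_system_def by (rule aux.integral_system_mean_on[OF eta])
  finally show ?thesis .
qed

lemma E_cond_eq:
  "E_cond K \<eta>0 V Vinf q N t k F = (\<integral>\<omega>. indicator (ring_event k) \<omega> * F_e V q t F (snd \<omega>) \<partial>aux_law) / poisson_wt k"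
  unfolding E_cond_def ring_event_def[symmetric] measure_ring_event[symmetric]
  by (rule integral_uniform_measure[OF aux_law_prob(1) sets_ring_event measurable_F_e])

text \<open>The numerator and the Poisson weight share the factor exp (- lam * t) * (Vinf / N) ^ k.
  It cancels, and with it all dependence on N.\<close>

lemma E_cond_formula:
  "E_cond K \<eta>0 V Vinf q N t k F =
    (\<integral>x. aux.ring_term k 0 x \<partial>PiM {..<q} (\<lambda>_. \<eta>0)) * (fact k / (real (card (aux_clocks q)) * t) ^ k)"
proof -
  have r: "Vinf / real N \<noteq> 0" using Vinf_pos N by simp
  have "(\<integral>x. aux.mean_on {k} 0 x \<partial>PiM {..<q} (\<lambda>_. \<eta>0)) = (\<integral>x. (exp (- aux.lam * t) * (Vinf / real N) ^ k) * aux.ring_term k 0 x \<partial>PiM {..<q} (\<lambda>_. \<eta>0))"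
  proof (rule Bochner_Integration.integral_cong[OF refl])
    fix x assume "x \<in> space (PiM {..<q} (\<lambda>_. \<eta>0))"
    then have "x \<in> space (state_space q)" by (auto simp: space_PiM space_state_space PiE_def)
    then show "aux.mean_on {k} 0 x = (exp (- aux.lam * t) * (Vinf / real N) ^ k) * aux.ring_term k 0 x"
      using aux.mean_on_singleton[of 0 x k] t0 by simp
  qed
  then have "E_cond K \<eta>0 V Vinf q N t k F = (exp (- aux.lam * t) * (Vinf / real N) ^ k) * (\<integral>x. aux.ring_term k 0 x \<partial>PiM {..<q} (\<lambda>_. \<eta>0)) / poisson_wt k"
    unfolding E_cond_eq integral_ring_event by simp
  also have "poisson_wt k = exp (- aux.lam * t) * (Vinf / real N) ^ k * ((real (card (aux_clocks q)) * t) ^ k / fact k)"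
    by (simp add: poisson_wt_def aux.lam_def power_mult_distrib power_divide)
  finally have *: "E_cond K \<eta>0 V Vinf q N t k F = (exp (- aux.lam * t) * (Vinf / real N) ^ k) * (\<integral>x. aux.ring_term k 0 x \<partial>PiM {..<q} (\<lambda>_. \<eta>0)) /
      (exp (- aux.lam * t) * (Vinf / real N) ^ k * ((real (card (aux_clocks q)) * t) ^ k / fact k))" .
  \<comment> \<open>For q = 1 and k \<ge> 1 there are no clocks and d = 0. Both sides are then 0
    through division by zero, in agreement with the convention for the terms without clocks.\<close>
  have "c * I / (c * (d / e)) = I * (e / d)" if "c \<noteq> 0" for c d e I :: real
    using that by simp
  then show ?thesis unfolding * using r by (meson exp_not_eq_zero mult_eq_0_iff power_not_zero)
qed

text \<open>If the weight vanishes, so does the integral over that number of rings by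
  \<open>integral_mean_on_bound\<close>; the product is therefore right although the conditional
  mean is then only a default value.\<close>

lemma poisson_E_cond: "poisson_wt k * E_cond K \<eta>0 V Vinf q N t k F = (\<integral>x. aux.mean_on {k} 0 x \<partial>PiM {..<q} (\<lambda>_. \<eta>0))"
proof (cases "poisson_wt k = 0")
  case True
  have "\<bar>\<integral>x. aux.mean_on {k} 0 x \<partial>PiM {..<q} (\<lambda>_. \<eta>0)\<bar> \<le> BF * poisson_wt k"
    using aux.integral_mean_on_bound[OF eta, of k] by (simp add: poisson_wt_def aux.lam_def)
  then show ?thesis using True by simp
next
  case False
  then show ?thesis unfolding E_cond_eq integral_ring_event by simp
qed

lemma E_cond_bound: "\<bar>E_cond K \<eta>0 V Vinf q N t k F\<bar> \<le> BF"
proof -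
  have B0: "0 \<le> BF" by (rule bounded_fun_bound_nonneg[OF F])
  have p0: "0 \<le> poisson_wt k" using measure_nonneg[of aux_law "ring_event k"] by (simp add: measure_ring_event)
  show ?thesis
  proof (cases "poisson_wt k = 0")
    case True
    then show ?thesis using B0 by (simp add: E_cond_eq)
  next
    case False
    then have p: "0 < poisson_wt k" using p0 by simp
    have "\<bar>\<integral>x. aux.mean_on {k} 0 x \<partial>PiM {..<q} (\<lambda>_. \<eta>0)\<bar> \<le> BF * poisson_wt k"
      using aux.integral_mean_on_bound[OF eta, of k] by (simp add: poisson_wt_def aux.lam_def)
    then show ?thesis unfolding E_cond_eq integral_ring_event using p by (simp add: abs_divide pos_divide_le_eq)
  qed
qed

lemma poisson_sums:
  "(\<lambda>k. poisson_wt k * E_cond K \<eta>0 V Vinf q N t k F) sums (\<integral>x. aux.mean_on UNIV 0 x \<partial>PiM {..<q} (\<lambda>_. \<eta>0))"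
  unfolding poisson_E_cond by (rule aux.integral_system_sums[OF eta])

lemma integral_F_e: "(\<integral>\<omega>. F_e V q t F (snd \<omega>) \<partial>aux_law) = (\<integral>x. aux.mean_on UNIV 0 x \<partial>PiM {..<q} (\<lambda>_. \<eta>0))"
  unfolding F_e_eq aux_system_def using aux.integral_system_UNIV[OF eta] by (simp add: aux.wt_def)

text \<open>The term without rings is a Feynman-Kac mean over q independent trajectories. The
  product of their exponential weights is the exponential of minus the integrated sum
  \<open>Waux\<close>, so the weighted law of the final positions is the q-fold product of
  \<open>gamma_flow\<close>, as is checked on boxes.\<close>

lemma integral_gamma_flow:
  "(\<integral>x. F x \<partial>PiM {..<q} (\<lambda>_. gamma_flow K \<eta>0 V t)) = (\<integral>x. aux.ring_term 0 0 x \<partial>PiM {..<q} (\<lambda>_. \<eta>0))"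
proof -
  define h where "h \<omega> = exp (- (LINT s:{0..t}|lborel. V s (\<omega> s)))" for \<omega> :: "real \<Rightarrow> 'a"
  have h_eq: "h \<omega> = exp (- tint 0 t (\<lambda>s. V (max 0 s) (\<omega> (max 0 s))))" for \<omega>
    unfolding h_def tint_eq_set_integral[symmetric] by (intro arg_cong[where f="\<lambda>x. exp (- x)"] tint_cong) simp
  have Vm: "(\<lambda>(\<omega>, s). V (max 0 s) (\<omega> (max 0 s))) \<in> borel_measurable (path_space \<Otimes>\<^sub>M borel)"
    unfolding case_prod_beta' by (rule measurable_V, simp, rule measurable_path_eval') auto
  have hm[measurable]: "h \<in> borel_measurable path_space"
    unfolding h_eq[abs_def] using Vm by measurable
  have h0: "0 \<le> h \<omega>" "h \<omega> \<le> 1" for \<omega>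
  proof -
    have "0 \<le> tint 0 t (\<lambda>s. V (max 0 s) (\<omega> (max 0 s)))" by (rule tint_nonneg) (rule V_bounds)
    then show "0 \<le> h \<omega>" "h \<omega> \<le> 1" by (auto simp: h_eq)
  qed
  let ?X = "X_law K \<eta>0"
  have K0: "K 0 \<in> borel \<rightarrow>\<^sub>M prob_algebra path_space"
    using measurable_K[of "\<lambda>_. 0" borel "\<lambda>x. x"] by simp
  have eta_sp: "\<eta>0 \<in> space (prob_algebra borel)" using eta by (simp add: space_prob_algebra)
  have X: "prob_space ?X" "sets ?X = sets path_space"
    unfolding X_law_def using prob_space_bind'[OF eta_sp K0] sets_bind'[OF eta_sp K0] by auto
  interpret X: prob_space ?X by (rule X)
  have hmX: "h \<in> borel_measurable ?X" using hm by (simp cong: measurable_cong_sets add: X(2))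
  have evX: "(\<lambda>\<omega>. \<omega> t) \<in> borel_measurable ?X"
    using path_space_coord[of t] t0 by (simp cong: measurable_cong_sets add: X(2))
  let ?G = "gamma_flow K \<eta>0 V t"
  have G_eq: "?G = distr (density ?X (\<lambda>\<omega>. ennreal (h \<omega>))) borel (\<lambda>\<omega>. \<omega> t)"
    unfolding gamma_flow_def h_def ..
  have Gem: "emeasure ?G A = (\<integral>\<^sup>+\<omega>. ennreal (h \<omega>) * indicator A (\<omega> t) \<partial>?X)" if A: "A \<in> sets borel" for A
  proof -
    have "emeasure ?G A = (\<integral>\<^sup>+x. indicator A x \<partial>?G)" using A by (simp add: G_eq)
    also have "\<dots> = (\<integral>\<^sup>+\<omega>. indicator A (\<omega> t) \<partial>density ?X (\<lambda>\<omega>. ennreal (h \<omega>)))"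
      unfolding G_eq by (rule nn_integral_distr) (use evX A in \<open>auto\<close>)
    also have "\<dots> = (\<integral>\<^sup>+\<omega>. ennreal (h \<omega>) * indicator A (\<omega> t) \<partial>?X)"
      by (rule nn_integral_density) (use hmX measurable_compose[OF evX borel_measurable_indicator[OF A]] in auto)
    finally show ?thesis .
  qed
  have "(\<integral>\<^sup>+\<omega>. ennreal (h \<omega>) \<partial>?X) \<le> (\<integral>\<^sup>+\<omega>. 1 \<partial>?X)"
    using h0 by (intro nn_integral_mono) simp
  moreover have "space ?G = UNIV" by (simp add: G_eq)
  ultimately have "emeasure ?G (space ?G) \<le> (\<integral>\<^sup>+\<omega>. 1 \<partial>?X)"
    using Gem[of UNIV] by simp
  then interpret G: finite_measure ?G
    by (intro finite_measureI) (auto simp: X.emeasure_space_1 top_unique)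
  \<comment> \<open>\<open>gamma_flow\<close> has mass at most 1 but need not be a probability
    measure, so its product is identified in the setting of \<sigma>-finite measures.\<close>
  interpret G: product_sigma_finite "\<lambda>_::nat. ?G" by unfold_locales
  let ?P = "PiM {..<q} (\<lambda>_. ?X)"
  have P: "prob_space ?P" "sets ?P = sets (paths q)"
    using X by (auto simp: paths_def intro!: prob_space_PiM sets_PiM_cong)
  have spP: "space ?P = space (paths q)" using P(2) by (rule sets_eq_imp_space_eq)
  have dens: "(\<Prod>i<q. ennreal (h (z i))) = ennreal (aux.wt 0 t z)" if z: "z \<in> space (paths q)" for z
  proof -
    have "(\<Prod>i<q. h (z i)) = exp (\<Sum>i<q. - tint 0 t (\<lambda>s. V (max 0 s) (z i (max 0 s))))"
      by (simp add: h_eq exp_sum)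
    also have "(\<Sum>i<q. - tint 0 t (\<lambda>s. V (max 0 s) (z i (max 0 s)))) = - tint 0 t (\<lambda>s. \<Sum>i<q. V (max 0 s) (z i (max 0 s)))"
    proof (subst tint_sum[where B=Vinf])
      show "(\<lambda>s. V (max 0 s) (z i (max 0 s))) \<in> borel_measurable borel" if "i \<in> {..<q}" for i
        using measurable_Pair2[OF Vm, of "z i"] z that by (simp add: space_paths)
      show "\<bar>V (max 0 u) (z i (max 0 u))\<bar> \<le> Vinf" for i u
        using V_bounds by (simp add: abs_of_nonneg)
    qed (auto simp: sum_negf)
    also have "tint 0 t (\<lambda>s. \<Sum>i<q. V (max 0 s) (z i (max 0 s))) = tint 0 t (\<lambda>v. Waux v (pos q z v))"
      unfolding Waux_def by (rule tint_cong) (simp add: pos_def)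
    finally have "(\<Prod>i<q. h (z i)) = aux.wt 0 t z" by (simp add: aux.wt_def)
    then show ?thesis using h0 by (simp add: prod_ennreal)
  qed
  have wtP: "(\<lambda>z. ennreal (aux.wt 0 t z)) \<in> borel_measurable ?P"
  proof -
    have "aux.wt 0 t \<in> borel_measurable (paths q)" by measurable
    then show ?thesis by (simp add: P(2) cong: measurable_cong_sets)
  qed
  have posP: "(\<lambda>z. pos q z t) \<in> ?P \<rightarrow>\<^sub>M state_space q"
  proof -
    have "(\<lambda>z. pos q z t) \<in> paths q \<rightarrow>\<^sub>M state_space q" by measurable
    then show ?thesis by (simp add: P(2) cong: measurable_cong_sets)
  qed
  have FS: "F \<in> borel_measurable (state_space q)" by (rule bounded_fun_measurable[OF F])
  let ?R = "distr (density ?P (\<lambda>z. ennreal (aux.wt 0 t z))) (state_space q) (\<lambda>z. pos q z t)"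
  have "?R = PiM {..<q} (\<lambda>_. ?G)"
  proof (rule G.PiM_eqI)
    show "sets ?R = sets (PiM {..<q} (\<lambda>_. ?G))"
      by (simp add: state_space_def G_eq cong: sets_PiM_cong)
    fix A assume "\<And>i. i \<in> {..<q} \<Longrightarrow> A i \<in> sets ?G"
    then have A: "A i \<in> sets borel" if "i < q" for i using that by (simp add: G_eq)
    have As: "PiE {..<q} A \<in> sets (state_space q)" unfolding state_space_def using A by (intro sets_PiM_I_finite) auto
    have "emeasure ?R (PiE {..<q} A) = (\<integral>\<^sup>+x. indicator (PiE {..<q} A) x \<partial>?R)" using As by simp
    also have "\<dots> = (\<integral>\<^sup>+z. indicator (PiE {..<q} A) (pos q z t) \<partial>density ?P (\<lambda>z. ennreal (aux.wt 0 t z)))"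
      by (rule nn_integral_distr) (use posP As in auto)
    also have "\<dots> = (\<integral>\<^sup>+z. ennreal (aux.wt 0 t z) * indicator (PiE {..<q} A) (pos q z t) \<partial>?P)"
      by (rule nn_integral_density[OF wtP]) (use measurable_compose[OF posP borel_measurable_indicator[OF As]] in auto)
    also have "\<dots> = (\<integral>\<^sup>+z. (\<Prod>i<q. ennreal (h (z i)) * indicator (A i) (z i t)) \<partial>?P)"
    proof (rule nn_integral_cong)
      fix z assume z: "z \<in> space ?P"
      have "pos q z t \<in> PiE {..<q} A \<longleftrightarrow> (\<forall>i<q. z i t \<in> A i)" using t0 by (auto simp: pos_def)
      then have "indicator (PiE {..<q} A) (pos q z t) = (\<Prod>i<q. indicator (A i) (z i t) :: ennreal)"
        by (auto simp: indicator_def prod_zero_iff)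
      then show "ennreal (aux.wt 0 t z) * indicator (PiE {..<q} A) (pos q z t) = (\<Prod>i<q. ennreal (h (z i)) * indicator (A i) (z i t))"
        using dens[of z] z spP by (simp add: prod.distrib)
    qed
    also have "\<dots> = (\<Prod>i<q. \<integral>\<^sup>+\<omega>. ennreal (h \<omega>) * indicator (A i) (\<omega> t) \<partial>?X)"
      by (rule nn_integral_PiM_prod)
         (use X hmX A measurable_compose[OF evX borel_measurable_indicator] in \<open>auto intro!: borel_measurable_times_ennreal\<close>)
    also have "\<dots> = (\<Prod>i<q. emeasure ?G (A i))" by (intro prod.cong refl Gem[symmetric] A) auto
    finally show "emeasure ?R (PiE {..<q} A) = (\<Prod>i<q. emeasure ?G (A i))" .
  qed simp
  then have "(\<integral>x. F x \<partial>PiM {..<q} (\<lambda>_. ?G)) = (\<integral>x. F x \<partial>?R)" by simp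
  also have "\<dots> = (\<integral>z. F (pos q z t) \<partial>density ?P (\<lambda>z. ennreal (aux.wt 0 t z)))"
    by (rule integral_distr) (use posP FS in auto)
  also have "\<dots> = (\<integral>z. aux.wt 0 t z * F (pos q z t) \<partial>?P)"
  proof (subst integral_density)
    have "aux.wt 0 t \<in> borel_measurable (paths q)" by measurable
    then show "aux.wt 0 t \<in> borel_measurable ?P" by (simp add: P(2) cong: measurable_cong_sets)
  qed (use measurable_compose[OF posP FS] aux.wt_le in auto)
  \<comment> \<open>q independent trajectories of X amount to q independent starting points followed
    by independent motions, by \<open>PiM_bind\<close>.\<close>
  also have "?P = PiM {..<q} (\<lambda>_. \<eta>0) \<bind> (\<lambda>x. prod_law K q 0 x)"
    unfolding X_law_def prod_law_def
    by (subst PiM_bind[where M'="\<lambda>_. borel" and N="\<lambda>_. path_space"]) (use eta_sp K0 in auto)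
  also have "(\<integral>z. aux.wt 0 t z * F (pos q z t) \<partial>(PiM {..<q} (\<lambda>_. \<eta>0) \<bind> (\<lambda>x. prod_law K q 0 x))) =
     (\<integral>x. \<integral>z. aux.wt 0 t z * F (pos q z t) \<partial>prod_law K q 0 x \<partial>PiM {..<q} (\<lambda>_. \<eta>0))"
  proof (rule integral_bind_bounded[OF aux.Init_prob[OF eta]])
    show "(\<lambda>x. prod_law K q 0 x) \<in> state_space q \<rightarrow>\<^sub>M prob_algebra (paths q)" by measurable
    show "(\<lambda>z. aux.wt 0 t z * F (pos q z t)) \<in> borel_measurable (paths q)" by measurable
    show "\<bar>aux.wt 0 t z * F (pos q z t)\<bar> \<le> BF" for z using aux.F_wt_bound[of z 0 t] by (simp add: mult.commute)
  qed
  also have "\<dots> = (\<integral>x. aux.ring_term 0 0 x \<partial>PiM {..<q} (\<lambda>_. \<eta>0))"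
    by (simp add: PK_def aux.wt_def mult.commute)
  finally show ?thesis .
qed

end

end

end

section \<open>Expansion in powers of \<open>1/N\<close>\<close>

lemma sums_exp: "(\<lambda>k. x ^ k / fact k) sums exp (x::real)"
  using exp_converges[of x] by (simp add: divide_inverse mult.commute)

lemma summable_norm_exp: "summable (\<lambda>k. norm (x ^ k / fact k :: real))"
  using sums_summable[OF sums_exp[of "\<bar>x\<bar>"]] by (simp add: power_abs abs_divide)

context
  fixes E :: "nat \<Rightarrow> real" and B x Q :: real
  assumes E: "\<And>k. \<bar>E k\<bar> \<le> B" and Q: "(\<lambda>k. x ^ k * exp (- x) / fact k * E k) sums Q"
begin

lemma summable_norm_exp_weighted: "summable (\<lambda>k. norm (x ^ k / fact k * E k))"
proof (rule summable_comparison_test'[where N=0])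
  show "summable (\<lambda>k. norm (x ^ k / fact k) * B)" by (intro summable_mult2 summable_norm_exp)
  show "norm (norm (x ^ k / fact k * E k)) \<le> norm (x ^ k / fact k) * B" for k
    unfolding norm_mult using E[of k] by (auto intro!: mult_left_mono simp del: times_divide_eq_left)
qed

lemma poisson_mixture_factored: "(\<Sum>k. x ^ k / fact k * E k) * exp (- x) = Q"
proof -
  have "(\<lambda>k. x ^ k / fact k * E k * exp (- x)) sums Q" using Q by (simp add: mult.commute mult.left_commute)
  moreover have "(\<lambda>k. x ^ k / fact k * E k * exp (- x)) sums ((\<Sum>k. x ^ k / fact k * E k) * exp (- x))"
    by (intro sums_mult2 summable_sums summable_norm_cancel[OF summable_norm_exp_weighted])
  ultimately show ?thesis by (rule sums_unique2[symmetric])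
qed

text \<open>The Cauchy product of the exponential series weighted by E with the series of exp (- x);
  on the diagonal k + i = r the powers of x combine to x ^ r.\<close>

lemma poisson_mixture_power_series:
  "(\<lambda>r. \<Sum>k\<le>r. (-1) ^ (r - k) / (fact k * fact (r - k)) * x ^ r * E k) sums Q"
proof -
  have "(\<lambda>r. \<Sum>k\<le>r. (x ^ k / fact k * E k) * ((- x) ^ (r - k) / fact (r - k))) sums ((\<Sum>k. x ^ k / fact k * E k) * (\<Sum>k. (- x) ^ k / fact k))"
    by (rule Cauchy_product_sums[OF summable_norm_exp_weighted summable_norm_exp])
  also have "(\<Sum>k. x ^ k / fact k * E k) * (\<Sum>k. (- x) ^ k / fact k) = Q"
    using poisson_mixture_factored sums_unique[OF sums_exp[of "- x"]] by simp
  finally have S: "(\<lambda>r. \<Sum>k\<le>r. (x ^ k / fact k * E k) * ((- x) ^ (r - k) / fact (r - k))) sums Q" .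
  have "(x ^ k / fact k * E k) * ((- x) ^ (r - k) / fact (r - k)) = (-1) ^ (r - k) / (fact k * fact (r - k)) * x ^ r * E k"
    if "k \<le> r" for k r :: nat
  proof -
    have "x ^ r = x ^ k * x ^ (r - k)" using that by (simp flip: power_add)
    moreover have "(- x) ^ (r - k) = (-1) ^ (r - k) * x ^ (r - k)" by (rule power_minus)
    ultimately show ?thesis by simp
  qed
  then have "(\<Sum>k\<le>r. (x ^ k / fact k * E k) * ((- x) ^ (r - k) / fact (r - k))) =
      (\<Sum>k\<le>r. (-1) ^ (r - k) / (fact k * fact (r - k)) * x ^ r * E k)" for r
    by (intro sum.cong refl) auto
  with S show ?thesis by (simp only:)
qed

text \<open>\<open>has_sum\<close> refers to no order of summation, so absolute summability over all
  pairs comes first. The total is then computed row by row, and the omitted pair (0, 0) carries the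
  value E 0.\<close>

lemma poisson_mixture_double_series:
  "((\<lambda>(k, i). (-1) ^ i * (x ^ (k + i) / (fact k * fact i)) * E k) has_sum (Q - E 0)) {(k, i). k + i \<ge> 1}"
proof -
  let ?a = "\<lambda>k. x ^ k / fact k * E k" and ?b = "\<lambda>i. (- x) ^ i / fact i"
  let ?f = "\<lambda>(k, i). (-1) ^ i * (x ^ (k + i) / (fact k * fact i)) * E k :: real"
  have f: "?f (k, i) = ?a k * ?b i" for k i by (simp add: power_add power_minus[of x i])
  have b: "(?b has_sum exp (- x)) UNIV" by (rule norm_summable_imp_has_sum[OF summable_norm_exp sums_exp])
  have nb: "((\<lambda>i. norm (?b i)) has_sum (\<Sum>i. norm (?b i))) UNIV"
    by (rule norm_summable_imp_has_sum) (use summable_norm_exp[of "- x"] in \<open>auto intro!: summable_sums\<close>)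
  have a: "(?a has_sum (\<Sum>k. ?a k)) UNIV"
    by (rule norm_summable_imp_has_sum[OF summable_norm_exp_weighted summable_sums[OF summable_norm_cancel[OF summable_norm_exp_weighted]]])
  have na: "((\<lambda>k. norm (?a k)) has_sum (\<Sum>k. norm (?a k))) UNIV"
    by (rule norm_summable_imp_has_sum) (use summable_norm_exp_weighted in \<open>auto intro!: summable_sums\<close>)
  have "(\<lambda>p. norm (?f p)) summable_on Sigma UNIV (\<lambda>_. UNIV)"
  proof (rule summable_on_SigmaI)
    show "((\<lambda>i. norm (?f (k, i))) has_sum (norm (?a k) * (\<Sum>i. norm (?b i)))) UNIV" for k
      unfolding f norm_mult[of "?a k"] by (rule has_sum_cmult_right[OF nb])
    show "(\<lambda>k. norm (?a k) * (\<Sum>i. norm (?b i))) summable_on UNIV"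
      using has_sum_cmult_left[OF na] by (rule has_sum_imp_summable)
  qed auto
  then have sm: "?f summable_on UNIV \<times> UNIV" by (rule abs_summable_summable)
  have "(?f has_sum ((\<Sum>k. ?a k) * exp (- x))) (Sigma UNIV (\<lambda>_. UNIV))"
  proof (rule has_sum_SigmaI[OF _ _ sm])
    show "((\<lambda>i. ?f (k, i)) has_sum (?a k * exp (- x))) UNIV" for k
      unfolding f by (rule has_sum_cmult_right[OF b])
    show "((\<lambda>k. ?a k * exp (- x)) has_sum ((\<Sum>k. ?a k) * exp (- x))) UNIV"
      by (rule has_sum_cmult_left[OF a])
  qed
  then have tot: "infsum ?f UNIV = Q" unfolding poisson_mixture_factored using infsumI[of ?f "UNIV \<times> UNIV" Q] by (simp only: UNIV_Times_UNIV)
  have sm': "?f summable_on UNIV" using sm by simp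
  have "infsum ?f (UNIV - {(0, 0)}) = infsum ?f UNIV - infsum ?f {(0, 0)}"
    by (rule infsum_Diff[OF sm']) auto
  also have "\<dots> = Q - E 0" unfolding tot by simp
  finally have "(?f has_sum (Q - E 0)) (UNIV - {(0, 0)})"
    using has_sum_infsum[OF summable_on_subset_banach[OF sm', of "UNIV - {(0, 0)}"]] by simp
  moreover have "UNIV - {(0, 0)} = {(k, i). k + i \<ge> (1::nat)}" by auto
  ultimately show ?thesis by simp
qed

end

text \<open>Each coefficient is at most B times that of the Cauchy product of the series of exp c
  with itself. The constant exp c * exp c will bound the discrete derivatives of all orders,
  uniformly in N.\<close>

lemma summable_power_series_coeffs:
  fixes E :: "nat \<Rightarrow> real"
  assumes E: "\<And>k. \<bar>E k\<bar> \<le> B" and c: "0 \<le> c"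
  defines "a \<equiv> \<lambda>r. \<Sum>k\<le>r. (-1) ^ (r - k) / (fact k * fact (r - k)) * c ^ r * E k"
  shows "summable (\<lambda>r. \<bar>a r\<bar>)" "(\<Sum>r. \<bar>a r\<bar>) \<le> exp c * exp c * B"
proof -
  have S: "(\<lambda>r. \<Sum>k\<le>r. (c ^ k / fact k) * (c ^ (r - k) / fact (r - k))) sums (exp c * exp c)"
    using Cauchy_product_sums[OF summable_norm_exp[of c] summable_norm_exp[of c]]
    by (simp add: sums_unique[OF sums_exp, symmetric])
  have le: "\<bar>a r\<bar> \<le> (\<Sum>k\<le>r. (c ^ k / fact k) * (c ^ (r - k) / fact (r - k))) * B" for r
  proof -
    have "\<bar>a r\<bar> \<le> (\<Sum>k\<le>r. \<bar>(-1) ^ (r - k) / (fact k * fact (r - k)) * c ^ r * E k\<bar>)"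
      unfolding a_def by (rule sum_abs)
    also have "\<dots> \<le> (\<Sum>k\<le>r. (c ^ k / fact k) * (c ^ (r - k) / fact (r - k)) * B)"
    proof (rule sum_mono)
      fix k assume "k \<in> {..r}"
      then have "c ^ r = c ^ k * c ^ (r - k)" by (simp flip: power_add)
      then have "\<bar>(-1) ^ (r - k) / (fact k * fact (r - k)) * c ^ r * E k\<bar> = (c ^ k / fact k) * (c ^ (r - k) / fact (r - k)) * \<bar>E k\<bar>"
        using c by (simp add: abs_mult power_abs)
      also have "\<dots> \<le> (c ^ k / fact k) * (c ^ (r - k) / fact (r - k)) * B"
        using c E by (intro mult_left_mono) auto
      finally show "\<bar>(-1) ^ (r - k) / (fact k * fact (r - k)) * c ^ r * E k\<bar> \<le> \<dots>" .
    qed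
    finally show ?thesis by (simp add: sum_distrib_right)
  qed
  show s: "summable (\<lambda>r. \<bar>a r\<bar>)"
    by (rule summable_comparison_test'[where N=0, OF sums_summable[OF sums_mult2[OF S, of B]]]) (use le in auto)
  show "(\<Sum>r. \<bar>a r\<bar>) \<le> exp c * exp c * B"
    using sums_le[OF le summable_sums[OF s] sums_mult2[OF S, of B]] .
qed

section \<open>Discrete derivatives of power series in 1/N\<close>

lemma power_series_shift:
  fixes b :: "nat \<Rightarrow> real"
  assumes D: "(\<lambda>j. b j / real N ^ j) sums D" and N: "0 < N"
  shows "(\<lambda>j. b (Suc j) / real N ^ j) sums (real N * (D - b 0))"
proof -
  have "(\<lambda>j. b (Suc j) / real N ^ Suc j) sums (D - b 0)" using D sums_Suc_iff[of "\<lambda>j. b j / real N ^ j" "D - b 0"] by simp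
  then have "(\<lambda>j. real N * (b (Suc j) / real N ^ Suc j)) sums (real N * (D - b 0))" by (rule sums_mult)
  then show ?thesis using N by simp
qed

lemma power_series_bound:
  fixes b :: "nat \<Rightarrow> real"
  assumes b: "summable (\<lambda>j. \<bar>b j\<bar>)" and D: "(\<lambda>j. b j / real N ^ j) sums D" and N: "0 < N"
  shows "\<bar>D\<bar> \<le> (\<Sum>j. \<bar>b j\<bar>)"
proof -
  have le: "\<bar>b j / real N ^ j\<bar> \<le> \<bar>b j\<bar>" for j
    using N by (simp add: abs_divide divide_le_eq mult_le_cancel_left1 one_le_power)
  have s: "summable (\<lambda>j. \<bar>b j / real N ^ j\<bar>)"
    by (rule summable_comparison_test'[OF b, of 0]) (use le in auto)
  have "\<bar>D\<bar> \<le> (\<Sum>j. \<bar>b j / real N ^ j\<bar>)" using summable_rabs[OF s] sums_unique[OF D] by simp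
  also have "\<dots> \<le> (\<Sum>j. \<bar>b j\<bar>)" by (rule suminf_le[OF le s b])
  finally show ?thesis .
qed

text \<open>N times the remainder D N - b 0 is again a power series with absolutely summable
  coefficients, so the remainder is of order 1/N.\<close>

lemma power_series_limit:
  fixes b :: "nat \<Rightarrow> real"
  assumes b: "summable (\<lambda>j. \<bar>b j\<bar>)" and D: "\<And>N. q \<le> N \<Longrightarrow> (\<lambda>j. b j / real N ^ j) sums D N" and q: "1 \<le> q"
  shows "D \<longlonglongrightarrow> b 0"
proof -
  let ?S = "\<Sum>j. \<bar>b (Suc j)\<bar>"
  have bS: "summable (\<lambda>j. \<bar>b (Suc j)\<bar>)" using b summable_Suc_iff[of "\<lambda>j. \<bar>b j\<bar>"] by simp
  have "\<bar>D N - b 0\<bar> \<le> ?S / real N" if N: "q \<le> N" for N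
  proof -
    have N0: "0 < N" using N q by simp
    have "\<bar>real N * (D N - b 0)\<bar> \<le> ?S"
      by (rule power_series_bound[OF bS power_series_shift[OF D[OF N] N0] N0])
    then show ?thesis using N0 by (simp add: abs_mult le_divide_eq mult.commute)
  qed
  then have "eventually (\<lambda>N. norm (D N - b 0) \<le> ?S / real N) sequentially"
    unfolding eventually_sequentially real_norm_def by blast
  then have "(\<lambda>N. D N - b 0) \<longlonglongrightarrow> 0"
    by (rule Lim_null_comparison) (rule lim_const_over_n)
  then show ?thesis by (rule LIM_zero_cancel)
qed

text \<open>Subtracting the limit, which is the constant coefficient, and multiplying by N shifts
  the coefficients by one place. So the r-th discrete derivative starts with a r, and since N \<ge>
  1 the sum of the absolute values of all coefficients bounds every order.\<close>

lemma discrete_deriv_power_series: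
  fixes a :: "nat \<Rightarrow> real"
  assumes a: "summable (\<lambda>j. \<bar>a j\<bar>)" and \<Theta>: "\<And>N. q \<le> N \<Longrightarrow> (\<lambda>j. a j / real N ^ j) sums \<Theta> N F" and q: "1 \<le> q"
  shows "q \<le> N \<Longrightarrow> (\<lambda>j. a (j + r) / real N ^ j) sums discrete_deriv r \<Theta> N F"
    and "(\<lambda>N. discrete_deriv r \<Theta> N F) \<longlonglongrightarrow> a r"
    and "q \<le> N \<Longrightarrow> \<bar>discrete_deriv r \<Theta> N F\<bar> \<le> (\<Sum>j. \<bar>a j\<bar>)"
proof -
  have ar: "summable (\<lambda>j. \<bar>a (j + r)\<bar>)" for r using a by (rule summable_ignore_initial_segment)
  have s: "\<forall>N\<ge>q. (\<lambda>j. a (j + r) / real N ^ j) sums discrete_deriv r \<Theta> N F" for r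
  proof (induction r)
    case 0
    then show ?case using \<Theta> by simp
  next
    case (Suc r)
    have "(\<lambda>N. discrete_deriv r \<Theta> N F) \<longlonglongrightarrow> a (0 + r)"
      by (rule power_series_limit[OF ar _ q]) (use Suc in auto)
    then have l: "lim (\<lambda>N. discrete_deriv r \<Theta> N F) = a (0 + r)" by (rule limI)
    show ?case
    proof (intro allI impI)
      fix N assume N: "q \<le> N"
      show "(\<lambda>j. a (j + Suc r) / real N ^ j) sums discrete_deriv (Suc r) \<Theta> N F"
        using power_series_shift[OF Suc[rule_format, OF N]] N q by (simp add: l)
    qed
  qed
  show "q \<le> N \<Longrightarrow> (\<lambda>j. a (j + r) / real N ^ j) sums discrete_deriv r \<Theta> N F" using s by blast
  show "(\<lambda>N. discrete_deriv r \<Theta> N F) \<longlonglongrightarrow> a r"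
    using power_series_limit[OF ar s[rule_format] q] by simp
  assume N: "q \<le> N"
  have "\<bar>discrete_deriv r \<Theta> N F\<bar> \<le> (\<Sum>j. \<bar>a (j + r)\<bar>)"
    by (rule power_series_bound[OF ar s[rule_format, OF N]]) (use N q in auto)
  also have "\<dots> \<le> (\<Sum>j. \<bar>a j\<bar>)" using suminf_split_initial_segment[OF a, of r] by (simp add: sum_nonneg)
  finally show "\<bar>discrete_deriv r \<Theta> N F\<bar> \<le> (\<Sum>j. \<bar>a j\<bar>)" .
qed

text \<open>The two finite measures come from the positive and the negative part of the weight D,
  carried to the state space by \<pi>.\<close>

lemma is_signed_measure_weighted:
  fixes D :: "'b \<Rightarrow> real"
  assumes M: "prob_space M" and D[measurable]: "D \<in> borel_measurable M" and C: "\<And>\<omega>. \<bar>D \<omega>\<bar> \<le> C"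
    and \<pi>[measurable]: "\<pi> \<in> M \<rightarrow>\<^sub>M state_space q" and \<B>: "test_class q \<B>"
    and \<Theta>: "\<And>f. f \<in> \<B> \<Longrightarrow> \<Theta> f = (\<integral>\<omega>. D \<omega> * f (\<pi> \<omega>) \<partial>M)"
  shows "is_signed_measure q \<B> \<Theta>"
proof -
  interpret prob_space M by fact
  define \<mu> where "\<mu> G = distr (density M (\<lambda>\<omega>. ennreal (max 0 (G \<omega>)))) (state_space q) \<pi>" for G :: "'b \<Rightarrow> real"
  have fin: "finite_measure (\<mu> G)" if [measurable]: "G \<in> borel_measurable M" and G: "\<And>\<omega>. \<bar>G \<omega>\<bar> \<le> C" for G
  proof (rule finite_measureI)
    have "emeasure (\<mu> G) (space (\<mu> G)) = (\<integral>\<^sup>+\<omega>. ennreal (max 0 (G \<omega>)) \<partial>M)"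
      unfolding \<mu>_def by (subst emeasure_distr) (auto simp: emeasure_density intro!: nn_integral_cong simp: measurable_space[OF \<pi>])
    also have "\<dots> \<le> (\<integral>\<^sup>+\<omega>. ennreal C \<partial>M)"
    proof (intro nn_integral_mono ennreal_leI)
      show "max 0 (G \<omega>) \<le> C" for \<omega> using G[of \<omega>] by auto
    qed
    also have "\<dots> = ennreal C" by (simp add: emeasure_space_1)
    finally show "emeasure (\<mu> G) (space (\<mu> G)) \<noteq> \<infinity>" by (auto simp: top_unique)
  qed
  have int: "(\<integral>x. f x \<partial>\<mu> G) = (\<integral>\<omega>. max 0 (G \<omega>) * f (\<pi> \<omega>) \<partial>M)"
    if [measurable]: "G \<in> borel_measurable M" "f \<in> borel_measurable (state_space q)" for G f
    unfolding \<mu>_def by (subst integral_distr, simp, simp, subst integral_density) auto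
  have "\<Theta> f = (\<integral>x. f x \<partial>\<mu> D) - (\<integral>x. f x \<partial>\<mu> (\<lambda>\<omega>. - D \<omega>))" if f: "f \<in> \<B>" for f
  proof -
    obtain b where [measurable]: "f \<in> borel_measurable (state_space q)" and b: "\<And>x. x \<in> space (state_space q) \<Longrightarrow> \<bar>f x\<bar> \<le> b"
      using \<B> f unfolding test_class_def by blast
    have i: "integrable M (\<lambda>\<omega>. max 0 (G \<omega>) * f (\<pi> \<omega>))" if [measurable]: "G \<in> borel_measurable M" and G: "\<And>\<omega>. \<bar>G \<omega>\<bar> \<le> C" for G
    proof (rule prob_integrable_bounded[OF M, where B="C * b"])
      fix \<omega> assume "\<omega> \<in> space M"
      then have "\<bar>f (\<pi> \<omega>)\<bar> \<le> b" using b measurable_space[OF \<pi>] by auto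
      moreover have "\<bar>max 0 (G \<omega>)\<bar> \<le> C" using G[of \<omega>] by auto
      ultimately show "\<bar>max 0 (G \<omega>) * f (\<pi> \<omega>)\<bar> \<le> C * b" unfolding abs_mult by (intro mult_mono) auto
    qed measurable
    have "(\<integral>x. f x \<partial>\<mu> D) - (\<integral>x. f x \<partial>\<mu> (\<lambda>\<omega>. - D \<omega>)) =
      (\<integral>\<omega>. max 0 (D \<omega>) * f (\<pi> \<omega>) - max 0 (- D \<omega>) * f (\<pi> \<omega>) \<partial>M)"
      using i[of D] i[of "\<lambda>\<omega>. - D \<omega>"] C by (simp add: int)
    also have "\<dots> = (\<integral>\<omega>. D \<omega> * f (\<pi> \<omega>) \<partial>M)"
      by (intro Bochner_Integration.integral_cong refl) (auto simp: max_def)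
    finally show ?thesis using \<Theta>[OF f] by simp
  qed
  moreover have "sets (\<mu> G) = sets (state_space q)" for G by (simp add: \<mu>_def)
  ultimately show ?thesis unfolding is_signed_measure_def using fin[of D] fin[of "\<lambda>\<omega>. - D \<omega>"] C
    by (intro exI[of _ "\<mu> D"] exI[of _ "\<mu> (\<lambda>\<omega>. - D \<omega>)"]) auto
qed

lemma test_class_bounded_fun: "test_class q \<B> \<Longrightarrow> F \<in> \<B> \<Longrightarrow> \<exists>B. bounded_fun q F B"
  by (auto simp: test_class_def bounded_fun_def)

section \<open>The expansion of \<open>Q_N\<close> and its derivatives\<close>

context feynman_kac begin

abbreviation "total_rate \<equiv> real q * (real q - 1) * Vinf * t"

text \<open>The conditional means do not depend on N; the choice N = q fixes one
  representative.\<close>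

abbreviation "cond_mean k F \<equiv> E_cond K \<eta>0 V Vinf q q t k F"

definition deriv_coeff :: "((nat \<Rightarrow> 'a) \<Rightarrow> real) \<Rightarrow> nat \<Rightarrow> real" where
  "deriv_coeff F r = (\<Sum>k\<le>r. (-1) ^ (r - k) / (fact k * fact (r - k)) * total_rate ^ r * cond_mean k F)"

lemma total_rate_nonneg: "0 \<le> total_rate"
  using q1 t0 Vinf_pos by simp

text \<open>In \<open>E_cond_formula\<close> the right-hand side is free of N, since
  \<open>ring_term\<close> does not involve the rate of the clocks.\<close>

lemma E_cond_N_independent:
  assumes N: "0 < N" and F: "bounded_fun q F BF"
  shows "E_cond K \<eta>0 V Vinf q N t k F = cond_mean k F"
  using E_cond_formula[OF N F, of k] E_cond_formula[OF _ F, of q k] q1 by simp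

lemma cond_mean_0:
  assumes F: "bounded_fun q F BF"
  shows "cond_mean 0 F = (\<integral>x. F x \<partial>PiM {..<q} (\<lambda>_. gamma_flow K \<eta>0 V t))"
  using E_cond_formula[OF _ F, of q 0] integral_gamma_flow[OF _ F, of q] q1 by simp

lemma Q_N_poisson_sums:
  assumes N: "q \<le> N" and F: "bounded_fun q F BF"
  shows "(\<lambda>k. (total_rate / real N) ^ k * exp (- (total_rate / real N)) / fact k * cond_mean k F) sums Q_N K \<eta>0 V Vinf t q N F"
proof -
  have N0: "0 < N" using N q1 by simp
  have r: "real (card (aux_clocks q)) * (Vinf / real N) * t = total_rate / real N"
    using card_aux_clocks[OF q1] by simp
  have "(\<lambda>k. poisson_wt N k * E_cond K \<eta>0 V Vinf q N t k F) sums Q_N K \<eta>0 V Vinf t q N F"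
    unfolding Q_N_eq[OF N F] by (rule poisson_sums[OF N0 F])
  then show ?thesis
    unfolding poisson_wt_def[OF N0] E_cond_N_independent[OF N0 F] mult_minus_left r by (simp only: mult.commute)
qed

lemma cond_mean_bound: "bounded_fun q F BF \<Longrightarrow> \<bar>cond_mean k F\<bar> \<le> BF"
  using E_cond_bound[of q F BF k] q1 by simp

lemma Q_N_power_series:
  assumes N: "q \<le> N" and F: "bounded_fun q F BF"
  shows "(\<lambda>r. deriv_coeff F r / real N ^ r) sums Q_N K \<eta>0 V Vinf t q N F"
  using poisson_mixture_power_series[OF cond_mean_bound[OF F] Q_N_poisson_sums[OF N F]]
  by (simp add: deriv_coeff_def power_divide sum_divide_distrib)

lemma deriv_coeff_summable:
  assumes F: "bounded_fun q F BF"
  shows "summable (\<lambda>r. \<bar>deriv_coeff F r\<bar>)" "(\<Sum>r. \<bar>deriv_coeff F r\<bar>) \<le> exp total_rate * exp total_rate * BF"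
  unfolding deriv_coeff_def
  by (rule summable_power_series_coeffs[where E="\<lambda>k. cond_mean k F", OF cond_mean_bound[OF F] total_rate_nonneg])+

lemma discrete_deriv_Q_N:
  assumes F: "bounded_fun q F BF"
  shows "(\<lambda>N. discrete_deriv r (Q_N K \<eta>0 V Vinf t q) N F) \<longlonglongrightarrow> deriv_coeff F r"
    and "q \<le> N \<Longrightarrow> \<bar>discrete_deriv r (Q_N K \<eta>0 V Vinf t q) N F\<bar> \<le> exp total_rate * exp total_rate * BF"
proof -
  note D = discrete_deriv_power_series[where \<Theta>="Q_N K \<eta>0 V Vinf t q" and F=F,
    OF deriv_coeff_summable(1)[OF F] Q_N_power_series[OF _ F] q1]
  show "(\<lambda>N. discrete_deriv r (Q_N K \<eta>0 V Vinf t q) N F) \<longlonglongrightarrow> deriv_coeff F r" by (rule D(2))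
  show "q \<le> N \<Longrightarrow> \<bar>discrete_deriv r (Q_N K \<eta>0 V Vinf t q) N F\<bar> \<le> exp total_rate * exp total_rate * BF"
    using D(3)[of N r] deriv_coeff_summable(2)[OF F] by linarith
qed

lemma limit_deriv_Q_N:
  "bounded_fun q F BF \<Longrightarrow> limit_deriv r (Q_N K \<eta>0 V Vinf t q) F = deriv_coeff F r"
  unfolding limit_deriv_def by (intro limI discrete_deriv_Q_N)

lemma strongly_converges_Q_N:
  assumes \<B>: "test_class q \<B>"
  shows "strongly_converges q \<B> (discrete_deriv r (Q_N K \<eta>0 V Vinf t q)) (limit_deriv r (Q_N K \<eta>0 V Vinf t q))"
  unfolding strongly_converges_def
proof
  let ?C = "exp total_rate * exp total_rate"
  have "(SUP N\<in>{q..}. tv_norm q \<B> (discrete_deriv r (Q_N K \<eta>0 V Vinf t q) N)) \<le> ennreal ?C"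
    unfolding tv_norm_def
  proof (intro SUP_least ennreal_leI)
    fix N f assume N: "N \<in> {q..}" and f: "f \<in> {f \<in> \<B>. \<forall>x\<in>space (state_space q). \<bar>f x\<bar> \<le> 1}"
    then have "bounded_fun q f 1" using \<B> by (auto simp: bounded_fun_def test_class_def)
    then show "\<bar>discrete_deriv r (Q_N K \<eta>0 V Vinf t q) N f\<bar> \<le> ?C"
      using discrete_deriv_Q_N(2)[of f 1 N r] N by simp
  qed
  then show "uniformly_bounded q \<B> (discrete_deriv r (Q_N K \<eta>0 V Vinf t q))"
    unfolding uniformly_bounded_def infinity_ennreal_def using ennreal_less_top by (rule le_less_trans)
  show "\<forall>f\<in>\<B>. (\<lambda>N. discrete_deriv r (Q_N K \<eta>0 V Vinf t q) N f) \<longlonglongrightarrow> limit_deriv r (Q_N K \<eta>0 V Vinf t q) f"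
  proof
    fix f assume "f \<in> \<B>"
    then obtain b where "bounded_fun q f b" using test_class_bounded_fun[OF \<B>] by blast
    then show "(\<lambda>N. discrete_deriv r (Q_N K \<eta>0 V Vinf t q) N f) \<longlonglongrightarrow> limit_deriv r (Q_N K \<eta>0 V Vinf t q) f"
      using discrete_deriv_Q_N(1) limit_deriv_Q_N by metis
  qed
qed

text \<open>\<open>F_e\<close> depends linearly on F through the final positions, so integrating it
  with a bounded weight g means integrating F against a signed measure on the final
  positions.\<close>

lemma aux_law_signed_measure:
  fixes g :: "_ \<Rightarrow> real"
  assumes N: "0 < N" and g[measurable]: "g \<in> borel_measurable (aux_system K \<eta>0 V Vinf q N t)" and C: "\<And>\<omega>. \<bar>g \<omega>\<bar> \<le> C"
    and \<B>: "test_class q \<B>"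
    and \<Theta>: "\<And>f. f \<in> \<B> \<Longrightarrow> \<Theta> f = (\<integral>\<omega>. g \<omega> * F_e V q t f (snd \<omega>) \<partial>aux_system K \<eta>0 V Vinf q N t)"
  shows "is_signed_measure q \<B> \<Theta>"
proof (rule is_signed_measure_weighted[OF aux_law_prob(1)[OF N] _ _ _ \<B>])
  \<comment> \<open>At the constant function 1, \<open>F_e\<close> is the exponential weight
    alone.\<close>
  let ?w = "\<lambda>\<omega>. F_e V q t (\<lambda>_. 1) (snd \<omega>)"
  have "bounded_fun q (\<lambda>_. 1 :: real) 1" by (simp add: bounded_fun_def)
  from measurable_F_e[OF N this] show "(\<lambda>\<omega>. g \<omega> * ?w \<omega>) \<in> borel_measurable (aux_system K \<eta>0 V Vinf q N t)" by measurable
  show "\<bar>g \<omega> * ?w \<omega>\<bar> \<le> C" for \<omega>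
  proof -
    have "0 \<le> tint 0 t (\<lambda>v. Waux v (pos q (snd \<omega>) v))"
      by (rule tint_nonneg) (unfold Waux_def, intro sum_nonneg V_bounds)
    then have "\<bar>?w \<omega>\<bar> \<le> 1" by (simp add: F_e_eq)
    then show ?thesis using mult_mono[OF C[of \<omega>], of "\<bar>?w \<omega>\<bar>" 1] order_trans[OF abs_ge_zero C[of \<omega>]] by (simp add: abs_mult)
  qed
  have "(\<lambda>\<omega>. pos q (snd \<omega>) t) \<in> clocks (aux_clocks q) (Vinf / real N) \<Otimes>\<^sub>M paths q \<rightarrow>\<^sub>M state_space q" by measurable
  then show "(\<lambda>\<omega>. pos q (snd \<omega>) t) \<in> aux_system K \<eta>0 V Vinf q N t \<rightarrow>\<^sub>M state_space q"
    unfolding measurable_cong_sets[OF aux_law_prob(2)[OF N] refl] .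
  show "\<Theta> f = (\<integral>\<omega>. g \<omega> * ?w \<omega> * f (pos q (snd \<omega>) t) \<partial>aux_system K \<eta>0 V Vinf q N t)" if "f \<in> \<B>" for f
    unfolding \<Theta>[OF that] by (intro Bochner_Integration.integral_cong refl) (simp add: F_e_eq)
qed

lemma Q_N_signed_measure:
  assumes N: "q \<le> N" and \<B>: "test_class q \<B>"
  shows "is_signed_measure q \<B> (Q_N K \<eta>0 V Vinf t q N)"
proof -
  have N0: "0 < N" using N q1 by simp
  show ?thesis
  proof (rule aux_law_signed_measure[OF N0 _ _ \<B>, of "\<lambda>_. 1" 1])
    fix f assume "f \<in> \<B>"
    then obtain b where b: "bounded_fun q f b" using test_class_bounded_fun[OF \<B>] by blast
    show "Q_N K \<eta>0 V Vinf t q N f = (\<integral>\<omega>. 1 * F_e V q t f (snd \<omega>) \<partial>aux_system K \<eta>0 V Vinf q N t)"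
      using Q_N_eq[OF N b] integral_F_e[OF N0 b] by simp
  qed auto
qed

lemma limit_deriv_signed_measure:
  assumes \<B>: "test_class q \<B>"
  shows "is_signed_measure q \<B> (limit_deriv r (Q_N K \<eta>0 V Vinf t q))"
proof -
  have N0: "0 < q" using q1 by simp
  let ?L = "aux_system K \<eta>0 V Vinf q q t"
  \<comment> \<open>Dividing by \<open>poisson_wt\<close> turns the restriction to k rings into
    conditioning on k rings, as in \<open>E_cond_eq\<close>.\<close>
  define d where "d k = (-1) ^ (r - k) / (fact k * fact (r - k)) * total_rate ^ r / poisson_wt q k" for k
  note sets_ring_event[OF N0, measurable]
  interpret L: prob_space ?L by (rule aux_law_prob(1)[OF N0])
  show ?thesis
  proof (rule aux_law_signed_measure[OF N0 _ _ \<B>, where g="\<lambda>\<omega>. \<Sum>k\<le>r. d k * indicator (ring_event q k) \<omega>" and C="\<Sum>k\<le>r. \<bar>d k\<bar>"])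
    show "(\<lambda>\<omega>. \<Sum>k\<le>r. d k * indicator (ring_event q k) \<omega>) \<in> borel_measurable ?L" by measurable
    show "\<bar>\<Sum>k\<le>r. d k * indicator (ring_event q k) \<omega>\<bar> \<le> (\<Sum>k\<le>r. \<bar>d k\<bar>)" for \<omega>
      by (rule order_trans[OF sum_abs sum_mono]) (auto simp: indicator_def)
    fix f assume "f \<in> \<B>"
    then obtain b where b: "bounded_fun q f b" using test_class_bounded_fun[OF \<B>] by blast
    note measurable_F_e[OF N0 b, measurable]
    have Fb: "\<bar>F_e V q t f z\<bar> \<le> b" for z
    proof -
      have "0 \<le> tint 0 t (\<lambda>v. Waux v (pos q z v))"
        by (rule tint_nonneg) (unfold Waux_def, intro sum_nonneg V_bounds)
      then have "\<bar>f (pos q z t)\<bar> * exp (- tint 0 t (\<lambda>v. Waux v (pos q z v))) \<le> b * 1"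
        using bounded_fun_bound_nonneg[OF b] by (intro mult_mono bounded_fun_le[OF b]) (auto simp: pos_def space_state_space)
      then show ?thesis by (simp add: F_e_eq abs_mult)
    qed
    have i: "integrable ?L (\<lambda>\<omega>. d k * (indicator (ring_event q k) \<omega> * F_e V q t f (snd \<omega>)))" for k
      by (intro integrable_mult_right prob_integrable_bounded[where B=b])
         (use Fb bounded_fun_bound_nonneg[OF b] L.prob_space_axioms in \<open>auto simp: indicator_def\<close>)
    have "limit_deriv r (Q_N K \<eta>0 V Vinf t q) f = (\<Sum>k\<le>r. d k * (\<integral>\<omega>. indicator (ring_event q k) \<omega> * F_e V q t f (snd \<omega>) \<partial>?L))"
      unfolding limit_deriv_Q_N[OF b] deriv_coeff_def E_cond_eq[OF N0 b] d_def by simp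
    also have "\<dots> = (\<integral>\<omega>. (\<Sum>k\<le>r. d k * (indicator (ring_event q k) \<omega> * F_e V q t f (snd \<omega>))) \<partial>?L)"
      using i by (subst Bochner_Integration.integral_sum) auto
    finally show "limit_deriv r (Q_N K \<eta>0 V Vinf t q) f = (\<integral>\<omega>. (\<Sum>k\<le>r. d k * indicator (ring_event q k) \<omega>) * F_e V q t f (snd \<omega>) \<partial>?L)"
      by (simp only: sum_distrib_right mult.assoc)
  qed
qed

lemma differentiable_Q_N:
  "test_class q \<B> \<Longrightarrow> differentiable_any_order q \<B> (Q_N K \<eta>0 V Vinf t q)"
  by (simp add: differentiable_any_order_def Q_N_signed_measure strongly_converges_Q_N limit_deriv_signed_measure)

end

theorem theorem1p3:
  fixes K :: "real \<Rightarrow> 'a::metric_space \<Rightarrow> (real \<Rightarrow> 'a) measure"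
    and \<eta>0 :: "'a measure" and V :: "real \<Rightarrow> 'a \<Rightarrow> real" and Vinf t :: real and q :: nat
    and \<B> :: "((nat \<Rightarrow> 'a) \<Rightarrow> real) set"
  assumes model: "feynman_kac_model K \<eta>0 V Vinf"
    and q: "q \<ge> 1" and t: "t > 0"
    and \<B>: "test_class q \<B>"
  defines "lam \<equiv> \<lambda>N. real q * (real q - 1) * (Vinf / real N)"
    and "Q \<equiv> Q_N K \<eta>0 V Vinf t q"
    and "\<E> \<equiv> \<lambda>N k F. E_cond K \<eta>0 V Vinf q N t k F"
    and "\<gamma> \<equiv> \<lambda>F. (\<integral>x. F x \<partial>(PiM {..<q} (\<lambda>_. gamma_flow K \<eta>0 V t)))"
  shows "(\<forall>N\<ge>q. \<forall>F\<in>\<B>. symmetric_fun q F \<longrightarrow>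
            (\<lambda>k. (lam N * t) ^ k * exp (- lam N * t) / fact k * \<E> N k F) sums Q N F \<and>
            ((\<lambda>(k, i). (-1) ^ i * ((lam N * t) ^ (k + i) / (fact k * fact i)) * \<E> N k F)
               has_sum (Q N F - \<gamma> F)) {(k, i). k + i \<ge> 1} \<and>
            (\<lambda>r. 1 / real N ^ Suc r *
                 (\<Sum>k\<le>Suc r. (-1) ^ (Suc r - k) / (fact k * fact (Suc r - k)) *
                    (real q * (real q - 1) * Vinf * t) ^ Suc r * \<E> N k F))
               sums (Q N F - \<gamma> F)) \<and>
         differentiable_any_order q \<B> Q \<and>
         (\<forall>r. \<forall>F\<in>\<B>. symmetric_fun q F \<longrightarrow> (\<forall>N\<ge>q.
            limit_deriv r Q F =
              (\<Sum>k\<le>r. (-1) ^ (r - k) / (fact k * fact (r - k)) *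
                 (real q * (real q - 1) * Vinf * t) ^ r * \<E> N k F)))"
proof -
  interpret feynman_kac K \<eta>0 V Vinf t q
    using model q t by unfold_locales (auto simp: feynman_kac_model_def)
  have lam: "lam N * t = total_rate / real N" for N by (simp add: lam_def)
  have A: "(\<lambda>k. (lam N * t) ^ k * exp (- lam N * t) / fact k * \<E> N k F) sums Q N F \<and>
            ((\<lambda>(k, i). (-1) ^ i * ((lam N * t) ^ (k + i) / (fact k * fact i)) * \<E> N k F)
               has_sum (Q N F - \<gamma> F)) {(k, i). k + i \<ge> 1} \<and>
            (\<lambda>r. 1 / real N ^ Suc r *
                 (\<Sum>k\<le>Suc r. (-1) ^ (Suc r - k) / (fact k * fact (Suc r - k)) *
                    total_rate ^ Suc r * \<E> N k F))
               sums (Q N F - \<gamma> F)" if N: "q \<le> N" and F: "F \<in> \<B>" for N F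
  proof -
    obtain b where b: "bounded_fun q F b" using test_class_bounded_fun[OF \<B> F] by blast
    have N0: "0 < N" using N q by simp
    have E: "\<E> N k F = cond_mean k F" for k unfolding \<E>_def by (rule E_cond_N_independent[OF N0 b])
    have g: "\<gamma> F = cond_mean 0 F" unfolding \<gamma>_def by (rule cond_mean_0[OF b, symmetric])
    note S = Q_N_poisson_sums[OF N b, folded Q_def]
    \<comment> \<open>The constant coefficient is the conditional mean without rings, that is
      \<gamma> F; moving it to the other side leaves the series from r = 1 on.\<close>
    have "(\<lambda>r. deriv_coeff F (Suc r) / real N ^ Suc r) sums (Q N F - deriv_coeff F 0)"
      using Q_N_power_series[OF N b] sums_Suc_iff[of "\<lambda>r. deriv_coeff F r / real N ^ r" "Q N F - deriv_coeff F 0"]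
      by (simp add: Q_def)
    then have "(\<lambda>r. 1 / real N ^ Suc r * deriv_coeff F (Suc r)) sums (Q N F - \<gamma> F)"
      by (simp add: g deriv_coeff_def[of F 0])
    then show ?thesis
      unfolding E mult_minus_left lam deriv_coeff_def
      using S poisson_mixture_double_series[OF cond_mean_bound[OF b] S] by (simp only: g)
  qed
  have B: "limit_deriv r Q F = (\<Sum>k\<le>r. (-1) ^ (r - k) / (fact k * fact (r - k)) * total_rate ^ r * \<E> N k F)"
    if N: "q \<le> N" and F: "F \<in> \<B>" for r N F
  proof -
    obtain b where b: "bounded_fun q F b" using test_class_bounded_fun[OF \<B> F] by blast
    have "0 < N" using N q by simp
    then show ?thesis
      unfolding Q_def \<E>_def limit_deriv_Q_N[OF b] deriv_coeff_def using E_cond_N_independent[OF _ b] by simp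
  qed
  show ?thesis using A B differentiable_Q_N[OF \<B>] unfolding Q_def by blast
qed

end
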